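(* Let $R>1$, $\omega\ge 0$ and let $f\in L^2(\Omega_R;\mathbb{R}^2)$ be rotationally invariant, $f(\xi)=f^\rho(\rho)\widehat\rho+f^\theta(\rho)\widehat\theta$ with $f^\rho,f^\theta\in L^2(1,R)$. Put $$A_R(\omega,f)=\frac{R}{R^2-1}\Big(\omega+\frac R2\int_1^R f^\theta(t)\,dt-\frac1{2R}\int_1^R t^2 f^\theta(t)\,dt\Big),$$ $$g(\rho)=A_R(\omega,f)\Big(\rho-\frac1\rho\Big)-\frac\rho2\int_1^\rho f^\theta(t)\,dt+\frac1{2\rho}\int_1^\rho t^2f^\theta(t)\,dt,\qquad \rho\in[1,R],$$ and define on $\Omega_R$ $$v_*(\xi)=g(\rho)\,\widehat\theta,\qquad q_*(\xi)=\int_1^\rho \frac{g(t)^2}{t}\,dt+\int_1^\rho f^\rho(t)\,dt .$$ Then $(v_*,q_* )$ is a strong solution of problem (P). Moreover: (i) $(v_*,q_* )$ is the unique strong solution of (P) among pairs $(u,p)$ with $u$ and $p$ rotationally invariant, $u\in H^2(\Omega_R)$, $p\in H^1(\Omega_R)$ (with $p$ determined up to an additive constant), for every $\omega\ge0$ and every rotationally invariant $f\in L^2(\Omega_R)$; (ii) if $$K_R(\omega,f):=\omega+\frac{\sqrt{R-1}}{\sqrt{15}\,R}\sqrt{8R^4-7R^3-7R^2+3R+3}\;\|f^\theta\|_{L^2(\Omega_R)}<\sqrt{\lambda(\Omega_R)},$$ then $(v_*,q_* )$ is the unique strong solution of (P) in the whole space $H^2(\Omega_R)\times H^1(\Omega_R)/\mathbb{R}$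 (no symmetry assumed), where $\|f^\theta\|_{L^2(\Omega_R)}^2=2\pi\int_1^R\rho\,f^\theta(\rho)^2\,d\rho$.
   Context: For $R>1$, $\Omega_R=\{\xi\in\mathbb{R}^2: 1<|\xi|<R\}$. Polar coordinates $\xi=\rho\widehat\rho$ with $\widehat\rho=(\cos\theta,\sin\theta)$, $\widehat\theta=(-\sin\theta,\cos\theta)$. Problem (P) (planar Taylor–Couette problem): $-\Delta u+(u\cdot\nabla)u+\nabla p=f$, $\nabla\cdot u=0$ in $\Omega_R$, $u=\omega\widehat\theta$ on $\{|\xi|=R\}$, $u=0$ on $\{|\xi|=1\}$. A strong solution is a pair $(u,p)\in H^2(\Omega_R)\times H^1(\Omega_R)$ satisfying the equations a.e. and the boundary conditions in the trace sense. With $\mathcal R(\phi)$ the rotation matrix by angle $\phi$, a vector field $v$ is rotationally invariant if $v(\xi)=\mathcal R(\phi)^\top v(\mathcal R(\phi)\xi)$ for all $\xi$ and all $\phi\in[0,2\pi]$ (equivalently $v=v^\rho(\rho)\widehat\rho+v^\theta(\rho)\widehat\theta$), and a scalar $q$ is rotationally invariant if $q(\xi)=q(\mathcal R(\phi)\xi)$. $\lambda(\Omega_R)=\min_{v\in H^1_0(\Omega_R)\setminus\{0\}}\|\nabla v\|_{L^2}^2/\|v\|_{L^2}^2$ is the least Dirichlet eigenvalue of $-\Delta$ in $\Omega_R$. *)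

theory Defs
  imports "HOL-Analysis.Analysis"
begin

definition annulus :: "real \<Rightarrow> (real \<times> real) set" where
  "annulus R = {x. 1 < norm x \<and> norm x < R}"

definition coord :: "nat \<Rightarrow> real \<times> real \<Rightarrow> real" where
  "coord i v = (if i = 1 then fst v else snd v)"

definition ebasis :: "nat \<Rightarrow> real \<times> real" where
  "ebasis i = (if i = 1 then (1, 0) else (0, 1))"

definition pderiv :: "nat \<Rightarrow> (real \<times> real \<Rightarrow> real) \<Rightarrow> real \<times> real \<Rightarrow> real" where
  "pderiv i \<phi> x = frechet_derivative \<phi> (at x) (ebasis i)"

fun iter_pderiv :: "nat list \<Rightarrow> (real \<times> real \<Rightarrow> real) \<Rightarrow> real \<times> real \<Rightarrow> real" where
  "iter_pderiv [] \<phi> = \<phi>"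
| "iter_pderiv (i # is) \<phi> = pderiv i (iter_pderiv is \<phi>)"

definition smooth_fun :: "(real \<times> real \<Rightarrow> real) \<Rightarrow> bool" where
  "smooth_fun \<phi> \<longleftrightarrow> (\<forall>is x. iter_pderiv is \<phi> differentiable (at x))"

definition test_fun :: "(real \<times> real) set \<Rightarrow> (real \<times> real \<Rightarrow> real) \<Rightarrow> bool" where
  "test_fun U \<phi> \<longleftrightarrow> smooth_fun \<phi> \<and> compact (closure {x. \<phi> x \<noteq> 0})
      \<and> closure {x. \<phi> x \<noteq> 0} \<subseteq> U"

definition L2 :: "(real \<times> real) set \<Rightarrow> (real \<times> real \<Rightarrow> real) \<Rightarrow> bool" where
  "L2 U f \<longleftrightarrow> set_borel_measurable lebesgue U f \<and> set_integrable lebesgue U (\<lambda>x. (f x)\<^sup>2)"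

definition is_weak_pderiv ::
  "(real \<times> real) set \<Rightarrow> nat \<Rightarrow> (real \<times> real \<Rightarrow> real) \<Rightarrow> (real \<times> real \<Rightarrow> real) \<Rightarrow> bool" where
  "is_weak_pderiv U i f g \<longleftrightarrow>
     set_integrable lebesgue U g \<and>
     (\<forall>\<phi>. test_fun U \<phi> \<longrightarrow>
        set_integrable lebesgue U (\<lambda>x. f x * pderiv i \<phi> x) \<and>
        (LINT x:U|lebesgue. f x * pderiv i \<phi> x) = - (LINT x:U|lebesgue. g x * \<phi> x))"

definition weak_pderiv :: "(real \<times> real) set \<Rightarrow> nat \<Rightarrow> (real \<times> real \<Rightarrow> real) \<Rightarrow> real \<times> real \<Rightarrow> real" where
  "weak_pderiv U i f = (SOME g. is_weak_pderiv U i f g)"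

definition H1 :: "(real \<times> real) set \<Rightarrow> (real \<times> real \<Rightarrow> real) \<Rightarrow> bool" where
  "H1 U f \<longleftrightarrow> L2 U f \<and> (\<forall>i\<in>{1,2}. \<exists>g. L2 U g \<and> is_weak_pderiv U i f g)"

definition H2 :: "(real \<times> real) set \<Rightarrow> (real \<times> real \<Rightarrow> real) \<Rightarrow> bool" where
  "H2 U f \<longleftrightarrow> L2 U f \<and> (\<forall>i\<in>{1,2}. \<exists>g. H1 U g \<and> is_weak_pderiv U i f g)"

definition H1_dist2 :: "(real \<times> real) set \<Rightarrow> (real \<times> real \<Rightarrow> real) \<Rightarrow> (real \<times> real \<Rightarrow> real) \<Rightarrow> real" where
  "H1_dist2 U f h = (LINT x:U|lebesgue. (f x - h x)\<^sup>2)
     + (\<Sum>i\<in>{1,2}. LINT x:U|lebesgue. (weak_pderiv U i f x - weak_pderiv U i h x)\<^sup>2)"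

definition H1_0 :: "(real \<times> real) set \<Rightarrow> (real \<times> real \<Rightarrow> real) \<Rightarrow> bool" where
  "H1_0 U f \<longleftrightarrow> H1 U f \<and>
     (\<exists>\<phi> :: nat \<Rightarrow> real \<times> real \<Rightarrow> real. (\<forall>n. test_fun U (\<phi> n)) \<and>
        (\<lambda>n. H1_dist2 U (\<phi> n) f) \<longlonglongrightarrow> 0)"

definition dirichlet_eigenvalue :: "(real \<times> real) set \<Rightarrow> real" where
  "dirichlet_eigenvalue U = Inf {(\<Sum>i\<in>{1,2}. LINT x:U|lebesgue. (weak_pderiv U i v x)\<^sup>2)
        / (LINT x:U|lebesgue. (v x)\<^sup>2) | v. H1_0 U v \<and> \<not> (AE x in lebesgue. x \<in> U \<longrightarrow> v x = 0)}"

definition rho_hat :: "real \<times> real \<Rightarrow> real \<times> real" where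
  "rho_hat x = (fst x / norm x, snd x / norm x)"

definition theta_hat :: "real \<times> real \<Rightarrow> real \<times> real" where
  "theta_hat x = (- snd x / norm x, fst x / norm x)"

definition rot :: "real \<Rightarrow> real \<times> real \<Rightarrow> real \<times> real" where
  "rot \<phi> x = (cos \<phi> * fst x - sin \<phi> * snd x, sin \<phi> * fst x + cos \<phi> * snd x)"

definition rotT :: "real \<Rightarrow> real \<times> real \<Rightarrow> real \<times> real" where
  "rotT \<phi> x = (cos \<phi> * fst x + sin \<phi> * snd x, - sin \<phi> * fst x + cos \<phi> * snd x)"

definition rot_inv_field :: "real \<Rightarrow> (real \<times> real \<Rightarrow> real \<times> real) \<Rightarrow> bool" where
  "rot_inv_field R v \<longleftrightarrow> (\<forall>\<xi>\<in>annulus R. \<forall>\<phi>\<in>{0..2*pi}. v \<xi> = rotT \<phi> (v (rot \<phi> \<xi>)))"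

definition rot_inv_scalar :: "real \<Rightarrow> (real \<times> real \<Rightarrow> real) \<Rightarrow> bool" where
  "rot_inv_scalar R q \<longleftrightarrow> (\<forall>\<xi>\<in>annulus R. \<forall>\<phi>\<in>{0..2*pi}. q \<xi> = q (rot \<phi> \<xi>))"

text \<open>Strong solution of problem (P) on the annulus Omega_R. The boundary conditions
  in the trace sense are expressed as u_j - w_j in H^1_0, where w is the smooth
  extension w(xi) = omega (|xi|-1)/(R-1) theta_hat(xi) of the boundary data.\<close>
definition bdry_ext :: "real \<Rightarrow> real \<Rightarrow> real \<times> real \<Rightarrow> real \<times> real" where
  "bdry_ext R \<omega> x = ((\<omega> * (norm x - 1) / (R - 1)) *\<^sub>R theta_hat x)"

definition strong_solution ::
  "real \<Rightarrow> real \<Rightarrow> (real \<times> real \<Rightarrow> real \<times> real) \<Rightarrow> (real \<times> real \<Rightarrow> real \<times> real)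
     \<Rightarrow> (real \<times> real \<Rightarrow> real) \<Rightarrow> bool" where
  "strong_solution R \<omega> f u p \<longleftrightarrow>
     (let U = annulus R; uc = (\<lambda>j x. coord j (u x)) in
       (\<forall>j\<in>{1,2}. H2 U (uc j)) \<and> H1 U p \<and>
       (\<forall>j\<in>{1,2}. AE x in lebesgue. x \<in> U \<longrightarrow>
          - (\<Sum>i\<in>{1,2}. weak_pderiv U i (weak_pderiv U i (uc j)) x)
          + (\<Sum>i\<in>{1,2}. uc i x * weak_pderiv U i (uc j) x)
          + weak_pderiv U j p x = coord j (f x)) \<and>
       (AE x in lebesgue. x \<in> U \<longrightarrow> (\<Sum>i\<in>{1,2}. weak_pderiv U i (uc i) x) = 0) \<and>
       (\<forall>j\<in>{1,2}. H1_0 U (\<lambda>x. uc j x - coord j (bdry_ext R \<omega> x))))"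

definition A_R :: "real \<Rightarrow> real \<Rightarrow> (real \<Rightarrow> real) \<Rightarrow> real" where
  "A_R R \<omega> ft = R / (R\<^sup>2 - 1) * (\<omega> + R / 2 * (LINT t:{1..R}|lborel. ft t)
       - 1 / (2 * R) * (LINT t:{1..R}|lborel. t\<^sup>2 * ft t))"

definition g_prof :: "real \<Rightarrow> real \<Rightarrow> (real \<Rightarrow> real) \<Rightarrow> real \<Rightarrow> real" where
  "g_prof R \<omega> ft \<rho> = A_R R \<omega> ft * (\<rho> - 1 / \<rho>) - \<rho> / 2 * (LINT t:{1..\<rho>}|lborel. ft t)
       + 1 / (2 * \<rho>) * (LINT t:{1..\<rho>}|lborel. t\<^sup>2 * ft t)"

definition v_star :: "real \<Rightarrow> real \<Rightarrow> (real \<Rightarrow> real) \<Rightarrow> real \<times> real \<Rightarrow> real \<times> real" where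
  "v_star R \<omega> ft \<xi> = g_prof R \<omega> ft (norm \<xi>) *\<^sub>R theta_hat \<xi>"

definition q_star :: "real \<Rightarrow> real \<Rightarrow> (real \<Rightarrow> real) \<Rightarrow> (real \<Rightarrow> real) \<Rightarrow> real \<times> real \<Rightarrow> real" where
  "q_star R \<omega> fr ft \<xi> = (LINT t:{1..norm \<xi>}|lborel. (g_prof R \<omega> ft t)\<^sup>2 / t)
       + (LINT t:{1..norm \<xi>}|lborel. fr t)"

definition K_R :: "real \<Rightarrow> real \<Rightarrow> (real \<Rightarrow> real) \<Rightarrow> real" where
  "K_R R \<omega> ft = \<omega> + sqrt (R - 1) / (sqrt 15 * R) * sqrt (8 * R^4 - 7 * R^3 - 7 * R\<^sup>2 + 3 * R + 3)
       * sqrt (2 * pi * (LINT t:{1..R}|lborel. t * (ft t)\<^sup>2))"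

definition same_solution ::
  "real \<Rightarrow> (real \<times> real \<Rightarrow> real \<times> real) \<Rightarrow> (real \<times> real \<Rightarrow> real)
     \<Rightarrow> (real \<times> real \<Rightarrow> real \<times> real) \<Rightarrow> (real \<times> real \<Rightarrow> real) \<Rightarrow> bool" where
  "same_solution R u p v q \<longleftrightarrow>
     (AE x in lebesgue. x \<in> annulus R \<longrightarrow> u x = v x) \<and>
     (\<exists>c. AE x in lebesgue. x \<in> annulus R \<longrightarrow> p x = q x + c)"

end

theory Submission
  imports Defs
begin

text \<open>
  Existence: away from the origin \<open>v\<^sub>* = h(\<rho>) (- x\<^sub>2, x\<^sub>1)\<close> with \<open>h(\<rho>) = g(\<rho>) / \<rho>\<close>, and
  \<open>h' = \<rho> m\<close> for \<open>m = (2 A\<^sub>R - \<integral>\<^sub>1\<^sup>\<rho> t\<^sup>2 f\<^sup>\<theta>) / \<rho>\<^sup>4\<close>, so two derivatives of \<open>v\<^sub>*\<close> only involve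
  one derivative of the absolutely continuous function \<open>m\<close>.

  Uniqueness: let \<open>w\<close> be the difference of a solution \<open>u\<close> and \<open>v\<^sub>*\<close>. Testing the difference of the two
  equations with \<open>w\<close> (admissible because Ladyzhenskaya's inequality puts \<open>w\<close> in \<open>L\<^sup>4\<close>) eliminates the
  pressure and the term transported by \<open>u\<close>, and leaves
  \<open>\<parallel>\<nabla>w\<parallel>\<^sup>2 = - \<integral> (w \<cdot> \<nabla>)v\<^sub>* \<cdot> w = \<integral> (w \<cdot> \<nabla>)w \<cdot> v\<^sub>*\<close>.
  If \<open>u\<close> is rotationally invariant, then \<open>x \<cdot> u\<close> has zero gradient (it is constant along circles, and
  \<open>div u = 0\<close> fixes its radial derivative), hence \<open>x \<cdot> w = 0\<close> and the right-hand side vanishes pointwise.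
  In general it is at most \<open>sup |g| \<parallel>w\<parallel> \<parallel>\<nabla>w\<parallel>\<close>. Writing \<open>J r = \<integral>\<^sub>1\<^sup>r (r - t\<^sup>2/r) f\<^sup>\<theta>\<close>, \<open>g\<close> equals
  \<open>\<theta> \<omega> + \<theta> J R / 2 - J \<rho> / 2\<close> for some \<open>\<theta>\<close> in \<open>[0,1]\<close>, so the Cauchy-Schwarz inequality gives
  \<open>|g| \<le> K\<^sub>R\<close>, and \<open>K\<^sub>R < sqrt \<lambda>\<close> forces \<open>\<nabla>w = 0\<close>.
\<close>

section \<open>Smooth functions\<close>

text \<open>The obstacle is low regularity: \<open>fr\<close> and \<open>ft\<close> are only square
  integrable, so the second derivatives of \<open>v_star\<close> exist only in L2. Identities are
  proved for smooth functions and carried to limits: on the interval by approximating derivatives in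
  L1 by continuous functions, on the domain by the test functions that define \<open>H1_0\<close>.
  Zero boundary values always mean being an H1 limit of test functions, so integration by parts
  leaves no boundary terms.

  The pressure, lost in the energy identity, returns at the end: once the velocities agree, the
  equations give \<open>p - q\<close> a zero weak gradient, and the annulus is connected.

  In \<open>K_R\<close> the factor before the norm of \<open>ft\<close> is the L2 norm over (1,R) of
  the kernel R - t^2/R, which dominates the kernels r - t^2/r. The norm of \<open>ft\<close> on the
  interval is bounded by the one on the annulus because 2 pi t \<ge> 1. Finally K < sqrt \<lambda>
  lets the bound K |w| |grad w| be absorbed into |grad w|^2 by the Rayleigh quotient.\<close>

lemma pderiv_eqI:
  assumes "(f has_derivative D) (at x)"
  shows "pderiv i f x = D (ebasis i)"
  using frechet_derivative_at[OF assms] by (simp add: pderiv_def)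

lemma iter_pderiv_append: "iter_pderiv (xs @ ys) \<phi> = iter_pderiv xs (iter_pderiv ys \<phi>)"
  by (induction xs) auto

lemma smooth_fun_differentiable: "smooth_fun \<phi> \<Longrightarrow> \<phi> differentiable (at x)"
  unfolding smooth_fun_def by (metis iter_pderiv.simps(1))

lemma smooth_fun_pderiv: "smooth_fun \<phi> \<Longrightarrow> smooth_fun (pderiv i \<phi>)"
  unfolding smooth_fun_def
  by (metis iter_pderiv.simps iter_pderiv_append)

text \<open>\<open>smooth_fun\<close> is the greatest class of everywhere differentiable functions
  closed under \<open>pderiv\<close>, so any invariant \<open>P\<close> with these two properties
  certifies smoothness.\<close>

lemma smooth_fun_coinduct:
  assumes "P f" and step: "\<And>f. P f \<Longrightarrow> (\<forall>x. f differentiable (at x)) \<and> (\<forall>i. P (pderiv i f))"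
  shows "smooth_fun f"
proof -
  have "P (iter_pderiv is f)" for "is"
    by (induction "is") (use assms in auto)
  then show ?thesis unfolding smooth_fun_def using step by blast
qed

lemma smooth_funI:
  assumes "\<And>x. f differentiable (at x)" "smooth_fun (pderiv 1 f)" "smooth_fun (pderiv 2 f)"
  shows "smooth_fun f"
proof (rule smooth_fun_coinduct[where P = "\<lambda>h. h = f \<or> smooth_fun h"])
  fix h assume h: "h = f \<or> smooth_fun h"
  \<comment> \<open>\<open>ebasis\<close> sends every index other than 1 to the second unit vector,
    so two partial derivatives account for all \<open>i\<close>.\<close>
  have "pderiv i f = pderiv 1 f \<or> pderiv i f = pderiv 2 f" for i
    by (auto simp: pderiv_def ebasis_def fun_eq_iff)
  then show "(\<forall>x. h differentiable (at x)) \<and> (\<forall>i. pderiv i h = f \<or> smooth_fun (pderiv i h))"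
    using h assms smooth_fun_pderiv smooth_fun_differentiable by metis
qed simp

lemma smooth_fun_has_derivative:
  assumes "smooth_fun \<phi>"
  shows "(\<phi> has_derivative (\<lambda>h. pderiv 1 \<phi> x * fst h + pderiv 2 \<phi> x * snd h)) (at x)"
proof -
  let ?D = "frechet_derivative \<phi> (at x)"
  have D: "(\<phi> has_derivative ?D) (at x)"
    using smooth_fun_differentiable[OF assms] frechet_derivative_works by blast
  then interpret bounded_linear ?D by (rule has_derivative_bounded_linear)
  have "?D h = pderiv 1 \<phi> x * fst h + pderiv 2 \<phi> x * snd h" for h
  proof -
    have "h = fst h *\<^sub>R (1, 0) + snd h *\<^sub>R (0, 1)" by (cases h) auto
    then have "?D h = fst h * ?D (1, 0) + snd h * ?D (0, 1)" by (metis add real_scaleR_def scaleR)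
    then show ?thesis by (simp add: pderiv_def ebasis_def)
  qed
  then have "?D = (\<lambda>h. pderiv 1 \<phi> x * fst h + pderiv 2 \<phi> x * snd h)" by blast
  then show ?thesis using D by simp
qed

text \<open>The functions t^(-k) exp(-1/t), extended by zero. The whole family in \<open>k\<close>
  appears because differentiation raises the power; \<open>k = 0\<close> is the smooth step from
  which all bumps and cutoffs are built.\<close>

definition exp_cut :: "nat \<Rightarrow> real \<Rightarrow> real" where
  "exp_cut k t = (if t > 0 then (1 / t) ^ k * exp (- (1 / t)) else 0)"

lemma exp_cut_tendsto_0: "(exp_cut k \<longlongrightarrow> 0) (at_right 0)"
proof -
  have "((\<lambda>s::real. s ^ k / exp s) \<longlongrightarrow> 0) at_top" by (rule tendsto_power_div_exp_0)
  then have "((\<lambda>t::real. (inverse t) ^ k / exp (inverse t)) \<longlongrightarrow> 0) (at_right 0)"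
    by (rule filterlim_compose) (rule filterlim_inverse_at_top_right)
  moreover have "\<forall>\<^sub>F t in at_right 0. (inverse t) ^ k / exp (inverse t) = exp_cut k t"
    by (auto simp: eventually_at_filter exp_cut_def exp_minus field_simps)
  ultimately show ?thesis by (rule Lim_transform_eventually)
qed

lemma exp_cut_deriv: "(exp_cut k has_real_derivative (exp_cut (k + 2) t - k * exp_cut (k + 1) t)) (at t)"
proof -
  consider "t > 0" | "t < 0" | "t = 0" by linarith
  then show ?thesis
  proof cases
    case 1
    define s where "s = 1 / t"
    have "((\<lambda>s. s ^ k * exp (- s)) has_real_derivative (real k * s ^ (k - 1) * exp (- s) - s ^ k * exp (- s))) (at (1 / t))"
      unfolding s_def by (auto intro!: derivative_eq_intros)
    moreover have "((\<lambda>t. 1 / t) has_real_derivative - (s ^ 2)) (at t)"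
      unfolding s_def using 1 by (auto intro!: derivative_eq_intros simp: power2_eq_square)
    ultimately have "((\<lambda>t. (1 / t) ^ k * exp (- (1 / t))) has_real_derivative
        (real k * s ^ (k - 1) * exp (- s) - s ^ k * exp (- s)) * - (s ^ 2)) (at t)"
      by (rule DERIV_chain2)
    moreover have "(real k * s ^ (k - 1) * exp (- s) - s ^ k * exp (- s)) * - (s ^ 2)
        = exp_cut (k + 2) t - k * exp_cut (k + 1) t"
      using 1 by (cases k) (auto simp: exp_cut_def s_def[symmetric] algebra_simps power2_eq_square)
    ultimately have "((\<lambda>t. (1 / t) ^ k * exp (- (1 / t))) has_real_derivative (exp_cut (k + 2) t - k * exp_cut (k + 1) t)) (at t)"
      by simp
    then show ?thesis
      by (rule has_field_derivative_transform_within_open[where S = "{0<..}"]) (use 1 in \<open>auto simp: exp_cut_def\<close>)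
  next
    case 2
    have "((\<lambda>t. 0) has_real_derivative (exp_cut (k + 2) t - k * exp_cut (k + 1) t)) (at t)"
      using 2 by (auto simp: exp_cut_def)
    then show ?thesis
      by (rule has_field_derivative_transform_within_open[where S = "{..<0}"]) (use 2 in \<open>auto simp: exp_cut_def\<close>)
  next
    case 3
    \<comment> \<open>For h > 0 the difference quotient at 0 is \<open>exp_cut (Suc k) h\<close>,
      whose limit is already known.\<close>
    have "((\<lambda>h. (exp_cut k h - exp_cut k 0) / (h - 0)) \<longlongrightarrow> 0) (at_right 0)"
      using exp_cut_tendsto_0[of "Suc k"]
      by (rule Lim_transform_eventually) (auto simp: eventually_at_filter exp_cut_def)
    moreover have "((\<lambda>h. (exp_cut k h - exp_cut k 0) / (h - 0)) \<longlongrightarrow> 0) (at_left 0)"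
      by (rule Lim_transform_eventually[OF tendsto_const]) (auto simp: eventually_at_filter exp_cut_def)
    ultimately have "((\<lambda>h. (exp_cut k h - exp_cut k 0) / (h - 0)) \<longlongrightarrow> 0) (at 0)"
      by (rule filterlim_split_at[rotated])
    then show ?thesis using 3 by (simp add: has_field_derivative_iff exp_cut_def)
  qed
qed

lemma exp_cut_nonneg: "0 \<le> exp_cut k t"
  by (simp add: exp_cut_def)

lemma exp_cut_0_le: "exp_cut 0 t \<le> 1"
  by (simp add: exp_cut_def)

lemma exp_cut_continuous: "continuous_on S (exp_cut k)"
  using exp_cut_deriv DERIV_isCont continuous_at_imp_continuous_on by blast

text \<open>The class is built so that partial derivatives stay inside it, which makes it an
  invariant for \<open>smooth_fun_coinduct\<close>. The last clause at angle 0 puts every smooth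
  function into the class, so the two notions coincide and the clauses become closure rules for
  \<open>smooth_fun\<close>.\<close>

inductive smooth_alg :: "(real \<times> real \<Rightarrow> real) \<Rightarrow> bool" where
  "smooth_alg (\<lambda>x. c)"
| "smooth_alg fst"
| "smooth_alg snd"
| "smooth_alg f \<Longrightarrow> smooth_alg g \<Longrightarrow> smooth_alg (\<lambda>x. f x + g x)"
| "smooth_alg f \<Longrightarrow> smooth_alg g \<Longrightarrow> smooth_alg (\<lambda>x. f x * g x)"
| "smooth_alg f \<Longrightarrow> smooth_alg (\<lambda>x. exp_cut k (f x))"
| "smooth_fun f \<Longrightarrow> smooth_alg (\<lambda>x. f (rot t x))"

lemma rot_has_derivative: "(rot t has_derivative rot t) (at x)"
  unfolding rot_def[abs_def] by (auto intro!: derivative_eq_intros)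

lemma smooth_alg_step:
  assumes "smooth_alg f"
  shows "(\<forall>x. f differentiable (at x)) \<and> (\<forall>i. smooth_alg (pderiv i f))"
  using assms
proof induction
  case (1 c)
  have "pderiv i (\<lambda>x. c) = (\<lambda>x. 0)" for i
    by (auto simp: fun_eq_iff intro!: pderiv_eqI[THEN trans] derivative_eq_intros)
  then show ?case using smooth_alg.intros(1) by auto
next
  case 2
  have "pderiv i fst = (\<lambda>x. fst (ebasis i))" for i
    by (auto simp: fun_eq_iff intro!: pderiv_eqI[THEN trans] derivative_eq_intros)
  then show ?case using smooth_alg.intros(1) by (auto intro!: bounded_linear_imp_differentiable bounded_linear_fst)
next
  case 3
  have "pderiv i snd = (\<lambda>x. snd (ebasis i))" for i
    by (auto simp: fun_eq_iff intro!: pderiv_eqI[THEN trans] derivative_eq_intros)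
  then show ?case using smooth_alg.intros(1) by (auto intro!: bounded_linear_imp_differentiable bounded_linear_snd)
next
  case (4 f g)
  have d: "(f has_derivative frechet_derivative f (at x)) (at x)" "(g has_derivative frechet_derivative g (at x)) (at x)" for x
    using 4 frechet_derivative_works by blast+
  have "pderiv i (\<lambda>x. f x + g x) = (\<lambda>x. pderiv i f x + pderiv i g x)" for i
    by (auto simp: fun_eq_iff pderiv_def[of _ f] pderiv_def[of _ g]
        intro!: pderiv_eqI[THEN trans] derivative_eq_intros d)
  then show ?case using 4 smooth_alg.intros by auto
next
  case (5 f g)
  have d: "(f has_derivative frechet_derivative f (at x)) (at x)" "(g has_derivative frechet_derivative g (at x)) (at x)" for x
    using 5 frechet_derivative_works by blast+
  have "pderiv i (\<lambda>x. f x * g x) = (\<lambda>x. f x * pderiv i g x + pderiv i f x * g x)" for i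
    by (auto simp: fun_eq_iff pderiv_def[of _ f] pderiv_def[of _ g]
        intro!: pderiv_eqI[THEN trans] derivative_eq_intros d)
  then show ?case using 5 smooth_alg.intros by auto
next
  case (6 f k)
  have d: "(f has_derivative frechet_derivative f (at x)) (at x)" for x
    using 6 frechet_derivative_works by blast+
  have d': "((\<lambda>x. exp_cut k (f x)) has_derivative
      (\<lambda>h. frechet_derivative f (at x) h * (exp_cut (k + 2) (f x) + (- real k) * exp_cut (k + 1) (f x)))) (at x)" for x
    using DERIV_compose_FDERIV[OF exp_cut_deriv d, of k x] by simp
  have "pderiv i (\<lambda>x. exp_cut k (f x)) = (\<lambda>x. pderiv i f x * (exp_cut (k + 2) (f x) + (- real k) * exp_cut (k + 1) (f x)))" for i
    using pderiv_eqI[OF d'] by (auto simp: pderiv_def[of _ f])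
  moreover have "smooth_alg (\<lambda>x. pderiv i f x * (exp_cut (k + 2) (f x) + (- real k) * exp_cut (k + 1) (f x)))" for i
    using 6 by (intro smooth_alg.intros) auto
  moreover have "\<forall>x. (\<lambda>x. exp_cut k (f x)) differentiable (at x)"
    using d' unfolding differentiable_def by blast
  ultimately show ?case by simp
next
  case (7 f t)
  have d: "((\<lambda>x. f (rot t x)) has_derivative
     (\<lambda>h. pderiv 1 f (rot t x) * fst (rot t h) + pderiv 2 f (rot t x) * snd (rot t h))) (at x)" for x
    by (rule has_derivative_compose[OF rot_has_derivative smooth_fun_has_derivative[OF 7]])
  have "pderiv i (\<lambda>x. f (rot t x)) =
     (\<lambda>x. pderiv 1 f (rot t x) * fst (rot t (ebasis i)) + pderiv 2 f (rot t x) * snd (rot t (ebasis i)))" for i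
    using pderiv_eqI[OF d] by auto
  moreover have "smooth_alg (\<lambda>x. pderiv 1 f (rot t x) * fst (rot t (ebasis i)) + pderiv 2 f (rot t x) * snd (rot t (ebasis i)))" for i
    using 7 smooth_fun_pderiv by (intro smooth_alg.intros) auto
  moreover have "\<forall>x. (\<lambda>x. f (rot t x)) differentiable (at x)"
    using d unfolding differentiable_def by blast
  ultimately show ?case by simp
qed

lemma smooth_alg_iff: "smooth_alg f \<longleftrightarrow> smooth_fun f"
proof
  assume "smooth_alg f" then show "smooth_fun f"
    by (rule smooth_fun_coinduct) (rule smooth_alg_step)
next
  assume "smooth_fun f"
  then have "smooth_alg (\<lambda>x. f (rot 0 x))" by (rule smooth_alg.intros)
  then show "smooth_alg f" by (simp add: rot_def)
qed

lemmas smooth_fun_intros = smooth_alg.intros(1-6)[unfolded smooth_alg_iff]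
lemmas smooth_fun_rot = smooth_alg.intros(7)[unfolded smooth_alg_iff]

lemma smooth_fun_minus: "smooth_fun f \<Longrightarrow> smooth_fun (\<lambda>x. - f x)"
  using smooth_fun_intros(5)[OF smooth_fun_intros(1)[of "-1"]] by simp

lemma smooth_fun_diff: "smooth_fun f \<Longrightarrow> smooth_fun g \<Longrightarrow> smooth_fun (\<lambda>x. f x - g x)"
  using smooth_fun_intros(4)[OF _ smooth_fun_minus] by simp

lemma smooth_fun_power: "smooth_fun f \<Longrightarrow> smooth_fun (\<lambda>x. f x ^ n)"
  by (induction n) (auto intro!: smooth_fun_intros)

lemma smooth_fun_sum: "(\<And>i. i \<in> I \<Longrightarrow> smooth_fun (f i)) \<Longrightarrow> smooth_fun (\<lambda>x. \<Sum>i\<in>I. f i x)"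
  by (induction I rule: infinite_finite_induct) (auto intro!: smooth_fun_intros)

lemma smooth_fun_continuous_on: "smooth_fun f \<Longrightarrow> continuous_on S f"
  by (meson continuous_at_imp_continuous_on differentiable_imp_continuous_within smooth_fun_differentiable)

lemma pderiv_add:
  "smooth_fun f \<Longrightarrow> smooth_fun g \<Longrightarrow> pderiv i (\<lambda>x. f x + g x) x = pderiv i f x + pderiv i g x"
  by (subst pderiv_eqI[OF has_derivative_add[OF smooth_fun_has_derivative smooth_fun_has_derivative]])
    (auto simp: ebasis_def pderiv_def)

lemma pderiv_mult:
  "smooth_fun f \<Longrightarrow> smooth_fun g \<Longrightarrow> pderiv i (\<lambda>x. f x * g x) x = f x * pderiv i g x + pderiv i f x * g x"
  by (subst pderiv_eqI[OF has_derivative_mult[OF smooth_fun_has_derivative smooth_fun_has_derivative]])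
    (auto simp: ebasis_def pderiv_def)

section \<open>Test functions and weak derivatives\<close>

lemma integrable_lebesgue_on:
  fixes f :: "'a::euclidean_space \<Rightarrow> real"
  shows "U \<in> sets lebesgue \<Longrightarrow> set_integrable lebesgue U f \<longleftrightarrow> integrable (lebesgue_on U) f"
  by (simp add: set_integrable_def integrable_restrict_space)

lemma integral_lebesgue_on:
  fixes f :: "'a::euclidean_space \<Rightarrow> real"
  shows "U \<in> sets lebesgue \<Longrightarrow> (LINT x:U|lebesgue. f x) = integral\<^sup>L (lebesgue_on U) f"
  by (simp add: set_lebesgue_integral_def integral_restrict_space)

lemma measurable_lebesgue_on:
  fixes f :: "'a::euclidean_space \<Rightarrow> real"
  shows "U \<in> sets lebesgue \<Longrightarrow> set_borel_measurable lebesgue U f \<longleftrightarrow> f \<in> borel_measurable (lebesgue_on U)"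
  by (simp add: set_borel_measurable_def borel_measurable_restrict_space_iff)

lemma AE_lebesgue_on:
  "U \<in> sets lebesgue \<Longrightarrow> (AE x in lebesgue. x \<in> U \<longrightarrow> P x) \<longleftrightarrow> (AE x in lebesgue_on U. P x)"
  by (simp add: AE_restrict_space_iff)

lemma is_weak_pderiv_iff:
  assumes "open U"
  shows "is_weak_pderiv U i f g \<longleftrightarrow> integrable (lebesgue_on U) g \<and>
     (\<forall>\<phi>. test_fun U \<phi> \<longrightarrow> integrable (lebesgue_on U) (\<lambda>x. f x * pderiv i \<phi> x) \<and>
        (\<integral>x. f x * pderiv i \<phi> x \<partial>lebesgue_on U) = - (\<integral>x. g x * \<phi> x \<partial>lebesgue_on U))"
  using assms unfolding is_weak_pderiv_def
  by (simp add: integrable_lebesgue_on integral_lebesgue_on)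

text \<open>By Lindelof countably many of the neighbourhoods cover, so the exceptional sets stay
  null. It carries statements proved on small boxes to all of an open set.\<close>

lemma AE_local:
  fixes U :: "'a::euclidean_space set"
  assumes "\<And>x. x \<in> U \<Longrightarrow> \<exists>V. open V \<and> x \<in> V \<and> (AE y in M. y \<in> V \<longrightarrow> P y)"
  shows "AE y in M. y \<in> U \<longrightarrow> P y"
proof -
  let ?F = "{V. open V \<and> (AE y in M. y \<in> V \<longrightarrow> P y)}"
  obtain F where F: "F \<subseteq> ?F" "countable F" "\<Union>F = \<Union>?F"
    using Lindelof[of ?F] by blast
  have "AE y in M. \<forall>V\<in>F. y \<in> V \<longrightarrow> P y"
    using F by (intro AE_ball_countable') auto
  moreover have "U \<subseteq> \<Union>F"
    using assms F(3) by blast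
  ultimately show ?thesis by (auto elim!: eventually_mono)
qed

lemma continuous_on_zero_extension:
  fixes F :: "'a::topological_space \<Rightarrow> real"
  assumes "open U" "closed K" "K \<subseteq> U" "continuous_on U F" "\<And>x. x \<in> U - K \<Longrightarrow> F x = 0"
  shows "continuous_on UNIV (\<lambda>x. if x \<in> U then F x else 0)"
proof -
  let ?f = "\<lambda>x. if x \<in> U then F x else 0"
  have "continuous_on U ?f" using assms(4) by (auto cong: continuous_on_cong)
  moreover have "continuous_on (- K) ?f"
    using assms(5) by (subst continuous_on_cong[where g = "\<lambda>x. 0"]) auto
  moreover have "U \<union> - K = UNIV" using assms by blast
  ultimately show ?thesis
    using assms(1,2) by (metis continuous_on_open_Un open_Compl)
qed

lemma integrable_compact_support:
  fixes F :: "'a::euclidean_space \<Rightarrow> real"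
  assumes "compact K" "continuous_on UNIV F" "\<And>x. x \<notin> K \<Longrightarrow> F x = 0"
  shows "integrable lborel F"
proof -
  have "integrable lborel (\<lambda>x. indicator K x *\<^sub>R F x)"
    using assms by (intro borel_integrable_compact) (auto intro: continuous_on_subset)
  also have "(\<lambda>x. indicator K x *\<^sub>R F x) = F" using assms(3) by (auto simp: fun_eq_iff indicator_def)
  finally show ?thesis .
qed

text \<open>Fubini with the inner integral along direction \<open>i\<close>: there the fundamental
  theorem on an interval beyond the support leaves only zero end values.\<close>

lemma integral_partial_derivative_eq_0:
  fixes k :: "real \<times> real \<Rightarrow> real" and k' :: "nat \<Rightarrow> real \<times> real \<Rightarrow> real"
  assumes deriv: "\<And>x. (k has_derivative (\<lambda>h. k' 1 x * fst h + k' 2 x * snd h)) (at x)"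
    and cont: "continuous_on UNIV (k' i)" and "compact K" "\<And>x. x \<notin> K \<Longrightarrow> k x = 0" "\<And>x. x \<notin> K \<Longrightarrow> k' i x = 0"
    and i: "i \<in> {1, 2}"
  shows "integral\<^sup>L lborel (k' i) = 0"
proof -
  obtain a where "K \<subseteq> ball 0 a" using compact_imp_bounded[OF \<open>compact K\<close>] bounded_subset_ballD by blast
  then have far: "norm x \<ge> a \<Longrightarrow> k x = 0" "norm x \<ge> a \<Longrightarrow> k' i x = 0" for x
  proof -
    assume "norm x \<ge> a"
    then have "x \<notin> K" using \<open>K \<subseteq> ball 0 a\<close> by auto
    then show "k x = 0" "k' i x = 0" using assms(4,5) by auto
  qed
  define b where "b = \<bar>a\<bar>"
  have big: "norm (s, t) \<ge> a" if "\<bar>s\<bar> \<ge> b \<or> \<bar>t\<bar> \<ge> b" for s t :: real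
    using that norm_fst_le[of s t] norm_snd_le[of t s] unfolding b_def by auto
  have FTC: "(\<integral>s. f s \<partial>lborel) = 0"
    if d: "\<And>s. (F has_real_derivative f s) (at s)" and c: "continuous_on UNIV f"
      and z: "\<And>s. \<bar>s\<bar> \<ge> b \<Longrightarrow> F s = 0" "\<And>s. \<bar>s\<bar> \<ge> b \<Longrightarrow> f s = 0" for f F :: "real \<Rightarrow> real"
  proof -
    have "(\<integral>s. indicator {-b..b} s *\<^sub>R f s \<partial>lborel) = F b - F (-b)"
      using d c by (intro integral_FTC_Icc)
        (auto simp: b_def has_real_derivative_iff_has_vector_derivative[symmetric]
          intro: has_field_derivative_at_within continuous_on_subset)
    also have "(\<lambda>s. indicator {-b..b} s *\<^sub>R f s) = f"
      using z(2) by (force simp: fun_eq_iff indicator_def abs_le_iff not_le)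
    finally show ?thesis using z(1)[of b] z(1)[of "-b"] by (simp add: b_def)
  qed
  have int: "integrable (lborel \<Otimes>\<^sub>M lborel) (case_prod (\<lambda>s t. k' i (s, t)))"
    using integrable_compact_support[OF \<open>compact K\<close> cont assms(5)] by (simp add: lborel_prod)
  have c1: "continuous_on UNIV (\<lambda>s. k' i (s, t))" and c2: "continuous_on UNIV (\<lambda>s. k' i (t, s))" for t
    using cont by (auto intro!: continuous_on_compose2[OF cont] continuous_intros)
  show ?thesis
  proof (cases "i = 1")
    case True
    have "((\<lambda>s. k (s, t)) has_real_derivative k' i (s, t)) (at s)" for s t
      unfolding has_field_derivative_def
      by (rule has_derivative_eq_rhs[OF has_derivative_compose[OF _ deriv]])
        (auto intro!: derivative_eq_intros simp: True)
    then have "(\<integral>s. k' i (s, t) \<partial>lborel) = 0" for t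
      using big far by (intro FTC[OF _ c1, of "\<lambda>s. k (s, t)"]) blast+
    then show ?thesis
      using lborel_pair.integral_snd[OF int] by (simp add: lborel_prod)
  next
    case False
    then have "i = 2" using i by simp
    have "((\<lambda>s. k (t, s)) has_real_derivative k' i (t, s)) (at s)" for s t
      unfolding has_field_derivative_def
      by (rule has_derivative_eq_rhs[OF has_derivative_compose[OF _ deriv]])
        (auto intro!: derivative_eq_intros simp: \<open>i = 2\<close>)
    then have "(\<integral>s. k' i (t, s) \<partial>lborel) = 0" for t
      using big far by (intro FTC[OF _ c2, of "\<lambda>s. k (t, s)"]) blast+
    then show ?thesis
      using lborel_pair.integral_fst[OF int] by (simp add: lborel_prod)
  qed
qed

lemma lebesgue_on_zero_extension:
  fixes F :: "'a::euclidean_space \<Rightarrow> real"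
  assumes "open U" and F: "integrable lborel (\<lambda>x. if x \<in> U then F x else 0)"
  shows "integrable (lebesgue_on U) F"
    and "integral\<^sup>L (lebesgue_on U) F = (\<integral>x. (if x \<in> U then F x else 0) \<partial>lborel)"
proof -
  have U: "U \<in> sets lebesgue" using assms by auto
  have "integrable lebesgue (\<lambda>x. if x \<in> U then F x else 0)"
    using F by (simp add: integrable_completion borel_measurable_integrable)
  then show "integrable (lebesgue_on U) F"
    using U Lebesgue_Measure.integrable_restrict_UNIV by blast
  show "integral\<^sup>L (lebesgue_on U) F = (\<integral>x. (if x \<in> U then F x else 0) \<partial>lborel)"
    using Lebesgue_Measure.integral_restrict_UNIV[OF U, of F] F
    by (simp add: integral_completion borel_measurable_integrable)
qed

section \<open>Supports of test functions and classical derivatives as weak ones\<close>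

definition tsupp :: "(real \<times> real \<Rightarrow> real) \<Rightarrow> (real \<times> real) set" where
  "tsupp \<phi> = closure {x. \<phi> x \<noteq> 0}"

lemma test_funD:
  assumes "test_fun U \<phi>"
  shows "smooth_fun \<phi>" "compact (tsupp \<phi>)" "closed (tsupp \<phi>)" "tsupp \<phi> \<subseteq> U"
    "\<And>x. x \<notin> tsupp \<phi> \<Longrightarrow> \<phi> x = 0" "\<And>x i. x \<notin> tsupp \<phi> \<Longrightarrow> pderiv i \<phi> x = 0"
proof -
  show *: "smooth_fun \<phi>" "compact (tsupp \<phi>)" "closed (tsupp \<phi>)" "tsupp \<phi> \<subseteq> U"
    using assms by (auto simp: test_fun_def tsupp_def)
  show z: "x \<notin> tsupp \<phi> \<Longrightarrow> \<phi> x = 0" for x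
    using closure_subset[of "{x. \<phi> x \<noteq> 0}"] by (auto simp: tsupp_def)
  show "x \<notin> tsupp \<phi> \<Longrightarrow> pderiv i \<phi> x = 0" for x i
  proof -
    assume x: "x \<notin> tsupp \<phi>"
    have "((\<lambda>_. 0) has_derivative (\<lambda>_. 0)) (at x)" by simp
    then have "(\<phi> has_derivative (\<lambda>_. 0)) (at x)"
      by (rule has_derivative_transform_within_open[where s = "- tsupp \<phi>"]) (use z x * in auto)
    then show "pderiv i \<phi> x = 0" by (simp add: pderiv_eqI)
  qed
qed

lemma test_funI:
  assumes "smooth_fun \<phi>" "compact K" "K \<subseteq> U" "\<And>x. x \<notin> K \<Longrightarrow> \<phi> x = 0"
  shows "test_fun U \<phi>"
proof -
  have "closure {x. \<phi> x \<noteq> 0} \<subseteq> K"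
    using assms by (intro closure_minimal compact_imp_closed) auto
  then show ?thesis
    using assms closed_Int_compact[OF closed_closure[of "{x. \<phi> x \<noteq> 0}"] \<open>compact K\<close>]
    unfolding test_fun_def by (simp add: Int_absorb2)
qed

lemma test_fun_mult:
  assumes "test_fun U \<phi>" "smooth_fun P"
  shows "test_fun U (\<lambda>x. P x * \<phi> x)"
  using test_funD[OF assms(1)] assms(2)
  by (intro test_funI[where K = "tsupp \<phi>"]) (auto intro: smooth_fun_intros)

lemma test_fun_add:
  assumes "test_fun U \<phi>" "test_fun U \<psi>"
  shows "test_fun U (\<lambda>x. \<phi> x + \<psi> x)"
  using test_funD[OF assms(1)] test_funD[OF assms(2)]
  by (intro test_funI[where K = "tsupp \<phi> \<union> tsupp \<psi>"]) (auto intro: smooth_fun_intros)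

lemma test_fun_diff:
  assumes "test_fun U \<phi>" "test_fun U \<psi>"
  shows "test_fun U (\<lambda>x. \<phi> x - \<psi> x)"
  using test_fun_add[OF assms(1) test_fun_mult[OF assms(2) smooth_fun_intros(1)[of "-1"]]] by simp

lemma pderiv_continuous_on: "smooth_fun \<phi> \<Longrightarrow> continuous_on S (pderiv i \<phi>)"
  by (intro smooth_fun_continuous_on smooth_fun_pderiv)

lemma pderiv_diff:
  "smooth_fun f \<Longrightarrow> smooth_fun g \<Longrightarrow> pderiv i (\<lambda>x. f x - g x) x = pderiv i f x - pderiv i g x"
  by (subst pderiv_eqI[OF has_derivative_diff[OF smooth_fun_has_derivative smooth_fun_has_derivative]])
    (auto simp: ebasis_def pderiv_def)

lemma integrable_cont_test:
  fixes F :: "'a::euclidean_space \<Rightarrow> real"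
  assumes "open U" "continuous_on U F" "compact K" "K \<subseteq> U" "\<And>x. x \<in> U - K \<Longrightarrow> F x = 0"
  shows "integrable lborel (\<lambda>x. if x \<in> U then F x else 0)" "integrable (lebesgue_on U) F"
proof -
  show "integrable lborel (\<lambda>x. if x \<in> U then F x else 0)"
    using integrable_compact_support[OF \<open>compact K\<close>
      continuous_on_zero_extension[OF \<open>open U\<close> compact_imp_closed[OF \<open>compact K\<close>] assms(4,2,5)]] assms(4,5)
    by auto
  then show "integrable (lebesgue_on U) F" using lebesgue_on_zero_extension assms by blast
qed

text \<open>\<open>G\<close> may be uncontrolled near the boundary, but \<open>G * \<phi>\<close>
  extended by zero is differentiable on the whole plane with compact support. Its partial derivative
  integrates to zero, and the product rule turns this into the defining identity.\<close>

lemma classical_imp_weak: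
  fixes G :: "real \<times> real \<Rightarrow> real" and g :: "nat \<Rightarrow> real \<times> real \<Rightarrow> real"
  assumes U: "open U"
    and deriv: "\<And>x. x \<in> U \<Longrightarrow> (G has_derivative (\<lambda>h. g 1 x * fst h + g 2 x * snd h)) (at x)"
    and cont: "continuous_on U (g i)" and int: "integrable (lebesgue_on U) (g i)" and i: "i \<in> {1, 2}"
  shows "is_weak_pderiv U i G (g i)"
  unfolding is_weak_pderiv_iff[OF U]
proof (intro conjI int allI impI)
  fix \<phi> assume \<phi>: "test_fun U \<phi>"
  note t = test_funD[OF \<phi>]
  define k where "k = (\<lambda>x. if x \<in> U then G x * \<phi> x else 0)"
  define k' where "k' j = (\<lambda>x. if x \<in> U then g j x * \<phi> x + G x * pderiv j \<phi> x else 0)" for j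
  have cG: "continuous_on U G"
    using deriv by (meson continuous_at_imp_continuous_on has_derivative_continuous)
  have c: "continuous_on U \<phi>" "continuous_on U (pderiv i \<phi>)"
    using t by (auto intro: smooth_fun_continuous_on pderiv_continuous_on)
  have i1: "integrable (lebesgue_on U) (\<lambda>x. g i x * \<phi> x)" and i2: "integrable (lebesgue_on U) (\<lambda>x. G x * pderiv i \<phi> x)"
    using U cont cG t c
    by (intro integrable_cont_test(2)[where K = "tsupp \<phi>"] continuous_intros; auto)+
  show "integrable (lebesgue_on U) (\<lambda>x. G x * pderiv i \<phi> x)" by fact
  have "(k has_derivative (\<lambda>h. k' 1 x * fst h + k' 2 x * snd h)) (at x)" for x
  proof (cases "x \<in> U")
    case True
    have "((\<lambda>x. G x * \<phi> x) has_derivative (\<lambda>h. k' 1 x * fst h + k' 2 x * snd h)) (at x)"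
      by (rule has_derivative_eq_rhs[OF has_derivative_mult[OF deriv[OF True] smooth_fun_has_derivative[OF t(1)]]])
        (auto simp: k'_def True algebra_simps)
    then show ?thesis
      by (rule has_derivative_transform_within_open[where s = U]) (use U True in \<open>auto simp: k_def\<close>)
  next
    case False
    then have x: "x \<notin> tsupp \<phi>" using t by blast
    have "((\<lambda>_. 0) has_derivative (\<lambda>h. k' 1 x * fst h + k' 2 x * snd h)) (at x)"
      by (simp add: k'_def False)
    then show ?thesis
      by (rule has_derivative_transform_within_open[where s = "- tsupp \<phi>"]) (use t x in \<open>auto simp: k_def\<close>)
  qed
  moreover have "continuous_on UNIV (k' i)" unfolding k'_def
    using U cont cG t c
    by (intro continuous_on_zero_extension[where K = "tsupp \<phi>"] continuous_intros) auto
  ultimately have "integral\<^sup>L lborel (k' i) = 0"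
    using t i by (intro integral_partial_derivative_eq_0[where K = "tsupp \<phi>" and k = k]) (auto simp: k_def k'_def)
  moreover have "continuous_on U (\<lambda>x. g i x * \<phi> x + G x * pderiv i \<phi> x)"
    using cont cG c by (intro continuous_intros)
  then have "integrable lborel (\<lambda>x. if x \<in> U then g i x * \<phi> x + G x * pderiv i \<phi> x else 0)"
    by (rule integrable_cont_test(1)[OF U _ t(2,4)]) (use t in auto)
  ultimately have "(\<integral>x. g i x * \<phi> x + G x * pderiv i \<phi> x \<partial>lebesgue_on U) = 0"
    using lebesgue_on_zero_extension(2)[OF U, of "\<lambda>x. g i x * \<phi> x + G x * pderiv i \<phi> x"]
    unfolding k'_def by simp
  then show "(\<integral>x. G x * pderiv i \<phi> x \<partial>lebesgue_on U) = - (\<integral>x. g i x * \<phi> x \<partial>lebesgue_on U)"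
    using i1 i2 by simp
qed

section \<open>The fundamental lemma of the calculus of variations\<close>

text \<open>The positive and the negative part of \<open>h\<close> are densities of two finite
  measures that agree on boxes. Boxes are stable under intersection and generate the Borel sets, so
  the measures and hence the densities agree.\<close>

lemma AE_zero_if_box_integrals_zero:
  fixes h :: "'a::euclidean_space \<Rightarrow> real"
  assumes h: "integrable lborel h" and z: "\<And>a b. (\<integral>x. h x * indicator (box a b) x \<partial>lborel) = 0"
  shows "AE x in lborel. h x = 0"
proof -
  have [measurable]: "h \<in> borel_measurable borel" using h by auto
  let ?p = "\<lambda>x. ennreal (h x)" and ?n = "\<lambda>x. ennreal (- h x)"
  have fin: "(\<integral>\<^sup>+ x. ?p x \<partial>lborel) < \<infinity>" "(\<integral>\<^sup>+ x. ?n x \<partial>lborel) < \<infinity>"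
    using h integrable_minus[OF h] unfolding real_integrable_def
    by (auto simp: less_top[symmetric])
  have "density lborel ?p = density lborel ?n"
  proof (rule measure_eqI_generator_eq[where \<Omega> = UNIV and E = "range (\<lambda>(a, b). box a b)"
        and A = "\<lambda>n::nat. box (- (real n *\<^sub>R One)) (real n *\<^sub>R One)"])
    show "Int_stable (range (\<lambda>(a, b). box a b::'a set))"
      by (auto simp: Int_stable_def box_Int_box)
    fix X :: "'a set" assume "X \<in> range (\<lambda>(a, b). box a b)"
    then obtain a b where X: "X = box a b" by auto
    have i: "integrable lborel (\<lambda>x. h x * indicator X x)" unfolding X
      using integrable_real_mult_indicator[OF _ h, of "box a b"] by simp
    have e: "(\<integral>\<^sup>+x. ennreal (h x * indicator X x) \<partial>lborel) = (\<integral>\<^sup>+x. ?p x * indicator X x \<partial>lborel)"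
      "(\<integral>\<^sup>+x. ennreal (- (h x * indicator X x)) \<partial>lborel) = (\<integral>\<^sup>+x. ?n x * indicator X x \<partial>lborel)"
      by (auto intro!: nn_integral_cong simp: indicator_def)
    have "(\<integral>\<^sup>+x. ?p x * indicator X x \<partial>lborel) < \<infinity>" "(\<integral>\<^sup>+x. ?n x * indicator X x \<partial>lborel) < \<infinity>"
      by (rule le_less_trans[OF nn_integral_mono fin(1)] le_less_trans[OF nn_integral_mono fin(2)], simp add: indicator_def)+
    moreover have "enn2real (\<integral>\<^sup>+x. ?p x * indicator X x \<partial>lborel) = enn2real (\<integral>\<^sup>+x. ?n x * indicator X x \<partial>lborel)"
      using z[of a b, folded X] real_lebesgue_integral_def[OF i, unfolded e] by linarith
    ultimately have "(\<integral>\<^sup>+x. ?p x * indicator X x \<partial>lborel) = (\<integral>\<^sup>+x. ?n x * indicator X x \<partial>lborel)"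
      by (metis ennreal_enn2real infinity_ennreal_def)
    then show "emeasure (density lborel ?p) X = emeasure (density lborel ?n) X"
      by (simp add: emeasure_density X)
  next
    fix n :: nat
    have "emeasure (density lborel ?p) (box (- (real n *\<^sub>R One)) (real n *\<^sub>R One)) \<le> (\<integral>\<^sup>+ x. ?p x \<partial>lborel)"
      by (auto simp: emeasure_density intro!: nn_integral_mono simp: indicator_def)
    then show "emeasure (density lborel ?p) (box (- (real n *\<^sub>R One)) (real n *\<^sub>R One)) \<noteq> \<infinity>"
      using fin(1) by auto
  qed (auto simp: borel_eq_box UN_box_eq_UNIV)
  then have "AE x in lborel. ?p x = ?n x"
    by (subst (asm) sigma_finite_measure.density_unique_iff[OF lborel.sigma_finite_measure_axioms]) auto
  then show ?thesis
  proof (rule AE_mp, intro AE_I2 impI)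
    fix x assume "?p x = ?n x"
    then show "h x = 0"
      by (metis (no_types, lifting) ennreal_eq_0_iff ennreal_neg linorder_linear neg_0_le_iff_le neg_le_0_iff_le order_antisym)
  qed
qed

text \<open>Positive exactly on the open interval from \<open>a\<close> to \<open>b\<close>. The
  factor \<open>Suc n\<close> steepens both flanks, so the limit in \<open>n\<close> is the
  indicator of that interval.\<close>

definition bump :: "nat \<Rightarrow> real \<Rightarrow> real \<Rightarrow> real \<Rightarrow> real" where
  "bump n a b t = exp_cut 0 (real (Suc n) * (t - a)) * exp_cut 0 (real (Suc n) * (b - t))"

lemma bump_bounds: "0 \<le> bump n a b t" "bump n a b t \<le> 1"
  unfolding bump_def using exp_cut_nonneg exp_cut_0_le by (auto intro: mult_le_one)

lemma bump_pos_iff: "bump n a b t \<noteq> 0 \<longleftrightarrow> a < t \<and> t < b"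
  by (auto simp: bump_def exp_cut_def zero_less_mult_iff)

lemma exp_cut_scaled_limit: "(\<lambda>n. exp_cut 0 (real (Suc n) * s)) \<longlonglongrightarrow> (if s > 0 then 1 else 0)"
proof (cases "s > 0")
  case True
  have "(\<lambda>n. exp (- (1 / s * inverse (real (Suc n))))) \<longlonglongrightarrow> exp (- (1 / s * 0))"
    by (intro tendsto_intros LIMSEQ_inverse_real_of_nat)
  then show ?thesis using True by (simp add: exp_cut_def divide_simps mult.commute)
next
  case False
  then have "exp_cut 0 (real (Suc n) * s) = 0" for n by (auto simp: exp_cut_def zero_less_mult_iff)
  then show ?thesis using False by simp
qed

lemma bump_limit: "(\<lambda>n. bump n a b t) \<longlonglongrightarrow> indicator {a<..<b} t"
  unfolding bump_def
  by (rule tendsto_eq_rhs[OF tendsto_mult[OF exp_cut_scaled_limit exp_cut_scaled_limit]])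
    (auto simp: indicator_def)

lemma smooth_fun_bump: "smooth_fun (\<lambda>x. bump n a b (fst x))" "smooth_fun (\<lambda>x. bump n a b (snd x))"
  unfolding bump_def by (auto intro!: smooth_fun_intros smooth_fun_diff)

lemma bump_continuous: "continuous_on S (bump n a b)"
  unfolding bump_def by (intro continuous_intros continuous_on_compose2[OF exp_cut_continuous[of UNIV]]) auto

lemma test_fun_bump:
  assumes "cbox (a, c) (b, d) \<subseteq> U"
  shows "test_fun U (\<lambda>x. bump n a b (fst x) * bump n c d (snd x))"
proof (rule test_funI)
  show "compact (cbox (a, c) (b, d))" by simp
  show "bump n a b (fst x) * bump n c d (snd x) = 0" if "x \<notin> cbox (a, c) (b, d)" for x
    using that bump_pos_iff[of n a b "fst x"] bump_pos_iff[of n c d "snd x"] by (cases x) (auto simp: cbox_Pair_eq)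
qed (use assms in \<open>auto intro: smooth_fun_intros smooth_fun_bump\<close>)

text \<open>Product bumps converge boundedly to indicators of boxes, so all box integrals of
  \<open>g\<close> inside \<open>U\<close> vanish. Testing with product bumps alone matters for
  \<open>weak_gradient_zero_box\<close>, where only products of one-variable functions are under
  control.\<close>

lemma fundamental_lemma_bump:
  assumes U: "open U" and g: "integrable (lebesgue_on U) g"
    and z: "\<And>n a b c d. cbox (a, c) (b, d) \<subseteq> U \<Longrightarrow>
      (\<integral>x. g x * (bump n a b (fst x) * bump n c d (snd x)) \<partial>lebesgue_on U) = 0"
  shows "AE x in lebesgue_on U. g x = 0"
proof -
  have U': "U \<in> sets lebesgue" using U by auto
  have box_pair: "box (a, c) (b, d) = {a<..<b} \<times> {c<..<d}" for a b c d :: real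
    by (auto simp: box_def Basis_prod_def)
  define G where "G = (\<lambda>x. if x \<in> U then g x else 0)"
  have G: "integrable lebesgue G"
    unfolding G_def using g U' Lebesgue_Measure.integrable_restrict_UNIV by blast
  have box0: "(\<integral>x. G x * indicator (box p q) x \<partial>lebesgue) = 0" if pq: "cbox p q \<subseteq> U" for p q
  proof -
    obtain a c b d where [simp]: "p = (a, c)" "q = (b, d)" by (metis surj_pair)
    let ?s = "\<lambda>n x. g x * (bump n a b (fst x) * bump n c d (snd x))"
    have m: "?s n \<in> borel_measurable (lebesgue_on U)" for n
    proof (intro borel_measurable_times)
      show "g \<in> borel_measurable (lebesgue_on U)" using g by simp
      show "(\<lambda>x. bump n a b (fst x)) \<in> borel_measurable (lebesgue_on U)" "(\<lambda>x. bump n c d (snd x)) \<in> borel_measurable (lebesgue_on U)"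
        by (rule continuous_imp_measurable_on_sets_lebesgue[OF smooth_fun_continuous_on[OF smooth_fun_bump(1)] U']
            continuous_imp_measurable_on_sets_lebesgue[OF smooth_fun_continuous_on[OF smooth_fun_bump(2)] U'])+
    qed
    have "(\<lambda>n. \<integral>x. ?s n x \<partial>lebesgue_on U) \<longlonglongrightarrow> (\<integral>x. g x * indicator (box p q) x \<partial>lebesgue_on U)"
    proof (rule integral_dominated_convergence[where w = "\<lambda>x. \<bar>g x\<bar>"])
      show "(\<lambda>x. g x * indicator (box p q) x) \<in> borel_measurable (lebesgue_on U)"
        by (rule borel_measurable_times[OF borel_measurable_integrable[OF g]
            measurable_restrict_space1[OF borel_measurable_indicator]]) auto
      show "AE x in lebesgue_on U. (\<lambda>n. ?s n x) \<longlonglongrightarrow> g x * indicator (box p q) x"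
      proof (intro AE_I2)
        fix x :: "real \<times> real"
        have "indicator (box p q) x = (indicator {a<..<b} (fst x) * indicator {c<..<d} (snd x) :: real)"
          by (cases x) (auto simp: box_pair indicator_def)
        then show "(\<lambda>n. ?s n x) \<longlonglongrightarrow> g x * indicator (box p q) x"
          by (simp only:) (intro tendsto_intros bump_limit)
      qed
      show "AE x in lebesgue_on U. norm (?s n x) \<le> \<bar>g x\<bar>" for n
        using bump_bounds by (intro AE_I2) (auto simp: abs_mult intro!: mult_left_le mult_le_one)
    qed (use g m in auto)
    moreover have "(\<integral>x. ?s n x \<partial>lebesgue_on U) = 0" for n using z pq by simp
    ultimately have "(\<integral>x. g x * indicator (box p q) x \<partial>lebesgue_on U) = 0"
      by (simp add: LIMSEQ_const_iff)
    moreover have "(\<lambda>x. G x * indicator (box p q) x) = (\<lambda>x. if x \<in> U then g x * indicator (box p q) x else 0)"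
      by (auto simp: G_def)
    ultimately show ?thesis
      using Lebesgue_Measure.integral_restrict_UNIV[OF U', of "\<lambda>x. g x * indicator (box p q) x"] by simp
  qed
  \<comment> \<open>\<open>AE_zero_if_box_integrals_zero\<close> concerns \<open>lborel\<close>, so
    \<open>G\<close> is exchanged for a Borel function that equals it almost everywhere.\<close>
  obtain G' where G': "G' \<in> borel_measurable lborel" "AE x in lborel. G x = G' x"
    using completion_ex_borel_measurable_real borel_measurable_integrable[OF G] by blast
  have G'int: "integrable lborel G'"
  proof -
    have "integrable lebesgue G'"
      using G AE_completion[OF G'(2)] measurable_completion[OF G'(1)]
      by (subst integrable_cong_AE[where g = G]) (auto elim: eventually_mono)
    then show ?thesis using G'(1) by (simp add: integrable_completion)
  qed
  have G'box: "(\<integral>x. G' x * indicator (box p q) x \<partial>lborel) = 0" if "cbox p q \<subseteq> U" for p q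
  proof -
    have "(\<integral>x. G' x * indicator (box p q) x \<partial>lborel) = (\<integral>x. G' x * indicator (box p q) x \<partial>lebesgue)"
      using G'(1) by (intro integral_completion[symmetric]) auto
    also have "\<dots> = (\<integral>x. G x * indicator (box p q) x \<partial>lebesgue)"
      using G'(1) AE_completion[OF G'(2)] borel_measurable_integrable[OF G]
      by (intro integral_cong_AE borel_measurable_times) (auto intro: measurable_completion elim: eventually_mono)
    finally show ?thesis using box0[OF that] by simp
  qed
  have "AE y in lborel. y \<in> U \<longrightarrow> G' y = 0"
  proof (rule AE_local)
    fix x assume "x \<in> U"
    then obtain a b where ab: "cbox a b \<subseteq> U" "x \<in> box a b"
      using open_contains_cbox[OF U \<open>x \<in> U\<close>] by metis
    have "AE y in lborel. G' y * indicator (box a b) y = 0"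
    proof (rule AE_zero_if_box_integrals_zero)
      show "integrable lborel (\<lambda>x. G' x * indicator (box a b) x)"
        using G'int by (intro integrable_real_mult_indicator) auto
      fix c d
      obtain p q where pq: "box a b \<inter> box c d = box p q" using box_Int_box by blast
      have "(\<integral>x. G' x * indicator (box p q) x \<partial>lborel) = 0"
      proof (cases "box p q = {}")
        case False
        have ne: "box a b \<noteq> {}" and sub: "box p q \<subseteq> box a b" using ab(2) pq by auto
        \<comment> \<open>The vanishing of box integrals is known only for boxes whose closure lies
          in \<open>U\<close>; passing to closures keeps the intersection inside
          \<open>cbox a b\<close>.\<close>
        have "cbox p q \<subseteq> cbox a b"
          using closure_mono[OF sub] unfolding closure_box[OF False] closure_box[OF ne] .
        then show ?thesis using ab G'box by blast
      qed simp
      then show "(\<integral>x. G' x * indicator (box a b) x * indicator (box c d) x \<partial>lborel) = 0"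
        by (simp add: pq[symmetric] indicator_inter_arith mult.assoc)
    qed
    then show "\<exists>V. open V \<and> x \<in> V \<and> (AE y in lborel. y \<in> V \<longrightarrow> G' y = 0)"
      using ab(2) by (intro exI[of _ "box a b"]) (auto elim!: eventually_mono)
  qed
  then have "AE y in lborel. y \<in> U \<longrightarrow> g y = 0"
    using G'(2) by eventually_elim (auto simp: G_def)
  then show ?thesis
    using AE_lebesgue_on[OF U'] AE_completion by blast
qed

lemma fundamental_lemma:
  assumes "open U" "integrable (lebesgue_on U) g"
    and "\<And>\<phi>. test_fun U \<phi> \<Longrightarrow> (\<integral>x. g x * \<phi> x \<partial>lebesgue_on U) = 0"
  shows "AE x in lebesgue_on U. g x = 0"
  using assms test_fun_bump by (intro fundamental_lemma_bump) auto

section \<open>Square-integrable functions\<close>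

text \<open>Stated over an arbitrary measure so that one Cauchy-Schwarz inequality serves both the
  plane domain and the interval [1,R].\<close>

definition sq_integrable :: "'a measure \<Rightarrow> ('a \<Rightarrow> real) \<Rightarrow> bool" where
  "sq_integrable M f \<longleftrightarrow> f \<in> borel_measurable M \<and> integrable M (\<lambda>x. (f x)\<^sup>2)"

lemma sq_integrable_measurable: "sq_integrable M f \<Longrightarrow> f \<in> borel_measurable M"
  by (simp add: sq_integrable_def)

lemma sq_integrable_mult:
  assumes "sq_integrable M f" "sq_integrable M g"
  shows "integrable M (\<lambda>x. f x * g x)"
proof (rule Bochner_Integration.integrable_bound)
  show "integrable M (\<lambda>x. (f x)\<^sup>2 + (g x)\<^sup>2)" "(\<lambda>x. f x * g x) \<in> borel_measurable M"
    using assms by (auto simp: sq_integrable_def)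
  have "\<bar>a * b\<bar> \<le> a\<^sup>2 + b\<^sup>2" for a b :: real
    using sum_squares_bound[of a b] sum_squares_bound[of a "-b"] by (simp add: abs_le_iff)
  then show "AE x in M. norm (f x * g x) \<le> norm ((f x)\<^sup>2 + (g x)\<^sup>2)" by simp
qed

lemma sq_integrable_add:
  assumes "sq_integrable M f" "sq_integrable M g"
  shows "sq_integrable M (\<lambda>x. f x + g x)"
  using assms sq_integrable_mult[OF assms]
  by (auto simp: sq_integrable_def power2_sum mult.assoc)

lemma sq_integrable_minus: "sq_integrable M f \<Longrightarrow> sq_integrable M (\<lambda>x. - f x)"
  by (auto simp: sq_integrable_def)

lemma sq_integrable_diff:
  "sq_integrable M f \<Longrightarrow> sq_integrable M g \<Longrightarrow> sq_integrable M (\<lambda>x. f x - g x)"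
  using sq_integrable_add[OF _ sq_integrable_minus] by simp

lemma sq_integrable_bounded_mult:
  assumes "sq_integrable M f" "h \<in> borel_measurable M" "AE x in M. \<bar>h x\<bar> \<le> B"
  shows "sq_integrable M (\<lambda>x. h x * f x)"
  unfolding sq_integrable_def
proof
  show "(\<lambda>x. h x * f x) \<in> borel_measurable M" using assms by (auto simp: sq_integrable_def)
  show "integrable M (\<lambda>x. (h x * f x)\<^sup>2)"
  proof (rule Bochner_Integration.integrable_bound)
    show "integrable M (\<lambda>x. B\<^sup>2 * (f x)\<^sup>2)" "(\<lambda>x. (h x * f x)\<^sup>2) \<in> borel_measurable M"
      using assms by (auto simp: sq_integrable_def)
    show "AE x in M. norm ((h x * f x)\<^sup>2) \<le> norm (B\<^sup>2 * (f x)\<^sup>2)"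
      using assms(3)
      by eventually_elim (auto simp: power_mult_distrib abs_le_square_iff[symmetric] intro!: mult_right_mono)
  qed
qed

lemma sq_integrable_cong_AE:
  assumes "sq_integrable M f" "AE x in M. f x = g x" "g \<in> borel_measurable M"
  shows "sq_integrable M g"
proof -
  have "integrable M (\<lambda>x. (f x)\<^sup>2) \<longleftrightarrow> integrable M (\<lambda>x. (g x)\<^sup>2)"
    using assms by (intro integrable_cong_AE) (auto simp: sq_integrable_def)
  then show ?thesis using assms by (auto simp: sq_integrable_def)
qed

lemma (in finite_measure) sq_integrable_bounded:
  assumes "f \<in> borel_measurable M" "AE x in M. \<bar>f x\<bar> \<le> B"
  shows "sq_integrable M f"
proof -
  have "sq_integrable M (\<lambda>x. 1)" by (simp add: sq_integrable_def)
  from sq_integrable_bounded_mult[OF this assms] show ?thesis by simp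
qed

lemma (in finite_measure) sq_integrable_integrable:
  assumes "sq_integrable M f"
  shows "integrable M f"
  using sq_integrable_mult[OF assms, of "\<lambda>x. 1"] by (simp add: sq_integrable_def)

lemma integral_Cauchy_Schwarz:
  assumes f: "sq_integrable M f" and g: "sq_integrable M g"
  shows "(\<integral>x. f x * g x \<partial>M)\<^sup>2 \<le> (\<integral>x. (f x)\<^sup>2 \<partial>M) * (\<integral>x. (g x)\<^sup>2 \<partial>M)"
proof -
  let ?A = "\<integral>x. (f x)\<^sup>2 \<partial>M" and ?B = "\<integral>x. f x * g x \<partial>M" and ?C = "\<integral>x. (g x)\<^sup>2 \<partial>M"
  note i = sq_integrable_mult[OF f g]
  have q: "0 \<le> ?A + 2 * t * ?B + t\<^sup>2 * ?C" for t
  proof -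
    have "(\<integral>x. (f x + t * g x)\<^sup>2 \<partial>M) = (\<integral>x. (f x)\<^sup>2 + 2 * t * (f x * g x) + t\<^sup>2 * (g x)\<^sup>2 \<partial>M)"
      by (rule Bochner_Integration.integral_cong) (auto simp: power2_eq_square algebra_simps)
    also have "\<dots> = ?A + 2 * t * ?B + t\<^sup>2 * ?C"
      using f g i by (simp add: sq_integrable_def)
    finally have "?A + 2 * t * ?B + t\<^sup>2 * ?C = (\<integral>x. (f x + t * g x)\<^sup>2 \<partial>M)" by simp
    also have "0 \<le> \<dots>" by simp
    finally show ?thesis by simp
  qed
  have C: "0 \<le> ?C" by (rule integral_nonneg_AE) simp
  show ?thesis
  proof (cases "?C = 0")
    case True
    have "?B = 0"
    proof (rule ccontr)
      assume "?B \<noteq> 0"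
      \<comment> \<open>Without its quadratic term the polynomial in \<open>t\<close> is affine, and
        at this \<open>t\<close> it takes the value -1.\<close>
      then show False using q[of "- (?A + 1) / (2 * ?B)"] True by (simp add: field_simps)
    qed
    then show ?thesis using True by simp
  next
    case False
    then have "0 < ?C" using C by linarith
    \<comment> \<open>The minimiser of the quadratic polynomial in \<open>t\<close>.\<close>
    then show ?thesis using q[of "- ?B / ?C"] by (simp add: field_simps power2_eq_square)
  qed
qed

lemma integral_Cauchy_Schwarz_abs:
  assumes f: "sq_integrable M f" and g: "sq_integrable M g"
  shows "\<bar>\<integral>x. f x * g x \<partial>M\<bar> \<le> sqrt (\<integral>x. (f x)\<^sup>2 \<partial>M) * sqrt (\<integral>x. (g x)\<^sup>2 \<partial>M)"
  using real_sqrt_le_mono[OF integral_Cauchy_Schwarz[OF assms]] by (simp add: real_sqrt_mult)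

text \<open>Expand f_n g_n - f g as (f_n - f)(g_n - g) + (f_n - f) g + f (g_n - g) and apply
  Cauchy-Schwarz to each term. Identities for test functions reach \<open>H10_grad\<close> functions
  through this continuity.\<close>

lemma L2_tendsto_mult:
  assumes f: "\<And>n. sq_integrable M (f n)" "sq_integrable M f'" "(\<lambda>n. \<integral>x. (f n x - f' x)\<^sup>2 \<partial>M) \<longlonglongrightarrow> 0"
    and g: "\<And>n. sq_integrable M (g n)" "sq_integrable M g'" "(\<lambda>n. \<integral>x. (g n x - g' x)\<^sup>2 \<partial>M) \<longlonglongrightarrow> 0"
  shows "(\<lambda>n. \<integral>x. f n x * g n x \<partial>M) \<longlonglongrightarrow> (\<integral>x. f' x * g' x \<partial>M)"
proof (rule LIM_zero_cancel, rule Lim_null_comparison)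
  let ?F = "\<lambda>n. sqrt (\<integral>x. (f n x - f' x)\<^sup>2 \<partial>M)" and ?G = "\<lambda>n. sqrt (\<integral>x. (g n x - g' x)\<^sup>2 \<partial>M)"
  let ?b = "\<lambda>n. ?F n * ?G n + ?F n * sqrt (\<integral>x. (g' x)\<^sup>2 \<partial>M) + sqrt (\<integral>x. (f' x)\<^sup>2 \<partial>M) * ?G n"
  have F: "?F \<longlonglongrightarrow> sqrt 0" and G: "?G \<longlonglongrightarrow> sqrt 0"
    using f(3) g(3) tendsto_real_sqrt by blast+
  have "?b \<longlonglongrightarrow> sqrt 0 * sqrt 0 + sqrt 0 * sqrt (\<integral>x. (g' x)\<^sup>2 \<partial>M) + sqrt (\<integral>x. (f' x)\<^sup>2 \<partial>M) * sqrt 0"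
    by (intro tendsto_intros F G)
  then show "?b \<longlonglongrightarrow> 0" by simp
  have "\<bar>(\<integral>x. f n x * g n x \<partial>M) - (\<integral>x. f' x * g' x \<partial>M)\<bar> \<le> ?b n" for n
  proof -
    have df: "sq_integrable M (\<lambda>x. f n x - f' x)" and dg: "sq_integrable M (\<lambda>x. g n x - g' x)"
      using f g by (auto intro: sq_integrable_diff)
    note i = sq_integrable_mult[OF df dg] sq_integrable_mult[OF df g(2)] sq_integrable_mult[OF f(2) dg]
    have "(\<integral>x. f n x * g n x \<partial>M) - (\<integral>x. f' x * g' x \<partial>M) = (\<integral>x. f n x * g n x - f' x * g' x \<partial>M)"
      using f g by (intro Bochner_Integration.integral_diff[symmetric] sq_integrable_mult)
    also have "\<dots> = (\<integral>x. (f n x - f' x) * (g n x - g' x) + (f n x - f' x) * g' x + f' x * (g n x - g' x) \<partial>M)"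
      by (rule Bochner_Integration.integral_cong) (auto simp: algebra_simps)
    also have "\<dots> = (\<integral>x. (f n x - f' x) * (g n x - g' x) \<partial>M) + (\<integral>x. (f n x - f' x) * g' x \<partial>M) + (\<integral>x. f' x * (g n x - g' x) \<partial>M)"
      using i by simp
    finally show ?thesis
      using integral_Cauchy_Schwarz_abs[OF df dg] integral_Cauchy_Schwarz_abs[OF df g(2)] integral_Cauchy_Schwarz_abs[OF f(2) dg]
      by linarith
  qed
  then show "\<forall>\<^sub>F n in sequentially. norm ((\<integral>x. f n x * g n x \<partial>M) - (\<integral>x. f' x * g' x \<partial>M)) \<le> ?b n" by simp
qed

lemma L2_tendsto_const: "(\<lambda>n::nat. \<integral>x. (f x - f x)\<^sup>2 \<partial>M) \<longlonglongrightarrow> (0::real)"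
  by simp

lemma L2_tendsto_add:
  assumes f: "\<And>n. sq_integrable M (f n)" "sq_integrable M f'" "(\<lambda>n. \<integral>x. (f n x - f' x)\<^sup>2 \<partial>M) \<longlonglongrightarrow> 0"
    and g: "\<And>n. sq_integrable M (g n)" "sq_integrable M g'" "(\<lambda>n. \<integral>x. (g n x - g' x)\<^sup>2 \<partial>M) \<longlonglongrightarrow> 0"
  shows "(\<lambda>n. \<integral>x. ((f n x + g n x) - (f' x + g' x))\<^sup>2 \<partial>M) \<longlonglongrightarrow> 0"
proof (rule tendsto_sandwich[OF _ _ tendsto_const])
  let ?b = "\<lambda>n. 2 * (\<integral>x. (f n x - f' x)\<^sup>2 \<partial>M) + 2 * (\<integral>x. (g n x - g' x)\<^sup>2 \<partial>M)"
  have "?b \<longlonglongrightarrow> 2 * 0 + 2 * 0" by (intro tendsto_intros f g)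
  then show "?b \<longlonglongrightarrow> 0" by simp
  have "(\<integral>x. ((f n x + g n x) - (f' x + g' x))\<^sup>2 \<partial>M) \<le> ?b n" for n
  proof -
    have df: "sq_integrable M (\<lambda>x. f n x - f' x)" and dg: "sq_integrable M (\<lambda>x. g n x - g' x)"
      using f g by (auto intro: sq_integrable_diff)
    have "(\<integral>x. ((f n x + g n x) - (f' x + g' x))\<^sup>2 \<partial>M) \<le> (\<integral>x. 2 * (f n x - f' x)\<^sup>2 + 2 * (g n x - g' x)\<^sup>2 \<partial>M)"
    proof (rule integral_mono)
      have "(\<lambda>x. (f n x - f' x) + (g n x - g' x)) = (\<lambda>x. (f n x + g n x) - (f' x + g' x))" by auto
      then show "integrable M (\<lambda>x. ((f n x + g n x) - (f' x + g' x))\<^sup>2)"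
        using sq_integrable_add[OF df dg] by (simp add: sq_integrable_def)
      show "integrable M (\<lambda>x. 2 * (f n x - f' x)\<^sup>2 + 2 * (g n x - g' x)\<^sup>2)"
        using df dg by (simp add: sq_integrable_def)
      show "((f n x + g n x) - (f' x + g' x))\<^sup>2 \<le> 2 * (f n x - f' x)\<^sup>2 + 2 * (g n x - g' x)\<^sup>2" for x
        using sum_squares_bound[of "f n x - f' x" "g n x - g' x"] by (simp add: power2_eq_square algebra_simps)
    qed
    also have "\<dots> = ?b n" using df dg by (simp add: sq_integrable_def)
    finally show ?thesis .
  qed
  then show "\<forall>\<^sub>F n in sequentially. (\<integral>x. ((f n x + g n x) - (f' x + g' x))\<^sup>2 \<partial>M) \<le> ?b n" by simp
qed simp

lemma L2_tendsto_bounded_mult: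
  assumes f: "\<And>n. sq_integrable M (f n)" "sq_integrable M f'" "(\<lambda>n. \<integral>x. (f n x - f' x)\<^sup>2 \<partial>M) \<longlonglongrightarrow> 0"
    and h: "h \<in> borel_measurable M" "AE x in M. \<bar>h x\<bar> \<le> B"
  shows "(\<lambda>n. \<integral>x. (h x * f n x - h x * f' x)\<^sup>2 \<partial>M) \<longlonglongrightarrow> 0"
proof (rule tendsto_sandwich[OF _ _ tendsto_const])
  let ?b = "\<lambda>n. B\<^sup>2 * (\<integral>x. (f n x - f' x)\<^sup>2 \<partial>M)"
  have "?b \<longlonglongrightarrow> B\<^sup>2 * 0" by (intro tendsto_intros f)
  then show "?b \<longlonglongrightarrow> 0" by simp
  have "(\<integral>x. (h x * f n x - h x * f' x)\<^sup>2 \<partial>M) \<le> ?b n" for n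
  proof -
    have df: "sq_integrable M (\<lambda>x. f n x - f' x)"
      using f by (auto intro: sq_integrable_diff)
    have "(\<integral>x. (h x * f n x - h x * f' x)\<^sup>2 \<partial>M) \<le> (\<integral>x. B\<^sup>2 * (f n x - f' x)\<^sup>2 \<partial>M)"
    proof (rule integral_mono_AE)
      show "integrable M (\<lambda>x. (h x * f n x - h x * f' x)\<^sup>2)"
        using sq_integrable_bounded_mult[OF df h] by (simp add: sq_integrable_def right_diff_distrib)
      show "AE x in M. (h x * f n x - h x * f' x)\<^sup>2 \<le> B\<^sup>2 * (f n x - f' x)\<^sup>2"
        using h(2)
        by eventually_elim (auto simp: power_mult_distrib right_diff_distrib[symmetric] abs_le_square_iff[symmetric] intro!: mult_right_mono)
    qed (use df in \<open>simp add: sq_integrable_def\<close>)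
    then show ?thesis by simp
  qed
  then show "\<forall>\<^sub>F n in sequentially. (\<integral>x. (h x * f n x - h x * f' x)\<^sup>2 \<partial>M) \<le> ?b n" by simp
qed simp

lemma L2_iff: "open U \<Longrightarrow> L2 U f \<longleftrightarrow> sq_integrable (lebesgue_on U) f"
  by (simp add: L2_def sq_integrable_def measurable_lebesgue_on integrable_lebesgue_on)

section \<open>Sobolev spaces on bounded open sets\<close>

text \<open>Boundedness makes Lebesgue measure on \<open>U\<close> finite and every smooth function
  bounded there, so L2 embeds in L1 and is stable under smooth factors.\<close>

locale bounded_open =
  fixes U :: "(real \<times> real) set"
  assumes open_U: "open U" and bounded_U: "bounded U"
begin

abbreviation "M \<equiv> lebesgue_on U"

lemma U_sets: "U \<in> sets lebesgue"
  using open_U by auto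

sublocale finite_measure M
proof
  have "emeasure lebesgue U < \<infinity>"
    using emeasure_bounded_finite[OF bounded_U] open_U by (simp add: emeasure_completion)
  then show "emeasure M (space M) \<noteq> \<infinity>"
    using U_sets by (simp add: emeasure_restrict_space)
qed

lemma smooth_measurable: "smooth_fun P \<Longrightarrow> P \<in> borel_measurable M"
  by (intro continuous_imp_measurable_on_sets_lebesgue[OF _ U_sets] smooth_fun_continuous_on)

lemma smooth_bounded:
  assumes "smooth_fun P"
  obtains B where "\<And>x. x \<in> U \<Longrightarrow> \<bar>P x\<bar> \<le> B"
proof -
  have "compact (P ` closure U)"
    using bounded_U by (intro compact_continuous_image smooth_fun_continuous_on assms) simp
  then obtain B where "\<forall>y\<in>P ` closure U. norm y \<le> B"
    using compact_imp_bounded bounded_iff by metis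
  then show ?thesis using that closure_subset by (metis (no_types, opaque_lifting) image_eqI real_norm_def subset_iff)
qed

lemma smooth_bounded_AE:
  assumes "smooth_fun P"
  obtains B where "AE x in M. \<bar>P x\<bar> \<le> B"
proof -
  obtain B where "\<And>x. x \<in> U \<Longrightarrow> \<bar>P x\<bar> \<le> B" using smooth_bounded[OF assms] by blast
  then show ?thesis by (intro that[of B] AE_I2) simp
qed

lemma sq_integrable_smooth: "smooth_fun P \<Longrightarrow> sq_integrable M P"
  using smooth_bounded_AE smooth_measurable sq_integrable_bounded by metis

lemma sq_integrable_smooth_mult: "smooth_fun P \<Longrightarrow> sq_integrable M f \<Longrightarrow> sq_integrable M (\<lambda>x. P x * f x)"
  using smooth_bounded_AE smooth_measurable sq_integrable_bounded_mult by metis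

lemma integrable_smooth_mult:
  assumes "smooth_fun P" "integrable M f"
  shows "integrable M (\<lambda>x. f x * P x)" "integrable M (\<lambda>x. P x * f x)"
proof -
  obtain B where B: "AE x in M. \<bar>P x\<bar> \<le> B" using smooth_bounded_AE[OF assms(1)] by blast
  show "integrable M (\<lambda>x. f x * P x)"
  proof (rule Bochner_Integration.integrable_bound)
    show "integrable M (\<lambda>x. B * f x)" "(\<lambda>x. f x * P x) \<in> borel_measurable M"
      using assms smooth_measurable by auto
    show "AE x in M. norm (f x * P x) \<le> norm (B * f x)"
      using B by eventually_elim (auto simp: abs_mult mult.commute intro!: mult_mono)
  qed
  then show "integrable M (\<lambda>x. P x * f x)" by (simp add: mult.commute)
qed

lemma test_integrable_mult:
  assumes "test_fun U \<phi>" "integrable M f"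
  shows "integrable M (\<lambda>x. f x * \<phi> x)"
  using integrable_smooth_mult[OF test_funD(1)[OF assms(1)] assms(2)] by blast

section \<open>Calculus of weak derivatives\<close>

lemmas weak_iff = is_weak_pderiv_iff[OF open_U]

lemma weak_unique:
  assumes "is_weak_pderiv U i f g" "is_weak_pderiv U i f h"
  shows "AE x in M. g x = h x"
proof -
  have "AE x in M. g x - h x = 0"
  proof (rule fundamental_lemma[OF open_U])
    show "integrable M (\<lambda>x. g x - h x)" using assms by (auto simp: weak_iff)
    fix \<phi> assume \<phi>: "test_fun U \<phi>"
    have "(\<integral>x. (g x - h x) * \<phi> x \<partial>M) = (\<integral>x. g x * \<phi> x \<partial>M) - (\<integral>x. h x * \<phi> x \<partial>M)"
      using assms test_integrable_mult[OF \<phi>] by (simp add: weak_iff left_diff_distrib)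
    then show "(\<integral>x. (g x - h x) * \<phi> x \<partial>M) = 0" using assms \<phi> unfolding weak_iff by auto
  qed
  then show ?thesis by simp
qed

lemma weak_cong:
  assumes w: "is_weak_pderiv U i f g" and f: "AE x in M. f x = f' x" and f': "f' \<in> borel_measurable M"
    and g: "AE x in M. g x = g' x" and g': "g' \<in> borel_measurable M"
  shows "is_weak_pderiv U i f' g'"
  unfolding weak_iff
proof (intro conjI allI impI)
  have [measurable]: "g \<in> borel_measurable M" using w by (auto simp: weak_iff)
  note [measurable] = f' g'
  show "integrable M g'" using w g integrable_cong_AE[of g M g'] by (auto simp: weak_iff)
  fix \<phi> assume \<phi>: "test_fun U \<phi>"
  have [measurable]: "\<phi> \<in> borel_measurable M" "pderiv i \<phi> \<in> borel_measurable M"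
    using test_funD(1)[OF \<phi>] smooth_measurable smooth_fun_pderiv by auto
  have i: "integrable M (\<lambda>x. f x * pderiv i \<phi> x)" using w \<phi> by (auto simp: weak_iff)
  then have [measurable]: "(\<lambda>x. f x * pderiv i \<phi> x) \<in> borel_measurable M" by auto
  have e: "AE x in M. f x * pderiv i \<phi> x = f' x * pderiv i \<phi> x" using f by auto
  show "integrable M (\<lambda>x. f' x * pderiv i \<phi> x)"
    using i integrable_cong_AE[OF _ _ e] by simp
  have "(\<integral>x. f' x * pderiv i \<phi> x \<partial>M) = (\<integral>x. f x * pderiv i \<phi> x \<partial>M)"
    using integral_cong_AE[OF _ _ e] by simp
  moreover have "(\<integral>x. g' x * \<phi> x \<partial>M) = (\<integral>x. g x * \<phi> x \<partial>M)"
    using g by (intro integral_cong_AE) auto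
  ultimately show "(\<integral>x. f' x * pderiv i \<phi> x \<partial>M) = - (\<integral>x. g' x * \<phi> x \<partial>M)"
    using w \<phi> by (simp add: weak_iff)
qed

lemma weak_add:
  assumes "is_weak_pderiv U i f g" "is_weak_pderiv U i f' g'"
  shows "is_weak_pderiv U i (\<lambda>x. f x + f' x) (\<lambda>x. g x + g' x)"
  using assms test_integrable_mult unfolding weak_iff by (auto simp: distrib_right)

lemma weak_cmult:
  assumes "is_weak_pderiv U i f g"
  shows "is_weak_pderiv U i (\<lambda>x. c * f x) (\<lambda>x. c * g x)"
  using assms unfolding weak_iff by (auto simp: mult.assoc)

lemma weak_diff:
  assumes "is_weak_pderiv U i f g" "is_weak_pderiv U i f' g'"
  shows "is_weak_pderiv U i (\<lambda>x. f x - f' x) (\<lambda>x. g x - g' x)"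
  using weak_add[OF assms(1) weak_cmult[OF assms(2), of "-1"]] by simp

text \<open>The Leibniz rule: \<open>P * \<phi>\<close> is again a test function, so the smooth
  factor can be moved onto it and removed by the classical product rule.\<close>

lemma weak_smooth_mult:
  assumes P: "smooth_fun P" and w: "is_weak_pderiv U i f g" and f: "integrable M f"
  shows "is_weak_pderiv U i (\<lambda>x. P x * f x) (\<lambda>x. P x * g x + pderiv i P x * f x)"
  unfolding weak_iff
proof (intro conjI allI impI)
  have g: "integrable M g" using w by (simp add: weak_iff)
  show "integrable M (\<lambda>x. P x * g x + pderiv i P x * f x)"
    using P f g by (intro Bochner_Integration.integrable_add integrable_smooth_mult smooth_fun_pderiv)
  fix \<phi> assume \<phi>: "test_fun U \<phi>"
  have s: "smooth_fun \<phi>" using test_funD[OF \<phi>] by simp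
  have i1: "integrable M (\<lambda>x. f x * (P x * pderiv i \<phi> x))" and i2: "integrable M (\<lambda>x. f x * (pderiv i P x * \<phi> x))"
    and i3: "integrable M (\<lambda>x. g x * (P x * \<phi> x))"
    by (intro integrable_smooth_mult(1) smooth_fun_intros(5) smooth_fun_pderiv P s f g)+
  show "integrable M (\<lambda>x. P x * f x * pderiv i \<phi> x)" using i1 by (simp add: mult_ac)
  have "(\<integral>x. f x * pderiv i (\<lambda>x. P x * \<phi> x) x \<partial>M) = - (\<integral>x. g x * (P x * \<phi> x) \<partial>M)"
    using w test_fun_mult[OF \<phi> P] by (simp add: weak_iff)
  moreover have "(\<integral>x. f x * pderiv i (\<lambda>x. P x * \<phi> x) x \<partial>M)
      = (\<integral>x. f x * (P x * pderiv i \<phi> x) + f x * (pderiv i P x * \<phi> x) \<partial>M)"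
    by (rule Bochner_Integration.integral_cong) (auto simp: pderiv_mult[OF P s] algebra_simps)
  ultimately have "(\<integral>x. f x * (P x * pderiv i \<phi> x) \<partial>M) = - ((\<integral>x. g x * (P x * \<phi> x) \<partial>M) + (\<integral>x. f x * (pderiv i P x * \<phi> x) \<partial>M))"
    using i1 i2 by simp
  also have "\<dots> = - (\<integral>x. g x * (P x * \<phi> x) + f x * (pderiv i P x * \<phi> x) \<partial>M)"
    using i2 i3 by simp
  finally show "(\<integral>x. P x * f x * pderiv i \<phi> x \<partial>M) = - (\<integral>x. (P x * g x + pderiv i P x * f x) * \<phi> x \<partial>M)"
    by (simp add: algebra_simps)
qed

lemma weak_smooth:
  assumes "smooth_fun P" "i \<in> {1, 2}"
  shows "is_weak_pderiv U i P (pderiv i P)"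
  using assms open_U
  by (intro classical_imp_weak[where g = "\<lambda>i. pderiv i P"] smooth_fun_has_derivative pderiv_continuous_on
      sq_integrable_integrable sq_integrable_smooth smooth_fun_pderiv) auto

text \<open>Carries a weak gradient as explicit data, so that the arbitrary choice made by
  \<open>weak_pderiv\<close> matters only when translating to and from the notions of the
  theorem.\<close>

definition H1_grad :: "(real \<times> real \<Rightarrow> real) \<Rightarrow> (nat \<Rightarrow> real \<times> real \<Rightarrow> real) \<Rightarrow> bool" where
  "H1_grad f g \<longleftrightarrow> sq_integrable M f \<and> (\<forall>i\<in>{1,2}. sq_integrable M (g i) \<and> is_weak_pderiv U i f (g i))"

lemma H1_gradD:
  assumes "H1_grad f g"
  shows "sq_integrable M f" "i \<in> {1,2} \<Longrightarrow> sq_integrable M (g i)" "i \<in> {1,2} \<Longrightarrow> is_weak_pderiv U i f (g i)"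
  using assms by (auto simp: H1_grad_def)

lemma H1_iff: "H1 U f \<longleftrightarrow> (\<exists>g. H1_grad f g)"
proof
  assume "H1 U f"
  then have L: "sq_integrable M f" and "\<forall>i\<in>{1,2}. \<exists>g. sq_integrable M g \<and> is_weak_pderiv U i f g"
    by (auto simp: H1_def L2_iff[OF open_U])
  then obtain g where "\<forall>i\<in>{1,2}. sq_integrable M (g i) \<and> is_weak_pderiv U i f (g i)" by metis
  then show "\<exists>g. H1_grad f g" using L by (auto simp: H1_grad_def)
qed (auto simp: H1_def L2_iff[OF open_U] H1_grad_def)

lemma weak_pderiv_is_weak:
  assumes "is_weak_pderiv U i f g"
  shows "is_weak_pderiv U i f (weak_pderiv U i f)" "AE x in M. weak_pderiv U i f x = g x"
proof -
  show "is_weak_pderiv U i f (weak_pderiv U i f)"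
    unfolding weak_pderiv_def using assms by (rule someI[where P = "is_weak_pderiv U i f"])
  then show "AE x in M. weak_pderiv U i f x = g x"
    using weak_unique assms by blast
qed

lemma H1_grad_weak_pderiv:
  assumes "H1_grad f g"
  shows "H1_grad f (\<lambda>i. weak_pderiv U i f)"
proof -
  have "sq_integrable M (weak_pderiv U i f)" if "i \<in> {1,2}" for i
  proof (rule sq_integrable_cong_AE)
    show "sq_integrable M (g i)" using assms that by (auto simp: H1_grad_def)
    have w: "is_weak_pderiv U i f (g i)" using assms that by (auto simp: H1_grad_def)
    show "AE x in M. g i x = weak_pderiv U i f x"
      using weak_pderiv_is_weak(2)[OF w] by (auto elim: eventually_mono)
    show "weak_pderiv U i f \<in> borel_measurable M"
      using weak_pderiv_is_weak(1)[OF w] by (auto simp: weak_iff)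
  qed
  then show ?thesis using assms weak_pderiv_is_weak by (auto simp: H1_grad_def)
qed

lemma H1_grad_add:
  "H1_grad f g \<Longrightarrow> H1_grad f' g' \<Longrightarrow> H1_grad (\<lambda>x. f x + f' x) (\<lambda>i x. g i x + g' i x)"
  by (auto simp: H1_grad_def intro: sq_integrable_add weak_add)

lemma H1_grad_diff:
  "H1_grad f g \<Longrightarrow> H1_grad f' g' \<Longrightarrow> H1_grad (\<lambda>x. f x - f' x) (\<lambda>i x. g i x - g' i x)"
  by (auto simp: H1_grad_def intro: sq_integrable_diff weak_diff)

lemma H1_grad_smooth: "smooth_fun P \<Longrightarrow> H1_grad P (\<lambda>i. pderiv i P)"
  unfolding H1_grad_def by (meson sq_integrable_smooth smooth_fun_pderiv weak_smooth)

lemma H1_grad_smooth_mult: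
  assumes "smooth_fun P" "H1_grad f g"
  shows "H1_grad (\<lambda>x. P x * f x) (\<lambda>i x. P x * g i x + pderiv i P x * f x)"
  using assms
  by (auto simp: H1_grad_def intro!: sq_integrable_add sq_integrable_smooth_mult weak_smooth_mult smooth_fun_pderiv
    sq_integrable_integrable)

lemma H1_grad_cong:
  assumes "H1_grad f g" "AE x in M. f x = f' x" "f' \<in> borel_measurable M"
    "\<And>i. i \<in> {1,2} \<Longrightarrow> AE x in M. g i x = g' i x" "\<And>i. i \<in> {1,2} \<Longrightarrow> g' i \<in> borel_measurable M"
  shows "H1_grad f' g'"
  unfolding H1_grad_def
proof (intro conjI ballI)
  show "sq_integrable M f'" using sq_integrable_cong_AE H1_gradD(1) assms by blast
  fix i :: nat assume i: "i \<in> {1,2}"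
  show "sq_integrable M (g' i)" using sq_integrable_cong_AE H1_gradD(2)[OF assms(1) i] assms(4,5)[OF i] by blast
  show "is_weak_pderiv U i f' (g' i)"
    using weak_cong H1_gradD(3)[OF assms(1) i] assms(2,3) assms(4,5)[OF i] by blast
qed

section \<open>Zero boundary values as H1 limits of test functions\<close>

definition approx_test :: "(nat \<Rightarrow> real \<times> real \<Rightarrow> real) \<Rightarrow> (real \<times> real \<Rightarrow> real) \<Rightarrow> (nat \<Rightarrow> real \<times> real \<Rightarrow> real) \<Rightarrow> bool" where
  "approx_test \<phi> f g \<longleftrightarrow> (\<forall>n. test_fun U (\<phi> n)) \<and> (\<lambda>n. \<integral>x. (\<phi> n x - f x)\<^sup>2 \<partial>M) \<longlonglongrightarrow> 0 \<and>
     (\<forall>i\<in>{1,2}. (\<lambda>n. \<integral>x. (pderiv i (\<phi> n) x - g i x)\<^sup>2 \<partial>M) \<longlonglongrightarrow> 0)"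

definition H10_grad :: "(real \<times> real \<Rightarrow> real) \<Rightarrow> (nat \<Rightarrow> real \<times> real \<Rightarrow> real) \<Rightarrow> bool" where
  "H10_grad f g \<longleftrightarrow> H1_grad f g \<and> (\<exists>\<phi>. approx_test \<phi> f g)"

lemma H10_gradD: "H10_grad f g \<Longrightarrow> H1_grad f g"
  by (simp add: H10_grad_def)

lemma H1_dist2_test:
  assumes "test_fun U \<phi>" "H1_grad f g"
  shows "H1_dist2 U \<phi> f = (\<integral>x. (\<phi> x - f x)\<^sup>2 \<partial>M) + (\<integral>x. (pderiv 1 \<phi> x - g 1 x)\<^sup>2 \<partial>M) + (\<integral>x. (pderiv 2 \<phi> x - g 2 x)\<^sup>2 \<partial>M)"
proof -
  have s: "smooth_fun \<phi>" using assms(1) test_funD by blast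
  have "(\<integral>x. (weak_pderiv U i \<phi> x - weak_pderiv U i f x)\<^sup>2 \<partial>M) = (\<integral>x. (pderiv i \<phi> x - g i x)\<^sup>2 \<partial>M)"
    if i: "i \<in> {1,2}" for i
  proof -
    have "AE x in M. weak_pderiv U i \<phi> x = pderiv i \<phi> x" "AE x in M. weak_pderiv U i f x = g i x"
      using weak_pderiv_is_weak(2) weak_smooth[OF s i] H1_gradD(3)[OF assms(2) i] by blast+
    moreover have "weak_pderiv U i \<phi> \<in> borel_measurable M" "pderiv i \<phi> \<in> borel_measurable M"
       "weak_pderiv U i f \<in> borel_measurable M" "g i \<in> borel_measurable M"
      using H1_gradD(2)[OF H1_grad_weak_pderiv[OF H1_grad_smooth[OF s]] i] H1_gradD(2)[OF H1_grad_smooth[OF s] i]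
        H1_gradD(2)[OF H1_grad_weak_pderiv[OF assms(2)] i] H1_gradD(2)[OF assms(2) i]
      by (simp_all add: sq_integrable_measurable)
    ultimately show ?thesis by (intro integral_cong_AE) auto
  qed
  from this[of 1] this[of 2] show ?thesis by (simp add: H1_dist2_def integral_lebesgue_on[OF U_sets])
qed

text \<open>\<open>H1_dist2\<close> is a sum of three non-negative integrals, so it tends to zero
  exactly when each of them does; the chosen derivatives inside it agree almost everywhere with the
  given \<open>g\<close>.\<close>

lemma H1_0_iff:
  assumes "H1_grad f g"
  shows "H1_0 U f \<longleftrightarrow> H10_grad f g"
proof -
  have "H1 U f" using assms H1_iff by blast
  have "(\<lambda>n. H1_dist2 U (\<phi> n) f) \<longlonglongrightarrow> 0 \<longleftrightarrow> approx_test \<phi> f g" if t: "\<forall>n. test_fun U (\<phi> n)" for \<phi>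
  proof
    let ?a = "\<lambda>n. \<integral>x. (\<phi> n x - f x)\<^sup>2 \<partial>M" and ?b = "\<lambda>i n. \<integral>x. (pderiv i (\<phi> n) x - g i x)\<^sup>2 \<partial>M"
    have e: "H1_dist2 U (\<phi> n) f = ?a n + ?b 1 n + ?b 2 n" for n using H1_dist2_test t assms by blast
    have nn: "0 \<le> ?a n" "0 \<le> ?b i n" for i n by auto
    {
      assume *: "(\<lambda>n. H1_dist2 U (\<phi> n) f) \<longlonglongrightarrow> 0"
      have s: "X \<longlonglongrightarrow> 0" if "\<And>n. 0 \<le> X n" "\<And>n. X n \<le> ?a n + ?b 1 n + ?b 2 n" for X :: "nat \<Rightarrow> real"
        by (rule tendsto_sandwich[OF _ _ tendsto_const *]) (use that in \<open>auto simp: e\<close>)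
      have c: "0 \<le> ?a n \<and> ?a n \<le> ?a n + ?b 1 n + ?b 2 n" "0 \<le> ?b 1 n \<and> ?b 1 n \<le> ?a n + ?b 1 n + ?b 2 n"
        "0 \<le> ?b 2 n \<and> ?b 2 n \<le> ?a n + ?b 1 n + ?b 2 n" for n
        using nn(1)[of n] nn(2)[of 1 n] nn(2)[of 2 n] by linarith+
      have "?a \<longlonglongrightarrow> 0" by (rule s) (use c(1) in blast)+
      moreover have "?b 1 \<longlonglongrightarrow> 0" by (rule s) (use c(2) in blast)+
      moreover have "?b 2 \<longlonglongrightarrow> 0" by (rule s) (use c(3) in blast)+
      ultimately
      show "approx_test \<phi> f g" using t by (auto simp: approx_test_def)
    }
    assume "approx_test \<phi> f g"
    then have "(\<lambda>n. ?a n + ?b 1 n + ?b 2 n) \<longlonglongrightarrow> 0 + 0 + 0"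
      by (intro tendsto_add) (auto simp: approx_test_def)
    then show "(\<lambda>n. H1_dist2 U (\<phi> n) f) \<longlonglongrightarrow> 0" by (simp add: e)
  qed
  then show ?thesis
    using \<open>H1 U f\<close> assms unfolding H1_0_def H10_grad_def by (metis approx_test_def)
qed

lemma approx_testD:
  assumes "approx_test \<phi> f g"
  shows "\<And>n. test_fun U (\<phi> n)" "\<And>n. smooth_fun (\<phi> n)" "\<And>n. sq_integrable M (\<phi> n)" "\<And>i n. sq_integrable M (pderiv i (\<phi> n))"
    "(\<lambda>n. \<integral>x. (\<phi> n x - f x)\<^sup>2 \<partial>M) \<longlonglongrightarrow> 0"
    "\<And>i. i \<in> {1,2} \<Longrightarrow> (\<lambda>n. \<integral>x. (pderiv i (\<phi> n) x - g i x)\<^sup>2 \<partial>M) \<longlonglongrightarrow> 0"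
  using assms test_funD(1) sq_integrable_smooth smooth_fun_pderiv unfolding approx_test_def by blast+

text \<open>For a test function this is the definition of the weak derivative of \<open>q\<close>,
  and both sides depend continuously on the H1 norm of \<open>f\<close>. No boundary term can
  arise.\<close>

lemma H10_parts:
  assumes f: "H10_grad f g" and q: "sq_integrable M q" "sq_integrable M r" "is_weak_pderiv U i q r" and i: "i \<in> {1,2}"
  shows "(\<integral>x. f x * r x \<partial>M) = - (\<integral>x. g i x * q x \<partial>M)"
proof -
  obtain \<phi> where \<phi>: "approx_test \<phi> f g" using f by (auto simp: H10_grad_def)
  note a = approx_testD[OF \<phi>] and fg = H1_gradD[OF H10_gradD[OF f]]
  have "(\<integral>x. \<phi> n x * r x \<partial>M) = - (\<integral>x. pderiv i (\<phi> n) x * q x \<partial>M)" for n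
    using q(3) a(1)[of n] by (simp add: weak_iff mult.commute)
  moreover have "(\<lambda>n. \<integral>x. \<phi> n x * r x \<partial>M) \<longlonglongrightarrow> (\<integral>x. f x * r x \<partial>M)"
    by (rule L2_tendsto_mult[OF a(3) fg(1) a(5) q(2) q(2) L2_tendsto_const])
  moreover have "(\<lambda>n. - (\<integral>x. pderiv i (\<phi> n) x * q x \<partial>M)) \<longlonglongrightarrow> - (\<integral>x. g i x * q x \<partial>M)"
    by (intro tendsto_minus L2_tendsto_mult[OF a(4) fg(2)[OF i] a(6)[OF i] q(1) q(1) L2_tendsto_const])
  ultimately show ?thesis using LIMSEQ_unique by force
qed

lemma H10_add:
  assumes "H10_grad f g" "H10_grad f' g'"
  shows "H10_grad (\<lambda>x. f x + f' x) (\<lambda>i x. g i x + g' i x)"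
proof -
  obtain \<phi> \<psi> where \<phi>: "approx_test \<phi> f g" and \<psi>: "approx_test \<psi> f' g'" using assms by (auto simp: H10_grad_def)
  note a = approx_testD[OF \<phi>] and b = approx_testD[OF \<psi>]
  note fg = H1_gradD[OF H10_gradD[OF assms(1)]] and fg' = H1_gradD[OF H10_gradD[OF assms(2)]]
  have "approx_test (\<lambda>n x. \<phi> n x + \<psi> n x) (\<lambda>x. f x + f' x) (\<lambda>i x. g i x + g' i x)"
    unfolding approx_test_def pderiv_add[OF a(2) b(2)]
    by (intro conjI allI ballI test_fun_add a b L2_tendsto_add fg fg')
  then show ?thesis using H1_grad_add[OF H10_gradD H10_gradD] assms by (auto simp: H10_grad_def)
qed

lemma H10_smooth_mult:
  assumes P: "smooth_fun P" and f: "H10_grad f g"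
  shows "H10_grad (\<lambda>x. P x * f x) (\<lambda>i x. P x * g i x + pderiv i P x * f x)"
proof -
  obtain \<phi> where \<phi>: "approx_test \<phi> f g" using assms by (auto simp: H10_grad_def)
  note a = approx_testD[OF \<phi>] and fg = H1_gradD[OF H10_gradD[OF f]]
  obtain B where B: "AE x in M. \<bar>P x\<bar> \<le> B" using smooth_bounded_AE[OF P] by blast
  have "approx_test (\<lambda>n x. P x * \<phi> n x) (\<lambda>x. P x * f x) (\<lambda>i x. P x * g i x + pderiv i P x * f x)"
    unfolding approx_test_def pderiv_mult[OF P a(2)]
  proof (intro conjI allI ballI)
    show "test_fun U (\<lambda>x. P x * \<phi> n x)" for n using a P by (intro test_fun_mult)
    show "(\<lambda>n. \<integral>x. (P x * \<phi> n x - P x * f x)\<^sup>2 \<partial>M) \<longlonglongrightarrow> 0"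
      by (intro L2_tendsto_bounded_mult[OF _ _ _ _ B] a fg smooth_measurable P)
    fix i :: nat assume i: "i \<in> {1,2}"
    obtain C where C: "AE x in M. \<bar>pderiv i P x\<bar> \<le> C" using smooth_bounded_AE[OF smooth_fun_pderiv[OF P]] by blast
    show "(\<lambda>n. \<integral>x. (P x * pderiv i (\<phi> n) x + pderiv i P x * \<phi> n x - (P x * g i x + pderiv i P x * f x))\<^sup>2 \<partial>M) \<longlonglongrightarrow> 0"
      by (intro L2_tendsto_add L2_tendsto_bounded_mult[OF _ _ _ _ B] L2_tendsto_bounded_mult[OF _ _ _ _ C]
          sq_integrable_smooth_mult smooth_fun_pderiv smooth_measurable P a fg i)
  qed
  then show ?thesis using H1_grad_smooth_mult[OF P H10_gradD[OF f]] by (auto simp: H10_grad_def)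
qed

lemma H10_diff:
  assumes "H10_grad f g" "H10_grad f' g'"
  shows "H10_grad (\<lambda>x. f x - f' x) (\<lambda>i x. g i x - g' i x)"
proof -
  have "H10_grad (\<lambda>x. -1 * f' x) (\<lambda>i x. -1 * g' i x + pderiv i (\<lambda>x. -1) x * f' x)"
    by (rule H10_smooth_mult[OF smooth_fun_intros(1) assms(2)])
  from H10_add[OF assms(1) this] show ?thesis by (simp add: pderiv_def)
qed

lemma H10_cong:
  assumes "H10_grad f g" "AE x in M. f x = f' x" "f' \<in> borel_measurable M"
    "\<And>i. i \<in> {1,2} \<Longrightarrow> AE x in M. g i x = g' i x" "\<And>i. i \<in> {1,2} \<Longrightarrow> g' i \<in> borel_measurable M"
  shows "H10_grad f' g'"
proof -
  obtain \<phi> where \<phi>: "approx_test \<phi> f g" using assms by (auto simp: H10_grad_def)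
  note a = approx_testD[OF \<phi>] and fg = H1_gradD[OF H10_gradD[OF assms(1)]]
  have "(\<integral>x. (\<phi> n x - f x)\<^sup>2 \<partial>M) = (\<integral>x. (\<phi> n x - f' x)\<^sup>2 \<partial>M)" for n
  proof (rule integral_cong_AE)
    show "AE x in M. (\<phi> n x - f x)\<^sup>2 = (\<phi> n x - f' x)\<^sup>2"
      using assms(2) by auto
  qed (use sq_integrable_measurable[OF a(3)[of n]] sq_integrable_measurable[OF fg(1)] assms(3) in auto)
  moreover have "(\<integral>x. (pderiv i (\<phi> n) x - g i x)\<^sup>2 \<partial>M) = (\<integral>x. (pderiv i (\<phi> n) x - g' i x)\<^sup>2 \<partial>M)"
    if "i \<in> {1,2}" for i n
  proof (rule integral_cong_AE)
    show "AE x in M. (pderiv i (\<phi> n) x - g i x)\<^sup>2 = (pderiv i (\<phi> n) x - g' i x)\<^sup>2"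
      using assms(4)[OF that] by auto
  qed (use sq_integrable_measurable[OF a(4)[of i n]] sq_integrable_measurable[OF fg(2)[OF that]] assms(5)[OF that] in auto)
  ultimately have "approx_test \<phi> f' g'"
    using \<phi> unfolding approx_test_def by auto
  then show ?thesis using H1_grad_cong[OF H10_gradD[OF assms(1)] assms(2-5)] by (auto simp: H10_grad_def)
qed

lemma pderiv_coord: "pderiv i fst x = fst (ebasis i)" "pderiv i snd x = snd (ebasis i)"
  by (auto intro!: pderiv_eqI[THEN trans] derivative_eq_intros)

text \<open>Testing with $x_1 f$ turns the norm of \<open>f\<close> into an integral against its gradient.\<close>
lemma H10_zero_gradient:
  assumes f: "H10_grad f g" and z: "AE x in M. g 1 x = 0"
  shows "AE x in M. f x = 0"
proof -
  note fg = H1_gradD[OF H10_gradD[OF f]]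
  note q = H1_gradD[OF H1_grad_smooth_mult[OF smooth_fun_intros(2) H10_gradD[OF f]]]
  have "(\<integral>x. f x * (fst x * g 1 x + pderiv 1 fst x * f x) \<partial>M) = - (\<integral>x. g 1 x * (fst x * f x) \<partial>M)"
    by (rule H10_parts[OF f q(1,2,3)]) auto
  also have "(\<integral>x. f x * (fst x * g 1 x + pderiv 1 fst x * f x) \<partial>M) = (\<integral>x. (f x)\<^sup>2 \<partial>M)"
    using z sq_integrable_measurable[OF q(2)[of 1]] sq_integrable_measurable[OF fg(1)]
    by (intro integral_cong_AE) (auto simp: pderiv_coord ebasis_def power2_eq_square)
  also have "(\<integral>x. g 1 x * (fst x * f x) \<partial>M) = (\<integral>x. 0 \<partial>M)"
    using z sq_integrable_measurable[OF q(1)] sq_integrable_measurable[OF fg(2)[of 1]]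
    by (intro integral_cong_AE) auto
  finally have "(\<integral>x. (f x)\<^sup>2 \<partial>M) = 0" by simp
  then have "AE x in M. (f x)\<^sup>2 = 0"
    using fg(1) by (subst (asm) integral_nonneg_eq_0_iff_AE) (auto simp: sq_integrable_def)
  then show ?thesis by simp
qed

end

section \<open>Ladyzhenskaya's inequality and the trilinear form\<close>

text \<open>The one-dimensional half of Ladyzhenskaya's argument: \<open>F t\<close> is the integral
  of its derivative from a point left of the support.\<close>

lemma compact_support_le_nn_integral:
  fixes F :: "real \<Rightarrow> real"
  assumes d: "\<And>s. (F has_real_derivative f s) (at s)" and c: "continuous_on UNIV f"
    and z: "\<And>s. \<bar>s\<bar> \<ge> b \<Longrightarrow> F s = 0" and G: "\<And>s. \<bar>f s\<bar> \<le> G s"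
  shows "ennreal (F t) \<le> (\<integral>\<^sup>+s. ennreal (G s) \<partial>lborel)"
proof -
  define a where "a = max \<bar>b\<bar> \<bar>t\<bar>"
  have h: "has_bochner_integral lborel (\<lambda>s. indicator {-a..t} s *\<^sub>R f s) (F t - F (-a))"
    using d c by (intro has_bochner_integral_FTC_Icc)
      (auto simp: a_def has_real_derivative_iff_has_vector_derivative[symmetric]
        intro: has_field_derivative_at_within continuous_on_subset)
  have "F (-a) = 0" using z[of "-a"] by (simp add: a_def)
  then have "ennreal (F t) \<le> ennreal (norm (\<integral>s. indicator {-a..t} s *\<^sub>R f s \<partial>lborel))"
    using has_bochner_integral_integral_eq[OF h] by (intro ennreal_leI) simp
  also have "\<dots> \<le> (\<integral>\<^sup>+s. ennreal (norm (indicator {-a..t} s *\<^sub>R f s)) \<partial>lborel)"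
    by (intro integral_norm_bound_ennreal integrable.intros[OF h])
  also have "\<dots> \<le> (\<integral>\<^sup>+s. ennreal (G s) \<partial>lborel)"
  proof (intro nn_integral_mono ennreal_leI)
    fix s show "norm (indicator {-a..t} s *\<^sub>R f s) \<le> G s"
      using G[of s] by (auto simp: indicator_def)
  qed
  finally show ?thesis .
qed

text \<open>\<phi>(x,y)^2 is bounded by an integral over the horizontal line through the point,
  which depends only on y, and by one over the vertical line, which depends only on x. Hence
  \<phi>^4 is below a product of a function of y and one of x, and the double integral factors.
  Estimating 2 |\<phi> D\<phi>| by a sum of squares brings in the full H1 norm.\<close>

lemma ladyzhenskaya:
  fixes \<phi> :: "real \<times> real \<Rightarrow> real"
  assumes s: "smooth_fun \<phi>" and K: "compact K" "\<And>x. x \<notin> K \<Longrightarrow> \<phi> x = 0"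
  shows "(\<integral>\<^sup>+x. ennreal ((\<phi> x) ^ 4) \<partial>lborel) \<le>
    (\<integral>\<^sup>+x. ennreal ((\<phi> x)\<^sup>2 + (pderiv 1 \<phi> x)\<^sup>2) \<partial>lborel) * (\<integral>\<^sup>+x. ennreal ((\<phi> x)\<^sup>2 + (pderiv 2 \<phi> x)\<^sup>2) \<partial>lborel)"
proof -
  let ?\<alpha> = "\<lambda>x. ennreal ((\<phi> x)\<^sup>2 + (pderiv 1 \<phi> x)\<^sup>2)" and ?\<beta> = "\<lambda>x. ennreal ((\<phi> x)\<^sup>2 + (pderiv 2 \<phi> x)\<^sup>2)"
  have c: "continuous_on UNIV \<phi>" "continuous_on UNIV (pderiv i \<phi>)" for i
    using s by (auto intro: smooth_fun_continuous_on pderiv_continuous_on)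
  note [measurable] = c[THEN borel_measurable_continuous_onI]
  obtain b where "K \<subseteq> ball 0 b" using compact_imp_bounded[OF K(1)] bounded_subset_ballD by blast
  then have far: "\<phi> x = 0" if "norm x \<ge> b" for x
    using K(2)[of x] that by force
  have big: "norm (p, q) \<ge> b" if "\<bar>p\<bar> \<ge> b \<or> \<bar>q\<bar> \<ge> b" for p q :: real
    using that norm_fst_le[of p q] norm_snd_le[of q p] by auto
  have two: "\<bar>2 * u * v\<bar> \<le> u\<^sup>2 + v\<^sup>2" for u v :: real
    using sum_squares_bound[of u v] sum_squares_bound[of u "-v"] by (simp add: abs_le_iff)
  define A where "A y = (\<integral>\<^sup>+p. ?\<alpha> (p, y) \<partial>lborel)" for y
  define B where "B x = (\<integral>\<^sup>+q. ?\<beta> (x, q) \<partial>lborel)" for x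
  have cc: "continuous_on UNIV (\<lambda>p. \<phi> (p, y))" "continuous_on UNIV (\<lambda>p. pderiv i \<phi> (p, y))"
    "continuous_on UNIV (\<lambda>p. \<phi> (y, p))" "continuous_on UNIV (\<lambda>p. pderiv i \<phi> (y, p))" for y i
    by (auto intro!: continuous_on_compose2[OF c(1)] continuous_on_compose2[OF c(2)] continuous_intros)
  have 1: "ennreal ((\<phi> (x, y))\<^sup>2) \<le> A y" for x y
    unfolding A_def
  proof (rule compact_support_le_nn_integral[where F = "\<lambda>p. (\<phi> (p, y))\<^sup>2" and t = x and b = b
      and f = "\<lambda>p. 2 * \<phi> (p, y) * pderiv 1 \<phi> (p, y)"])
    fix p
    have "((\<lambda>p. \<phi> (p, y)) has_real_derivative pderiv 1 \<phi> (p, y)) (at p)"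
      unfolding has_field_derivative_def
      by (rule has_derivative_eq_rhs[OF has_derivative_compose[OF _ smooth_fun_has_derivative[OF s]]])
        (auto intro!: derivative_eq_intros)
    then show "((\<lambda>p. (\<phi> (p, y))\<^sup>2) has_real_derivative 2 * \<phi> (p, y) * pderiv 1 \<phi> (p, y)) (at p)"
      by (auto intro!: derivative_eq_intros)
    show "continuous_on UNIV (\<lambda>p. 2 * \<phi> (p, y) * pderiv 1 \<phi> (p, y))"
      by (intro continuous_intros cc)
    show "\<bar>p\<bar> \<ge> b \<Longrightarrow> (\<phi> (p, y))\<^sup>2 = 0" using far big by simp
  qed (rule two)
  have 2: "ennreal ((\<phi> (x, y))\<^sup>2) \<le> B x" for x y
    unfolding B_def
  proof (rule compact_support_le_nn_integral[where F = "\<lambda>p. (\<phi> (x, p))\<^sup>2" and t = y and b = b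
      and f = "\<lambda>p. 2 * \<phi> (x, p) * pderiv 2 \<phi> (x, p)"])
    fix p
    have "((\<lambda>p. \<phi> (x, p)) has_real_derivative pderiv 2 \<phi> (x, p)) (at p)"
      unfolding has_field_derivative_def
      by (rule has_derivative_eq_rhs[OF has_derivative_compose[OF _ smooth_fun_has_derivative[OF s]]])
        (auto intro!: derivative_eq_intros)
    then show "((\<lambda>p. (\<phi> (x, p))\<^sup>2) has_real_derivative 2 * \<phi> (x, p) * pderiv 2 \<phi> (x, p)) (at p)"
      by (auto intro!: derivative_eq_intros)
    show "continuous_on UNIV (\<lambda>p. 2 * \<phi> (x, p) * pderiv 2 \<phi> (x, p))"
      by (intro continuous_intros cc)
    show "\<bar>p\<bar> \<ge> b \<Longrightarrow> (\<phi> (x, p))\<^sup>2 = 0" using far big by simp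
  qed (rule two)
  have mA [measurable]: "A \<in> borel_measurable lborel" and mB [measurable]: "B \<in> borel_measurable lborel"
    unfolding A_def B_def by (measurable; simp add: borel_prod[symmetric])+
  have "(\<integral>\<^sup>+x. ennreal ((\<phi> x) ^ 4) \<partial>lborel) \<le> (\<integral>\<^sup>+z. A (snd z) * B (fst z) \<partial>lborel)"
  proof (rule nn_integral_mono)
    fix z :: "real \<times> real"
    have "ennreal ((\<phi> z) ^ 4) = ennreal ((\<phi> z)\<^sup>2) * ennreal ((\<phi> z)\<^sup>2)"
      by (simp add: ennreal_mult[symmetric] power_add[symmetric])
    also have "\<dots> \<le> A (snd z) * B (fst z)"
      using 1[of "fst z" "snd z"] 2[of "fst z" "snd z"] by (intro mult_mono) auto
    finally show "ennreal ((\<phi> z) ^ 4) \<le> A (snd z) * B (fst z)" .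
  qed
  also have "\<dots> = (\<integral>\<^sup>+x. (\<integral>\<^sup>+y. A y * B x \<partial>lborel) \<partial>lborel)"
    using lborel.nn_integral_fst[of "\<lambda>z. A (snd z) * B (fst z)" lborel] mA mB
    by (simp add: lborel_prod borel_prod[symmetric])
  also have "\<dots> = (\<integral>\<^sup>+y. A y \<partial>lborel) * (\<integral>\<^sup>+x. B x \<partial>lborel)"
    by (simp add: nn_integral_multc nn_integral_cmult)
  also have "(\<integral>\<^sup>+y. A y \<partial>lborel) = (\<integral>\<^sup>+x. ?\<alpha> x \<partial>lborel)"
    unfolding A_def using lborel_pair.nn_integral_snd[of ?\<alpha>] by (simp add: lborel_prod)
  also have "(\<integral>\<^sup>+x. B x \<partial>lborel) = (\<integral>\<^sup>+x. ?\<beta> x \<partial>lborel)"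
    unfolding B_def using lborel.nn_integral_fst[of ?\<beta> lborel] by (simp add: lborel_prod)
  finally show ?thesis .
qed

section \<open>Fourth powers and convergence in L4\<close>

lemma power4_sum_le: "((a::real) + b) ^ 4 \<le> 8 * a ^ 4 + 8 * b ^ 4"
proof -
  have "(a + b)\<^sup>2 \<le> 2 * a\<^sup>2 + 2 * b\<^sup>2" using sum_squares_bound[of a b] by (simp add: power2_sum)
  then have "((a + b)\<^sup>2)\<^sup>2 \<le> (2 * a\<^sup>2 + 2 * b\<^sup>2)\<^sup>2" by (intro power_mono) auto
  also have "\<dots> \<le> 8 * (a\<^sup>2)\<^sup>2 + 8 * (b\<^sup>2)\<^sup>2"
    using sum_squares_bound[of "a\<^sup>2" "b\<^sup>2"] by (simp add: power2_sum power_mult_distrib)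
  finally show ?thesis by simp
qed

definition l4_integrable :: "'a measure \<Rightarrow> ('a \<Rightarrow> real) \<Rightarrow> bool" where
  "l4_integrable M f \<longleftrightarrow> f \<in> borel_measurable M \<and> sq_integrable M (\<lambda>x. (f x)\<^sup>2)"

lemma l4_integrable_mult:
  assumes "l4_integrable M f" "l4_integrable M g"
  shows "sq_integrable M (\<lambda>x. f x * g x)"
  using assms sq_integrable_mult[of M "\<lambda>x. (f x)\<^sup>2" "\<lambda>x. (g x)\<^sup>2"]
  by (auto simp: l4_integrable_def sq_integrable_def power_mult_distrib)

lemma l4_integrable_iff:
  "l4_integrable M f \<longleftrightarrow> f \<in> borel_measurable M \<and> (\<integral>\<^sup>+x. ennreal ((f x) ^ 4) \<partial>M) < \<infinity>"
proof -
  have "((f x)\<^sup>2)\<^sup>2 = (f x) ^ 4" for x by simp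
  then show ?thesis
    by (auto simp: l4_integrable_def sq_integrable_def integrable_iff_bounded)
qed

lemma l4_integrable_add:
  assumes "l4_integrable M f" "l4_integrable M g"
  shows "l4_integrable M (\<lambda>x. f x + g x)"
  unfolding l4_integrable_iff
proof
  have [measurable]: "f \<in> borel_measurable M" "g \<in> borel_measurable M" using assms by (auto simp: l4_integrable_def)
  show "(\<lambda>x. f x + g x) \<in> borel_measurable M" by simp
  have "(\<integral>\<^sup>+x. ennreal ((f x + g x) ^ 4) \<partial>M) \<le> (\<integral>\<^sup>+x. 8 * ennreal ((f x) ^ 4) + 8 * ennreal ((g x) ^ 4) \<partial>M)"
  proof (rule nn_integral_mono)
    fix x
    have "ennreal ((f x + g x) ^ 4) \<le> ennreal (8 * (f x) ^ 4 + 8 * (g x) ^ 4)"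
      by (intro ennreal_leI power4_sum_le)
    also have "\<dots> = 8 * ennreal ((f x) ^ 4) + 8 * ennreal ((g x) ^ 4)"
      by (simp add: ennreal_plus ennreal_mult)
    finally show "ennreal ((f x + g x) ^ 4) \<le> 8 * ennreal ((f x) ^ 4) + 8 * ennreal ((g x) ^ 4)" .
  qed
  also have "\<dots> = 8 * (\<integral>\<^sup>+x. ennreal ((f x) ^ 4) \<partial>M) + 8 * (\<integral>\<^sup>+x. ennreal ((g x) ^ 4) \<partial>M)"
    by (simp add: nn_integral_add nn_integral_cmult)
  also have "\<dots> < \<infinity>"
    using assms by (auto simp: l4_integrable_iff ennreal_mult_less_top)
  finally show "(\<integral>\<^sup>+x. ennreal ((f x + g x) ^ 4) \<partial>M) < \<infinity>" .
qed

lemma (in finite_measure) l4_integrable_bounded: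
  assumes "f \<in> borel_measurable M" "AE x in M. \<bar>f x\<bar> \<le> B"
  shows "l4_integrable M f"
  unfolding l4_integrable_def
proof
  have "AE x in M. \<bar>(f x)\<^sup>2\<bar> \<le> B\<^sup>2"
    using assms(2) by eventually_elim (auto simp: abs_le_square_iff[symmetric])
  then show "sq_integrable M (\<lambda>x. (f x)\<^sup>2)"
    using assms by (intro sq_integrable_bounded) auto
qed (fact assms)

context bounded_open
begin

lemma test_nn_integral:
  assumes "\<And>x. x \<notin> U \<Longrightarrow> F x = 0" "F \<in> borel_measurable borel" "\<And>x. 0 \<le> F x"
  shows "(\<integral>\<^sup>+x. ennreal (F x) \<partial>lborel) = (\<integral>\<^sup>+x. ennreal (F x) \<partial>M)"
proof -
  have "(\<integral>\<^sup>+x. ennreal (F x) \<partial>M) = (\<integral>\<^sup>+x. ennreal (F x) * indicator U x \<partial>lebesgue)"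
    using U_sets by (simp add: nn_integral_restrict_space)
  also have "\<dots> = (\<integral>\<^sup>+x. ennreal (F x) \<partial>lebesgue)"
    using assms(1) by (intro nn_integral_cong) (auto simp: indicator_def)
  also have "\<dots> = (\<integral>\<^sup>+x. ennreal (F x) \<partial>lborel)"
    using assms(2) by (intro nn_integral_completion)
  finally show ?thesis by simp
qed

lemma ladyzhenskaya_test:
  assumes \<phi>: "test_fun U \<phi>"
  shows "(\<integral>\<^sup>+x. ennreal ((\<phi> x) ^ 4) \<partial>M) \<le>
    ennreal (((\<integral>x. (\<phi> x)\<^sup>2 \<partial>M) + (\<integral>x. (pderiv 1 \<phi> x)\<^sup>2 \<partial>M) + (\<integral>x. (pderiv 2 \<phi> x)\<^sup>2 \<partial>M))\<^sup>2)"
proof -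
  note t = test_funD[OF \<phi>]
  let ?a = "\<integral>x. (\<phi> x)\<^sup>2 \<partial>M" and ?b = "\<lambda>i. \<integral>x. (pderiv i \<phi> x)\<^sup>2 \<partial>M"
  have [measurable]: "\<phi> \<in> borel_measurable borel" "pderiv i \<phi> \<in> borel_measurable borel" for i
    using t by (auto intro!: borel_measurable_continuous_onI smooth_fun_continuous_on pderiv_continuous_on)
  have o: "x \<notin> U \<Longrightarrow> \<phi> x = 0" "x \<notin> U \<Longrightarrow> pderiv i \<phi> x = 0" for x i using t(4,5,6) by blast+
  have sq: "integrable M (\<lambda>x. (\<phi> x)\<^sup>2)" "integrable M (\<lambda>x. (pderiv i \<phi> x)\<^sup>2)" for i
    using sq_integrable_smooth[OF t(1)] sq_integrable_smooth[OF smooth_fun_pderiv[OF t(1)]] by (auto simp: sq_integrable_def)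
  have nn: "0 \<le> ?a" "0 \<le> ?b i" for i by (auto intro!: integral_nonneg_AE)
  have e: "(\<integral>\<^sup>+x. ennreal ((\<phi> x)\<^sup>2 + (pderiv i \<phi> x)\<^sup>2) \<partial>M) = ennreal (?a + ?b i)" for i
    using sq by (subst nn_integral_eq_integral) auto
  have "(\<integral>\<^sup>+x. ennreal ((\<phi> x) ^ 4) \<partial>M) \<le> ennreal (?a + ?b 1) * ennreal (?a + ?b 2)"
    using ladyzhenskaya[OF t(1,2,5)]
    by (simp add: test_nn_integral o e[symmetric] del: ennreal_plus)
  also have "\<dots> = ennreal ((?a + ?b 1) * (?a + ?b 2))"
    using nn by (intro ennreal_mult[symmetric] add_nonneg_nonneg)
  also have "\<dots> \<le> ennreal ((?a + ?b 1 + ?b 2)\<^sup>2)"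
    unfolding power2_eq_square[of "?a + ?b 1 + ?b 2"] using nn(1) nn(2)[of 1] nn(2)[of 2]
    by (intro ennreal_leI mult_mono) linarith+
  finally show ?thesis .
qed

text \<open>The approximating test functions are Cauchy in L4 by Ladyzhenskaya's inequality applied
  to their differences. Fatou's lemma along a subsequence converging almost everywhere identifies
  the limit as \<open>f\<close>. Since test functions are bounded, \<open>f\<close> itself lies in
  L4.\<close>

lemma H10_l4_convergence:
  assumes f: "H1_grad f g" and \<phi>: "approx_test \<phi> f g"
  shows "l4_integrable M f" "(\<lambda>n. \<integral>x. (\<phi> n x - f x) ^ 4 \<partial>M) \<longlonglongrightarrow> 0"
    "\<And>n. l4_integrable M (\<lambda>x. \<phi> n x - f x)"
proof -
  note a = approx_testD[OF \<phi>] and fg = H1_gradD[OF f]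
  define e where "e n = (\<integral>x. (\<phi> n x - f x)\<^sup>2 \<partial>M) + (\<integral>x. (pderiv 1 (\<phi> n) x - g 1 x)\<^sup>2 \<partial>M) + (\<integral>x. (pderiv 2 (\<phi> n) x - g 2 x)\<^sup>2 \<partial>M)" for n
  have "e \<longlonglongrightarrow> 0 + 0 + 0" unfolding e_def by (intro tendsto_add a) auto
  then have e0: "e \<longlonglongrightarrow> 0" by simp
  have e_nn: "0 \<le> e n" for n unfolding e_def by (intro add_nonneg_nonneg integral_nonneg_AE) auto
  have split: "(\<integral>x. (u x - v x)\<^sup>2 \<partial>M) \<le> 2 * (\<integral>x. (u x - w x)\<^sup>2 \<partial>M) + 2 * (\<integral>x. (v x - w x)\<^sup>2 \<partial>M)"
    if "sq_integrable M u" "sq_integrable M v" "sq_integrable M w" for u v w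
  proof -
    note i = sq_integrable_diff[OF that(1,2)] sq_integrable_diff[OF that(1,3)] sq_integrable_diff[OF that(2,3)]
    have "(\<integral>x. (u x - v x)\<^sup>2 \<partial>M) \<le> (\<integral>x. 2 * (u x - w x)\<^sup>2 + 2 * (v x - w x)\<^sup>2 \<partial>M)"
    proof (rule integral_mono)
      show "(u x - v x)\<^sup>2 \<le> 2 * (u x - w x)\<^sup>2 + 2 * (v x - w x)\<^sup>2" for x
        using sum_squares_bound[of "u x - w x" "-(v x - w x)"] by (simp add: power2_eq_square algebra_simps)
    qed (use i in \<open>auto simp: sq_integrable_def\<close>)
    then show ?thesis using i by (simp add: sq_integrable_def)
  qed
  \<comment> \<open>Each H1 distance between two test functions is split at the limit
    \<open>f\<close>, which gives the factors 2.\<close>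
  have cauchy: "(\<integral>\<^sup>+x. ennreal ((\<phi> n x - \<phi> m x) ^ 4) \<partial>M) \<le> ennreal ((2 * e n + 2 * e m)\<^sup>2)" for n m
  proof -
    let ?\<psi> = "\<lambda>x. \<phi> n x - \<phi> m x"
    have "(\<integral>\<^sup>+x. ennreal ((?\<psi> x) ^ 4) \<partial>M) \<le>
      ennreal (((\<integral>x. (?\<psi> x)\<^sup>2 \<partial>M) + (\<integral>x. (pderiv 1 ?\<psi> x)\<^sup>2 \<partial>M) + (\<integral>x. (pderiv 2 ?\<psi> x)\<^sup>2 \<partial>M))\<^sup>2)"
      by (rule ladyzhenskaya_test[OF test_fun_diff[OF a(1) a(1)]])
    also have "\<dots> \<le> ennreal ((2 * e n + 2 * e m)\<^sup>2)"
    proof (intro ennreal_leI power_mono)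
      have g: "sq_integrable M (g 1)" "sq_integrable M (g 2)" using fg by auto
      have arith: "x + y + z \<le> 2 * (p + q + r) + 2 * (p' + q' + r')"
        if "x \<le> 2 * p + 2 * p'" "y \<le> 2 * q + 2 * q'" "z \<le> 2 * r + 2 * r'" for x y z p q r p' q' r' :: real
        using add_mono[OF add_mono[OF that(1,2)] that(3)] by (simp add: algebra_simps)
      show "(\<integral>x. (?\<psi> x)\<^sup>2 \<partial>M) + (\<integral>x. (pderiv 1 ?\<psi> x)\<^sup>2 \<partial>M) + (\<integral>x. (pderiv 2 ?\<psi> x)\<^sup>2 \<partial>M) \<le> 2 * e n + 2 * e m"
        unfolding e_def pderiv_diff[OF a(2) a(2)]
        by (rule arith) (rule split[OF a(3) a(3) fg(1)] split[OF a(4) a(4) g(1)] split[OF a(4) a(4) g(2)])+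
    qed (auto intro!: add_nonneg_nonneg integral_nonneg_AE)
    finally show ?thesis .
  qed
  \<comment> \<open>Fatou needs pointwise convergence, which L2 convergence provides only along a
    subsequence.\<close>
  have "\<exists>r. strict_mono r \<and> (AE x in M. (\<lambda>n. (\<phi> (r n) x - f x)\<^sup>2) \<longlonglongrightarrow> 0)"
    using sq_integrable_diff[OF a(3) fg(1)] a(5) by (intro tendsto_L1_AE_subseq) (auto simp: sq_integrable_def)
  then obtain r where r: "strict_mono r" "AE x in M. (\<lambda>n. (\<phi> (r n) x - f x)\<^sup>2) \<longlonglongrightarrow> 0" by blast
  have r': "AE x in M. (\<lambda>n. \<phi> (r n) x) \<longlonglongrightarrow> f x"
    using r(2)
  proof eventually_elim
    fix x assume "(\<lambda>n. (\<phi> (r n) x - f x)\<^sup>2) \<longlonglongrightarrow> 0"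
    then have "(\<lambda>n. sqrt ((\<phi> (r n) x - f x)\<^sup>2)) \<longlonglongrightarrow> sqrt 0" by (rule tendsto_real_sqrt)
    then have "(\<lambda>n. \<phi> (r n) x - f x) \<longlonglongrightarrow> 0" by (simp add: tendsto_rabs_zero_iff)
    then show "(\<lambda>n. \<phi> (r n) x) \<longlonglongrightarrow> f x" by (rule LIM_zero_cancel)
  qed
  have [measurable]: "\<phi> n \<in> borel_measurable M" "f \<in> borel_measurable M" for n
    using a(3) fg(1) by (auto simp: sq_integrable_def)
  \<comment> \<open>Fatou in the second index of the Cauchy estimate: \<open>e (r m)\<close> tends
    to 0 and (2 e n)^2 remains.\<close>
  have main: "(\<integral>\<^sup>+x. ennreal ((\<phi> n x - f x) ^ 4) \<partial>M) \<le> ennreal (4 * (e n)\<^sup>2)" for n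
  proof -
    have "(\<integral>\<^sup>+x. ennreal ((\<phi> n x - f x) ^ 4) \<partial>M) = (\<integral>\<^sup>+x. liminf (\<lambda>m. ennreal ((\<phi> n x - \<phi> (r m) x) ^ 4)) \<partial>M)"
    proof (rule nn_integral_cong_AE)
      show "AE x in M. ennreal ((\<phi> n x - f x) ^ 4) = liminf (\<lambda>m. ennreal ((\<phi> n x - \<phi> (r m) x) ^ 4))"
        using r'
      proof eventually_elim
        fix x assume "(\<lambda>m. \<phi> (r m) x) \<longlonglongrightarrow> f x"
        then have "(\<lambda>m. ennreal ((\<phi> n x - \<phi> (r m) x) ^ 4)) \<longlonglongrightarrow> ennreal ((\<phi> n x - f x) ^ 4)"
          by (intro tendsto_intros)
        then show "ennreal ((\<phi> n x - f x) ^ 4) = liminf (\<lambda>m. ennreal ((\<phi> n x - \<phi> (r m) x) ^ 4))"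
          using lim_imp_Liminf[OF trivial_limit_sequentially] by metis
      qed
    qed
    also have "\<dots> \<le> liminf (\<lambda>m. \<integral>\<^sup>+x. ennreal ((\<phi> n x - \<phi> (r m) x) ^ 4) \<partial>M)"
      by (rule nn_integral_liminf) measurable
    also have "\<dots> \<le> liminf (\<lambda>m. ennreal ((2 * e n + 2 * e (r m))\<^sup>2))"
      by (intro Liminf_mono always_eventually allI cauchy)
    also have "\<dots> = ennreal ((2 * e n + 2 * 0)\<^sup>2)"
      using LIMSEQ_subseq_LIMSEQ[OF e0 r(1)]
      by (intro lim_imp_Liminf tendsto_intros) (auto simp: comp_def)
    finally show ?thesis by (simp add: power_mult_distrib)
  qed
  show l4: "l4_integrable M (\<lambda>x. \<phi> n x - f x)" for n
    unfolding l4_integrable_iff using le_less_trans[OF main] by auto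
  have "l4_integrable M (\<phi> 0)"
  proof -
    obtain B where "AE x in M. \<bar>\<phi> 0 x\<bar> \<le> B" using smooth_bounded_AE a(2) by blast
    then show ?thesis by (intro l4_integrable_bounded) auto
  qed
  moreover have "l4_integrable M (\<lambda>x. - (\<phi> 0 x - f x))"
  proof -
    have neg: "(- y) ^ 4 = y ^ 4" for y :: real by simp
    show ?thesis
      using l4[of 0] unfolding l4_integrable_iff neg by auto
  qed
  ultimately show "l4_integrable M f"
    using l4_integrable_add by fastforce
  show "(\<lambda>n. \<integral>x. (\<phi> n x - f x) ^ 4 \<partial>M) \<longlonglongrightarrow> 0"
  proof (rule tendsto_sandwich[OF _ _ tendsto_const])
    have "(\<lambda>n. 4 * (e n)\<^sup>2) \<longlonglongrightarrow> 4 * 0\<^sup>2" by (intro tendsto_intros e0)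
    then show "(\<lambda>n. 4 * (e n)\<^sup>2) \<longlonglongrightarrow> 0" by simp
    have "(\<integral>x. (\<phi> n x - f x) ^ 4 \<partial>M) \<le> 4 * (e n)\<^sup>2" for n
    proof -
      have "ennreal (\<integral>x. (\<phi> n x - f x) ^ 4 \<partial>M) = (\<integral>\<^sup>+x. ennreal ((\<phi> n x - f x) ^ 4) \<partial>M)"
        using l4[of n] by (intro nn_integral_eq_integral[symmetric])
          (auto simp: l4_integrable_def sq_integrable_def)
      then have "ennreal (\<integral>x. (\<phi> n x - f x) ^ 4 \<partial>M) \<le> ennreal (4 * (e n)\<^sup>2)"
        using main[of n] by simp
      then show ?thesis by (rule ennreal_le_iff[THEN iffD1, rotated]) simp
    qed
    then show "\<forall>\<^sub>F n in sequentially. (\<integral>x. (\<phi> n x - f x) ^ 4 \<partial>M) \<le> 4 * (e n)\<^sup>2" by simp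
  qed (auto intro!: always_eventually integral_nonneg_AE)
qed

text \<open>For a test function, a . (\<phi> grad \<phi>) is half of a . grad(\<phi>^2), whose
  integral vanishes because \<open>a\<close> is weakly divergence free. Membership of
  \<open>a\<close> in L4 together with the L4 convergence of the test functions makes a \<phi>_n
  converge in L2, so the identity survives the limit. No boundary condition on \<open>a\<close>
  enters, since \<phi> has compact support.\<close>

lemma trilinear_zero:
  fixes a :: "nat \<Rightarrow> real \<times> real \<Rightarrow> real"
  assumes a: "\<And>i. i \<in> {1,2} \<Longrightarrow> l4_integrable M (a i)"
    and div: "\<And>\<psi>. test_fun U \<psi> \<Longrightarrow> (\<integral>x. a 1 x * pderiv 1 \<psi> x \<partial>M) + (\<integral>x. a 2 x * pderiv 2 \<psi> x \<partial>M) = 0"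
    and f: "H10_grad f g"
  shows "(\<integral>x. (a 1 x * f x) * g 1 x \<partial>M) + (\<integral>x. (a 2 x * f x) * g 2 x \<partial>M) = 0"
    and "\<And>i. i \<in> {1,2} \<Longrightarrow> sq_integrable M (\<lambda>x. a i x * f x)"
proof -
  obtain \<phi> where \<phi>: "approx_test \<phi> f g" using f by (auto simp: H10_grad_def)
  note t = approx_testD[OF \<phi>] and fg = H1_gradD[OF H10_gradD[OF f]]
  note l = H10_l4_convergence[OF H10_gradD[OF f] \<phi>]
  show sq: "sq_integrable M (\<lambda>x. a i x * f x)" if "i \<in> {1,2}" for i
    using a[OF that] l(1) by (rule l4_integrable_mult)
  have lim: "(\<lambda>n. \<integral>x. (a i x * \<phi> n x) * pderiv i (\<phi> n) x \<partial>M) \<longlonglongrightarrow> (\<integral>x. (a i x * f x) * g i x \<partial>M)" if i: "i \<in> {1,2}" for i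
  proof (rule L2_tendsto_mult[OF _ sq[OF i] _ t(4) fg(2)[OF i] t(6)[OF i]])
    have l\<phi>: "l4_integrable M (\<phi> n)" for n
    proof -
      obtain B where "AE x in M. \<bar>\<phi> n x\<bar> \<le> B" using smooth_bounded_AE t(2) by blast
      then show ?thesis using t(3)[of n] by (intro l4_integrable_bounded) (auto simp: sq_integrable_def)
    qed
    show "sq_integrable M (\<lambda>x. a i x * \<phi> n x)" for n
      using a[OF i] l\<phi> by (rule l4_integrable_mult)
    show "(\<lambda>n. \<integral>x. (a i x * \<phi> n x - a i x * f x)\<^sup>2 \<partial>M) \<longlonglongrightarrow> 0"
    proof (rule tendsto_sandwich[OF _ _ tendsto_const])
      let ?c = "sqrt (\<integral>x. ((a i x)\<^sup>2)\<^sup>2 \<partial>M)"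
      have "(\<lambda>n. ?c * sqrt (\<integral>x. (\<phi> n x - f x) ^ 4 \<partial>M)) \<longlonglongrightarrow> ?c * sqrt 0"
        by (intro tendsto_intros l)
      then show "(\<lambda>n. ?c * sqrt (\<integral>x. (\<phi> n x - f x) ^ 4 \<partial>M)) \<longlonglongrightarrow> 0" by simp
      have "(\<integral>x. (a i x * \<phi> n x - a i x * f x)\<^sup>2 \<partial>M) \<le> ?c * sqrt (\<integral>x. (\<phi> n x - f x) ^ 4 \<partial>M)" for n
      proof -
        have "(\<integral>x. (a i x * \<phi> n x - a i x * f x)\<^sup>2 \<partial>M) = (\<integral>x. (a i x)\<^sup>2 * (\<phi> n x - f x)\<^sup>2 \<partial>M)"
          by (simp add: right_diff_distrib[symmetric] power_mult_distrib)
        also have "\<dots> \<le> ?c * sqrt (\<integral>x. ((\<phi> n x - f x)\<^sup>2)\<^sup>2 \<partial>M)"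
          using integral_Cauchy_Schwarz_abs[of M "\<lambda>x. (a i x)\<^sup>2" "\<lambda>x. (\<phi> n x - f x)\<^sup>2"] a[OF i] l(3)[of n]
          by (auto simp: l4_integrable_def)
        also have "(\<lambda>x. ((\<phi> n x - f x)\<^sup>2)\<^sup>2) = (\<lambda>x. (\<phi> n x - f x) ^ 4)" by auto
        finally show ?thesis .
      qed
      then show "\<forall>\<^sub>F n in sequentially. (\<integral>x. (a i x * \<phi> n x - a i x * f x)\<^sup>2 \<partial>M) \<le> ?c * sqrt (\<integral>x. (\<phi> n x - f x) ^ 4 \<partial>M)"
        by simp
    qed (auto intro!: always_eventually integral_nonneg_AE)
  qed
  have "(\<integral>x. (a 1 x * \<phi> n x) * pderiv 1 (\<phi> n) x \<partial>M) + (\<integral>x. (a 2 x * \<phi> n x) * pderiv 2 (\<phi> n) x \<partial>M) = 0" for n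
  proof -
    \<comment> \<open>The divergence hypothesis is used with the test function \<phi>^2; its
      gradient supplies the factor 2.\<close>
    have e: "(\<integral>x. a i x * pderiv i (\<lambda>x. \<phi> n x * \<phi> n x) x \<partial>M) = 2 * (\<integral>x. (a i x * \<phi> n x) * pderiv i (\<phi> n) x \<partial>M)" for i :: nat
    proof -
      have "(\<lambda>x. a i x * pderiv i (\<lambda>x. \<phi> n x * \<phi> n x) x) = (\<lambda>x. 2 * ((a i x * \<phi> n x) * pderiv i (\<phi> n) x))"
        unfolding pderiv_mult[OF t(2) t(2)] by (auto simp: algebra_simps)
      then show ?thesis by simp
    qed
    show ?thesis using div[OF test_fun_mult[OF t(1)[of n] t(2)[of n]]] unfolding e by simp
  qed
  moreover have "(\<lambda>n. (\<integral>x. (a 1 x * \<phi> n x) * pderiv 1 (\<phi> n) x \<partial>M) + (\<integral>x. (a 2 x * \<phi> n x) * pderiv 2 (\<phi> n) x \<partial>M))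
      \<longlonglongrightarrow> (\<integral>x. (a 1 x * f x) * g 1 x \<partial>M) + (\<integral>x. (a 2 x * f x) * g 2 x \<partial>M)"
    by (intro tendsto_add lim) auto
  ultimately show "(\<integral>x. (a 1 x * f x) * g 1 x \<partial>M) + (\<integral>x. (a 2 x * f x) * g 2 x \<partial>M) = 0"
    by (simp add: LIMSEQ_const_iff)
qed

end

section \<open>Functions with vanishing weak gradient\<close>

lemma lebesgue_on_subset:
  fixes F :: "'a::euclidean_space \<Rightarrow> real"
  assumes "B \<in> sets lebesgue" "U \<in> sets lebesgue" "B \<subseteq> U"
  shows "integral\<^sup>L (lebesgue_on B) F = (\<integral>x. (if x \<in> B then F x else 0) \<partial>lebesgue_on U)"
    and "integrable (lebesgue_on U) F \<Longrightarrow> integrable (lebesgue_on B) F"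
proof -
  show "integral\<^sup>L (lebesgue_on B) F = (\<integral>x. (if x \<in> B then F x else 0) \<partial>lebesgue_on U)"
    using Lebesgue_Measure.integral_restrict[OF assms(3,1,2), of F] by simp
  assume "integrable (lebesgue_on U) F"
  then have "set_integrable lebesgue U F" using assms by (simp add: integrable_lebesgue_on)
  then have "set_integrable lebesgue B F" using assms set_integrable_subset by blast
  then show "integrable (lebesgue_on B) F" using assms by (simp add: integrable_lebesgue_on)
qed

text \<open>The antiderivative starting at the left end vanishes again beyond the right end because
  the total integral is zero. Smoothness is phrased through \<open>fst\<close> and
  \<open>snd\<close> since \<open>smooth_fun\<close> concerns functions on the plane.\<close>

lemma smooth_antiderivative:
  assumes s: "smooth_fun (\<lambda>x. \<theta> (fst x))" "smooth_fun (\<lambda>x. \<theta> (snd x))"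
    and z: "\<And>s. s \<notin> {a..b} \<Longrightarrow> \<theta> s = 0" and "a \<le> b" and int: "(\<integral>s. \<theta> s \<partial>lborel) = 0"
  obtains \<Theta> where "smooth_fun (\<lambda>x. \<Theta> (fst x))" "smooth_fun (\<lambda>x. \<Theta> (snd x))" "\<And>s. s \<notin> {a..b} \<Longrightarrow> \<Theta> s = 0"
    "\<And>s. (\<Theta> has_real_derivative \<theta> s) (at s)"
proof -
  have cont: "continuous_on UNIV \<theta>"
    using continuous_on_compose2[OF smooth_fun_continuous_on[OF s(1)], of UNIV "\<lambda>s. (s, 0)" UNIV]
    by (simp add: continuous_on_Pair)
  define \<Theta> where "\<Theta> s = (LBINT y=ereal a..ereal s. \<theta> y)" for s
  have d: "(\<Theta> has_real_derivative \<theta> s) (at s)" for s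
  proof -
    let ?l = "min a s - 1" and ?r = "max a s + 1"
    have "(\<Theta> has_vector_derivative \<theta> s) (at s within {?l..?r})"
      unfolding \<Theta>_def using cont by (intro interval_integral_FTC2) (auto intro: continuous_on_subset)
    then show ?thesis
      unfolding has_real_derivative_iff_has_vector_derivative by (subst (asm) at_within_interior) auto
  qed
  have left: "\<Theta> s = 0" if "s \<le> a" for s
  proof -
    have "\<theta> y = 0" if "y < a" for y using z that by auto
    then have "\<Theta> constant_on {..a}"
    proof -
      assume *: "\<And>y. y < a \<Longrightarrow> \<theta> y = 0"
      have "\<exists>c. \<forall>x\<in>{..<a}. \<Theta> x = c"
      proof (rule has_field_derivative_zero_constant)
        show "(\<Theta> has_real_derivative 0) (at x within {..<a})" if "x \<in> {..<a}" for x
          using d[of x] *[of x] that by (auto intro: has_field_derivative_at_within)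
      qed simp
      then obtain c where c: "\<And>x. x < a \<Longrightarrow> \<Theta> x = c" by auto
      \<comment> \<open>Constancy is known on the open half-line; continuity extends it to the end
        point \<open>a\<close>, where the integral is over an empty range.\<close>
      have "(\<Theta> \<longlongrightarrow> \<Theta> a) (at_left a)"
        using DERIV_isCont[OF d] by (simp add: isCont_def filterlim_at_split)
      moreover have "(\<Theta> \<longlongrightarrow> c) (at_left a)"
        using c by (intro tendsto_eventually) (auto simp: eventually_at_filter)
      ultimately have "\<Theta> a = c" using tendsto_unique trivial_limit_at_left_real by blast
      then show ?thesis using c unfolding constant_on_def by (metis atMost_iff order_le_less)
    qed
    then have "\<Theta> s = \<Theta> a" using that unfolding constant_on_def by (metis atMost_iff order_refl)
    then show ?thesis by (simp add: \<Theta>_def)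
  qed
  have FTC: "\<Theta> s = 0" if "s > b" for s
  proof -
    have "(\<integral>y. indicator {a..s} y *\<^sub>R \<theta> y \<partial>lborel) = \<Theta> s - \<Theta> a"
      using d cont that \<open>a \<le> b\<close>
      by (intro integral_FTC_Icc) (auto simp: has_real_derivative_iff_has_vector_derivative[symmetric]
          intro: has_field_derivative_at_within continuous_on_subset)
    moreover have "(\<lambda>y. indicator {a..s} y *\<^sub>R \<theta> y) = \<theta>"
      using z that by (force simp: fun_eq_iff indicator_def)
    ultimately show ?thesis using int left by simp
  qed
  have f1: "((\<lambda>x::real \<times> real. \<Theta> (fst x)) has_derivative (\<lambda>h. \<theta> (fst x) * fst h)) (at x)" for x
    using DERIV_compose_FDERIV[OF d has_derivative_fst[OF has_derivative_ident]] by (simp add: mult.commute)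
  have f2: "((\<lambda>x::real \<times> real. \<Theta> (snd x)) has_derivative (\<lambda>h. \<theta> (snd x) * snd h)) (at x)" for x
    using DERIV_compose_FDERIV[OF d has_derivative_snd[OF has_derivative_ident]] by (simp add: mult.commute)
  have p1: "pderiv i (\<lambda>x. \<Theta> (fst x)) = (\<lambda>x. \<theta> (fst x) * fst (ebasis i))" for i
    using pderiv_eqI[OF f1] by auto
  have p2: "pderiv i (\<lambda>x. \<Theta> (snd x)) = (\<lambda>x. \<theta> (snd x) * snd (ebasis i))" for i
    using pderiv_eqI[OF f2] by auto
  show ?thesis
  proof (rule that)
    show "smooth_fun (\<lambda>x. \<Theta> (fst x))"
    proof (rule smooth_funI)
      show "(\<lambda>x. \<Theta> (fst x)) differentiable (at x)" for x :: "real \<times> real"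
        using f1[of x] unfolding differentiable_def by blast
    qed (unfold p1, (rule smooth_fun_intros(5)[OF s(1) smooth_fun_intros(1)])+)
    show "smooth_fun (\<lambda>x. \<Theta> (snd x))"
    proof (rule smooth_funI)
      show "(\<lambda>x. \<Theta> (snd x)) differentiable (at x)" for x :: "real \<times> real"
        using f2[of x] unfolding differentiable_def by blast
    qed (unfold p2, (rule smooth_fun_intros(5)[OF s(2) smooth_fun_intros(1)])+)
    show "\<Theta> s = 0" if "s \<notin> {a..b}" for s
      using left[of s] FTC[of s] that by (cases "s \<le> a") auto
    show "(\<Theta> has_real_derivative \<theta> s) (at s)" for s by (rule d)
  qed
qed

lemma bump_integral:
  shows "integrable lborel (bump n a b)" "a < b \<Longrightarrow> 0 < (\<integral>s. bump n a b s \<partial>lborel)"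
proof -
  show i: "integrable lborel (bump n a b)"
  proof (intro integrable_compact_support[of "{a..b}"] bump_continuous)
    show "bump n a b s = 0" if "s \<notin> {a..b}" for s using bump_pos_iff[of n a b s] that by auto
  qed simp
  assume "a < b"
  have "(\<integral>s. bump n a b s \<partial>lborel) \<noteq> 0"
  proof
    assume "(\<integral>s. bump n a b s \<partial>lborel) = 0"
    then have "AE s in lborel. bump n a b s = 0"
      using i by (subst (asm) integral_nonneg_eq_0_iff_AE) (auto simp: bump_bounds)
    then have "AE s in lborel. s \<notin> {a<..<b}"
      using bump_pos_iff[of n a b] by (auto elim!: eventually_mono)
    moreover have "{x. a < x \<and> x < b} = {a<..<b}" by auto
    ultimately have "emeasure lborel {a<..<b} = 0"
      by (subst (asm) AE_iff_measurable[OF _ refl]) auto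
    then show False using \<open>a < b\<close> by simp
  qed
  moreover have "0 \<le> (\<integral>s. bump n a b s \<partial>lborel)" by (simp add: bump_bounds)
  ultimately show "0 < (\<integral>s. bump n a b s \<partial>lborel)" by simp
qed

context bounded_open
begin

lemma bump_product_integral:
  assumes "cbox (a, c) (b, d) \<subseteq> U"
  shows "(\<integral>x. bump n a b (fst x) * bump m c d (snd x) \<partial>M) = (\<integral>s. bump n a b s \<partial>lborel) * (\<integral>s. bump m c d s \<partial>lborel)"
proof -
  let ?F = "\<lambda>x. bump n a b (fst x) * bump m c d (snd x)"
  have z: "?F x = 0" if "x \<notin> cbox (a, c) (b, d)" for x
    using that bump_pos_iff[of n a b "fst x"] bump_pos_iff[of m c d "snd x"] by (cases x) (auto simp: cbox_Pair_eq)
  have i: "integrable lborel ?F"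
    using z by (intro integrable_compact_support[of "cbox (a, c) (b, d)"] smooth_fun_continuous_on smooth_fun_intros smooth_fun_bump) auto
  have "?F x = 0" if "x \<notin> U" for x using z assms that by blast
  then have e: "(\<lambda>x. if x \<in> U then ?F x else 0) = ?F" by auto
  have "(\<integral>x. ?F x \<partial>M) = (\<integral>x. ?F x \<partial>lborel)"
    using lebesgue_on_zero_extension(2)[OF open_U, of ?F] i unfolding e by simp
  also have "\<dots> = (\<integral>s. (\<integral>t. bump n a b s * bump m c d t \<partial>lborel) \<partial>lborel)"
    using lborel_pair.integral_fst[of "\<lambda>s t. bump n a b s * bump m c d t"] i
    by (simp add: lborel_prod case_prod_beta')
  finally show ?thesis by simp
qed

text \<open>Pairing \<open>q\<close> with a product \<phi>(x) \<psi>(y) gives 0 as soon as one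
  factor has mean zero, because that factor is then the derivative of a compactly supported
  function. So the pairing depends on \<phi> and \<psi> only through their integrals and agrees with
  the pairing of a constant.\<close>

lemma weak_gradient_zero_box:
  assumes q: "integrable M q" and w: "is_weak_pderiv U 1 q (\<lambda>x. 0)" "is_weak_pderiv U 2 q (\<lambda>x. 0)"
    and sub: "cbox (a, c) (b, d) \<subseteq> U" and ab: "a < b" "c < d"
  shows "\<exists>k. AE x in lebesgue_on (box (a, c) (b, d)). q x = k"
proof -
  let ?B = "box (a, c) (b, d)"
  let ?\<eta> = "bump 0 a b" and ?\<zeta> = "bump 0 c d"
  define I where "I = (\<integral>s. ?\<eta> s \<partial>lborel)"
  define J where "J = (\<integral>s. ?\<zeta> s \<partial>lborel)"
  have IJ: "0 < I" "0 < J" using bump_integral ab by (auto simp: I_def J_def)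
  define T where "T \<phi> \<psi> = (\<integral>x. q x * (\<phi> (fst x) * \<psi> (snd x)) \<partial>M)" for \<phi> \<psi>
  \<comment> \<open>The constant is read off from one fixed pair of reference bumps with non-zero
    integrals \<open>I\<close> and \<open>J\<close>.\<close>
  define k where "k = T ?\<eta> ?\<zeta> / (I * J)"
  have tst: "test_fun U (\<lambda>x. \<phi> (fst x) * \<psi> (snd x))"
    if "smooth_fun (\<lambda>x. \<phi> (fst x))" "smooth_fun (\<lambda>x. \<psi> (snd x))" "\<And>s. s \<notin> {a..b} \<Longrightarrow> \<phi> s = 0" "\<And>s. s \<notin> {c..d} \<Longrightarrow> \<psi> s = 0" for \<phi> \<psi>
  proof (rule test_funI)
    show "compact (cbox (a, c) (b, d))" by simp
    show "\<phi> (fst x) * \<psi> (snd x) = 0" if "x \<notin> cbox (a, c) (b, d)" for x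
      using that \<open>\<And>s. s \<notin> {a..b} \<Longrightarrow> \<phi> s = 0\<close> \<open>\<And>s. s \<notin> {c..d} \<Longrightarrow> \<psi> s = 0\<close>
      by (cases x) (auto simp: cbox_Pair_eq)
  qed (use that sub in \<open>auto intro: smooth_fun_intros\<close>)
  have T1: "T \<theta> \<psi> = 0"
    if \<theta>: "smooth_fun (\<lambda>x. \<theta> (fst x))" "smooth_fun (\<lambda>x. \<theta> (snd x))" "\<And>s. s \<notin> {a..b} \<Longrightarrow> \<theta> s = 0" "(\<integral>s. \<theta> s \<partial>lborel) = 0"
      and \<psi>: "smooth_fun (\<lambda>x. \<psi> (snd x))" "\<And>s. s \<notin> {c..d} \<Longrightarrow> \<psi> s = 0" for \<theta> \<psi>
  proof -
    obtain \<Theta> where \<Theta>: "smooth_fun (\<lambda>x. \<Theta> (fst x))" "\<And>s. s \<notin> {a..b} \<Longrightarrow> \<Theta> s = 0" "\<And>s. (\<Theta> has_real_derivative \<theta> s) (at s)"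
      using smooth_antiderivative[OF \<theta>(1,2,3) less_imp_le[OF ab(1)] \<theta>(4)] by metis
    have d: "pderiv 1 (\<lambda>x. \<Theta> (fst x) * \<psi> (snd x)) x = \<theta> (fst x) * \<psi> (snd x)" for x
    proof -
      have "((\<lambda>x::real \<times> real. \<Theta> (fst x)) has_derivative (\<lambda>h. fst h * \<theta> (fst x))) (at x)"
        by (rule DERIV_compose_FDERIV[OF \<Theta>(3) has_derivative_fst[OF has_derivative_ident]])
      from has_derivative_mult[OF this smooth_fun_has_derivative[OF \<psi>(1), of x], THEN pderiv_eqI, of 1]
      have "pderiv 1 (\<lambda>x. \<Theta> (fst x) * \<psi> (snd x)) x = \<theta> (fst x) * \<psi> (snd x) + \<Theta> (fst x) * pderiv 1 (\<lambda>x. \<psi> (snd x)) x"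
        by (simp add: ebasis_def)
      moreover have "pderiv 1 (\<lambda>x. \<psi> (snd x)) x = 0"
      proof -
        \<comment> \<open>The function does not vary along the first axis; comparing the chain rule
          on that line with the derivative 0 yields the vanishing partial derivative.\<close>
        have 1: "((\<lambda>s. \<psi> (snd (x + s *\<^sub>R (1, 0)))) has_derivative (\<lambda>s. pderiv 1 (\<lambda>x. \<psi> (snd x)) x * s)) (at 0)"
          by (rule has_derivative_eq_rhs[OF has_derivative_compose[OF _ smooth_fun_has_derivative[OF \<psi>(1)]]])
            (auto intro!: derivative_eq_intros simp: zero_prod_def[symmetric])
        have 2: "((\<lambda>s. \<psi> (snd (x + s *\<^sub>R (1, 0)))) has_derivative (\<lambda>s. 0)) (at (0::real))"
          by simp
        from fun_cong[OF has_derivative_unique[OF 1 2], of 1] show ?thesis by simp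
      qed
      ultimately show ?thesis by simp
    qed
    have "test_fun U (\<lambda>x. \<Theta> (fst x) * \<psi> (snd x))" using tst \<Theta> \<psi> by blast
    then have "(\<integral>x. q x * pderiv 1 (\<lambda>x. \<Theta> (fst x) * \<psi> (snd x)) x \<partial>M) = 0"
      using w(1) by (simp add: weak_iff)
    then show ?thesis unfolding d T_def .
  qed
  have T2: "T \<psi> \<theta> = 0"
    if \<theta>: "smooth_fun (\<lambda>x. \<theta> (fst x))" "smooth_fun (\<lambda>x. \<theta> (snd x))" "\<And>s. s \<notin> {c..d} \<Longrightarrow> \<theta> s = 0" "(\<integral>s. \<theta> s \<partial>lborel) = 0"
      and \<psi>: "smooth_fun (\<lambda>x. \<psi> (fst x))" "\<And>s. s \<notin> {a..b} \<Longrightarrow> \<psi> s = 0" for \<theta> \<psi>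
  proof -
    obtain \<Theta> where \<Theta>: "smooth_fun (\<lambda>x. \<Theta> (snd x))" "\<And>s. s \<notin> {c..d} \<Longrightarrow> \<Theta> s = 0" "\<And>s. (\<Theta> has_real_derivative \<theta> s) (at s)"
      using smooth_antiderivative[OF \<theta>(1,2,3) less_imp_le[OF ab(2)] \<theta>(4)] by metis
    have d: "pderiv 2 (\<lambda>x. \<psi> (fst x) * \<Theta> (snd x)) x = \<psi> (fst x) * \<theta> (snd x)" for x
    proof -
      have "((\<lambda>x::real \<times> real. \<Theta> (snd x)) has_derivative (\<lambda>h. snd h * \<theta> (snd x))) (at x)"
        by (rule DERIV_compose_FDERIV[OF \<Theta>(3) has_derivative_snd[OF has_derivative_ident]])
      from has_derivative_mult[OF smooth_fun_has_derivative[OF \<psi>(1), of x] this, THEN pderiv_eqI, of 2]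
      have "pderiv 2 (\<lambda>x. \<psi> (fst x) * \<Theta> (snd x)) x = \<psi> (fst x) * \<theta> (snd x) + pderiv 2 (\<lambda>x. \<psi> (fst x)) x * \<Theta> (snd x)"
        by (simp add: ebasis_def)
      moreover have "pderiv 2 (\<lambda>x. \<psi> (fst x)) x = 0"
      proof -
        have 1: "((\<lambda>s. \<psi> (fst (x + s *\<^sub>R (0, 1)))) has_derivative (\<lambda>s. pderiv 2 (\<lambda>x. \<psi> (fst x)) x * s)) (at 0)"
          by (rule has_derivative_eq_rhs[OF has_derivative_compose[OF _ smooth_fun_has_derivative[OF \<psi>(1)]]])
            (auto intro!: derivative_eq_intros simp: zero_prod_def[symmetric])
        have 2: "((\<lambda>s. \<psi> (fst (x + s *\<^sub>R (0, 1)))) has_derivative (\<lambda>s. 0)) (at (0::real))"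
          by simp
        from fun_cong[OF has_derivative_unique[OF 1 2], of 1] show ?thesis by simp
      qed
      ultimately show ?thesis by simp
    qed
    have "test_fun U (\<lambda>x. \<psi> (fst x) * \<Theta> (snd x))" using tst \<Theta> \<psi> by blast
    then have "(\<integral>x. q x * pderiv 2 (\<lambda>x. \<psi> (fst x) * \<Theta> (snd x)) x \<partial>M) = 0"
      using w(2) by (simp add: weak_iff)
    then show ?thesis unfolding d T_def .
  qed
  have z: "s \<notin> {a..b} \<Longrightarrow> bump n a' b' s = 0" if "a \<le> a'" "b' \<le> b" for a b a' b' s :: real and n :: nat
    using bump_pos_iff[of n a' b' s] that by force
  have qi: "integrable M (\<lambda>x. q x * (\<phi> (fst x) * \<psi> (snd x)))"
    if "smooth_fun (\<lambda>x. \<phi> (fst x))" "smooth_fun (\<lambda>x. \<psi> (snd x))" for \<phi> \<psi>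
    by (intro integrable_smooth_mult q smooth_fun_intros that)
  have main: "T (bump n a' b') (bump n c' d') = k * ((\<integral>s. bump n a' b' s \<partial>lborel) * (\<integral>s. bump n c' d' s \<partial>lborel))"
    if "a \<le> a'" "b' \<le> b" "c \<le> c'" "d' \<le> d" for n a' b' c' d'
  proof -
    let ?\<phi> = "bump n a' b'" and ?\<psi> = "bump n c' d'"
    let ?m = "(\<integral>s. ?\<phi> s \<partial>lborel)" and ?l = "(\<integral>s. ?\<psi> s \<partial>lborel)"
    \<comment> \<open>Subtracting this multiple of the reference bump makes the mean zero. It
      replaces the first factor by \<open>?\<eta>\<close>; the same is done below with the second
      factor and \<open>?\<zeta>\<close>.\<close>
    have "T (\<lambda>s. ?\<phi> s - (?m / I) * ?\<eta> s) ?\<psi> = 0"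
    proof (rule T1)
      show "(\<integral>s. ?\<phi> s - ?m / I * ?\<eta> s \<partial>lborel) = 0"
        using bump_integral(1) IJ by (simp add: I_def[symmetric])
      show "?\<phi> s - ?m / I * ?\<eta> s = 0" if "s \<notin> {a..b}" for s
        using z[of a a' b' b s n] z[of a a b b s 0] that \<open>a \<le> a'\<close> \<open>b' \<le> b\<close> by simp
      show "?\<psi> s = 0" if "s \<notin> {c..d}" for s
        using z[of c c' d' d s n] that \<open>c \<le> c'\<close> \<open>d' \<le> d\<close> by simp
    qed (intro smooth_fun_diff smooth_fun_intros smooth_fun_bump)+
    moreover have "T (\<lambda>s. ?\<phi> s - (?m / I) * ?\<eta> s) ?\<psi> = T ?\<phi> ?\<psi> - (?m / I) * T ?\<eta> ?\<psi>"
    proof -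
      have "T (\<lambda>s. ?\<phi> s - (?m / I) * ?\<eta> s) ?\<psi> = (\<integral>x. q x * (?\<phi> (fst x) * ?\<psi> (snd x)) - (?m / I) * (q x * (?\<eta> (fst x) * ?\<psi> (snd x))) \<partial>M)"
        unfolding T_def by (rule Bochner_Integration.integral_cong) (auto simp: algebra_simps)
      then show ?thesis using qi[OF smooth_fun_bump] unfolding T_def by simp
    qed
    moreover have "T ?\<eta> (\<lambda>s. ?\<psi> s - (?l / J) * ?\<zeta> s) = 0"
    proof (rule T2)
      show "(\<integral>s. ?\<psi> s - ?l / J * ?\<zeta> s \<partial>lborel) = 0"
        using bump_integral(1) IJ by (simp add: J_def[symmetric])
      show "?\<psi> s - ?l / J * ?\<zeta> s = 0" if "s \<notin> {c..d}" for s
        using z[of c c' d' d s n] z[of c c d d s 0] that \<open>c \<le> c'\<close> \<open>d' \<le> d\<close> by simp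
      show "?\<eta> s = 0" if "s \<notin> {a..b}" for s
        using z[of a a b b s 0] that by simp
    qed (intro smooth_fun_diff smooth_fun_intros smooth_fun_bump)+
    moreover have "T ?\<eta> (\<lambda>s. ?\<psi> s - (?l / J) * ?\<zeta> s) = T ?\<eta> ?\<psi> - (?l / J) * T ?\<eta> ?\<zeta>"
    proof -
      have "T ?\<eta> (\<lambda>s. ?\<psi> s - (?l / J) * ?\<zeta> s) = (\<integral>x. q x * (?\<eta> (fst x) * ?\<psi> (snd x)) - (?l / J) * (q x * (?\<eta> (fst x) * ?\<zeta> (snd x))) \<partial>M)"
        unfolding T_def by (rule Bochner_Integration.integral_cong) (auto simp: algebra_simps)
      then show ?thesis using qi[OF smooth_fun_bump] unfolding T_def by simp
    qed
    ultimately show ?thesis using IJ by (simp add: k_def mult_ac)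
  qed
  have B: "?B \<in> sets lebesgue" "?B \<subseteq> U" using sub box_subset_cbox by auto
  have "AE x in lebesgue_on ?B. q x - k = 0"
  proof (rule fundamental_lemma_bump)
    show "integrable (lebesgue_on ?B) (\<lambda>x. q x - k)"
      using lebesgue_on_subset(2)[OF B(1) U_sets B(2)] q by simp
    fix n a' b' c' d' assume sub': "cbox (a', c') (b', d') \<subseteq> ?B"
    let ?F = "\<lambda>x. bump n a' b' (fst x) * bump n c' d' (snd x)"
    show "(\<integral>x. (q x - k) * ?F x \<partial>lebesgue_on ?B) = 0"
    proof (cases "a' < b' \<and> c' < d'")
      case False
      then have zero: "?F x = 0" for x using bump_pos_iff[of n a' b' "fst x"] bump_pos_iff[of n c' d' "snd x"] by force
      show ?thesis unfolding zero by simp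
    next
      case True
      then have "(a', c') \<in> ?B" "(b', d') \<in> ?B" using sub' by (auto simp: cbox_Pair_eq)
      then have le: "a \<le> a'" "b' \<le> b" "c \<le> c'" "d' \<le> d" by (auto simp: mem_box Basis_prod_def)
      have "x \<in> ?B" if "?F x \<noteq> 0" for x
      proof -
        have "x \<in> cbox (a', c') (b', d')"
          using that bump_pos_iff[of n a' b' "fst x"] bump_pos_iff[of n c' d' "snd x"]
          by (cases x) (auto simp: cbox_Pair_eq)
        then show ?thesis using sub' by blast
      qed
      then have out: "(q x - k) * ?F x = 0" if "x \<notin> ?B" for x using that by (metis mult_zero_right)
      have "(\<lambda>x. if x \<in> ?B then (q x - k) * ?F x else 0) = (\<lambda>x. (q x - k) * ?F x)"
      proof (rule ext)
        fix x
        show "(if x \<in> ?B then (q x - k) * ?F x else 0) = (q x - k) * ?F x"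
        proof (cases "x \<in> ?B")
          case True
          then show ?thesis by (simp only: if_True)
        next
          case False
          show ?thesis unfolding out[OF False] by (rule if_cancel)
        qed
      qed
      also have "\<dots> = (\<lambda>x. q x * ?F x - k * ?F x)" by (rule ext) (rule left_diff_distrib)
      finally have "(\<lambda>x. if x \<in> ?B then (q x - k) * ?F x else 0) = (\<lambda>x. q x * ?F x - k * ?F x)" .
      then have "(\<integral>x. (q x - k) * ?F x \<partial>lebesgue_on ?B) = (\<integral>x. q x * ?F x - k * ?F x \<partial>M)"
        using lebesgue_on_subset(1)[OF B(1) U_sets B(2), of "\<lambda>x. (q x - k) * ?F x"] by simp
      also have "\<dots> = T (bump n a' b') (bump n c' d') - k * (\<integral>x. ?F x \<partial>M)"
        using qi[OF smooth_fun_bump] sq_integrable_integrable[OF sq_integrable_smooth[OF smooth_fun_intros(5)[OF smooth_fun_bump]]]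
        unfolding T_def by simp
      also have "\<dots> = 0"
        using main[OF le] bump_product_integral[of a' c' b' d' n n] sub' B(2) by auto
      finally show ?thesis .
    qed
  qed (rule open_box)
  then show ?thesis by (intro exI[of _ k]) simp
qed

text \<open>Each point has a box on which \<open>q\<close> is almost everywhere constant. On
  overlapping neighbourhoods the constants agree, since a non-empty open set is not null, so the
  local constant is locally constant and connectedness finishes.\<close>

lemma weak_gradient_zero_const:
  assumes "connected U" and q: "integrable M q" and w: "is_weak_pderiv U 1 q (\<lambda>x. 0)" "is_weak_pderiv U 2 q (\<lambda>x. 0)"
  shows "\<exists>k. AE x in M. q x = k"
proof -
  let ?P = "\<lambda>x k V. open V \<and> x \<in> V \<and> V \<subseteq> U \<and> (AE y in lebesgue. y \<in> V \<longrightarrow> q y = k)"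
  have ex: "\<exists>k V. ?P x k V" if x: "x \<in> U" for x
  proof -
    obtain p r where pr: "cbox p r \<subseteq> U" "x \<in> box p r" "\<forall>i\<in>Basis. p \<bullet> i < r \<bullet> i"
      using open_contains_cbox[OF open_U x] by metis
    obtain a c b d where [simp]: "p = (a, c)" "r = (b, d)" by (metis surj_pair)
    have "a < b" "c < d" using pr(3) by (auto simp: Basis_prod_def)
    then obtain k where "AE x in lebesgue_on (box (a, c) (b, d)). q x = k"
      using weak_gradient_zero_box[OF q w, of a c b d] pr(1) by auto
    moreover have "box p r \<subseteq> U" using pr(1) box_subset_cbox by blast
    ultimately have "?P x k (box p r)" using pr(2) by (auto simp: AE_lebesgue_on)
    then show ?thesis by blast
  qed
  define c where "c x = (SOME k. \<exists>V. ?P x k V)" for x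
  have c: "\<exists>V. ?P x (c x) V" if "x \<in> U" for x
    unfolding c_def using ex[OF that] by (rule someI_ex)
  have uniq: "k = k'" if "?P x k V" "?P x k' V'" for x k k' V V'
  proof (rule ccontr)
    assume "k \<noteq> k'"
    have "AE y in lebesgue. y \<notin> V \<inter> V'"
      using that \<open>k \<noteq> k'\<close> by (auto elim!: eventually_elim2)
    then have "negligible (V \<inter> V')"
      using that by (subst (asm) AE_iff_null_sets[symmetric]) (auto simp: negligible_iff_null_sets)
    moreover have "open (V \<inter> V')" "V \<inter> V' \<noteq> {}" using that by auto
    ultimately show False using open_not_negligible by blast
  qed
  have "c constant_on U"
  proof (rule locally_constant_imp_constant[OF \<open>connected U\<close>])
    fix x assume "x \<in> U"
    then obtain V where V: "?P x (c x) V" using c by blast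
    have "c y = c x" if y: "y \<in> V" for y
    proof -
      have "?P y (c x) V" using V y by blast
      moreover obtain V' where "?P y (c y) V'" using c y V by blast
      ultimately show ?thesis using uniq by blast
    qed
    moreover have "openin (top_of_set U) V" "x \<in> V" using V by (simp_all add: open_subset)
    ultimately show "\<exists>T. openin (top_of_set U) T \<and> x \<in> T \<and> (\<forall>y\<in>T. c y = c x)"
      by blast
  qed
  then obtain k where k: "\<And>x. x \<in> U \<Longrightarrow> c x = k" unfolding constant_on_def by blast
  have "AE y in lebesgue. y \<in> U \<longrightarrow> q y = k"
  proof (rule AE_local)
    fix x assume x: "x \<in> U"
    then obtain V where "?P x (c x) V" using c by blast
    then show "\<exists>V. open V \<and> x \<in> V \<and> (AE y in lebesgue. y \<in> V \<longrightarrow> q y = k)"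
      unfolding k[OF x] by (intro exI[of _ V] conjI) simp_all
  qed
  then show ?thesis using AE_lebesgue_on[OF U_sets] by blast
qed

end

section \<open>Rotations\<close>

text \<open>Tonelli reduces a shear to a translation on each line, and one-dimensional Lebesgue
  measure is translation invariant.\<close>

lemma shear_lborel:
  fixes c :: real
  shows "distr lborel borel (\<lambda>z::real \<times> real. (fst z + c * snd z, snd z)) = lborel"
    and "distr lborel borel (\<lambda>z::real \<times> real. (fst z, snd z + c * fst z)) = lborel"
proof -
  show "distr lborel borel (\<lambda>z::real \<times> real. (fst z + c * snd z, snd z)) = lborel"
  proof (rule measure_eqI)
    fix A :: "(real \<times> real) set" assume "A \<in> sets (distr lborel borel (\<lambda>z::real \<times> real. (fst z + c * snd z, snd z)))"
    then have A[measurable]: "A \<in> sets borel" by simp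
    have A': "A \<in> sets (borel \<Otimes>\<^sub>M borel)" using A by (subst borel_prod)
    have S[measurable]: "(\<lambda>z::real \<times> real. (fst z + c * snd z, snd z)) \<in> borel_measurable borel"
      by (intro borel_measurable_continuous_onI continuous_intros)
    have "emeasure (distr lborel borel (\<lambda>z::real \<times> real. (fst z + c * snd z, snd z))) A
        = (\<integral>\<^sup>+z. indicator A (fst z + c * snd z, snd z) \<partial>(lborel \<Otimes>\<^sub>M lborel))"
      using S by (subst nn_integral_indicator[symmetric], simp, subst nn_integral_distr) (auto simp: lborel_prod)
    also have "\<dots> = (\<integral>\<^sup>+y. (\<integral>\<^sup>+x. indicator A (x + c * y, y) \<partial>lborel) \<partial>lborel)"
      using S by (subst lborel_pair.nn_integral_snd[symmetric]) (auto simp: lborel_prod)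
    also have "\<dots> = (\<integral>\<^sup>+y. (\<integral>\<^sup>+x. indicator A (x, y) \<partial>lborel) \<partial>lborel)"
    proof (rule nn_integral_cong)
      fix y :: real
      have "(\<lambda>x. indicator A (x, y) :: ennreal) \<in> borel_measurable borel"
        using A' by measurable
      from nn_integral_real_affine[OF this, of 1 "c * y"]
      show "(\<integral>\<^sup>+x. indicator A (x + c * y, y) \<partial>lborel) = (\<integral>\<^sup>+x. indicator A (x, y) \<partial>lborel)"
        by (simp add: add.commute)
    qed
    also have "\<dots> = (\<integral>\<^sup>+z. indicator A z \<partial>(lborel \<Otimes>\<^sub>M lborel))"
      by (subst lborel_pair.nn_integral_snd[symmetric]) (auto simp: lborel_prod)
    finally show "emeasure (distr lborel borel (\<lambda>z::real \<times> real. (fst z + c * snd z, snd z))) A = emeasure lborel A"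
      by (simp add: lborel_prod)
  qed simp
  show "distr lborel borel (\<lambda>z::real \<times> real. (fst z, snd z + c * fst z)) = lborel"
  proof (rule measure_eqI)
    fix A :: "(real \<times> real) set" assume "A \<in> sets (distr lborel borel (\<lambda>z::real \<times> real. (fst z, snd z + c * fst z)))"
    then have A[measurable]: "A \<in> sets borel" by simp
    have A': "A \<in> sets (borel \<Otimes>\<^sub>M borel)" using A by (subst borel_prod)
    have S[measurable]: "(\<lambda>z::real \<times> real. (fst z, snd z + c * fst z)) \<in> borel_measurable borel"
      by (intro borel_measurable_continuous_onI continuous_intros)
    have "emeasure (distr lborel borel (\<lambda>z::real \<times> real. (fst z, snd z + c * fst z))) A
        = (\<integral>\<^sup>+z. indicator A (fst z, snd z + c * fst z) \<partial>(lborel \<Otimes>\<^sub>M lborel))"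
      using S by (subst nn_integral_indicator[symmetric], simp, subst nn_integral_distr) (auto simp: lborel_prod)
    also have "\<dots> = (\<integral>\<^sup>+x. (\<integral>\<^sup>+y. indicator A (x, y + c * x) \<partial>lborel) \<partial>lborel)"
      using S by (subst lborel.nn_integral_fst[symmetric]) (auto simp: lborel_prod)
    also have "\<dots> = (\<integral>\<^sup>+x. (\<integral>\<^sup>+y. indicator A (x, y) \<partial>lborel) \<partial>lborel)"
    proof (rule nn_integral_cong)
      fix x :: real
      have "(\<lambda>y. indicator A (x, y) :: ennreal) \<in> borel_measurable borel"
        using A' by measurable
      from nn_integral_real_affine[OF this, of 1 "c * x"]
      show "(\<integral>\<^sup>+y. indicator A (x, y + c * x) \<partial>lborel) = (\<integral>\<^sup>+y. indicator A (x, y) \<partial>lborel)"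
        by (simp add: add.commute)
    qed
    also have "\<dots> = (\<integral>\<^sup>+z. indicator A z \<partial>(lborel \<Otimes>\<^sub>M lborel))"
      by (subst lborel.nn_integral_fst[symmetric]) (auto simp: lborel_prod)
    finally show "emeasure (distr lborel borel (\<lambda>z::real \<times> real. (fst z, snd z + c * fst z))) A = emeasure lborel A"
      by (simp add: lborel_prod)
  qed simp
qed

text \<open>A rotation by an angle with nonzero sine is a product of three shears.\<close>
lemma rot_lborel:
  assumes "sin t \<noteq> 0"
  shows "distr lborel borel (rot t) = lborel"
proof -
  \<comment> \<open>\<open>\<tau>\<close> is tan(t/2); the shear factors are -tan(t/2), sin t,
    -tan(t/2), which is why the sine must not vanish.\<close>
  define \<tau> where "\<tau> = (1 - cos t) / sin t"
  let ?A = "\<lambda>z::real \<times> real. (fst z + (-\<tau>) * snd z, snd z)" and ?B = "\<lambda>z::real \<times> real. (fst z, snd z + sin t * fst z)"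
  have m: "?A \<in> borel \<rightarrow>\<^sub>M borel" "?B \<in> borel \<rightarrow>\<^sub>M borel"
    by (intro borel_measurable_continuous_onI continuous_intros)+
  have e1: "1 - \<tau> * sin t = cos t" using assms by (simp add: \<tau>_def)
  have e2: "-2 * \<tau> + sin t * \<tau>\<^sup>2 = - sin t"
  proof -
    have "(-2 * \<tau> + sin t * \<tau>\<^sup>2) * sin t = -2 * (1 - cos t) + (1 - cos t)\<^sup>2"
      using assms by (simp add: \<tau>_def field_simps power2_eq_square)
    also have "\<dots> = - (sin t)\<^sup>2" by (simp add: sin_squared_eq power2_eq_square algebra_simps)
    finally show ?thesis using assms by (simp add: power2_eq_square) (metis mult_cancel_right mult_minus_left)
  qed
  have "rot t = ?A \<circ> (?B \<circ> ?A)"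
  proof
    fix z :: "real \<times> real"
    have "fst z - \<tau> * snd z - \<tau> * (snd z + sin t * (fst z - \<tau> * snd z))
      = (1 - \<tau> * sin t) * fst z + (-2 * \<tau> + sin t * \<tau>\<^sup>2) * snd z"
      by (simp add: algebra_simps power2_eq_square)
    moreover have "snd z + sin t * (fst z - \<tau> * snd z) = sin t * fst z + (1 - \<tau> * sin t) * snd z"
      by (simp add: algebra_simps)
    ultimately show "rot t z = (?A \<circ> (?B \<circ> ?A)) z"
      unfolding rot_def e1 e2 by simp
  qed
  moreover have "distr lborel borel (?A \<circ> (?B \<circ> ?A)) = distr (distr (distr lborel borel ?A) borel ?B) borel ?A"
    using m by (simp add: distr_distr comp_assoc)
  ultimately show ?thesis unfolding shear_lborel by simp
qed

lemma rot_measurable: "rot t \<in> borel_measurable borel"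
  unfolding rot_def[abs_def] by (intro borel_measurable_continuous_onI continuous_intros)

lemma rot_lebesgue:
  assumes "sin t \<noteq> 0"
  shows "rot t \<in> lebesgue \<rightarrow>\<^sub>M lebesgue" "distr lebesgue lebesgue (rot t) = lebesgue"
proof -
  have m: "rot t \<in> lebesgue \<rightarrow>\<^sub>M lborel"
    using rot_measurable by (intro measurable_completion) simp
  have eq: "distr lebesgue lborel (rot t) = lborel"
    using rot_lborel[OF assms] rot_measurable distr_completion[of "rot t" lborel lborel] by (simp cong: distr_cong)
  show "rot t \<in> lebesgue \<rightarrow>\<^sub>M lebesgue"
    using m by (intro completion.measurable_completion2) (auto simp: eq)
  show "distr lebesgue lebesgue (rot t) = lebesgue"
    using completion.completion_distr_eq[OF m] by (simp add: eq)
qed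

lemma rot_integral:
  fixes F :: "real \<times> real \<Rightarrow> real"
  assumes "sin t \<noteq> 0" "F \<in> borel_measurable lebesgue"
  shows "(\<integral>x. F (rot t x) \<partial>lebesgue) = (\<integral>x. F x \<partial>lebesgue)"
  using integral_distr[OF rot_lebesgue(1)[OF assms(1)] assms(2)] rot_lebesgue(2)[OF assms(1)] by simp

lemma rot_compose_derivative:
  assumes "smooth_fun \<phi>"
  shows "((\<lambda>t. \<phi> (rot t x)) has_real_derivative
    (fst (rot t x) * pderiv 2 \<phi> (rot t x) - snd (rot t x) * pderiv 1 \<phi> (rot t x))) (at t)"
proof -
  have "((\<lambda>t. rot t x) has_derivative (\<lambda>h. (- snd (rot t x) * h, fst (rot t x) * h))) (at t)"
    unfolding rot_def by (auto intro!: derivative_eq_intros simp: algebra_simps)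
  from has_derivative_compose[OF this smooth_fun_has_derivative[OF assms]]
  show ?thesis unfolding has_field_derivative_def
    by (rule has_derivative_eq_rhs) (auto simp: algebra_simps)
qed

lemma rot_0 [simp]: "rot 0 x = x"
  by (simp add: rot_def)

text \<open>Rotations preserve Lebesgue measure and \<open>\<alpha>\<close>, so the integral of
  \<open>\<alpha>\<close> against \<phi>(rot t x) - \<phi>(x) is zero. Dividing by t and letting t
  tend to 0 produces the angular derivative of \<phi>. The invariance is thus turned into a weak
  differential identity without differentiating \<open>\<alpha>\<close>.\<close>

lemma (in bounded_open) angular_derivative_zero:
  assumes rotU: "\<And>t x. rot t x \<in> U \<longleftrightarrow> x \<in> U"
    and \<alpha>: "integrable M \<alpha>" and inv: "\<And>t x. x \<in> U \<Longrightarrow> 0 \<le> t \<Longrightarrow> t \<le> 2 * pi \<Longrightarrow> \<alpha> (rot t x) = \<alpha> x"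
    and \<phi>: "test_fun U \<phi>"
  shows "(\<integral>x. \<alpha> x * (fst x * pderiv 2 \<phi> x - snd x * pderiv 1 \<phi> x) \<partial>M) = 0"
proof -
  note s = test_funD(1)[OF \<phi>]
  let ?D = "\<lambda>x. fst x * pderiv 2 \<phi> x - snd x * pderiv 1 \<phi> x"
  have sD: "smooth_fun ?D" by (intro smooth_fun_diff smooth_fun_intros smooth_fun_pderiv s)
  obtain B where B: "\<And>x. x \<in> U \<Longrightarrow> \<bar>?D x\<bar> \<le> B" using smooth_bounded[OF sD] by blast
  \<comment> \<open>Angles in (0,1] lie in the range of the invariance hypothesis and have positive
    sine, as the measure preservation lemma requires.\<close>
  define t where "t n = 1 / real (Suc n)" for n
  have t: "0 < t n" "t n \<le> 1" for n by (auto simp: t_def)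
  have t2: "t n \<le> 2 * pi" "sin (t n) \<noteq> 0" for n
    using t[of n] pi_gt3 sin_gt_zero[of "t n"] by auto
  have t0: "t \<longlonglongrightarrow> 0" unfolding t_def using LIMSEQ_inverse_real_of_nat by (simp add: inverse_eq_divide)
  let ?s = "\<lambda>n x. \<alpha> x * ((\<phi> (rot (t n) x) - \<phi> x) / t n)"
  have sr: "smooth_fun (\<lambda>x. \<phi> (rot (t n) x))" for n by (rule smooth_fun_rot[OF s])
  have zero: "(\<integral>x. ?s n x \<partial>M) = 0" for n
  proof -
    define F where "F = (\<lambda>x. if x \<in> U then \<alpha> x * \<phi> x else 0)"
    have Fr: "F (rot (t n) x) = (if x \<in> U then \<alpha> x * \<phi> (rot (t n) x) else 0)" for x
      using rotU inv[of x "t n"] t[of n] t2[of n] by (auto simp: F_def)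
    have i: "integrable M (\<lambda>x. \<alpha> x * \<phi> x)" "integrable M (\<lambda>x. \<alpha> x * \<phi> (rot (t n) x))"
      by (intro integrable_smooth_mult \<alpha> s sr)+
    have "F \<in> borel_measurable lebesgue"
      unfolding F_def using i(1) U_sets Lebesgue_Measure.integrable_restrict_UNIV borel_measurable_integrable by blast
    from rot_integral[OF t2(2) this, of n]
    have "(\<integral>x. \<alpha> x * \<phi> (rot (t n) x) \<partial>M) = (\<integral>x. \<alpha> x * \<phi> x \<partial>M)"
      unfolding Fr unfolding F_def Lebesgue_Measure.integral_restrict_UNIV[OF U_sets] .
    then have "(\<integral>x. \<alpha> x * \<phi> (rot (t n) x) - \<alpha> x * \<phi> x \<partial>M) = 0" using i by simp
    moreover have "?s n = (\<lambda>x. (\<alpha> x * \<phi> (rot (t n) x) - \<alpha> x * \<phi> x) / t n)"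
      by (auto simp: fun_eq_iff right_diff_distrib)
    ultimately show ?thesis by simp
  qed
  have [measurable]: "\<alpha> \<in> borel_measurable M" "?D \<in> borel_measurable M" "\<phi> \<in> borel_measurable M"
    "(\<lambda>x. \<phi> (rot (t n) x)) \<in> borel_measurable M" for n
    using \<alpha> smooth_measurable sD s sr by auto
  have "(\<lambda>n. \<integral>x. ?s n x \<partial>M) \<longlonglongrightarrow> (\<integral>x. \<alpha> x * ?D x \<partial>M)"
  proof (rule integral_dominated_convergence[where w = "\<lambda>x. \<bar>B * \<alpha> x\<bar>"])
    show "(\<lambda>x. \<alpha> x * ?D x) \<in> borel_measurable M" by measurable
    show "AE x in M. (\<lambda>n. ?s n x) \<longlonglongrightarrow> \<alpha> x * ?D x"
    proof (intro AE_I2 tendsto_intros)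
      fix x
      have "((\<lambda>h. (\<phi> (rot h x) - \<phi> (rot 0 x)) / (h - 0)) \<longlongrightarrow> ?D x) (at 0)"
        using rot_compose_derivative[OF s, of x 0] by (simp add: has_field_derivative_iff)
      moreover have "filterlim t (at 0) sequentially"
        using t0 t(1) by (auto simp: filterlim_at less_imp_neq[symmetric] intro!: always_eventually)
      ultimately show "(\<lambda>n. (\<phi> (rot (t n) x) - \<phi> x) / t n) \<longlonglongrightarrow> ?D x"
        by (auto dest: filterlim_compose)
    qed
    show "AE x in M. norm (?s n x) \<le> \<bar>B * \<alpha> x\<bar>" for n
    proof (intro AE_I2)
      fix x assume "x \<in> space M"
      then have x: "x \<in> U" by simp
      \<comment> \<open>The mean value theorem along the circle bounds the quotient by the supremum
        of the angular derivative, which gives the dominating function.\<close>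
      obtain z where "\<phi> (rot (t n) x) - \<phi> (rot 0 x) = (t n - 0) * ?D (rot z x)"
        using MVT2[where a = 0 and b = "t n" and f = "\<lambda>t. \<phi> (rot t x)" and f' = "\<lambda>t. ?D (rot t x)"]
          t(1)[of n] rot_compose_derivative[OF s] by blast
      then have "\<bar>(\<phi> (rot (t n) x) - \<phi> x) / t n\<bar> \<le> B"
        using B[of "rot z x"] rotU[of z x] x t(1)[of n] by simp
      then have "\<bar>\<alpha> x\<bar> * \<bar>(\<phi> (rot (t n) x) - \<phi> x) / t n\<bar> \<le> \<bar>\<alpha> x\<bar> * \<bar>B\<bar>"
        by (intro mult_left_mono) auto
      then show "norm (?s n x) \<le> \<bar>B * \<alpha> x\<bar>"
        unfolding real_norm_def abs_mult by (simp only: mult.commute)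
    qed
  qed (use \<alpha> in auto)
  then show ?thesis unfolding zero by (simp add: LIMSEQ_const_iff)
qed

section \<open>The energy of a difference of solutions\<close>

declare One_nat_def [simp del]

lemma sum_12: "(\<Sum>i\<in>{1,2::nat}. F i) = F 1 + F 2"
  by simp

context bounded_open
begin

lemma H1_grad_unique:
  assumes "H1_grad f g" "H1_grad f g'" "i \<in> {1,2}"
  shows "AE x in M. g i x = g' i x"
  using weak_unique H1_gradD(3) assms by blast

lemma H10_gradI:
  assumes "H1_0 U f" "H1_grad f g"
  shows "H10_grad f g"
  using assms H1_0_iff by blast

lemma H1_0_ex_grad: "H1_0 U f \<Longrightarrow> \<exists>G. H10_grad f G"
  using H10_gradI H1_iff unfolding H1_0_def by metis

text \<open>The data \<open>du\<close>, \<open>ddu\<close>, \<open>dp\<close> are weak derivatives, \<open>du j i\<close> being the derivative of \<open>u j\<close> in direction \<open>i\<close>.\<close>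
definition ns_data where
  "ns_data u du ddu p dp f b \<longleftrightarrow>
    (\<forall>j\<in>{1,2::nat}. H1_grad (u j) (du j)) \<and> (\<forall>j\<in>{1,2}. \<forall>i\<in>{1,2}. H1_grad (du j i) (ddu j i)) \<and> H1_grad p dp \<and>
    (\<forall>j\<in>{1,2}. AE x in M. - (ddu j 1 1 x + ddu j 2 2 x) + (u 1 x * du j 1 x + u 2 x * du j 2 x) + dp j x = f j x) \<and>
    (AE x in M. du 1 1 x + du 2 2 x = 0) \<and>
    (\<forall>j\<in>{1,2}. H1_0 U (\<lambda>x. u j x - b j x))"

lemma ns_dataD:
  assumes "ns_data u du ddu p dp f b"
  shows "\<And>j. j \<in> {1,2} \<Longrightarrow> H1_grad (u j) (du j)" "\<And>j i. j \<in> {1,2} \<Longrightarrow> i \<in> {1,2} \<Longrightarrow> H1_grad (du j i) (ddu j i)"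
    "H1_grad p dp"
    "\<And>j. j \<in> {1,2} \<Longrightarrow> AE x in M. - (ddu j 1 1 x + ddu j 2 2 x) + (u 1 x * du j 1 x + u 2 x * du j 2 x) + dp j x = f j x"
    "AE x in M. du 1 1 x + du 2 2 x = 0" "\<And>j. j \<in> {1,2} \<Longrightarrow> H1_0 U (\<lambda>x. u j x - b j x)"
  using assms unfolding ns_data_def by blast+

text \<open>Both velocities differ from the same boundary extension by \<open>H1_0\<close>
  functions, so the extension cancels; uniqueness of weak gradients then identifies the gradient of
  the difference.\<close>

lemma ns_difference_H10:
  assumes u: "ns_data u du ddu p dp f b" and v: "ns_data v dv ddv q dq f b" and j: "j \<in> {1,2}"
  shows "H10_grad (\<lambda>x. u j x - v j x) (\<lambda>i x. du j i x - dv j i x)"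
proof -
  have "\<exists>G. H10_grad (\<lambda>x. u j x - b j x) G" "\<exists>G. H10_grad (\<lambda>x. v j x - b j x) G"
    by (rule H1_0_ex_grad[OF ns_dataD(6)[OF u j]] H1_0_ex_grad[OF ns_dataD(6)[OF v j]])+
  then obtain G G' where G: "H10_grad (\<lambda>x. u j x - b j x) G" "H10_grad (\<lambda>x. v j x - b j x) G'" by blast
  have H: "H10_grad (\<lambda>x. u j x - v j x) (\<lambda>i x. G i x - G' i x)"
    using H10_diff[OF G] by simp
  have D: "H1_grad (\<lambda>x. u j x - v j x) (\<lambda>i x. du j i x - dv j i x)"
    by (rule H1_grad_diff[OF ns_dataD(1)[OF u j] ns_dataD(1)[OF v j]])
  show ?thesis
  proof (rule H10_cong[OF H])
    show "AE x in M. u j x - v j x = u j x - v j x" by simp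
    show "(\<lambda>x. u j x - v j x) \<in> borel_measurable M" using H1_gradD(1)[OF D] sq_integrable_measurable by blast
    show "AE x in M. G i x - G' i x = du j i x - dv j i x" if "i \<in> {1,2}" for i :: nat
      using H1_grad_unique[OF H10_gradD[OF H] D that] .
    show "(\<lambda>x. du j i x - dv j i x) \<in> borel_measurable M" if "i \<in> {1,2}" for i :: nat
      using H1_gradD(2)[OF D that] sq_integrable_measurable by blast
  qed
qed

text \<open>Componentwise integration by parts leaves the integral of q div w. This removes the
  pressure, and with a product in place of \<open>q\<close> it also drives
  \<open>transport_parts\<close>.\<close>

lemma H10_divergence_parts:
  fixes w :: "nat \<Rightarrow> real \<times> real \<Rightarrow> real"
  assumes w: "\<And>i. i \<in> {1,2} \<Longrightarrow> H10_grad (w i) (dw i)" and div: "AE x in M. dw 1 1 x + dw 2 2 x = 0" and q: "H1_grad q r"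
  shows "(\<integral>x. w 1 x * r 1 x \<partial>M) + (\<integral>x. w 2 x * r 2 x \<partial>M) = 0"
proof -
  have i: "integrable M (\<lambda>x. dw i i x * q x)" if "i \<in> {1,2}" for i :: nat
    using H1_gradD[OF H10_gradD[OF w[OF that]]] that by (intro sq_integrable_mult H1_gradD[OF q]) auto
  have "(\<integral>x. w i x * r i x \<partial>M) = - (\<integral>x. dw i i x * q x \<partial>M)" if "i \<in> {1,2}" for i :: nat
    using H10_parts[OF w[OF that] H1_gradD(1)[OF q] H1_gradD(2,3)[OF q that] that] .
  then have "(\<integral>x. w 1 x * r 1 x \<partial>M) + (\<integral>x. w 2 x * r 2 x \<partial>M) = - ((\<integral>x. dw 1 1 x * q x \<partial>M) + (\<integral>x. dw 2 2 x * q x \<partial>M))"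
    by simp
  also have "(\<integral>x. dw 1 1 x * q x \<partial>M) + (\<integral>x. dw 2 2 x * q x \<partial>M) = (\<integral>x. dw 1 1 x * q x + dw 2 2 x * q x \<partial>M)"
    using i by simp
  also have "\<dots> = (\<integral>x. 0 \<partial>M)"
  proof (rule integral_cong_AE)
    show "(\<lambda>x. dw 1 1 x * q x + dw 2 2 x * q x) \<in> borel_measurable M"
      using i[of 1] i[of 2] by (intro borel_measurable_add borel_measurable_integrable) auto
    show "AE x in M. dw 1 1 x * q x + dw 2 2 x * q x = 0"
      using div by eventually_elim (simp add: distrib_right[symmetric])
  qed simp
  finally show ?thesis by simp
qed

text \<open>For a test function \<phi> in place of \<open>z\<close>, the field \<open>w\<close> is
  orthogonal to the gradient of \<phi> v, and the Leibniz rule splits that gradient into the two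
  sides. Boundedness of \<open>v\<close> and \<open>dv\<close> keeps w v and w dv in L2, which
  permits the limit from \<phi> to \<open>z\<close>.\<close>

lemma transport_parts:
  fixes w :: "nat \<Rightarrow> real \<times> real \<Rightarrow> real"
  assumes w: "\<And>i. i \<in> {1,2} \<Longrightarrow> H10_grad (w i) (dw i)" and div: "AE x in M. dw 1 1 x + dw 2 2 x = 0"
    and v: "H1_grad v dv" and bv: "AE x in M. \<bar>v x\<bar> \<le> B" and bdv: "\<And>i. i \<in> {1,2} \<Longrightarrow> AE x in M. \<bar>dv i x\<bar> \<le> B"
    and z: "H10_grad z dz"
  shows "(\<integral>x. (w 1 x * dv 1 x) * z x \<partial>M) + (\<integral>x. (w 2 x * dv 2 x) * z x \<partial>M)
    = - ((\<integral>x. (w 1 x * v x) * dz 1 x \<partial>M) + (\<integral>x. (w 2 x * v x) * dz 2 x \<partial>M))"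
proof -
  obtain \<phi> where \<phi>: "approx_test \<phi> z dz" using z by (auto simp: H10_grad_def)
  note t = approx_testD[OF \<phi>] and zd = H1_gradD[OF H10_gradD[OF z]] and vd = H1_gradD[OF v]
  have sw: "sq_integrable M (w i)" if "i \<in> {1,2}" for i using H1_gradD(1)[OF H10_gradD[OF w[OF that]]] .
  have s1: "sq_integrable M (\<lambda>x. w i x * dv i x)" if "i \<in> {1,2}" for i :: nat
    using sq_integrable_bounded_mult[OF sw[OF that] sq_integrable_measurable[OF vd(2)[OF that]] bdv[OF that]]
    by (simp add: mult.commute)
  have s2: "sq_integrable M (\<lambda>x. w i x * v x)" if "i \<in> {1,2}" for i :: nat
    using sq_integrable_bounded_mult[OF sw[OF that] sq_integrable_measurable[OF vd(1)] bv]
    by (simp add: mult.commute)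
  have l1: "(\<lambda>n. \<integral>x. (w i x * dv i x) * \<phi> n x \<partial>M) \<longlonglongrightarrow> (\<integral>x. (w i x * dv i x) * z x \<partial>M)" if "i \<in> {1,2}" for i :: nat
    by (rule L2_tendsto_mult[OF s1[OF that] s1[OF that] L2_tendsto_const t(3) zd(1) t(5)])
  have l2: "(\<lambda>n. \<integral>x. (w i x * v x) * pderiv i (\<phi> n) x \<partial>M) \<longlonglongrightarrow> (\<integral>x. (w i x * v x) * dz i x \<partial>M)" if "i \<in> {1,2}" for i :: nat
    by (rule L2_tendsto_mult[OF s2[OF that] s2[OF that] L2_tendsto_const t(4) zd(2)[OF that] t(6)[OF that]])
  have "(\<integral>x. (w 1 x * dv 1 x) * \<phi> n x \<partial>M) + (\<integral>x. (w 2 x * dv 2 x) * \<phi> n x \<partial>M)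
    + ((\<integral>x. (w 1 x * v x) * pderiv 1 (\<phi> n) x \<partial>M) + (\<integral>x. (w 2 x * v x) * pderiv 2 (\<phi> n) x \<partial>M)) = 0" for n
  proof -
    have e: "(\<integral>x. w i x * (\<phi> n x * dv i x + pderiv i (\<phi> n) x * v x) \<partial>M)
      = (\<integral>x. (w i x * dv i x) * \<phi> n x \<partial>M) + (\<integral>x. (w i x * v x) * pderiv i (\<phi> n) x \<partial>M)" if "i \<in> {1,2}" for i :: nat
    proof -
      have "(\<integral>x. w i x * (\<phi> n x * dv i x + pderiv i (\<phi> n) x * v x) \<partial>M)
        = (\<integral>x. (w i x * dv i x) * \<phi> n x + (w i x * v x) * pderiv i (\<phi> n) x \<partial>M)"
        by (rule Bochner_Integration.integral_cong) (auto simp: algebra_simps)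
      then show ?thesis
        using sq_integrable_mult[OF s1[OF that] t(3)] sq_integrable_mult[OF s2[OF that] t(4)] by simp
    qed
    show ?thesis
      using H10_divergence_parts[OF w div H1_grad_smooth_mult[OF t(2)[of n] v]] e[of 1] e[of 2] by simp
  qed
  moreover have "(\<lambda>n. (\<integral>x. (w 1 x * dv 1 x) * \<phi> n x \<partial>M) + (\<integral>x. (w 2 x * dv 2 x) * \<phi> n x \<partial>M)
    + ((\<integral>x. (w 1 x * v x) * pderiv 1 (\<phi> n) x \<partial>M) + (\<integral>x. (w 2 x * v x) * pderiv 2 (\<phi> n) x \<partial>M)))
   \<longlonglongrightarrow> (\<integral>x. (w 1 x * dv 1 x) * z x \<partial>M) + (\<integral>x. (w 2 x * dv 2 x) * z x \<partial>M)
    + ((\<integral>x. (w 1 x * v x) * dz 1 x \<partial>M) + (\<integral>x. (w 2 x * v x) * dz 2 x \<partial>M))"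
    by (intro tendsto_add l1 l2) auto
  ultimately show ?thesis by (simp add: LIMSEQ_const_iff)
qed

definition energy where
  "energy d = (\<integral>x. (d 1 1 x)\<^sup>2 + (d 1 2 x)\<^sup>2 + (d 2 1 x)\<^sup>2 + (d 2 2 x)\<^sup>2 \<partial>M)"

text \<open>The difference of the convective terms is (u . grad) w + (w . grad) v. After pairing
  with \<open>w\<close> its first part vanishes by \<open>trilinear_zero\<close>; the second
  remains, and \<open>transport_parts\<close> gives the other form, in which the derivative falls on
  \<open>w\<close>.\<close>

lemma energy_identity:
  assumes u: "ns_data u du ddu p dp f b" and v: "ns_data v dv ddv q dq f b"
    and bv: "\<And>j. j \<in> {1,2} \<Longrightarrow> AE x in M. \<bar>v j x\<bar> \<le> B"
    and bdv: "\<And>i j. i \<in> {1,2} \<Longrightarrow> j \<in> {1,2} \<Longrightarrow> AE x in M. \<bar>dv j i x\<bar> \<le> B"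
    and w_def: "w = (\<lambda>j x. u j x - v j x)" and dw_def: "dw = (\<lambda>j i x. du j i x - dv j i x)"
  shows "energy dw = - (\<integral>x. w 1 x * dv 1 1 x * w 1 x + w 2 x * dv 1 2 x * w 1 x + (w 1 x * dv 2 1 x * w 2 x + w 2 x * dv 2 2 x * w 2 x) \<partial>M)"
    and "energy dw = (\<integral>x. w 1 x * v 1 x * dw 1 1 x + w 2 x * v 1 x * dw 1 2 x + (w 1 x * v 2 x * dw 2 1 x + w 2 x * v 2 x * dw 2 2 x) \<partial>M)"
proof -
  have H: "H10_grad (w j) (dw j)" if "j \<in> {1,2}" for j :: nat
    using ns_difference_H10[OF u v that] by (simp add: w_def dw_def)
  note h = H1_gradD[OF H10_gradD[OF H]]
  have div: "AE x in M. dw 1 1 x + dw 2 2 x = 0"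
    using ns_dataD(5)[OF u] ns_dataD(5)[OF v] by eventually_elim (simp add: dw_def)
  have dd: "H1_grad (dw j i) (\<lambda>k x. ddu j i k x - ddv j i k x)" if "j \<in> {1,2}" "i \<in> {1,2}" for j i :: nat
    using H1_grad_diff[OF ns_dataD(2)[OF u that] ns_dataD(2)[OF v that]] by (simp add: dw_def)
  have dpq: "H1_grad (\<lambda>x. p x - q x) (\<lambda>j x. dp j x - dq j x)"
    by (rule H1_grad_diff[OF ns_dataD(3)[OF u] ns_dataD(3)[OF v]])
  have press: "(\<integral>x. w 1 x * (dp 1 x - dq 1 x) \<partial>M) + (\<integral>x. w 2 x * (dp 2 x - dq 2 x) \<partial>M) = 0"
    by (rule H10_divergence_parts[OF H div dpq])
  have su: "sq_integrable M (u j)" "sq_integrable M (v j)" if "j \<in> {1,2}" for j :: nat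
    using H1_gradD(1) ns_dataD(1) u v that by blast+
  have sdv: "sq_integrable M (dv j i)" if "j \<in> {1,2}" "i \<in> {1,2}" for j i :: nat
    using H1_gradD(2) ns_dataD(1)[OF v] that by blast
  \<comment> \<open>\<open>u\<close> is the sum of \<open>w\<close>, in L4 as a limit of test
    functions, and the bounded field \<open>v\<close>.\<close>
  have l4: "l4_integrable M (u i)" if i: "i \<in> {1,2}" for i :: nat
  proof -
    obtain \<phi> where "approx_test \<phi> (w i) (dw i)" using H[OF i] by (auto simp: H10_grad_def)
    then have "l4_integrable M (w i)" using H10_l4_convergence(1) H10_gradD[OF H[OF i]] by blast
    moreover have "l4_integrable M (v i)"
      using l4_integrable_bounded[OF sq_integrable_measurable[OF su(2)[OF i]] bv[OF i]] .
    ultimately have "l4_integrable M (\<lambda>x. w i x + v i x)" by (rule l4_integrable_add)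
    then show ?thesis by (simp add: w_def)
  qed
  have udiv: "(\<integral>x. u 1 x * pderiv 1 \<psi> x \<partial>M) + (\<integral>x. u 2 x * pderiv 2 \<psi> x \<partial>M) = 0" if \<psi>: "test_fun U \<psi>" for \<psi>
  proof -
    have i: "integrable M (\<lambda>x. du i i x * \<psi> x)" if "i \<in> {1,2}" for i :: nat
      using test_integrable_mult[OF \<psi>] H1_gradD(3)[OF ns_dataD(1)[OF u that] that] by (simp add: weak_iff)
    have "(\<integral>x. u i x * pderiv i \<psi> x \<partial>M) = - (\<integral>x. du i i x * \<psi> x \<partial>M)" if "i \<in> {1,2}" for i :: nat
      using H1_gradD(3)[OF ns_dataD(1)[OF u that] that] \<psi> by (simp add: weak_iff)
    then have "(\<integral>x. u 1 x * pderiv 1 \<psi> x \<partial>M) + (\<integral>x. u 2 x * pderiv 2 \<psi> x \<partial>M) = - (\<integral>x. du 1 1 x * \<psi> x + du 2 2 x * \<psi> x \<partial>M)"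
      using i by simp
    also have "(\<integral>x. du 1 1 x * \<psi> x + du 2 2 x * \<psi> x \<partial>M) = (\<integral>x. 0 \<partial>M)"
    proof (rule integral_cong_AE)
      show "(\<lambda>x. du 1 1 x * \<psi> x + du 2 2 x * \<psi> x) \<in> borel_measurable M"
        using i[of 1] i[of 2] by (intro borel_measurable_add borel_measurable_integrable) auto
      show "AE x in M. du 1 1 x * \<psi> x + du 2 2 x * \<psi> x = 0"
        using ns_dataD(5)[OF u] by eventually_elim (simp add: distrib_right[symmetric])
    qed simp
    finally show ?thesis by simp
  qed
  have sB: "sq_integrable M (\<lambda>x. w i x * dv j i x)" if "j \<in> {1,2}" "i \<in> {1,2}" for i j :: nat
    using sq_integrable_bounded_mult[OF h(1)[OF that(2)] sq_integrable_measurable[OF sdv[OF that]] bdv[OF that(2,1)]]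
    by (simp add: mult.commute)
  have sC: "sq_integrable M (\<lambda>x. w i x * v j x)" if "j \<in> {1,2}" "i \<in> {1,2}" for i j :: nat
    using sq_integrable_bounded_mult[OF h(1)[OF that(2)] sq_integrable_measurable[OF su(2)[OF that(1)]] bv[OF that(1)]]
    by (simp add: mult.commute)
  let ?E = "\<lambda>j. (\<integral>x. (dw j 1 x)\<^sup>2 \<partial>M) + (\<integral>x. (dw j 2 x)\<^sup>2 \<partial>M)"
  let ?T = "\<lambda>j. (\<integral>x. (w 1 x * dv j 1 x) * w j x \<partial>M) + (\<integral>x. (w 2 x * dv j 2 x) * w j x \<partial>M)"
  let ?S = "\<lambda>j. (\<integral>x. (w 1 x * v j x) * dw j 1 x \<partial>M) + (\<integral>x. (w 2 x * v j x) * dw j 2 x \<partial>M)"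
  have comp: "?E j + ?T j + (\<integral>x. w j x * (dp j x - dq j x) \<partial>M) = 0" if j: "j \<in> {1,2}" for j :: nat
  proof -
    have tri1: "(\<integral>x. (u 1 x * w j x) * dw j 1 x \<partial>M) + (\<integral>x. (u 2 x * w j x) * dw j 2 x \<partial>M) = 0"
      using trilinear_zero(1)[of u "w j" "dw j"] l4 udiv H[OF j] by blast
    have tri2: "sq_integrable M (\<lambda>x. u i x * w j x)" if "i \<in> {1,2}" for i :: nat
      using trilinear_zero(2)[of u "w j" "dw j" i] l4 udiv H[OF j] that by blast
    have lap: "(\<integral>x. w j x * (ddu j i i x - ddv j i i x) \<partial>M) = - (\<integral>x. (dw j i x)\<^sup>2 \<partial>M)"
      and ilap: "integrable M (\<lambda>x. w j x * (ddu j i i x - ddv j i i x))" if i: "i \<in> {1,2}" for i :: nat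
      using H10_parts[OF H[OF j] H1_gradD(1)[OF dd[OF j i]] H1_gradD(2,3)[OF dd[OF j i] i] i]
        sq_integrable_mult[OF h(1)[OF j] H1_gradD(2)[OF dd[OF j i] i]] by (simp_all add: power2_eq_square)
    have i2: "integrable M (\<lambda>x. (u i x * w j x) * dw j i x)" if i: "i \<in> {1,2}" for i :: nat
      by (rule sq_integrable_mult[OF tri2[OF i] h(2)[OF j i]])
    have i3: "integrable M (\<lambda>x. (w i x * dv j i x) * w j x)" if i: "i \<in> {1,2}" for i :: nat
      by (rule sq_integrable_mult[OF sB[OF j i] h(1)[OF j]])
    have i4: "integrable M (\<lambda>x. w j x * (dp j x - dq j x))"
      by (rule sq_integrable_mult[OF h(1)[OF j] H1_gradD(2)[OF dpq j]])
    note ii = ilap[of 1] ilap[of 2] i2[of 1] i2[of 2] i3[of 1] i3[of 2] i4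
    let ?F = "\<lambda>x. - (w j x * (ddu j 1 1 x - ddv j 1 1 x)) - w j x * (ddu j 2 2 x - ddv j 2 2 x)
      + (u 1 x * w j x) * dw j 1 x + (u 2 x * w j x) * dw j 2 x
      + (w 1 x * dv j 1 x) * w j x + (w 2 x * dv j 2 x) * w j x + w j x * (dp j x - dq j x)"
    have iF: "integrable M ?F" using ii by auto
    have "(\<integral>x. ?F x \<partial>M) = (\<integral>x. 0 \<partial>M)"
    proof (rule integral_cong_AE)
      show "?F \<in> borel_measurable M" using iF by auto
      show "AE x in M. ?F x = 0"
        using ns_dataD(4)[OF u j] ns_dataD(4)[OF v j]
      proof eventually_elim
        case (elim x)
        \<comment> \<open>u . grad u_j - v . grad v_j is written as u . grad w_j + w . grad v_j; the
          rest is the difference of the two momentum equations, multiplied by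
          \<open>w j\<close>.\<close>
        have "?F x = w j x * ((- (ddu j 1 1 x + ddu j 2 2 x) + (u 1 x * du j 1 x + u 2 x * du j 2 x) + dp j x)
           - (- (ddv j 1 1 x + ddv j 2 2 x) + (v 1 x * dv j 1 x + v 2 x * dv j 2 x) + dq j x))"
          unfolding w_def dw_def by (simp add: algebra_simps)
        then show ?case using elim by simp
      qed
    qed simp
    moreover have "(\<integral>x. ?F x \<partial>M) = - (\<integral>x. w j x * (ddu j 1 1 x - ddv j 1 1 x) \<partial>M) - (\<integral>x. w j x * (ddu j 2 2 x - ddv j 2 2 x) \<partial>M)
      + (\<integral>x. (u 1 x * w j x) * dw j 1 x \<partial>M) + (\<integral>x. (u 2 x * w j x) * dw j 2 x \<partial>M)
      + (\<integral>x. (w 1 x * dv j 1 x) * w j x \<partial>M) + (\<integral>x. (w 2 x * dv j 2 x) * w j x \<partial>M) + (\<integral>x. w j x * (dp j x - dq j x) \<partial>M)"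
      using ii by simp
    ultimately show ?thesis
      using lap[of 1] lap[of 2] tri1 by simp
  qed
  have transp: "?T j = - ?S j" if j: "j \<in> {1,2}" for j :: nat
    by (rule transport_parts[OF H div ns_dataD(1)[OF v j] bv[OF j] bdv[OF _ j] H[OF j]])
  have sqd: "integrable M (\<lambda>x. (dw j i x)\<^sup>2)" if "j \<in> {1,2}" "i \<in> {1,2}" for i j :: nat
    using h(2)[OF that] by (simp add: sq_integrable_def)
  have E: "energy dw = ?E 1 + ?E 2"
    unfolding energy_def using sqd[of 1 1] sqd[of 1 2] sqd[of 2 1] sqd[of 2 2] by simp
  have T: "(\<integral>x. w 1 x * dv 1 1 x * w 1 x + w 2 x * dv 1 2 x * w 1 x + (w 1 x * dv 2 1 x * w 2 x + w 2 x * dv 2 2 x * w 2 x) \<partial>M) = ?T 1 + ?T 2"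
    using sq_integrable_mult[OF sB[of 1 1] h(1)[of 1]] sq_integrable_mult[OF sB[of 1 2] h(1)[of 1]]
      sq_integrable_mult[OF sB[of 2 1] h(1)[of 2]] sq_integrable_mult[OF sB[of 2 2] h(1)[of 2]] by simp
  have S: "(\<integral>x. w 1 x * v 1 x * dw 1 1 x + w 2 x * v 1 x * dw 1 2 x + (w 1 x * v 2 x * dw 2 1 x + w 2 x * v 2 x * dw 2 2 x) \<partial>M) = ?S 1 + ?S 2"
    using sq_integrable_mult[OF sC[of 1 1] h(2)[of 1 1]] sq_integrable_mult[OF sC[of 1 2] h(2)[of 1 2]]
      sq_integrable_mult[OF sC[of 2 1] h(2)[of 2 1]] sq_integrable_mult[OF sC[of 2 2] h(2)[of 2 2]] by simp
  show "energy dw = - (\<integral>x. w 1 x * dv 1 1 x * w 1 x + w 2 x * dv 1 2 x * w 1 x + (w 1 x * dv 2 1 x * w 2 x + w 2 x * dv 2 2 x * w 2 x) \<partial>M)"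
    unfolding E T using comp[of 1] comp[of 2] press by simp
  show "energy dw = (\<integral>x. w 1 x * v 1 x * dw 1 1 x + w 2 x * v 1 x * dw 1 2 x + (w 1 x * v 2 x * dw 2 1 x + w 2 x * v 2 x * dw 2 2 x) \<partial>M)"
    unfolding E S using comp[of 1] comp[of 2] press transp[of 1] transp[of 2] by simp
qed

text \<open>Zero energy makes the first derivatives agree, hence the velocities, by the zero
  boundary values of their difference. The second derivatives then agree as well, so the equations
  leave a zero weak gradient for \<open>p - q\<close>.\<close>

lemma ns_unique_if_energy_zero:
  assumes u: "ns_data u du ddu p dp f b" and v: "ns_data v dv ddv q dq f b" and "connected U"
    and e: "energy (\<lambda>j i x. du j i x - dv j i x) = 0"
  shows "\<And>j. j \<in> {1,2} \<Longrightarrow> AE x in M. u j x = v j x" "\<exists>c. AE x in M. p x = q x + c"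
proof -
  let ?d = "\<lambda>j i x. du j i x - dv j i x"
  have H: "H10_grad (\<lambda>x. u j x - v j x) (?d j)" if "j \<in> {1,2}" for j :: nat
    by (rule ns_difference_H10[OF u v that])
  note h = H1_gradD[OF H10_gradD[OF H]]
  have sqd: "integrable M (\<lambda>x. (?d j i x)\<^sup>2)" if "j \<in> {1,2}" "i \<in> {1,2}" for i j :: nat
    using h(2)[OF that] by (simp add: sq_integrable_def)
  have "AE x in M. (?d 1 1 x)\<^sup>2 + (?d 1 2 x)\<^sup>2 + (?d 2 1 x)\<^sup>2 + (?d 2 2 x)\<^sup>2 = 0"
    using e sqd[of 1 1] sqd[of 1 2] sqd[of 2 1] sqd[of 2 2] unfolding energy_def
    by (subst (asm) integral_nonneg_eq_0_iff_AE) auto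
  then have z: "AE x in M. ?d 1 1 x = 0 \<and> ?d 1 2 x = 0 \<and> ?d 2 1 x = 0 \<and> ?d 2 2 x = 0"
    by eventually_elim (simp add: add_nonneg_eq_0_iff)
  then have zd: "AE x in M. du j i x = dv j i x" if "j \<in> {1,2}" "i \<in> {1,2}" for i j :: nat
    using z by eventually_elim (use that in auto)
  show eq: "AE x in M. u j x = v j x" if j: "j \<in> {1,2}" for j :: nat
  proof -
    have "AE x in M. ?d j 1 x = 0" using zd[OF j, of 1] by auto
    from H10_zero_gradient[OF H[OF j] this] show ?thesis by auto
  qed
  have dpq: "H1_grad (\<lambda>x. p x - q x) (\<lambda>j x. dp j x - dq j x)"
    by (rule H1_grad_diff[OF ns_dataD(3)[OF u] ns_dataD(3)[OF v]])
  have zp: "is_weak_pderiv U j (\<lambda>x. p x - q x) (\<lambda>x. 0)" if j: "j \<in> {1,2}" for j :: nat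
  proof (rule weak_cong[OF H1_gradD(3)[OF dpq j]])
    \<comment> \<open>As \<open>du j i\<close> and \<open>dv j i\<close> agree almost everywhere,
      \<open>ddu j i\<close> is a weak gradient of both, and weak gradients are unique.\<close>
    have ddz: "AE x in M. ddu j i i x = ddv j i i x" if i: "i \<in> {1,2}" for i :: nat
    proof -
      have "H1_grad (dv j i) (ddu j i)"
        using H1_gradD(1)[OF ns_dataD(2)[OF v j i]] H1_gradD(2)[OF ns_dataD(2)[OF u j i]] zd[OF j i]
        by (intro H1_grad_cong[OF ns_dataD(2)[OF u j i]]) (auto intro: sq_integrable_measurable)
      then show ?thesis using H1_grad_unique[OF _ ns_dataD(2)[OF v j i] i] by blast
    qed
    show "AE x in M. dp j x - dq j x = 0"
      using ns_dataD(4)[OF u j] ns_dataD(4)[OF v j] ddz[of 1, simplified] ddz[of 2, simplified] zd[OF j, of 1, simplified] zd[OF j, of 2, simplified]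
        eq[of 1, simplified] eq[of 2, simplified]
      by eventually_elim simp
  qed (use H1_gradD(1)[OF dpq] sq_integrable_measurable in auto)
  obtain c where "AE x in M. p x - q x = c"
    using weak_gradient_zero_const[OF \<open>connected U\<close> sq_integrable_integrable[OF H1_gradD(1)[OF dpq]] zp[of 1] zp[of 2]] by auto
  then show "\<exists>c. AE x in M. p x = q x + c"
    by (intro exI[of _ c]) (auto elim!: eventually_mono)
qed

section \<open>Vanishing of the energy under smallness or symmetry\<close>

lemma dirichlet_eigenvalue_le:
  assumes "H10_grad w g"
  shows "dirichlet_eigenvalue U * (\<integral>x. (w x)\<^sup>2 \<partial>M) \<le> (\<integral>x. (g 1 x)\<^sup>2 \<partial>M) + (\<integral>x. (g 2 x)\<^sup>2 \<partial>M)"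
proof (cases "AE x in M. w x = 0")
  case True
  then have "(\<integral>x. (w x)\<^sup>2 \<partial>M) = (\<integral>x. 0 \<partial>M)"
    using H1_gradD(1)[OF H10_gradD[OF assms]] by (intro integral_cong_AE) (auto simp: sq_integrable_def)
  moreover have "0 \<le> (\<integral>x. (g 1 x)\<^sup>2 \<partial>M) + (\<integral>x. (g 2 x)\<^sup>2 \<partial>M)"
    by (intro add_nonneg_nonneg integral_nonneg_AE) auto
  ultimately show ?thesis by simp
next
  case False
  note h = H1_gradD[OF H10_gradD[OF assms]]
  let ?Q = "\<lambda>v. (\<Sum>i\<in>{1,2}. LINT x:U|lebesgue. (weak_pderiv U i v x)\<^sup>2) / (LINT x:U|lebesgue. (v x)\<^sup>2)"
  let ?S = "{?Q v | v. H1_0 U v \<and> \<not> (AE x in lebesgue. x \<in> U \<longrightarrow> v x = 0)}"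
  have nn: "0 \<le> ?Q v" for v
    unfolding set_lebesgue_integral_def by (intro divide_nonneg_nonneg sum_nonneg integral_nonneg_AE) auto
  have "(\<integral>x. (w x)\<^sup>2 \<partial>M) \<noteq> 0"
    using False h(1) by (subst integral_nonneg_eq_0_iff_AE) (auto simp: sq_integrable_def)
  moreover have "0 \<le> (\<integral>x. (w x)\<^sup>2 \<partial>M)" by (rule integral_nonneg_AE) simp
  ultimately have pos: "0 < (\<integral>x. (w x)\<^sup>2 \<partial>M)" by linarith
  have "?Q w \<in> ?S"
    using False H1_0_iff[OF H10_gradD[OF assms]] assms AE_lebesgue_on[OF U_sets, of "\<lambda>x. w x = 0"] by blast
  then have "dirichlet_eigenvalue U \<le> ?Q w"
    unfolding dirichlet_eigenvalue_def by (intro cInf_lower bdd_belowI[of _ 0]) (use nn in auto)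
  also have "?Q w = ((\<integral>x. (g 1 x)\<^sup>2 \<partial>M) + (\<integral>x. (g 2 x)\<^sup>2 \<partial>M)) / (\<integral>x. (w x)\<^sup>2 \<partial>M)"
  proof -
    have "(\<integral>x. (weak_pderiv U i w x)\<^sup>2 \<partial>M) = (\<integral>x. (g i x)\<^sup>2 \<partial>M)" if i: "i \<in> {1,2}" for i :: nat
    proof (rule integral_cong_AE)
      show "AE x in M. (weak_pderiv U i w x)\<^sup>2 = (g i x)\<^sup>2"
        using weak_pderiv_is_weak(2)[OF h(3)[OF i]] by eventually_elim simp
    qed (use H1_gradD(2)[OF H1_grad_weak_pderiv[OF H10_gradD[OF assms]] i] h(2)[OF i] in \<open>auto simp: sq_integrable_def\<close>)
    then show ?thesis by (simp add: integral_lebesgue_on[OF U_sets])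
  qed
  finally show ?thesis using pos by (simp add: pos_le_divide_eq)
qed

text \<open>Cauchy-Schwarz twice bounds the trilinear expression by K |w| |d|, and Young's
  inequality with weight \<open>l\<close> splits the product. The weight is left free so that the
  Dirichlet eigenvalue can be inserted.\<close>

lemma trilinear_pointwise:
  fixes w1 w2 v1 v2 d11 d12 d21 d22 K l :: real
  assumes "v1\<^sup>2 + v2\<^sup>2 \<le> K\<^sup>2" "0 < l"
  shows "w1 * v1 * d11 + w2 * v1 * d12 + (w1 * v2 * d21 + w2 * v2 * d22)
    \<le> (l / 2) * (w1\<^sup>2 + w2\<^sup>2) + (K\<^sup>2 / (2 * l)) * (d11\<^sup>2 + d12\<^sup>2 + d21\<^sup>2 + d22\<^sup>2)"
proof -
  have CS: "(a * c + b * d)\<^sup>2 \<le> (a\<^sup>2 + b\<^sup>2) * (c\<^sup>2 + d\<^sup>2)" for a b c d :: real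
    using zero_le_power2[of "a * d - b * c"] by (simp add: power2_eq_square algebra_simps)
  let ?a = "w1\<^sup>2 + w2\<^sup>2" and ?d = "d11\<^sup>2 + d12\<^sup>2 + d21\<^sup>2 + d22\<^sup>2"
  let ?y1 = "w1 * d11 + w2 * d12" and ?y2 = "w1 * d21 + w2 * d22"
  let ?S = "w1 * v1 * d11 + w2 * v1 * d12 + (w1 * v2 * d21 + w2 * v2 * d22)"
  have nn: "0 \<le> ?a" "0 \<le> ?d" by auto
  have "?S\<^sup>2 = (v1 * ?y1 + v2 * ?y2)\<^sup>2" by (simp add: algebra_simps)
  also have "\<dots> \<le> (v1\<^sup>2 + v2\<^sup>2) * (?y1\<^sup>2 + ?y2\<^sup>2)" by (rule CS)
  also have "\<dots> \<le> K\<^sup>2 * (?a * ?d)"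
  proof (rule mult_mono)
    show "?y1\<^sup>2 + ?y2\<^sup>2 \<le> ?a * ?d"
      using CS[of w1 d11 w2 d12] CS[of w1 d21 w2 d22] by (simp add: algebra_simps)
  qed (use assms in auto)
  finally have 1: "?S\<^sup>2 \<le> K\<^sup>2 * (?a * ?d)" .
  let ?r = "(l / 2) * ?a + (K\<^sup>2 / (2 * l)) * ?d"
  \<comment> \<open>Young's inequality in squared form, (a + b)^2 = (a - b)^2 + 4ab, which keeps
    square roots out of the estimate.\<close>
  have "?r\<^sup>2 = ((l / 2) * ?a - (K\<^sup>2 / (2 * l)) * ?d)\<^sup>2 + 4 * ((l / 2) * ?a) * ((K\<^sup>2 / (2 * l)) * ?d)"
    by (simp add: power2_sum power2_diff)
  also have "4 * ((l / 2) * ?a) * ((K\<^sup>2 / (2 * l)) * ?d) = K\<^sup>2 * (?a * ?d)"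
    using assms(2) by simp
  finally have "K\<^sup>2 * (?a * ?d) \<le> ?r\<^sup>2" by simp
  with 1 have "?S\<^sup>2 \<le> ?r\<^sup>2" by linarith
  moreover have "0 \<le> ?r" using assms(2) nn by (intro add_nonneg_nonneg mult_nonneg_nonneg) auto
  ultimately show ?thesis by (rule power2_le_imp_le)
qed

text \<open>With the eigenvalue \<lambda> as Young weight, and the scalar Rayleigh bound applied to
  each component, the energy satisfies E \<le> E/2 + (K^2/\<lambda>) E/2. Since K^2 < \<lambda>,
  this forces E = 0.\<close>

lemma energy_zero_if_small:
  assumes u: "ns_data u du ddu p dp f b" and v: "ns_data v dv ddv q dq f b"
    and bdv: "\<And>i j. i \<in> {1,2} \<Longrightarrow> j \<in> {1,2} \<Longrightarrow> AE x in M. \<bar>dv j i x\<bar> \<le> B"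
    and K: "AE x in M. (v 1 x)\<^sup>2 + (v 2 x)\<^sup>2 \<le> K\<^sup>2" "0 \<le> K" "K < sqrt (dirichlet_eigenvalue U)"
  shows "energy (\<lambda>j i x. du j i x - dv j i x) = 0"
proof -
  define w where "w = (\<lambda>j x. u j x - v j x)"
  define dw where "dw = (\<lambda>j i x. du j i x - dv j i x)"
  let ?l = "dirichlet_eigenvalue U"
  have l: "0 < ?l" "K\<^sup>2 < ?l"
  proof -
    \<comment> \<open>0 \<le> K < sqrt \<lambda> also yields that \<lambda> is positive, so the
      later divisions by it are legitimate.\<close>
    show "0 < ?l" using K(2,3) real_sqrt_gt_0_iff[of ?l] by linarith
    then show "K\<^sup>2 < ?l" using power_strict_mono[OF K(3,2), of 2] by simp
  qed
  define B' where "B' = max B K"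
  have bv: "AE x in M. \<bar>v j x\<bar> \<le> B'" if "j \<in> {1,2}" for j :: nat
    using K(1)
  proof eventually_elim
    case (elim x)
    have "(v 1 x)\<^sup>2 \<le> K\<^sup>2" "(v 2 x)\<^sup>2 \<le> K\<^sup>2"
      using elim zero_le_power2[of "v 1 x"] zero_le_power2[of "v 2 x"] by linarith+
    then have "(v j x)\<^sup>2 \<le> K\<^sup>2" using that by auto
    then have "\<bar>v j x\<bar> \<le> K" using K(2) by (simp add: abs_le_square_iff[symmetric])
    then show ?case by (simp add: B'_def)
  qed
  have bdv': "AE x in M. \<bar>dv j i x\<bar> \<le> B'" if "i \<in> {1,2}" "j \<in> {1,2}" for i j :: nat
    using bdv[OF that] by eventually_elim (simp add: B'_def)
  have H: "H10_grad (w j) (dw j)" if "j \<in> {1,2}" for j :: nat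
    using ns_difference_H10[OF u v that] by (simp add: w_def dw_def)
  note h = H1_gradD[OF H10_gradD[OF H]]
  have sqd: "integrable M (\<lambda>x. (dw j i x)\<^sup>2)" if "j \<in> {1,2}" "i \<in> {1,2}" for i j :: nat
    using h(2)[OF that] by (simp add: sq_integrable_def)
  have sqw: "integrable M (\<lambda>x. (w j x)\<^sup>2)" if "j \<in> {1,2}" for j :: nat
    using h(1)[OF that] by (simp add: sq_integrable_def)
  note sq = sqd[of 1 1, simplified] sqd[of 1 2, simplified] sqd[of 2 1, simplified] sqd[of 2 2, simplified] sqw[of 1, simplified] sqw[of 2, simplified]
  let ?W = "(\<integral>x. (w 1 x)\<^sup>2 \<partial>M) + (\<integral>x. (w 2 x)\<^sup>2 \<partial>M)"
  have E: "energy dw = (\<integral>x. (dw 1 1 x)\<^sup>2 \<partial>M) + (\<integral>x. (dw 1 2 x)\<^sup>2 \<partial>M) + (\<integral>x. (dw 2 1 x)\<^sup>2 \<partial>M) + (\<integral>x. (dw 2 2 x)\<^sup>2 \<partial>M)"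
    unfolding energy_def using sq by simp
  have lW: "?l * ?W \<le> energy dw"
    unfolding E distrib_left
    using dirichlet_eigenvalue_le[OF H[of 1]] dirichlet_eigenvalue_le[OF H[of 2]] by simp
  have "energy dw = (\<integral>x. w 1 x * v 1 x * dw 1 1 x + w 2 x * v 1 x * dw 1 2 x + (w 1 x * v 2 x * dw 2 1 x + w 2 x * v 2 x * dw 2 2 x) \<partial>M)"
    using energy_identity(2)[OF u v bv bdv' w_def dw_def] .
  also have "\<dots> \<le> (\<integral>x. (?l / 2) * ((w 1 x)\<^sup>2 + (w 2 x)\<^sup>2) + (K\<^sup>2 / (2 * ?l)) * ((dw 1 1 x)\<^sup>2 + (dw 1 2 x)\<^sup>2 + (dw 2 1 x)\<^sup>2 + (dw 2 2 x)\<^sup>2) \<partial>M)"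
  proof (rule integral_mono_AE)
    have sC: "sq_integrable M (\<lambda>x. w i x * v j x)" if "j \<in> {1,2}" "i \<in> {1,2}" for i j :: nat
      using sq_integrable_bounded_mult[OF h(1)[OF that(2)] sq_integrable_measurable[OF H1_gradD(1)[OF ns_dataD(1)[OF v that(1)]]] bv[OF that(1)]]
      by (simp add: mult.commute)
    show "integrable M (\<lambda>x. w 1 x * v 1 x * dw 1 1 x + w 2 x * v 1 x * dw 1 2 x + (w 1 x * v 2 x * dw 2 1 x + w 2 x * v 2 x * dw 2 2 x))"
      by (intro Bochner_Integration.integrable_add sq_integrable_mult sC h(2)) auto
    show "integrable M (\<lambda>x. (?l / 2) * ((w 1 x)\<^sup>2 + (w 2 x)\<^sup>2) + (K\<^sup>2 / (2 * ?l)) * ((dw 1 1 x)\<^sup>2 + (dw 1 2 x)\<^sup>2 + (dw 2 1 x)\<^sup>2 + (dw 2 2 x)\<^sup>2))"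
      by (intro Bochner_Integration.integrable_add integrable_mult_right sq)
    show "AE x in M. w 1 x * v 1 x * dw 1 1 x + w 2 x * v 1 x * dw 1 2 x + (w 1 x * v 2 x * dw 2 1 x + w 2 x * v 2 x * dw 2 2 x)
      \<le> (?l / 2) * ((w 1 x)\<^sup>2 + (w 2 x)\<^sup>2) + (K\<^sup>2 / (2 * ?l)) * ((dw 1 1 x)\<^sup>2 + (dw 1 2 x)\<^sup>2 + (dw 2 1 x)\<^sup>2 + (dw 2 2 x)\<^sup>2)"
      using K(1) by eventually_elim (rule trilinear_pointwise[OF _ l(1)])
  qed
  also have "\<dots> = (?l / 2) * ?W + (K\<^sup>2 / (2 * ?l)) * energy dw"
    unfolding E using sq by (simp add: distrib_left)
  finally have *: "energy dw \<le> (?l / 2) * ?W + (K\<^sup>2 / (2 * ?l)) * energy dw" .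
  have "(K\<^sup>2 / (2 * ?l)) = (K\<^sup>2 / ?l) / 2" by simp
  then have "energy dw \<le> energy dw / 2 + (K\<^sup>2 / ?l) * energy dw / 2"
    using * lW by simp
  then have "(1 - K\<^sup>2 / ?l) * energy dw \<le> 0" by (simp add: algebra_simps)
  moreover have "0 < 1 - K\<^sup>2 / ?l" using l by simp
  ultimately have "energy dw \<le> 0" by (simp add: mult_le_0_iff)
  moreover have "0 \<le> energy dw" unfolding energy_def by (intro integral_nonneg_AE) auto
  ultimately show ?thesis by (simp add: dw_def)
qed

text \<open>Besides \<alpha> = x . u the swirl \<beta> = x_1 u_2 - x_2 u_1 is needed. Both are
  rotation-invariant scalars, so their angular derivatives vanish, and x . grad \<alpha> plus the
  angular derivative of \<beta> equals |x|^2 div u. Thus grad \<alpha> = 0 away from the origin.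
  Because \<open>b\<close> is tangential, \<alpha> has zero boundary values.\<close>

lemma radial_component_zero:
  assumes rotU: "\<And>t x. rot t x \<in> U \<longleftrightarrow> x \<in> U" and U0: "\<And>x. x \<in> U \<Longrightarrow> x \<noteq> 0"
    and inv: "\<And>t x. x \<in> U \<Longrightarrow> 0 \<le> t \<Longrightarrow> t \<le> 2 * pi \<Longrightarrow> (u 1 x, u 2 x) = rotT t (u 1 (rot t x), u 2 (rot t x))"
    and u: "ns_data u du ddu p dp f b" and b: "\<And>x. fst x * b 1 x + snd x * b 2 x = 0"
  shows "AE x in M. fst x * u 1 x + snd x * u 2 x = 0"
proof -
  let ?\<alpha> = "\<lambda>x. fst x * u 1 x + snd x * u 2 x" and ?\<beta> = "\<lambda>x. fst x * u 2 x - snd x * u 1 x"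
  let ?d\<alpha> = "\<lambda>i x. (fst x * du 1 i x + pderiv i fst x * u 1 x) + (snd x * du 2 i x + pderiv i snd x * u 2 x)"
  let ?d\<beta> = "\<lambda>i x. (fst x * du 2 i x + pderiv i fst x * u 2 x) - (snd x * du 1 i x + pderiv i snd x * u 1 x)"
  have h: "H1_grad (u 1) (du 1)" "H1_grad (u 2) (du 2)" using ns_dataD(1)[OF u] by auto
  have \<alpha>: "H1_grad ?\<alpha> ?d\<alpha>" and \<beta>: "H1_grad ?\<beta> ?d\<beta>"
    by (intro H1_grad_add H1_grad_diff H1_grad_smooth_mult h smooth_fun_intros)+
  have I: "?\<alpha> (rot t x) = ?\<alpha> x \<and> ?\<beta> (rot t x) = ?\<beta> x" if "x \<in> U" "0 \<le> t" "t \<le> 2 * pi" for t x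
  proof -
    obtain p q where pq: "u 1 (rot t x) = p" "u 2 (rot t x) = q" by blast
    have u12: "u 1 x = cos t * p + sin t * q" "u 2 x = - sin t * p + cos t * q"
      using inv[OF that] pq by (simp_all add: rotT_def)
    show ?thesis unfolding pq u12 by (simp add: rot_def algebra_simps)
  qed
  have ang: "AE x in M. fst x * d 2 x - snd x * d 1 x = 0"
    if \<gamma>: "H1_grad \<gamma> d" and inv: "\<And>t x. x \<in> U \<Longrightarrow> 0 \<le> t \<Longrightarrow> t \<le> 2 * pi \<Longrightarrow> \<gamma> (rot t x) = \<gamma> x" for \<gamma> d
  proof (rule fundamental_lemma[OF open_U])
    note g = H1_gradD[OF \<gamma>]
    have id: "integrable M (d 1)" "integrable M (d 2)" "integrable M \<gamma>" using g sq_integrable_integrable by auto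
    show "integrable M (\<lambda>x. fst x * d 2 x - snd x * d 1 x)"
      by (intro Bochner_Integration.integrable_diff integrable_smooth_mult smooth_fun_intros id)
    fix \<phi> assume \<phi>: "test_fun U \<phi>"
    note s = test_funD(1)[OF \<phi>]
    \<comment> \<open>Testing the two weak derivatives with x_1 \<phi> and x_2 \<phi> assembles the
      angular derivative; the weights contribute nothing, since each is differentiated in the other
      direction.\<close>
    have 1: "(\<integral>x. \<gamma> x * pderiv 2 (\<lambda>x. fst x * \<phi> x) x \<partial>M) = - (\<integral>x. d 2 x * (fst x * \<phi> x) \<partial>M)"
      and i1: "integrable M (\<lambda>x. \<gamma> x * pderiv 2 (\<lambda>x. fst x * \<phi> x) x)"
      using g(3)[of 2] test_fun_mult[OF \<phi> smooth_fun_intros(2)] by (auto simp: weak_iff)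
    have 2: "(\<integral>x. \<gamma> x * pderiv 1 (\<lambda>x. snd x * \<phi> x) x \<partial>M) = - (\<integral>x. d 1 x * (snd x * \<phi> x) \<partial>M)"
      and i2: "integrable M (\<lambda>x. \<gamma> x * pderiv 1 (\<lambda>x. snd x * \<phi> x) x)"
      using g(3)[of 1] test_fun_mult[OF \<phi> smooth_fun_intros(3)] by (auto simp: weak_iff)
    have "(\<integral>x. (fst x * d 2 x - snd x * d 1 x) * \<phi> x \<partial>M) = (\<integral>x. d 2 x * (fst x * \<phi> x) - d 1 x * (snd x * \<phi> x) \<partial>M)"
      by (rule Bochner_Integration.integral_cong) (auto simp: algebra_simps)
    also have "\<dots> = (\<integral>x. d 2 x * (fst x * \<phi> x) \<partial>M) - (\<integral>x. d 1 x * (snd x * \<phi> x) \<partial>M)"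
      by (intro Bochner_Integration.integral_diff integrable_smooth_mult smooth_fun_intros s id)
    also have "\<dots> = (\<integral>x. \<gamma> x * pderiv 1 (\<lambda>x. snd x * \<phi> x) x \<partial>M) - (\<integral>x. \<gamma> x * pderiv 2 (\<lambda>x. fst x * \<phi> x) x \<partial>M)"
      using 1 2 by simp
    also have "\<dots> = (\<integral>x. \<gamma> x * pderiv 1 (\<lambda>x. snd x * \<phi> x) x - \<gamma> x * pderiv 2 (\<lambda>x. fst x * \<phi> x) x \<partial>M)"
      using i1 i2 by simp
    also have "\<dots> = (\<integral>x. - (\<gamma> x * (fst x * pderiv 2 \<phi> x - snd x * pderiv 1 \<phi> x)) \<partial>M)"
      by (rule Bochner_Integration.integral_cong)
        (auto simp: pderiv_mult[OF smooth_fun_intros(2) s] pderiv_mult[OF smooth_fun_intros(3) s] pderiv_coord ebasis_def algebra_simps)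
    also have "\<dots> = 0"
      using angular_derivative_zero[OF rotU id(3) inv \<phi>] by simp
    finally show "(\<integral>x. (fst x * d 2 x - snd x * d 1 x) * \<phi> x \<partial>M) = 0" .
  qed
  have A: "AE x in M. fst x * ?d\<alpha> 2 x - snd x * ?d\<alpha> 1 x = 0" using ang[OF \<alpha>] I by blast
  have B: "AE x in M. fst x * ?d\<beta> 2 x - snd x * ?d\<beta> 1 x = 0" using ang[OF \<beta>] I by blast
  have z: "AE x in M. ?d\<alpha> 1 x = 0"
    using A B ns_dataD(5)[OF u] AE_space
  proof eventually_elim
    case (elim x)
    let ?x = "fst x" and ?y = "snd x"
    have xy: "?x\<^sup>2 + ?y\<^sup>2 \<noteq> 0"
      using U0[of x] elim(4) by (auto simp: sum_power2_eq_zero_iff prod_eq_iff)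
    \<comment> \<open>The undifferentiated terms of \<alpha> and \<beta> cancel as well as the mixed
      derivatives, leaving the divergence.\<close>
    have "?x * ?d\<alpha> 1 x + ?y * ?d\<alpha> 2 x + (?x * ?d\<beta> 2 x - ?y * ?d\<beta> 1 x) = (?x\<^sup>2 + ?y\<^sup>2) * (du 1 1 x + du 2 2 x)"
      by (simp add: pderiv_coord ebasis_def algebra_simps power2_eq_square)
    then have r: "?x * ?d\<alpha> 1 x + ?y * ?d\<alpha> 2 x = 0" using elim by simp
    have "(?x\<^sup>2 + ?y\<^sup>2) * ?d\<alpha> 1 x = ?x * (?x * ?d\<alpha> 1 x + ?y * ?d\<alpha> 2 x) - ?y * (?x * ?d\<alpha> 2 x - ?y * ?d\<alpha> 1 x)"
      by (simp add: algebra_simps power2_eq_square)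
    also have "\<dots> = 0" unfolding r elim(1) by simp
    finally show ?case using xy by (metis mult_eq_0_iff)
  qed
  have "\<exists>G. H10_grad (\<lambda>x. u j x - b j x) G" if j: "j \<in> {1,2}" for j :: nat
    by (rule H1_0_ex_grad[OF ns_dataD(6)[OF u j]])
  then obtain G1 G2 where G: "H10_grad (\<lambda>x. u 1 x - b 1 x) G1" "H10_grad (\<lambda>x. u 2 x - b 2 x) G2"
    by force
  have "H10_grad (\<lambda>x. fst x * (u 1 x - b 1 x) + snd x * (u 2 x - b 2 x))
     (\<lambda>i x. (fst x * G1 i x + pderiv i fst x * (u 1 x - b 1 x)) + (snd x * G2 i x + pderiv i snd x * (u 2 x - b 2 x)))"
    (is "H10_grad ?a ?G")
    by (intro H10_add H10_smooth_mult smooth_fun_intros G)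
  \<comment> \<open>Subtracting a tangential field does not change the radial component, so the zero
    boundary values of u - b pass to \<alpha>.\<close>
  moreover have "?a = ?\<alpha>"
  proof
    fix x show "?a x = ?\<alpha> x" using b[of x] by (simp add: algebra_simps)
  qed
  ultimately have G: "H10_grad ?\<alpha> ?G" by simp
  have "AE x in M. ?G 1 x = 0"
    using H1_grad_unique[OF H10_gradD[OF G] \<alpha>, of 1] z by (auto elim!: eventually_elim2)
  from H10_zero_gradient[OF G this] show ?thesis .
qed

end

section \<open>Radial functions on the annulus\<close>

text \<open>Regularity of Lebesgue measure gives a closed set inside \<open>A\<close> and an open
  set around it with small differences; an Urysohn function between them differs from the indicator
  only there.\<close>

lemma indicator_approx_continuous:
  fixes A :: "real set"
  assumes A: "A \<in> sets borel" "emeasure lborel A < \<infinity>" and e: "(0::real) < e"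
  shows "\<exists>u. continuous_on UNIV u \<and> integrable lborel u \<and> (\<integral>x. \<bar>indicator A x - u x\<bar> \<partial>lborel) < e"
proof -
  have A': "A \<in> sets lebesgue" using A by auto
  obtain V where V: "open V" "A \<subseteq> V" "V - A \<in> lmeasurable" "emeasure lebesgue (V - A) < ennreal (e / 2)"
    using sets_lebesgue_outer_open[OF A', of "e / 2"] e by auto
  obtain K where K: "closed K" "K \<subseteq> A" "A - K \<in> lmeasurable" "emeasure lebesgue (A - K) < ennreal (e / 2)"
    using sets_lebesgue_inner_closed[OF A', of "e / 2"] e by auto
  have disj: "K \<inter> - V = {}" using K V by blast
  obtain u :: "real \<Rightarrow> real" where u: "continuous_on UNIV u" "\<And>x. u x \<in> closed_segment 1 0" "\<And>x. x \<in> K \<Longrightarrow> u x = 1" "\<And>x. x \<in> - V \<Longrightarrow> u x = 0"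
    using Urysohn[OF K(1) closed_Compl[OF V(1)] disj, of "1::real" 0] by metis
  have u01: "0 \<le> u x" "u x \<le> 1" for x using u(2)[of x] by (auto simp: closed_segment_eq_real_ivl)
  have [measurable]: "u \<in> borel_measurable borel" "A \<in> sets borel" "V \<in> sets borel" "K \<in> sets borel"
    using u(1) A V K by (auto intro: borel_measurable_continuous_onI)
  have VA: "emeasure lborel (V - A) < ennreal (e / 2)" and AK: "emeasure lborel (A - K) < ennreal (e / 2)"
    using V(4) K(4) by (auto simp: emeasure_completion)
  have "emeasure lborel V \<le> emeasure lborel A + emeasure lborel (V - A)"
    using V(2) by (subst plus_emeasure) (auto simp: Un_absorb1)
  also have "\<dots> < \<infinity>" using A VA by (auto simp: ennreal_add_less_top intro: less_trans)
  finally have Vfin: "emeasure lborel V < \<infinity>" .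
  have iu: "integrable lborel u"
  proof (rule Bochner_Integration.integrable_bound)
    show "integrable lborel (indicator V :: real \<Rightarrow> real)" using Vfin by (simp add: integrable_indicator_iff)
    show "AE x in lborel. norm (u x) \<le> norm (indicator V x :: real)"
      using u01 u(4) by (intro AE_I2) (auto simp: indicator_def)
  qed simp
  have iA: "integrable lborel (indicator A :: real \<Rightarrow> real)" using A by simp
  have "ennreal (\<integral>x. \<bar>indicator A x - u x\<bar> \<partial>lborel) = (\<integral>\<^sup>+x. ennreal \<bar>indicator A x - u x\<bar> \<partial>lborel)"
    using iA iu by (intro nn_integral_eq_integral[symmetric]) auto
  also have "\<dots> \<le> (\<integral>\<^sup>+x. indicator (V - A) x + indicator (A - K) x \<partial>lborel)"
  proof (rule nn_integral_mono)
    fix x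
    have "\<bar>indicator A x - u x\<bar> \<le> indicator (V - A) x + (indicator (A - K) x :: real)"
      using u01[of x] u(3)[of x] u(4)[of x] V(2) K(2) by (auto simp: indicator_def)
    then have "ennreal \<bar>indicator A x - u x\<bar> \<le> ennreal (indicator (V - A) x + indicator (A - K) x)"
      by (rule ennreal_leI)
    then show "ennreal \<bar>indicator A x - u x\<bar> \<le> indicator (V - A) x + indicator (A - K) x"
      by (simp add: ennreal_indicator)
  qed
  also have "\<dots> = emeasure lborel (V - A) + emeasure lborel (A - K)"
    by (subst nn_integral_add) auto
  also have "\<dots> < ennreal (e / 2) + ennreal (e / 2)" using VA AK by (rule add_strict_mono)
  also have "\<dots> = ennreal e" using e by (simp add: ennreal_plus[symmetric] del: ennreal_plus)
  finally have "(\<integral>x. \<bar>indicator A x - u x\<bar> \<partial>lborel) < e"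
    using e by (simp add: ennreal_less_iff)
  then show ?thesis using u(1) iu by blast
qed

lemma L1_approx_continuous:
  fixes f :: "real \<Rightarrow> real"
  assumes "integrable lborel f" "(0::real) < e"
  shows "\<exists>g. continuous_on UNIV g \<and> integrable lborel g \<and> (\<integral>x. \<bar>f x - g x\<bar> \<partial>lborel) < e"
  using assms
proof (induction arbitrary: e rule: integrable_induct)
  case (base A c)
  show ?case
  proof (cases "c = 0")
    case True
    then show ?thesis using base by (intro exI[of _ "\<lambda>_. 0"]) auto
  next
    case False
    then obtain u where u: "continuous_on UNIV u" "integrable lborel u" "(\<integral>x. \<bar>indicator A x - u x\<bar> \<partial>lborel) < e / \<bar>c\<bar>"
      using indicator_approx_continuous[of A "e / \<bar>c\<bar>"] base by auto
    have "(\<lambda>x. \<bar>indicator A x *\<^sub>R c - c * u x\<bar>) = (\<lambda>x. \<bar>c\<bar> * \<bar>indicator A x - u x\<bar>)"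
      by (auto simp: abs_mult[symmetric] algebra_simps)
    then have "(\<integral>x. \<bar>indicator A x *\<^sub>R c - c * u x\<bar> \<partial>lborel) = \<bar>c\<bar> * (\<integral>x. \<bar>indicator A x - u x\<bar> \<partial>lborel)" by simp
    also have "\<dots> < e" using u(3) False by (simp add: pos_less_divide_eq mult.commute)
    finally show ?thesis using u by (intro exI[of _ "\<lambda>x. c * u x"]) (auto intro: continuous_intros)
  qed
next
  case (add f g)
  obtain u v where u: "continuous_on UNIV u" "integrable lborel u" "(\<integral>x. \<bar>f x - u x\<bar> \<partial>lborel) < e / 2"
    and v: "continuous_on UNIV v" "integrable lborel v" "(\<integral>x. \<bar>g x - v x\<bar> \<partial>lborel) < e / 2"
    using add.IH(1)[of "e / 2"] add.IH(2)[of "e / 2"] add.prems by auto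
  have "(\<integral>x. \<bar>f x + g x - (u x + v x)\<bar> \<partial>lborel) \<le> (\<integral>x. \<bar>f x - u x\<bar> + \<bar>g x - v x\<bar> \<partial>lborel)"
    using add.hyps u v by (intro integral_mono) auto
  also have "\<dots> < e" using add.hyps u v by simp
  finally show ?case using u v by (intro exI[of _ "\<lambda>x. u x + v x"]) (auto intro: continuous_intros)
next
  case (lim f s)
  have "(\<lambda>i. \<integral>x. \<bar>f x - s i x\<bar> \<partial>lborel) \<longlonglongrightarrow> (\<integral>x. 0 \<partial>(lborel::real measure))"
  \<comment> \<open>The approximating simple functions satisfy |s i x| \<le> 2 |f x|, whence the
    factor 3.\<close>
  proof (rule integral_dominated_convergence[where w = "\<lambda>x. 3 * \<bar>f x\<bar>"])
    show "AE x in lborel. (\<lambda>i. \<bar>f x - s i x\<bar>) \<longlonglongrightarrow> 0"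
    proof (intro AE_I2)
      fix x :: real
      have "(\<lambda>i. \<bar>f x - s i x\<bar>) \<longlonglongrightarrow> \<bar>f x - f x\<bar>" using lim.hyps(2) by (intro tendsto_intros) auto
      then show "(\<lambda>i. \<bar>f x - s i x\<bar>) \<longlonglongrightarrow> 0" by simp
    qed
    show "AE x in lborel. norm \<bar>f x - s i x\<bar> \<le> 3 * \<bar>f x\<bar>" for i
      using lim.hyps(3)[of _ i] by (intro AE_I2) (smt (verit) UNIV_I real_norm_def space_lborel)
  qed (use lim.hyps in auto)
  then have "\<forall>\<^sub>F i in sequentially. (\<integral>x. \<bar>f x - s i x\<bar> \<partial>lborel) < e / 2"
    using order_tendstoD(2)[of _ "0::real" sequentially "e / 2"] lim.prems by simp
  then obtain i where i: "(\<integral>x. \<bar>f x - s i x\<bar> \<partial>lborel) < e / 2"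
    by (auto simp: eventually_sequentially)
  have "0 < e / 2" using lim.prems by simp
  then obtain g where g: "continuous_on UNIV g" "integrable lborel g" "(\<integral>x. \<bar>s i x - g x\<bar> \<partial>lborel) < e / 2"
    using lim.IH by blast
  have "(\<integral>x. \<bar>f x - g x\<bar> \<partial>lborel) \<le> (\<integral>x. \<bar>f x - s i x\<bar> + \<bar>s i x - g x\<bar> \<partial>lborel)"
    using lim.hyps g by (intro integral_mono) auto
  also have "\<dots> < e" using i g lim.hyps by simp
  finally show ?case using g by blast
qed

text \<open>Test functions and their derivatives are bounded on \<open>U\<close>, so L1 convergence
  of functions and derivatives suffices to pass to the limit in the defining identity.\<close>

lemma (in bounded_open) weak_L1_limit:
  assumes w: "\<And>n. is_weak_pderiv U i (f n) (g n)" and i: "\<And>n. integrable M (f n)" "integrable M f'" "integrable M g'"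
    and f: "(\<lambda>n. \<integral>x. \<bar>f n x - f' x\<bar> \<partial>M) \<longlonglongrightarrow> 0" and g: "(\<lambda>n. \<integral>x. \<bar>g n x - g' x\<bar> \<partial>M) \<longlonglongrightarrow> 0"
  shows "is_weak_pderiv U i f' g'"
  unfolding weak_iff
proof (intro conjI allI impI)
  show "integrable M g'" by fact
  fix \<phi> assume \<phi>: "test_fun U \<phi>"
  note s = test_funD(1)[OF \<phi>]
  show "integrable M (\<lambda>x. f' x * pderiv i \<phi> x)"
    by (intro integrable_smooth_mult smooth_fun_pderiv s i)
  have ig: "integrable M (g n)" for n using w by (simp add: weak_iff)
  have lim: "(\<lambda>n. \<integral>x. F n x * P x \<partial>M) \<longlonglongrightarrow> (\<integral>x. F' x * P x \<partial>M)"
    if P: "smooth_fun P" and F: "\<And>n. integrable M (F n)" "integrable M F'" "(\<lambda>n. \<integral>x. \<bar>F n x - F' x\<bar> \<partial>M) \<longlonglongrightarrow> 0" for F F' P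
  proof -
    obtain B where B: "\<And>x. x \<in> U \<Longrightarrow> \<bar>P x\<bar> \<le> B" using smooth_bounded[OF P] by blast
    show ?thesis
    proof (rule LIM_zero_cancel, rule Lim_null_comparison)
    have "(\<lambda>n. \<bar>B\<bar> * (\<integral>x. \<bar>F n x - F' x\<bar> \<partial>M)) \<longlonglongrightarrow> \<bar>B\<bar> * 0" by (intro tendsto_intros F)
    then show "(\<lambda>n. \<bar>B\<bar> * (\<integral>x. \<bar>F n x - F' x\<bar> \<partial>M)) \<longlonglongrightarrow> 0" by simp
    have "norm ((\<integral>x. F n x * P x \<partial>M) - (\<integral>x. F' x * P x \<partial>M)) \<le> \<bar>B\<bar> * (\<integral>x. \<bar>F n x - F' x\<bar> \<partial>M)" for n
    proof -
      have "(\<integral>x. F n x * P x \<partial>M) - (\<integral>x. F' x * P x \<partial>M) = (\<integral>x. (F n x - F' x) * P x \<partial>M)"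
        using integrable_smooth_mult(1)[OF P F(1)] integrable_smooth_mult(1)[OF P F(2)] by (simp add: left_diff_distrib)
      also have "norm \<dots> \<le> (\<integral>x. norm ((F n x - F' x) * P x) \<partial>M)" by (rule integral_norm_bound)
      also have "\<dots> \<le> (\<integral>x. \<bar>B\<bar> * \<bar>F n x - F' x\<bar> \<partial>M)"
      proof (rule integral_mono)
        show "integrable M (\<lambda>x. norm ((F n x - F' x) * P x))"
          by (intro integrable_norm integrable_smooth_mult P Bochner_Integration.integrable_diff F)
        show "integrable M (\<lambda>x. \<bar>B\<bar> * \<bar>F n x - F' x\<bar>)" using F by auto
        fix x assume "x \<in> space M"
        then have "\<bar>P x\<bar> \<le> \<bar>B\<bar>" using B[of x] by auto
        then show "norm ((F n x - F' x) * P x) \<le> \<bar>B\<bar> * \<bar>F n x - F' x\<bar>"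
          by (simp add: abs_mult mult.commute mult_right_mono)
      qed
      finally show ?thesis by simp
    qed
    then show "\<forall>\<^sub>F n in sequentially. norm ((\<integral>x. F n x * P x \<partial>M) - (\<integral>x. F' x * P x \<partial>M)) \<le> \<bar>B\<bar> * (\<integral>x. \<bar>F n x - F' x\<bar> \<partial>M)"
      by simp
    qed
  qed
  have "(\<lambda>n. \<integral>x. f n x * pderiv i \<phi> x \<partial>M) \<longlonglongrightarrow> (\<integral>x. f' x * pderiv i \<phi> x \<partial>M)"
    by (rule lim[OF smooth_fun_pderiv[OF s] i(1,2) f])
  moreover have "(\<lambda>n. - (\<integral>x. g n x * \<phi> x \<partial>M)) \<longlonglongrightarrow> - (\<integral>x. g' x * \<phi> x \<partial>M)"
    by (intro tendsto_minus lim[OF s ig i(3) g])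
  moreover have "(\<integral>x. f n x * pderiv i \<phi> x \<partial>M) = - (\<integral>x. g n x * \<phi> x \<partial>M)" for n
    using w \<phi> by (simp add: weak_iff)
  ultimately show "(\<integral>x. f' x * pderiv i \<phi> x \<partial>M) = - (\<integral>x. g' x * \<phi> x \<partial>M)"
    using LIMSEQ_unique by force
qed

section \<open>Polar coordinates for radial integrands\<close>

lemma open_annulus: "open (annulus R)"
  unfolding annulus_def by (intro open_Collect_conj open_Collect_less continuous_intros)

lemma annulus_area:
  assumes "0 \<le> a" "a < b"
  shows "emeasure lborel {x::real \<times> real. a < norm x \<and> norm x < b} = ennreal (pi * b\<^sup>2 - pi * a\<^sup>2)"
proof -
  have "{x::real \<times> real. a < norm x \<and> norm x < b} = ball 0 b - cball 0 a" by auto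
  moreover have "emeasure lborel (ball (0::real \<times> real) b - cball 0 a) = emeasure lborel (ball (0::real \<times> real) b) - emeasure lborel (cball (0::real \<times> real) a)"
    using assms by (intro emeasure_Diff) (auto simp: emeasure_cball)
  ultimately show ?thesis
    using assms by (simp add: emeasure_ball emeasure_cball unit_ball_vol_2 ennreal_minus power2_eq_square)
qed

text \<open>The image measure of the annulus under the norm is compared with its density on
  intervals, where both sides are areas of rings; the null end points allow the fundamental theorem
  on a closed interval.\<close>

lemma annulus_norm_distr:
  assumes R: "1 < R"
  shows "distr (restrict_space lborel (annulus R)) borel norm = density lborel (\<lambda>t. ennreal (2 * pi * t) * indicator {1<..<R} t)" (is "?\<nu> = ?\<mu>")
proof (rule measure_eqI_generator_eq[where \<Omega> = UNIV and E = "range (\<lambda>(a, b). box a b)"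
      and A = "\<lambda>n::nat. box (- (real n *\<^sub>R One)) (real n *\<^sub>R One)"])
  have ann: "annulus R \<inter> space lborel \<in> sets lborel" using open_annulus by simp
  have m: "(norm :: real \<times> real \<Rightarrow> real) \<in> restrict_space lborel (annulus R) \<rightarrow>\<^sub>M borel"
    by (intro measurable_restrict_space1) simp
  have e: "emeasure ?\<nu> {a<..<b} = emeasure lborel {x :: real \<times> real. max a 1 < norm x \<and> norm x < min b R}" for a b :: real
  proof -
    have "emeasure ?\<nu> {a<..<b} = emeasure (restrict_space lborel (annulus R)) (norm -` {a<..<b} \<inter> annulus R)"
      using m by (subst emeasure_distr) (auto simp: space_restrict_space)
    also have "\<dots> = emeasure lborel (norm -` {a<..<b} \<inter> annulus R)"
      using ann by (subst emeasure_restrict_space) auto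
    also have "norm -` {a<..<b} \<inter> annulus R = {x. max a 1 < norm x \<and> norm x < min b R}"
      by (auto simp: annulus_def)
    finally show ?thesis .
  qed
  have d: "emeasure ?\<mu> {a<..<b} = (\<integral>\<^sup>+t. ennreal (2 * pi * t) * indicator {max a 1<..<min b R} t \<partial>lborel)" for a b :: real
    by (subst emeasure_density) (auto intro!: nn_integral_cong simp: indicator_def)
  have eq: "emeasure ?\<nu> {a<..<b} = emeasure ?\<mu> {a<..<b}" for a b
  proof (cases "max a 1 < min b R")
    case False
    then have z: "{x :: real \<times> real. max a 1 < norm x \<and> norm x < min b R} = {}" "{max a 1<..<min b R} = {}" by auto
    show ?thesis unfolding e d z by simp
  next
    case True
    let ?a = "max a 1" and ?b = "min b R"
    have "(\<integral>\<^sup>+t. ennreal (2 * pi * t) * indicator {?a<..<?b} t \<partial>lborel) = (\<integral>\<^sup>+t. ennreal (2 * pi * t) * indicator {?a..?b} t \<partial>lborel)"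
    proof (rule nn_integral_cong_AE)
      have "AE t in lborel. t \<noteq> ?a \<and> t \<noteq> ?b" using AE_lborel_singleton by (intro AE_conjI)
      then show "AE t in lborel. ennreal (2 * pi * t) * indicator {?a<..<?b} t = ennreal (2 * pi * t) * indicator {?a..?b} t"
        by eventually_elim (auto simp: indicator_def)
    qed
    also have "\<dots> = ennreal (pi * ?b\<^sup>2 - pi * ?a\<^sup>2)"
      using True by (intro nn_integral_FTC_Icc) (auto intro!: derivative_eq_intros)
    also have "\<dots> = emeasure lborel {x :: real \<times> real. ?a < norm x \<and> norm x < ?b}"
      using True by (intro annulus_area[symmetric]) auto
    finally show ?thesis unfolding e d by simp
  qed
  show "Int_stable (range (\<lambda>(a, b). box a b::real set))"
    by (auto simp: Int_stable_def box_Int_box)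
  show "emeasure ?\<nu> X = emeasure ?\<mu> X" if "X \<in> range (\<lambda>(a, b). box a b)" for X
    using that eq by (auto simp: box_real)
  show "emeasure ?\<nu> (box (- (real n *\<^sub>R One)) (real n *\<^sub>R One)) \<noteq> \<infinity>" for n
  proof -
    have "emeasure ?\<nu> {- real n<..<real n} \<le> emeasure lborel (ball (0::real \<times> real) R)"
      unfolding e by (intro emeasure_mono) auto
    also have "\<dots> < \<infinity>" by (intro emeasure_bounded_finite) simp
    finally show ?thesis by (simp add: box_real)
  qed
  show "(\<Union>n::nat. box (- (real n *\<^sub>R One)) (real n *\<^sub>R One)) = (UNIV :: real set)"
    by (rule UN_box_eq_UNIV)
qed (auto simp: borel_eq_box)

text \<open>The density 2 pi t is replaced by its largest value; such an upper bound gives both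
  integrability and L1 convergence of radial functions.\<close>

lemma annulus_nn_integral:
  fixes \<eta> :: "real \<Rightarrow> real"
  assumes R: "1 < R" and \<eta>: "\<eta> \<in> borel_measurable borel" "\<And>t. 0 \<le> \<eta> t"
  shows "(\<integral>\<^sup>+x. ennreal (\<eta> (norm x)) \<partial>lebesgue_on (annulus R)) \<le> ennreal (2 * pi * R) * (\<integral>\<^sup>+t. ennreal (\<eta> t) * indicator {1..R} t \<partial>lborel)"
proof -
  note [measurable] = \<eta>(1)
  have U: "annulus R \<in> sets borel" using open_annulus by auto
  have "(\<integral>\<^sup>+x. ennreal (\<eta> (norm x)) \<partial>lebesgue_on (annulus R)) = (\<integral>\<^sup>+x. ennreal (\<eta> (norm x)) * indicator (annulus R) x \<partial>lebesgue)"
    using U by (simp add: nn_integral_restrict_space)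
  also have "\<dots> = (\<integral>\<^sup>+x. ennreal (\<eta> (norm x)) * indicator (annulus R) x \<partial>lborel)"
    using U by (intro nn_integral_completion) measurable
  also have "\<dots> = (\<integral>\<^sup>+x. ennreal (\<eta> (norm x)) \<partial>restrict_space lborel (annulus R))"
    using U by (simp add: nn_integral_restrict_space)
  also have "\<dots> = (\<integral>\<^sup>+t. ennreal (\<eta> t) \<partial>distr (restrict_space lborel (annulus R)) borel norm)"
    by (subst nn_integral_distr) (auto intro: measurable_restrict_space1)
  also have "\<dots> = (\<integral>\<^sup>+t. (ennreal (2 * pi * t) * indicator {1<..<R} t) * ennreal (\<eta> t) \<partial>lborel)"
    unfolding annulus_norm_distr[OF R] by (subst nn_integral_density) auto
  also have "\<dots> \<le> (\<integral>\<^sup>+t. ennreal (2 * pi * R) * (ennreal (\<eta> t) * indicator {1..R} t) \<partial>lborel)"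
    using R by (intro nn_integral_mono) (auto simp: indicator_def intro!: mult_right_mono ennreal_leI)
  also have "\<dots> = ennreal (2 * pi * R) * (\<integral>\<^sup>+t. ennreal (\<eta> t) * indicator {1..R} t \<partial>lborel)"
    by (rule nn_integral_cmult) measurable
  finally show ?thesis .
qed

section \<open>Radial functions with absolutely continuous profiles\<close>

locale annulus_domain =
  fixes R :: real
  assumes R: "1 < R"
begin

sublocale bounded_open "annulus R"
proof
  show "open (annulus R)" by (rule open_annulus)
  show "bounded (annulus R)"
    by (rule bounded_subset[OF bounded_ball[of 0 R]]) (auto simp: annulus_def)
qed

lemma annulus_norm: "x \<in> annulus R \<Longrightarrow> norm x \<in> {1..R}" "x \<in> annulus R \<Longrightarrow> norm x \<in> {1<..<R}"
  by (auto simp: annulus_def)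

lemma radial_measurable:
  fixes \<phi> :: "real \<Rightarrow> real"
  assumes "set_borel_measurable lborel {1..R} \<phi>"
  shows "(\<lambda>x. \<phi> (norm x)) \<in> borel_measurable M"
proof -
  let ?\<phi> = "\<lambda>t. indicator {1..R} t *\<^sub>R \<phi> t"
  have [measurable]: "?\<phi> \<in> borel_measurable borel" using assms by (simp add: set_borel_measurable_def)
  have "(\<lambda>x::real \<times> real. ?\<phi> (norm x)) \<in> borel_measurable borel" by measurable
  then have "(\<lambda>x. ?\<phi> (norm x)) \<in> borel_measurable M"
    by (intro measurable_restrict_space1 measurable_completion) simp
  then show ?thesis
    by (rule measurable_cong[THEN iffD1, rotated]) (use annulus_norm in auto)
qed

lemma radial_integrable:
  fixes \<phi> :: "real \<Rightarrow> real"
  assumes \<phi>: "set_integrable lborel {1..R} \<phi>"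
  shows "integrable M (\<lambda>x. \<phi> (norm x))" "(\<integral>x. \<bar>\<phi> (norm x)\<bar> \<partial>M) \<le> 2 * pi * R * (LINT t:{1..R}|lborel. \<bar>\<phi> t\<bar>)"
proof -
  let ?\<phi> = "\<lambda>t. indicator {1..R} t *\<^sub>R \<phi> t"
  have i: "integrable lborel ?\<phi>" using \<phi> by (simp add: set_integrable_def)
  then have [measurable]: "?\<phi> \<in> borel_measurable borel" by auto
  have m: "(\<lambda>x. \<phi> (norm x)) \<in> borel_measurable M"
    using i by (intro radial_measurable) (auto simp: set_borel_measurable_def)
  have "(\<integral>\<^sup>+x. ennreal \<bar>\<phi> (norm x)\<bar> \<partial>M) = (\<integral>\<^sup>+x. ennreal \<bar>?\<phi> (norm x)\<bar> \<partial>M)"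
    by (intro nn_integral_cong) (use annulus_norm in auto)
  also have "\<dots> \<le> ennreal (2 * pi * R) * (\<integral>\<^sup>+t. ennreal \<bar>?\<phi> t\<bar> * indicator {1..R} t \<partial>lborel)"
    by (rule annulus_nn_integral[OF R borel_measurable_abs[OF \<open>?\<phi> \<in> borel_measurable borel\<close>]]) simp
  also have "(\<integral>\<^sup>+t. ennreal \<bar>?\<phi> t\<bar> * indicator {1..R} t \<partial>lborel) = (\<integral>\<^sup>+t. ennreal \<bar>?\<phi> t\<bar> \<partial>lborel)"
    by (intro nn_integral_cong) (auto simp: indicator_def)
  also have "\<dots> = ennreal (\<integral>t. \<bar>?\<phi> t\<bar> \<partial>lborel)"
    using i by (intro nn_integral_eq_integral) auto
  also have "(\<integral>t. \<bar>?\<phi> t\<bar> \<partial>lborel) = (LINT t:{1..R}|lborel. \<bar>\<phi> t\<bar>)"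
    unfolding set_lebesgue_integral_def by (intro Bochner_Integration.integral_cong) (auto simp: indicator_def)
  also have "ennreal (2 * pi * R) * ennreal (LINT t:{1..R}|lborel. \<bar>\<phi> t\<bar>) = ennreal (2 * pi * R * (LINT t:{1..R}|lborel. \<bar>\<phi> t\<bar>))"
    using R by (intro ennreal_mult[symmetric]) (auto simp: set_lebesgue_integral_def intro!: integral_nonneg_AE)
  finally have *: "(\<integral>\<^sup>+x. ennreal \<bar>\<phi> (norm x)\<bar> \<partial>M) \<le> ennreal (2 * pi * R * (LINT t:{1..R}|lborel. \<bar>\<phi> t\<bar>))" .
  then show int: "integrable M (\<lambda>x. \<phi> (norm x))"
    using m le_less_trans[OF *] by (auto simp: integrable_iff_bounded)
  have "ennreal (\<integral>x. \<bar>\<phi> (norm x)\<bar> \<partial>M) = (\<integral>\<^sup>+x. ennreal \<bar>\<phi> (norm x)\<bar> \<partial>M)"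
    using int by (intro nn_integral_eq_integral[symmetric]) auto
  with * have "ennreal (\<integral>x. \<bar>\<phi> (norm x)\<bar> \<partial>M) \<le> ennreal (2 * pi * R * (LINT t:{1..R}|lborel. \<bar>\<phi> t\<bar>))" by simp
  then show "(\<integral>x. \<bar>\<phi> (norm x)\<bar> \<partial>M) \<le> 2 * pi * R * (LINT t:{1..R}|lborel. \<bar>\<phi> t\<bar>)"
    using R by (subst (asm) ennreal_le_iff) (auto simp: set_lebesgue_integral_def intro!: integral_nonneg_AE mult_nonneg_nonneg)
qed

text \<open>Absolute continuity on [1,R], encoded as being a primitive of an integrable function.
  The derivative is carried along because it is only determined almost everywhere.\<close>

definition ac :: "(real \<Rightarrow> real) \<Rightarrow> (real \<Rightarrow> real) \<Rightarrow> bool" where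
  "ac F \<phi> \<longleftrightarrow> set_integrable lborel {1..R} \<phi> \<and> (\<forall>\<rho>\<in>{1..R}. F \<rho> = F 1 + (LINT t:{1..\<rho>}|lborel. \<phi> t))"

lemma acD:
  assumes "ac F \<phi>"
  shows "set_integrable lborel {1..R} \<phi>" "\<And>\<rho>. \<rho> \<in> {1..R} \<Longrightarrow> F \<rho> = F 1 + (LINT t:{1..\<rho>}|lborel. \<phi> t)"
    "\<And>\<rho>. \<rho> \<in> {1..R} \<Longrightarrow> set_integrable lborel {1..\<rho>} \<phi>"
proof -
  show i: "set_integrable lborel {1..R} \<phi>" using assms by (simp add: ac_def)
  show "F \<rho> = F 1 + (LINT t:{1..\<rho>}|lborel. \<phi> t)" if "\<rho> \<in> {1..R}" for \<rho>
    using assms that unfolding ac_def by blast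
  show "set_integrable lborel {1..\<rho>} \<phi>" if "\<rho> \<in> {1..R}" for \<rho>
    by (rule set_integrable_subset[OF i]) (use that in auto)
qed

lemma ac_C1:
  assumes d: "\<And>t. t \<in> {1..R} \<Longrightarrow> (G has_real_derivative G' t) (at t)" and c: "continuous_on {1..R} G'"
  shows "ac G G'"
  unfolding ac_def
proof (intro conjI ballI)
  show "set_integrable lborel {1..R} G'" using c by (rule borel_integrable_atLeastAtMost')
  fix \<rho> assume \<rho>: "\<rho> \<in> {1..R}"
  have "(LINT t:{1..\<rho>}|lborel. G' t) = G \<rho> - G 1"
    unfolding set_lebesgue_integral_def using \<rho> d
    by (intro integral_FTC_Icc continuous_on_subset[OF c])
      (auto simp: has_real_derivative_iff_has_vector_derivative[symmetric] intro: has_field_derivative_at_within)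
  then show "G \<rho> = G 1 + (LINT t:{1..\<rho>}|lborel. G' t)" by simp
qed

lemma ac_add:
  assumes "ac F \<phi>" "ac G \<gamma>"
  shows "ac (\<lambda>\<rho>. F \<rho> + G \<rho>) (\<lambda>t. \<phi> t + \<gamma> t)"
  unfolding ac_def
proof (intro conjI ballI)
  show "set_integrable lborel {1..R} (\<lambda>t. \<phi> t + \<gamma> t)" using acD(1) assms by blast
  fix \<rho> assume \<rho>: "\<rho> \<in> {1..R}"
  show "F \<rho> + G \<rho> = F 1 + G 1 + (LINT t:{1..\<rho>}|lborel. \<phi> t + \<gamma> t)"
    using acD(2)[OF assms(1) \<rho>] acD(2)[OF assms(2) \<rho>] acD(3)[OF assms(1) \<rho>] acD(3)[OF assms(2) \<rho>] by simp
qed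

lemma ac_cmult:
  assumes "ac F \<phi>"
  shows "ac (\<lambda>\<rho>. c * F \<rho>) (\<lambda>t. c * \<phi> t)"
  unfolding ac_def
proof (intro conjI ballI)
  show "set_integrable lborel {1..R} (\<lambda>t. c * \<phi> t)" using acD(1)[OF assms] by simp
  fix \<rho> assume \<rho>: "\<rho> \<in> {1..R}"
  show "c * F \<rho> = c * F 1 + (LINT t:{1..\<rho>}|lborel. c * \<phi> t)"
    using acD(2)[OF assms \<rho>] by (simp add: distrib_left)
qed

lemma ac_cong:
  assumes "ac F \<phi>" "\<And>t. t \<in> {1..R} \<Longrightarrow> F t = F' t" "\<And>t. t \<in> {1..R} \<Longrightarrow> \<phi> t = \<phi>' t"
  shows "ac F' \<phi>'"
  unfolding ac_def
proof (intro conjI ballI)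
  show "set_integrable lborel {1..R} \<phi>'"
    using acD(1)[OF assms(1)] assms(3) by (subst set_integrable_cong[OF refl refl, of _ _ \<phi>]) auto
  fix \<rho> assume \<rho>: "\<rho> \<in> {1..R}"
  have "(LINT t:{1..\<rho>}|lborel. \<phi>' t) = (LINT t:{1..\<rho>}|lborel. \<phi> t)"
    using assms(3) \<rho> by (intro set_lebesgue_integral_cong) auto
  then show "F' \<rho> = F' 1 + (LINT t:{1..\<rho>}|lborel. \<phi>' t)"
    using acD(2)[OF assms(1) \<rho>] assms(2)[of \<rho>] assms(2)[of 1] \<rho> R by simp
qed

lemma ac_primitive: "set_integrable lborel {1..R} \<phi> \<Longrightarrow> ac (\<lambda>\<rho>. LINT t:{1..\<rho>}|lborel. \<phi> t) \<phi>"
proof -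
  have "(LINT t:{1..1::real}|lborel. \<phi> t) = 0"
  proof -
    have "(\<integral>t. indicator {1..1::real} t *\<^sub>R \<phi> t \<partial>lborel) = (\<integral>t. 0 \<partial>(lborel :: real measure))"
    proof (rule integral_cong_AE)
      have "(\<lambda>t. indicator {1..1::real} t *\<^sub>R \<phi> t) = (\<lambda>t. indicator {1::real} t *\<^sub>R \<phi> 1)" by (auto simp: indicator_def)
      then show "(\<lambda>t. indicator {1..1::real} t *\<^sub>R \<phi> t) \<in> borel_measurable lborel" by simp
      show "AE t in lborel. indicator {1..1::real} t *\<^sub>R \<phi> t = 0"
        using AE_lborel_singleton[of "1::real"] by eventually_elim (auto simp: indicator_def)
    qed simp
    then show ?thesis by (simp add: set_lebesgue_integral_def)
  qed
  then show "set_integrable lborel {1..R} \<phi> \<Longrightarrow> ac (\<lambda>\<rho>. LINT t:{1..\<rho>}|lborel. \<phi> t) \<phi>"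
    by (simp add: ac_def)
qed

text \<open>Continuous functions are L1 dense, so the derivative is approximated first; keeping the
  initial value \<open>F 1\<close>, the primitives then converge uniformly at the same rate.\<close>

lemma ac_approx:
  assumes F: "ac F \<phi>"
  obtains \<psi> where "\<And>n::nat. continuous_on UNIV (\<psi> n)" "\<And>n. (LINT t:{1..R}|lborel. \<bar>\<psi> n t - \<phi> t\<bar>) \<le> 1 / real (Suc n)"
    "\<And>n. ac (\<lambda>\<rho>. F 1 + (LINT t:{1..\<rho>}|lborel. \<psi> n t)) (\<psi> n)"
    "\<And>n \<rho>. \<rho> \<in> {1..R} \<Longrightarrow> \<bar>F 1 + (LINT t:{1..\<rho>}|lborel. \<psi> n t) - F \<rho>\<bar> \<le> 1 / real (Suc n)"
proof -
  have i: "integrable lborel (\<lambda>t. indicator {1..R} t *\<^sub>R \<phi> t)" using acD(1)[OF F] by (simp add: set_integrable_def)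
  have "\<exists>g. continuous_on UNIV g \<and> integrable lborel g \<and> (\<integral>t. \<bar>indicator {1..R} t *\<^sub>R \<phi> t - g t\<bar> \<partial>lborel) < 1 / real (Suc n)" for n
    by (rule L1_approx_continuous[OF i]) simp
  then obtain \<psi> where \<psi>: "\<And>n. continuous_on UNIV (\<psi> n)" "\<And>n. integrable lborel (\<psi> n)"
    "\<And>n. (\<integral>t. \<bar>indicator {1..R} t *\<^sub>R \<phi> t - \<psi> n t\<bar> \<partial>lborel) < 1 / real (Suc n)" by metis
  have si: "set_integrable lborel S (\<psi> n)" if "S \<in> sets borel" for S n
    unfolding set_integrable_def using \<psi>(2) that by (intro integrable_mult_indicator) auto
  have si': "set_integrable lborel {1..\<rho>} (\<lambda>t. \<bar>\<psi> n t - \<phi> t\<bar>)" if "\<rho> \<in> {1..R}" for \<rho> n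
    using si[of "{1..\<rho>}" n] acD(3)[OF F that] by (intro set_integrable_abs set_integral_diff) auto
  have b: "(LINT t:{1..\<rho>}|lborel. \<bar>\<psi> n t - \<phi> t\<bar>) \<le> 1 / real (Suc n)" if \<rho>: "\<rho> \<in> {1..R}" for n \<rho>
  proof -
    have "(LINT t:{1..\<rho>}|lborel. \<bar>\<psi> n t - \<phi> t\<bar>) \<le> (\<integral>t. \<bar>indicator {1..R} t *\<^sub>R \<phi> t - \<psi> n t\<bar> \<partial>lborel)"
      unfolding set_lebesgue_integral_def
    proof (rule integral_mono)
      show "integrable lborel (\<lambda>t. indicator {1..\<rho>} t *\<^sub>R \<bar>\<psi> n t - \<phi> t\<bar>)"
        using si'[OF \<rho>] by (simp add: set_integrable_def)
      show "integrable lborel (\<lambda>t. \<bar>indicator {1..R} t *\<^sub>R \<phi> t - \<psi> n t\<bar>)" using i \<psi>(2) by auto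
      show "indicator {1..\<rho>} t *\<^sub>R \<bar>\<psi> n t - \<phi> t\<bar> \<le> \<bar>indicator {1..R} t *\<^sub>R \<phi> t - \<psi> n t\<bar>" for t
        using \<rho> by (auto simp: indicator_def)
    qed
    then show ?thesis using \<psi>(3)[of n] by simp
  qed
  show ?thesis
  proof (rule that)
    show "continuous_on UNIV (\<psi> n)" for n by (rule \<psi>)
    show "(LINT t:{1..R}|lborel. \<bar>\<psi> n t - \<phi> t\<bar>) \<le> 1 / real (Suc n)" for n using b[of R] R by simp
    show "ac (\<lambda>\<rho>. F 1 + (LINT t:{1..\<rho>}|lborel. \<psi> n t)) (\<psi> n)" for n
      using ac_add[OF ac_C1[of "\<lambda>_. F 1" "\<lambda>_. 0"] ac_primitive[OF si]] by simp
    show "\<bar>F 1 + (LINT t:{1..\<rho>}|lborel. \<psi> n t) - F \<rho>\<bar> \<le> 1 / real (Suc n)" if \<rho>: "\<rho> \<in> {1..R}" for n \<rho>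
    proof -
      have "F 1 + (LINT t:{1..\<rho>}|lborel. \<psi> n t) - F \<rho> = (LINT t:{1..\<rho>}|lborel. \<psi> n t - \<phi> t)"
        using acD(2)[OF F \<rho>] acD(3)[OF F \<rho>] si[of "{1..\<rho>}" n] by simp
      also have "\<bar>\<dots>\<bar> \<le> (LINT t:{1..\<rho>}|lborel. \<bar>\<psi> n t - \<phi> t\<bar>)"
        unfolding set_lebesgue_integral_def
        by (rule order_trans[OF integral_abs_bound]) (simp add: abs_mult)
      also have "\<dots> \<le> 1 / real (Suc n)" by (rule b[OF \<rho>])
      finally show ?thesis .
    qed
  qed
qed

lemma continuous_primitive:
  assumes c: "continuous_on UNIV \<psi>"
  shows "\<rho> \<in> {1<..<R} \<Longrightarrow> ((\<lambda>\<rho>. c + (LINT t:{1..\<rho>}|lborel. \<psi> t)) has_real_derivative \<psi> \<rho>) (at \<rho>)"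
    and "continuous_on {1..R} (\<lambda>\<rho>. c + (LINT t:{1..\<rho>}|lborel. \<psi> t))"
proof -
  have eq: "(LINT t:{1..\<rho>}|lborel. \<psi> t) = integral {1..\<rho>} \<psi>" for \<rho>
    by (intro set_borel_integral_eq_integral(2) borel_integrable_atLeastAtMost' continuous_on_subset[OF c]) simp
  have d: "((\<lambda>\<rho>. integral {1..\<rho>} \<psi>) has_real_derivative \<psi> \<rho>) (at \<rho> within {1..R})" if "\<rho> \<in> {1..R}" for \<rho>
    by (rule integral_has_real_derivative[OF continuous_on_subset[OF c] that]) simp
  show "((\<lambda>\<rho>. c + (LINT t:{1..\<rho>}|lborel. \<psi> t)) has_real_derivative \<psi> \<rho>) (at \<rho>)" if "\<rho> \<in> {1<..<R}"
  proof -
    have "at \<rho> within {1..R} = at \<rho>" using that by (intro at_within_interior) auto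
    then show ?thesis unfolding eq using d[of \<rho>] that by (auto intro!: derivative_eq_intros)
  qed
  show "continuous_on {1..R} (\<lambda>\<rho>. c + (LINT t:{1..\<rho>}|lborel. \<psi> t))"
    unfolding eq using d by (intro continuous_intros) (meson DERIV_continuous continuous_on_eq_continuous_within)
qed

lemma ac_continuous:
  assumes F: "ac F \<phi>"
  shows "continuous_on {1..R} F"
proof -
  obtain \<psi> where \<psi>: "\<And>n::nat. continuous_on UNIV (\<psi> n)"
    "\<And>n \<rho>. \<rho> \<in> {1..R} \<Longrightarrow> \<bar>F 1 + (LINT t:{1..\<rho>}|lborel. \<psi> n t) - F \<rho>\<bar> \<le> 1 / real (Suc n)"
    using ac_approx[OF F] by metis
  show ?thesis
  proof (rule uniform_limit_theorem)
    show "\<forall>\<^sub>F n in sequentially. continuous_on {1..R} (\<lambda>\<rho>. F 1 + (LINT t:{1..\<rho>}|lborel. \<psi> n t))"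
      using continuous_primitive(2)[OF \<psi>(1)] by simp
    show "uniform_limit {1..R} (\<lambda>n \<rho>. F 1 + (LINT t:{1..\<rho>}|lborel. \<psi> n t)) F sequentially"
    proof (rule uniform_limitI)
      fix e :: real assume "0 < e"
      then have "\<forall>\<^sub>F n in sequentially. 1 / real (Suc n) < e"
        using order_tendstoD(2)[OF LIMSEQ_inverse_real_of_nat] by (simp add: inverse_eq_divide)
      then show "\<forall>\<^sub>F n in sequentially. \<forall>\<rho>\<in>{1..R}. dist (F 1 + (LINT t:{1..\<rho>}|lborel. \<psi> n t)) (F \<rho>) < e"
      proof eventually_elim
        case (elim n)
        then show ?case unfolding dist_real_def using le_less_trans[OF \<psi>(2)[of _ n]] by blast
      qed
    qed
  qed simp
qed

lemma set_integrable_continuous_mult: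
  fixes \<phi> H :: "real \<Rightarrow> real"
  assumes \<phi>: "set_integrable lborel {1..R} \<phi>" and H: "continuous_on {1..R} H"
  shows "set_integrable lborel {1..R} (\<lambda>t. \<phi> t * H t)"
proof -
    have "bounded (H ` {1..R})" using compact_continuous_image[OF H] compact_imp_bounded by auto
    then obtain C where "\<forall>y\<in>H ` {1..R}. norm y \<le> C" unfolding bounded_iff by blast
    then have C: "\<bar>H t\<bar> \<le> C" if "t \<in> {1..R}" for t using that by auto
    have i: "integrable lborel (\<lambda>t. indicator {1..R} t *\<^sub>R \<phi> t)" using \<phi> by (simp add: set_integrable_def)
    have iH: "integrable lborel (\<lambda>t. indicator {1..R} t *\<^sub>R H t)"
      using borel_integrable_atLeastAtMost'[OF H] by (simp add: set_integrable_def)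
    have "integrable lborel (\<lambda>t. (indicator {1..R} t *\<^sub>R \<phi> t) * (indicator {1..R} t *\<^sub>R H t))"
    proof (rule Bochner_Integration.integrable_bound)
      show "integrable lborel (\<lambda>t. C * (indicator {1..R} t *\<^sub>R \<phi> t))" using i by simp
      show "(\<lambda>t. (indicator {1..R} t *\<^sub>R \<phi> t) * (indicator {1..R} t *\<^sub>R H t)) \<in> borel_measurable lborel"
        using i iH by (intro borel_measurable_times borel_measurable_integrable)
      show "AE t in lborel. norm ((indicator {1..R} t *\<^sub>R \<phi> t) * (indicator {1..R} t *\<^sub>R H t)) \<le> norm (C * (indicator {1..R} t *\<^sub>R \<phi> t))"
      proof (intro AE_I2)
        fix t show "norm ((indicator {1..R} t *\<^sub>R \<phi> t) * (indicator {1..R} t *\<^sub>R H t)) \<le> norm (C * (indicator {1..R} t *\<^sub>R \<phi> t))"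
          using C[of t] by (auto simp: indicator_def abs_mult mult.commute intro!: mult_right_mono)
      qed
    qed
    also have "(\<lambda>t. (indicator {1..R} t *\<^sub>R \<phi> t) * (indicator {1..R} t *\<^sub>R H t)) = (\<lambda>t. indicator {1..R} t *\<^sub>R (\<phi> t * H t))"
      by (auto simp: indicator_def)
    finally show ?thesis by (simp add: set_integrable_def)
qed

text \<open>For a continuous derivative in place of \<open>\<phi>\<close> this is the fundamental
  theorem applied to the product; the general case is the limit along
  \<open>ac_approx\<close>.\<close>

lemma ac_mult_C1:
  assumes F: "ac F \<phi>" and d: "\<And>t. t \<in> {1..R} \<Longrightarrow> (G has_real_derivative G' t) (at t)" and c: "continuous_on {1..R} G'"
  shows "ac (\<lambda>\<rho>. F \<rho> * G \<rho>) (\<lambda>t. \<phi> t * G t + F t * G' t)"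
proof -
  have cG: "continuous_on {1..R} G"
    using d by (meson DERIV_isCont continuous_at_imp_continuous_on)
  have cF: "continuous_on {1..R} F" by (rule ac_continuous[OF F])
  obtain B where B: "\<And>t. t \<in> {1..R} \<Longrightarrow> \<bar>G t\<bar> \<le> B" "\<And>t. t \<in> {1..R} \<Longrightarrow> \<bar>G' t\<bar> \<le> B"
  proof -
    have "bounded (G ` {1..R})" "bounded (G' ` {1..R})"
      using compact_continuous_image[OF cG] compact_continuous_image[OF c] compact_imp_bounded by auto
    then obtain B1 B2 where "\<forall>t\<in>{1..R}. \<bar>G t\<bar> \<le> B1" "\<forall>t\<in>{1..R}. \<bar>G' t\<bar> \<le> B2"
      by (auto simp: bounded_iff)
    then show ?thesis by (intro that[of "max B1 B2"]) (auto simp: max.coboundedI1 max.coboundedI2)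
  qed
  obtain \<psi> where \<psi>: "\<And>n::nat. continuous_on UNIV (\<psi> n)" "\<And>n. (LINT t:{1..R}|lborel. \<bar>\<psi> n t - \<phi> t\<bar>) \<le> 1 / real (Suc n)"
    "\<And>n. ac (\<lambda>\<rho>. F 1 + (LINT t:{1..\<rho>}|lborel. \<psi> n t)) (\<psi> n)"
    "\<And>n \<rho>. \<rho> \<in> {1..R} \<Longrightarrow> \<bar>F 1 + (LINT t:{1..\<rho>}|lborel. \<psi> n t) - F \<rho>\<bar> \<le> 1 / real (Suc n)"
    by (rule ac_approx[OF F]) (rule that; assumption)
  define F' where "F' n \<rho> = F 1 + (LINT t:{1..\<rho>}|lborel. \<psi> n t)" for n \<rho>
  have si: "set_integrable lborel {1..R} (\<lambda>t. \<phi> t * G t + F t * G' t)"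
    by (intro set_integral_add set_integrable_continuous_mult acD(1)[OF F] cG borel_integrable_atLeastAtMost' continuous_intros cF c)
  have cF': "continuous_on {1..R} (F' n)" for n
    unfolding F'_def by (rule continuous_primitive(2)[OF \<psi>(1)])
  show ?thesis
    unfolding ac_def
  proof (intro conjI ballI si)
    fix \<rho> assume \<rho>: "\<rho> \<in> {1..R}"
    have sub: "{1..\<rho>} \<subseteq> {1..R}" using \<rho> by auto
    have exact: "(LINT t:{1..\<rho>}|lborel. \<psi> n t * G t + F' n t * G' t) = F' n \<rho> * G \<rho> - F' n 1 * G 1" for n
      unfolding set_lebesgue_integral_def
    proof (rule integral_FTC_Icc)
      show "1 \<le> \<rho>" using \<rho> by simp
      show "continuous_on {1..\<rho>} (\<lambda>t. \<psi> n t * G t + F' n t * G' t)"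
        using sub by (intro continuous_intros continuous_on_subset[OF cF'] continuous_on_subset[OF cG] continuous_on_subset[OF c] continuous_on_subset[OF \<psi>(1)]) auto
      fix t assume t: "1 \<le> t" "t \<le> \<rho>"
      have eq: "(LINT t:{1..s}|lborel. \<psi> n t) = integral {1..s} (\<psi> n)" for s
        by (intro set_borel_integral_eq_integral(2) borel_integrable_atLeastAtMost' continuous_on_subset[OF \<psi>(1)]) simp
      have "((\<lambda>s. integral {1..s} (\<psi> n)) has_real_derivative \<psi> n t) (at t within {1..\<rho>})"
        by (rule integral_has_real_derivative[OF continuous_on_subset[OF \<psi>(1)]]) (use t in auto)
      then have dF: "(F' n has_real_derivative \<psi> n t) (at t within {1..\<rho>})"
        unfolding F'_def eq by (auto intro!: derivative_eq_intros)
      have dG: "(G has_real_derivative G' t) (at t within {1..\<rho>})"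
        using d[of t] t \<rho> by (auto intro: has_field_derivative_at_within)
      show "((\<lambda>\<rho>. F' n \<rho> * G \<rho>) has_vector_derivative \<psi> n t * G t + F' n t * G' t) (at t within {1..\<rho>})"
        using DERIV_mult[OF dF dG]
        by (simp add: has_real_derivative_iff_has_vector_derivative[symmetric] mult_ac add_ac)
    qed
    let ?I = "LINT t:{1..\<rho>}|lborel. \<phi> t * G t + F t * G' t"
    let ?I' = "\<lambda>n. LINT t:{1..\<rho>}|lborel. \<psi> n t * G t + F' n t * G' t"
    have B0: "0 \<le> B" using B(1)[of 1] R by auto
    \<comment> \<open>Three errors add up: the L1 error of the derivative times sup |G|, the uniform
      error of \<open>F' n\<close> against \<open>G'\<close> over a length of at most R - 1, and the
      uniform error at the end point.\<close>
    have err: "\<bar>F \<rho> * G \<rho> - F 1 * G 1 - ?I\<bar> \<le> (B + B + B * R) * (1 / real (Suc n))" for n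
    proof -
      let ?e = "1 / real (Suc n)"
      have i1: "set_integrable lborel {1..\<rho>} (\<lambda>t. \<psi> n t * G t + F' n t * G' t)"
        using sub by (intro borel_integrable_atLeastAtMost' continuous_intros continuous_on_subset[OF cF'] continuous_on_subset[OF cG] continuous_on_subset[OF c] continuous_on_subset[OF \<psi>(1)]) auto
      have i2: "set_integrable lborel {1..\<rho>} (\<lambda>t. \<phi> t * G t + F t * G' t)"
        using set_integrable_subset[OF si _ sub] by simp
      have i3: "set_integrable lborel {1..R} (\<lambda>t. \<bar>\<psi> n t - \<phi> t\<bar>)"
        using acD(1)[OF \<psi>(3)[of n]] acD(1)[OF F] by (intro set_integrable_abs set_integral_diff)
      have i4: "set_integrable lborel {1..R} (\<lambda>t. B * \<bar>\<psi> n t - \<phi> t\<bar> + B * ?e)"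
      proof -
        have "set_integrable lborel {1..R} (\<lambda>t. B * ?e)" by (intro borel_integrable_atLeastAtMost' continuous_intros)
        then show ?thesis using i3 by (intro set_integral_add(1)) simp
      qed
      have "\<bar>?I' n - ?I\<bar> = \<bar>LINT t:{1..\<rho>}|lborel. (\<psi> n t * G t + F' n t * G' t) - (\<phi> t * G t + F t * G' t)\<bar>"
        using i1 i2 by simp
      also have "\<dots> \<le> (\<integral>t. \<bar>indicator {1..\<rho>} t *\<^sub>R ((\<psi> n t * G t + F' n t * G' t) - (\<phi> t * G t + F t * G' t))\<bar> \<partial>lborel)"
        unfolding set_lebesgue_integral_def by (rule integral_abs_bound)
      also have "\<dots> \<le> (LINT t:{1..R}|lborel. B * \<bar>\<psi> n t - \<phi> t\<bar> + B * ?e)"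
        unfolding set_lebesgue_integral_def
      proof (rule integral_mono)
        show "integrable lborel (\<lambda>t. \<bar>indicator {1..\<rho>} t *\<^sub>R ((\<psi> n t * G t + F' n t * G' t) - (\<phi> t * G t + F t * G' t))\<bar>)"
          using set_integral_diff(1)[OF i1 i2] unfolding set_integrable_def by (rule integrable_abs)
        show "integrable lborel (\<lambda>t. indicator {1..R} t *\<^sub>R (B * \<bar>\<psi> n t - \<phi> t\<bar> + B * ?e))"
          using i4 by (simp add: set_integrable_def)
        fix t
        show "\<bar>indicator {1..\<rho>} t *\<^sub>R ((\<psi> n t * G t + F' n t * G' t) - (\<phi> t * G t + F t * G' t))\<bar>
          \<le> indicator {1..R} t *\<^sub>R (B * \<bar>\<psi> n t - \<phi> t\<bar> + B * ?e)"
        proof (cases "t \<in> {1..\<rho>}")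
          case True
          then have t: "t \<in> {1..R}" using sub by auto
          have "(\<psi> n t * G t + F' n t * G' t) - (\<phi> t * G t + F t * G' t) = G t * (\<psi> n t - \<phi> t) + G' t * (F' n t - F t)"
            by (simp add: algebra_simps)
          also have "\<bar>\<dots>\<bar> \<le> \<bar>G t\<bar> * \<bar>\<psi> n t - \<phi> t\<bar> + \<bar>G' t\<bar> * \<bar>F' n t - F t\<bar>"
            by (rule order_trans[OF abs_triangle_ineq]) (simp add: abs_mult)
          also have "\<dots> \<le> B * \<bar>\<psi> n t - \<phi> t\<bar> + B * ?e"
            using B[OF t] \<psi>(4)[OF t, of n] B0 by (intro add_mono mult_mono) (auto simp: F'_def)
          finally show ?thesis using True t by simp
        next
          case False
          then show ?thesis using B0 by (auto simp: indicator_def)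
        qed
      qed
      also have "\<dots> = B * (LINT t:{1..R}|lborel. \<bar>\<psi> n t - \<phi> t\<bar>) + B * ?e * (R - 1)"
      proof -
        have "set_integrable lborel {1..R} (\<lambda>t. B * ?e)" by (intro borel_integrable_atLeastAtMost' continuous_intros)
        then have "(LINT t:{1..R}|lborel. B * \<bar>\<psi> n t - \<phi> t\<bar> + B * ?e) = (LINT t:{1..R}|lborel. B * \<bar>\<psi> n t - \<phi> t\<bar>) + (LINT t:{1..R}|lborel. B * ?e)"
          using i3 by (intro set_integral_add(2)) auto
        then show ?thesis using R by (simp add: set_integral_const)
      qed
      also have "\<dots> \<le> B * ?e + B * ?e * (R - 1)"
        using \<psi>(2)[of n] B0 by (intro add_mono mult_left_mono) auto
      finally have a: "\<bar>?I' n - ?I\<bar> \<le> B * ?e + B * ?e * (R - 1)" .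
      have b: "\<bar>F' n \<rho> * G \<rho> - F \<rho> * G \<rho>\<bar> \<le> B * ?e"
      proof -
        have "\<bar>F' n \<rho> - F \<rho>\<bar> * \<bar>G \<rho>\<bar> \<le> ?e * B"
          unfolding F'_def by (intro mult_mono \<psi>(4)[OF \<rho>] B(1)[OF \<rho>]) auto
        then show ?thesis unfolding left_diff_distrib[symmetric] abs_mult by (simp only: mult.commute)
      qed
      have "F' n 1 = F 1"
        using acD(2)[OF \<psi>(3)[of n], of 1] R by (simp add: F'_def)
      then have "?I' n = F' n \<rho> * G \<rho> - F 1 * G 1" using exact[of n] by simp
      then have "\<bar>F \<rho> * G \<rho> - F 1 * G 1 - ?I\<bar> \<le> B * ?e + (B * ?e + B * ?e * (R - 1))" using a b by linarith
      also have "\<dots> \<le> (B + B + B * R) * ?e" using B0 by (simp add: algebra_simps divide_right_mono)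
      finally show ?thesis .
    qed
    have "(\<lambda>n. (B + B + B * R) * (1 / real (Suc n))) \<longlonglongrightarrow> (B + B + B * R) * 0"
      using LIMSEQ_inverse_real_of_nat by (intro tendsto_intros) (simp add: inverse_eq_divide)
    then have "\<bar>F \<rho> * G \<rho> - F 1 * G 1 - ?I\<bar> \<le> (B + B + B * R) * 0"
      using err by (intro LIMSEQ_le_const) auto
    then show "F \<rho> * G \<rho> = F 1 * G 1 + ?I" by simp
  qed
qed

lemma norm_has_derivative:
  assumes "x \<in> annulus R"
  shows "(norm has_derivative (\<lambda>h. fst x / norm x * fst h + snd x / norm x * snd h)) (at x)"
proof -
  have "x \<noteq> 0" using assms by (auto simp: annulus_def)
  then have "(norm has_derivative (\<lambda>h. x \<bullet> h / norm x)) (at x)"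
    using has_derivative_norm[of x] by (simp add: sgn_div_norm inner_commute divide_inverse mult.commute)
  then show ?thesis by (rule has_derivative_eq_rhs) (auto simp: inner_prod_def add_divide_distrib)
qed

lemma coord_bounds: "\<bar>coord i x\<bar> \<le> norm x" "coord 1 x = fst x" "coord 2 x = snd x"
  using norm_fst_le[of "fst x" "snd x"] norm_snd_le[of "snd x" "fst x"] by (auto simp: coord_def)

lemma smooth_fun_coord: "smooth_fun (coord i)"
proof -
  have "coord i = fst \<or> coord i = snd" by (auto simp: coord_def fun_eq_iff)
  then show ?thesis using smooth_fun_intros(2,3) by metis
qed

lemma norm_ratio:
  assumes "x \<in> annulus R"
  shows "\<bar>coord i x / norm x\<bar> \<le> 1"
proof -
  have "0 < norm x" using annulus_norm(1)[OF assms] by auto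
  then show ?thesis using coord_bounds(1)[of i x] by (simp only: abs_divide abs_norm_cancel divide_le_eq_1_pos)
qed

text \<open>Profiles with continuous derivative obey the classical chain rule, so they have the
  expected weak derivative. The ratio \<open>coord i x / norm x\<close> is at most 1 in modulus, so
  L1 convergence of the profile derivatives carries over to the annulus.\<close>

lemma ac_radial_weak:
  assumes F: "ac F \<phi>" and i: "i \<in> {1,2}"
  shows "is_weak_pderiv (annulus R) i (\<lambda>x. F (norm x)) (\<lambda>x. \<phi> (norm x) * (coord i x / norm x))"
proof -
  have bd: "continuous_on (annulus R) (\<lambda>x. coord i x / norm x)"
    by (intro continuous_intros smooth_fun_continuous_on smooth_fun_coord) (auto simp: annulus_def)
  have mc: "(\<lambda>x. coord i x / norm x) \<in> borel_measurable M"
    using bd by (rule continuous_imp_measurable_on_sets_lebesgue[OF _ U_sets])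
  have int: "integrable M (\<lambda>x. \<phi> (norm x) * (coord i x / norm x))" "integrable M (\<lambda>x. \<phi> (norm x))"
    if "set_integrable lborel {1..R} \<phi>" for \<phi>
  proof -
    show p: "integrable M (\<lambda>x. \<phi> (norm x))" by (rule radial_integrable[OF that])
    show "integrable M (\<lambda>x. \<phi> (norm x) * (coord i x / norm x))"
    proof (rule Bochner_Integration.integrable_bound[OF p])
      show "(\<lambda>x. \<phi> (norm x) * (coord i x / norm x)) \<in> borel_measurable M"
        by (rule borel_measurable_times[OF borel_measurable_integrable[OF p] mc])
      show "AE x in M. norm (\<phi> (norm x) * (coord i x / norm x)) \<le> norm (\<phi> (norm x))"
        unfolding real_norm_def abs_mult using norm_ratio[of _ i] by (intro AE_I2 mult_left_le) auto
    qed
  qed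
  have cint: "integrable M (\<lambda>x. G (norm x))" if "continuous_on {1..R} G" for G :: "real \<Rightarrow> real"
    by (rule radial_integrable[OF borel_integrable_atLeastAtMost'[OF that]])
  obtain \<psi> where \<psi>: "\<And>n::nat. continuous_on UNIV (\<psi> n)" "\<And>n. (LINT t:{1..R}|lborel. \<bar>\<psi> n t - \<phi> t\<bar>) \<le> 1 / real (Suc n)"
    "\<And>n. ac (\<lambda>\<rho>. F 1 + (LINT t:{1..\<rho>}|lborel. \<psi> n t)) (\<psi> n)"
    "\<And>n \<rho>. \<rho> \<in> {1..R} \<Longrightarrow> \<bar>F 1 + (LINT t:{1..\<rho>}|lborel. \<psi> n t) - F \<rho>\<bar> \<le> 1 / real (Suc n)"
    by (rule ac_approx[OF F]) (rule that; assumption)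
  define F' where "F' n \<rho> = F 1 + (LINT t:{1..\<rho>}|lborel. \<psi> n t)" for n \<rho>
  have cF': "continuous_on {1..R} (F' n)" for n
    unfolding F'_def by (rule continuous_primitive(2)[OF \<psi>(1)])
  have e0: "(\<lambda>n. C * (1 / real (Suc n))) \<longlonglongrightarrow> 0" for C :: real
    using tendsto_mult_right_zero[OF LIMSEQ_inverse_real_of_nat, of C] by (simp add: inverse_eq_divide)
  show ?thesis
  proof (rule weak_L1_limit)
    show "is_weak_pderiv (annulus R) i (\<lambda>x. F' n (norm x)) (\<lambda>x. \<psi> n (norm x) * (coord i x / norm x))" for n
    proof (rule classical_imp_weak[OF open_annulus, where g = "\<lambda>i x. \<psi> n (norm x) * (coord i x / norm x)" and G = "\<lambda>x. F' n (norm x)"])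
      fix x assume x: "x \<in> annulus R"
      have "(F' n has_real_derivative \<psi> n (norm x)) (at (norm x))"
        unfolding F'_def using annulus_norm(2)[OF x] by (rule continuous_primitive(1)[OF \<psi>(1)])
      from DERIV_compose_FDERIV[OF this norm_has_derivative[OF x]]
      show "((\<lambda>x. F' n (norm x)) has_derivative
        (\<lambda>h. \<psi> n (norm x) * (coord 1 x / norm x) * fst h + \<psi> n (norm x) * (coord 2 x / norm x) * snd h)) (at x)"
        by (rule has_derivative_eq_rhs) (auto simp: coord_bounds algebra_simps)
    next
      show "continuous_on (annulus R) (\<lambda>x. \<psi> n (norm x) * (coord i x / norm x))"
        by (intro continuous_on_mult bd continuous_on_compose2[OF \<psi>(1)] continuous_intros) auto
      show "integrable M (\<lambda>x. \<psi> n (norm x) * (coord i x / norm x))"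
        by (rule int[OF acD(1)[OF \<psi>(3)]])
    qed (rule i)
    show "integrable M (\<lambda>x. F' n (norm x))" for n by (rule cint[OF cF'])
    show "integrable M (\<lambda>x. F (norm x))" by (rule cint[OF ac_continuous[OF F]])
    show "integrable M (\<lambda>x. \<phi> (norm x) * (coord i x / norm x))" by (rule int[OF acD(1)[OF F]])
    show "(\<lambda>n. \<integral>x. \<bar>F' n (norm x) - F (norm x)\<bar> \<partial>M) \<longlonglongrightarrow> 0"
    proof (rule tendsto_sandwich[OF _ _ tendsto_const e0])
      have "(\<integral>x. \<bar>F' n (norm x) - F (norm x)\<bar> \<partial>M) \<le> (\<integral>x. 1 / real (Suc n) \<partial>M)" for n
        using \<psi>(4)[OF annulus_norm(1), of _ n] cint[OF cF', of n] cint[OF ac_continuous[OF F]]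
        by (intro integral_mono) (auto simp: F'_def)
      then show "\<forall>\<^sub>F n in sequentially. (\<integral>x. \<bar>F' n (norm x) - F (norm x)\<bar> \<partial>M) \<le> measure M (space M) * (1 / real (Suc n))"
        by simp
    qed (auto intro!: always_eventually integral_nonneg_AE)
    show "(\<lambda>n. \<integral>x. \<bar>\<psi> n (norm x) * (coord i x / norm x) - \<phi> (norm x) * (coord i x / norm x)\<bar> \<partial>M) \<longlonglongrightarrow> 0"
    proof (rule tendsto_sandwich[OF _ _ tendsto_const e0])
      have "(\<integral>x. \<bar>\<psi> n (norm x) * (coord i x / norm x) - \<phi> (norm x) * (coord i x / norm x)\<bar> \<partial>M) \<le> (2 * pi * R) * (1 / real (Suc n))" for n
      proof -
        have si: "set_integrable lborel {1..R} (\<lambda>t. \<psi> n t - \<phi> t)"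
          using acD(1)[OF \<psi>(3)[of n]] acD(1)[OF F] by (intro set_integral_diff)
        have "(\<integral>x. \<bar>\<psi> n (norm x) * (coord i x / norm x) - \<phi> (norm x) * (coord i x / norm x)\<bar> \<partial>M) \<le> (\<integral>x. \<bar>\<psi> n (norm x) - \<phi> (norm x)\<bar> \<partial>M)"
        proof (rule integral_mono)
          show "integrable M (\<lambda>x. \<bar>\<psi> n (norm x) * (coord i x / norm x) - \<phi> (norm x) * (coord i x / norm x)\<bar>)"
            by (intro integrable_abs Bochner_Integration.integrable_diff int acD(1)[OF F] acD(1)[OF \<psi>(3)])
          show "integrable M (\<lambda>x. \<bar>\<psi> n (norm x) - \<phi> (norm x)\<bar>)"
            using radial_integrable(1)[OF si] by (rule integrable_abs)
          fix x assume "x \<in> space M"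
          then show "\<bar>\<psi> n (norm x) * (coord i x / norm x) - \<phi> (norm x) * (coord i x / norm x)\<bar> \<le> \<bar>\<psi> n (norm x) - \<phi> (norm x)\<bar>"
            unfolding left_diff_distrib[symmetric] abs_mult using norm_ratio[of x i] by (intro mult_left_le) auto
        qed
        also have "\<dots> \<le> 2 * pi * R * (LINT t:{1..R}|lborel. \<bar>\<psi> n t - \<phi> t\<bar>)"
          by (rule radial_integrable(2)[OF si])
        also have "\<dots> \<le> 2 * pi * R * (1 / real (Suc n))"
          using \<psi>(2)[of n] R by (intro mult_left_mono) auto
        finally show ?thesis .
      qed
      then show "\<forall>\<^sub>F n in sequentially. (\<integral>x. \<bar>\<psi> n (norm x) * (coord i x / norm x) - \<phi> (norm x) * (coord i x / norm x)\<bar> \<partial>M) \<le> (2 * pi * R) * (1 / real (Suc n))"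
        by simp
    qed (auto intro!: always_eventually integral_nonneg_AE)
  qed
qed

lemma ac_radial_H1:
  assumes F: "ac F \<phi>" and sq: "set_integrable lborel {1..R} (\<lambda>t. (\<phi> t)\<^sup>2)"
  shows "H1_grad (\<lambda>x. F (norm x)) (\<lambda>i x. \<phi> (norm x) * (coord i x / norm x))"
  unfolding H1_grad_def
proof (intro conjI ballI)
  have "sq_integrable M (\<lambda>x. \<phi> (norm x))"
    using radial_integrable(1)[OF sq] radial_integrable(1)[OF acD(1)[OF F]] by (auto simp: sq_integrable_def)
  moreover have "(\<lambda>x. coord i x / norm x) \<in> borel_measurable M" for i
    by (intro continuous_imp_measurable_on_sets_lebesgue[OF _ U_sets] continuous_intros smooth_fun_continuous_on smooth_fun_coord)
      (auto simp: annulus_def)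
  ultimately have "sq_integrable M (\<lambda>x. (coord i x / norm x) * \<phi> (norm x))" for i
    using norm_ratio[of _ i] by (intro sq_integrable_bounded_mult[where B = 1] AE_I2) auto
  then show "sq_integrable M (\<lambda>x. \<phi> (norm x) * (coord i x / norm x))" for i by (simp add: mult.commute)
  show "is_weak_pderiv (annulus R) i (\<lambda>x. F (norm x)) (\<lambda>x. \<phi> (norm x) * (coord i x / norm x))" if "i \<in> {1,2}" for i
    by (rule ac_radial_weak[OF F that])
  have c: "continuous_on {1..R} (\<lambda>t. (F t)\<^sup>2)" by (intro continuous_intros ac_continuous[OF F])
  show "sq_integrable M (\<lambda>x. F (norm x))"
    using radial_integrable(1)[OF borel_integrable_atLeastAtMost'[OF c]]
      radial_integrable(1)[OF borel_integrable_atLeastAtMost'[OF ac_continuous[OF F]]] by (auto simp: sq_integrable_def)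
qed

end

section \<open>Boundary values of radial functions\<close>

text \<open>This bound and the next one control, uniformly in \<open>n\<close>, the gradient of the
  cutoff in \<open>cutoff_H10\<close>.\<close>

lemma exp_cut_1_le: "exp_cut 1 t \<le> 1"
proof (cases "t > 0")
  case True
  have "1 / t \<le> exp (1 / t)" using exp_ge_add_one_self[of "1 / t"] by linarith
  then have "1 / t * exp (- (1 / t)) \<le> exp (1 / t) * exp (- (1 / t))" by (intro mult_right_mono) auto
  then show ?thesis using True by (simp add: exp_cut_def exp_minus)
qed (simp add: exp_cut_def)

text \<open>With s = 1/t, squaring s/2 \<le> exp(s/2) gives s^2 \<le> 4 exp s.\<close>

lemma exp_cut_2_le: "exp_cut 2 t \<le> 4"
proof (cases "t > 0")
  case True
  let ?s = "1 / t"
  have "?s / 2 \<le> exp (?s / 2)" using exp_ge_add_one_self[of "?s / 2"] by linarith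
  then have "(?s / 2)\<^sup>2 \<le> (exp (?s / 2))\<^sup>2" using True by (intro power_mono) auto
  also have "(exp (?s / 2))\<^sup>2 = exp ?s" by (simp add: power2_eq_square exp_add[symmetric])
  finally have "?s\<^sup>2 * exp (- ?s) \<le> (4 * exp ?s) * exp (- ?s)" by (intro mult_right_mono) (auto simp: power_divide)
  also have "(4 * exp ?s) * exp (- ?s) = 4" by (simp add: mult.assoc exp_add[symmetric])
  finally show ?thesis using True by (simp add: exp_cut_def)
qed (simp add: exp_cut_def)

lemma exp_cut_0_at_top: "(exp_cut 0 \<longlongrightarrow> 1) at_top"
proof -
  have "((\<lambda>t::real. exp (- (1 / t))) \<longlongrightarrow> exp (- 0)) at_top"
    by (intro tendsto_intros tendsto_divide_0[OF tendsto_const] filterlim_at_top_imp_at_infinity filterlim_ident)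
  then have "((\<lambda>t::real. exp (- (1 / t))) \<longlongrightarrow> 1) at_top" by simp
  moreover have "\<forall>\<^sub>F t in at_top. exp (- (1 / t)) = exp_cut 0 t"
    using eventually_gt_at_top[of 0] by eventually_elim (simp add: exp_cut_def)
  ultimately show ?thesis by (rule Lim_transform_eventually)
qed

lemma exp_cut_Suc_at_top: "(exp_cut (Suc k) \<longlongrightarrow> 0) at_top"
proof -
  have "((\<lambda>t::real. (1 / t) ^ Suc k * exp (- (1 / t))) \<longlongrightarrow> 0 ^ Suc k * exp (- 0)) at_top"
    by (intro tendsto_intros tendsto_divide_0[OF tendsto_const] filterlim_at_top_imp_at_infinity filterlim_ident)
  then have "((\<lambda>t::real. (1 / t) ^ Suc k * exp (- (1 / t))) \<longlongrightarrow> 0) at_top" by simp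
  moreover have "\<forall>\<^sub>F t in at_top. (1 / t) ^ Suc k * exp (- (1 / t)) = exp_cut (Suc k) t"
    using eventually_gt_at_top[of 0] by eventually_elim (simp add: exp_cut_def)
  ultimately show ?thesis by (rule Lim_transform_eventually)
qed

context bounded_open
begin

lemma L2_bounded_convergence:
  fixes B :: real
  assumes m: "\<And>n. f n \<in> borel_measurable M" "f' \<in> borel_measurable M"
    and l: "\<And>x. x \<in> U \<Longrightarrow> (\<lambda>n. f n x) \<longlonglongrightarrow> f' x" and b: "\<And>n x. x \<in> U \<Longrightarrow> \<bar>f n x - f' x\<bar> \<le> B"
  shows "(\<lambda>n. \<integral>x. (f n x - f' x)\<^sup>2 \<partial>M) \<longlonglongrightarrow> 0"
proof -
  have "(\<lambda>n. \<integral>x. (f n x - f' x)\<^sup>2 \<partial>M) \<longlonglongrightarrow> (\<integral>x. 0 \<partial>M)"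
  proof (rule integral_dominated_convergence[where w = "\<lambda>x. B\<^sup>2"])
    show "AE x in M. (\<lambda>n. (f n x - f' x)\<^sup>2) \<longlonglongrightarrow> 0"
    proof (intro AE_I2)
      fix x assume "x \<in> space M"
      then have "(\<lambda>n. (f n x - f' x)\<^sup>2) \<longlonglongrightarrow> (f' x - f' x)\<^sup>2" using l[of x] by (intro tendsto_intros) simp
      then show "(\<lambda>n. (f n x - f' x)\<^sup>2) \<longlonglongrightarrow> 0" by simp
    qed
    show "AE x in M. norm ((f n x - f' x)\<^sup>2) \<le> B\<^sup>2" for n
    proof (intro AE_I2)
      fix x assume "x \<in> space M"
      then have "\<bar>f n x - f' x\<bar> \<le> \<bar>B\<bar>" using b[of x n] by auto
      then show "norm ((f n x - f' x)\<^sup>2) \<le> B\<^sup>2" by (simp add: abs_le_square_iff)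
    qed
  qed (use m in auto)
  then show ?thesis by simp
qed

text \<open>\<open>z\<close> plays the role of a distance to the boundary. \<open>P\<close> is
  multiplied by a cutoff that acts where z is of order 1/n. The gradient of the cutoff is of order n
  there, but \<open>P\<close> is at most C z, so the product stays bounded and tends to 0 pointwise.
  Dominated convergence then gives the H1 limit.\<close>

lemma cutoff_H10:
  assumes z: "smooth_fun z" and U: "\<And>x. x \<in> U \<longleftrightarrow> 0 < z x" and P: "smooth_fun P"
    and b: "\<And>x. x \<in> U \<Longrightarrow> \<bar>P x\<bar> \<le> C * z x"
  shows "H10_grad P (\<lambda>i. pderiv i P)"
proof -
  \<comment> \<open>The shift by 1 makes \<open>exp_cut 0 (t n x)\<close> vanish where z \<le>
    1/(n+1), which confines the support to a compact subset of \<open>U\<close>; inside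
    \<open>U\<close> the cutoff tends to 1.\<close>
  define t where "t n x = real (Suc n) * z x - 1" for n x
  define \<phi> where "\<phi> n x = P x * exp_cut 0 (t n x)" for n x
  have st: "smooth_fun (t n)" for n unfolding t_def by (intro smooth_fun_diff smooth_fun_intros z)
  have sE: "smooth_fun (\<lambda>x. exp_cut k (t n x))" for n k by (rule smooth_fun_intros(6)[OF st])
  have s\<phi>: "smooth_fun (\<phi> n)" for n unfolding \<phi>_def by (intro smooth_fun_intros(5) P sE)
  have "test_fun U (\<phi> n)" for n
  proof (rule test_funI[OF s\<phi>])
    let ?K = "{x. 1 / real (Suc n) \<le> z x}"
    have "closed ?K" by (intro closed_Collect_le continuous_intros smooth_fun_continuous_on z)
    moreover show sub: "?K \<subseteq> U"
    proof
      fix x assume "x \<in> ?K"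
      then have "0 < z x" by (auto intro: less_le_trans[rotated])
      then show "x \<in> U" using U by simp
    qed
    ultimately show "compact ?K" using bounded_subset[OF bounded_U] by (simp add: compact_eq_bounded_closed)
    fix x assume "x \<notin> ?K"
    then have "z x < 1 / real (Suc n)" by simp
    then have "t n x < 0" unfolding t_def by (simp add: field_simps del: of_nat_Suc)
    then show "\<phi> n x = 0" by (simp add: \<phi>_def exp_cut_def)
  qed
  moreover have "(\<lambda>n. \<integral>x. (\<phi> n x - P x)\<^sup>2 \<partial>M) \<longlonglongrightarrow> 0"
    and "\<forall>i\<in>{1,2}. (\<lambda>n. \<integral>x. (pderiv i (\<phi> n) x - pderiv i P x)\<^sup>2 \<partial>M) \<longlonglongrightarrow> 0"
  proof -
    have tinf: "filterlim (\<lambda>n. t n x) at_top sequentially" if "x \<in> U" for x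
    proof -
      have "filterlim (\<lambda>n. real (Suc n)) at_top sequentially"
        by (rule filterlim_compose[OF filterlim_real_sequentially filterlim_Suc])
      then have "filterlim (\<lambda>n. z x * real (Suc n)) at_top sequentially"
        using that U by (intro filterlim_tendsto_pos_mult_at_top[OF tendsto_const]) auto
      then have "filterlim (\<lambda>n. -1 + z x * real (Suc n)) at_top sequentially"
        by (rule filterlim_tendsto_add_at_top[OF tendsto_const])
      then show ?thesis unfolding t_def by (simp add: mult.commute)
    qed
    have l0: "(\<lambda>n. exp_cut 0 (t n x)) \<longlonglongrightarrow> 1" if "x \<in> U" for x
      by (rule filterlim_compose[OF exp_cut_0_at_top tinf[OF that]])
    have lS: "(\<lambda>n. exp_cut (Suc k) (t n x)) \<longlonglongrightarrow> 0" if "x \<in> U" for x k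
      by (rule filterlim_compose[OF exp_cut_Suc_at_top tinf[OF that]])
    have le1: "\<bar>a * exp_cut 0 s - a\<bar> \<le> \<bar>a\<bar>" for a s
    proof -
      have "\<bar>a * exp_cut 0 s - a\<bar> = \<bar>a\<bar> * \<bar>exp_cut 0 s - 1\<bar>" by (simp add: abs_mult[symmetric] right_diff_distrib)
      also have "\<dots> \<le> \<bar>a\<bar> * 1" using exp_cut_nonneg[of 0 s] exp_cut_0_le[of s] by (intro mult_left_mono) auto
      finally show ?thesis by simp
    qed
    obtain BP where BP: "\<And>x. x \<in> U \<Longrightarrow> \<bar>P x\<bar> \<le> BP" using smooth_bounded[OF P] by blast
    show "(\<lambda>n. \<integral>x. (\<phi> n x - P x)\<^sup>2 \<partial>M) \<longlonglongrightarrow> 0"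
    proof (rule L2_bounded_convergence)
      show "\<phi> n \<in> borel_measurable M" "P \<in> borel_measurable M" for n using s\<phi> P smooth_measurable by auto
      fix x assume x: "x \<in> U"
      show "(\<lambda>n. \<phi> n x) \<longlonglongrightarrow> P x"
        unfolding \<phi>_def using tendsto_mult[OF tendsto_const l0[OF x], of "P x"] by simp
      show "\<bar>\<phi> n x - P x\<bar> \<le> BP" for n
        unfolding \<phi>_def using le1[of "P x"] BP[OF x] order_trans by blast
    qed
    show "\<forall>i\<in>{1,2}. (\<lambda>n. \<integral>x. (pderiv i (\<phi> n) x - pderiv i P x)\<^sup>2 \<partial>M) \<longlonglongrightarrow> 0"
    proof
      fix i :: nat assume "i \<in> {1,2}"
      obtain Bd where Bd: "\<And>x. x \<in> U \<Longrightarrow> \<bar>pderiv i P x\<bar> \<le> Bd" using smooth_bounded[OF smooth_fun_pderiv[OF P]] by blast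
      obtain Bz where Bz: "\<And>x. x \<in> U \<Longrightarrow> \<bar>pderiv i z x\<bar> \<le> Bz" using smooth_bounded[OF smooth_fun_pderiv[OF z]] by blast
      define e where "e n x = P x * (real (Suc n) * pderiv i z x * exp_cut 2 (t n x))" for n x
      have dE: "pderiv i (\<lambda>x. exp_cut 0 (t n x)) x = real (Suc n) * pderiv i z x * exp_cut 2 (t n x)" for n x
      proof -
        have "(t n has_derivative (\<lambda>h. real (Suc n) * (pderiv 1 z x * fst h + pderiv 2 z x * snd h))) (at x)"
          unfolding t_def by (rule has_derivative_eq_rhs[OF has_derivative_diff[OF has_derivative_mult_right[OF smooth_fun_has_derivative[OF z]] has_derivative_const]]) simp
        from pderiv_eqI[OF DERIV_compose_FDERIV[OF exp_cut_deriv[of 0 "t n x"] this], of i]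
        show ?thesis by (simp add: ebasis_def pderiv_def numeral_2_eq_2)
      qed
      have d\<phi>: "pderiv i (\<phi> n) x = e n x + pderiv i P x * exp_cut 0 (t n x)" for n x
        unfolding \<phi>_def pderiv_mult[OF P sE] dE e_def ..
      have eb: "\<bar>e n x\<bar> \<le> (C * Bz) * (exp_cut 1 (t n x) + exp_cut 2 (t n x))" if x: "x \<in> U" for n x
      proof (cases "t n x > 0")
        case False
        then show ?thesis by (simp add: e_def exp_cut_def)
      next
        case True
        have Cz: "0 \<le> C * z x" using b[OF x] by linarith
        have "\<bar>e n x\<bar> = (\<bar>P x\<bar> * \<bar>pderiv i z x\<bar>) * (real (Suc n) * exp_cut 2 (t n x))"
          unfolding e_def using exp_cut_nonneg[of 2 "t n x"] by (simp add: abs_mult)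
        also have "\<dots> \<le> ((C * z x) * Bz) * (real (Suc n) * exp_cut 2 (t n x))"
          using b[OF x] Bz[OF x] Cz exp_cut_nonneg[of 2 "t n x"] by (intro mult_right_mono mult_mono) auto
        \<comment> \<open>The growth of the cutoff's gradient is paid for by the decay of
          \<open>P\<close>: \<open>Suc n * z x\<close> is \<open>t n x + 1\<close>, and a factor
          \<open>t n x\<close> lowers the index of \<open>exp_cut 2\<close> by one.\<close>
        also have "\<dots> = (C * Bz) * ((t n x + 1) * exp_cut 2 (t n x))" by (simp add: t_def)
        also have "(t n x + 1) * exp_cut 2 (t n x) = exp_cut 1 (t n x) + exp_cut 2 (t n x)"
          using True by (simp add: exp_cut_def power2_eq_square field_simps)
        finally show ?thesis .
      qed
      have CBz: "0 \<le> C * Bz" if x: "x \<in> U" for x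
      proof -
        have "0 < z x" using U x by simp
        moreover have "0 \<le> C * z x" using b[OF x] by linarith
        ultimately have "0 \<le> C" by (simp add: zero_le_mult_iff)
        then show ?thesis using Bz[OF x] by (intro mult_nonneg_nonneg) auto
      qed
      show "(\<lambda>n. \<integral>x. (pderiv i (\<phi> n) x - pderiv i P x)\<^sup>2 \<partial>M) \<longlonglongrightarrow> 0"
      proof (rule L2_bounded_convergence)
        show "pderiv i (\<phi> n) \<in> borel_measurable M" "pderiv i P \<in> borel_measurable M" for n
          using s\<phi> P smooth_measurable smooth_fun_pderiv by auto
        fix x assume x: "x \<in> U"
        have "(\<lambda>n. (C * Bz) * (exp_cut 1 (t n x) + exp_cut 2 (t n x))) \<longlonglongrightarrow> (C * Bz) * (0 + 0)"
          using lS[OF x, of 0] lS[OF x, of 1] by (intro tendsto_intros) (simp_all add: numeral_2_eq_2 One_nat_def)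
        then have "(\<lambda>n. (C * Bz) * (exp_cut 1 (t n x) + exp_cut 2 (t n x))) \<longlonglongrightarrow> 0" by simp
        then have "(\<lambda>n. e n x) \<longlonglongrightarrow> 0"
          by (rule Lim_null_comparison[rotated]) (use eb[OF x] in simp)
        from tendsto_add[OF this tendsto_mult[OF tendsto_const l0[OF x], of "pderiv i P x"]]
        show "(\<lambda>n. pderiv i (\<phi> n) x) \<longlonglongrightarrow> pderiv i P x" unfolding d\<phi> by simp
        show "\<bar>pderiv i (\<phi> n) x - pderiv i P x\<bar> \<le> C * Bz * 5 + Bd" for n
        proof -
          have "\<bar>e n x\<bar> \<le> C * Bz * 5"
            using eb[OF x, of n] mult_left_mono[OF _ CBz[OF x], of "exp_cut 1 (t n x) + exp_cut 2 (t n x)" 5]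
              exp_cut_1_le[of "t n x"] exp_cut_2_le[of "t n x"] by linarith
          moreover have "\<bar>pderiv i P x * exp_cut 0 (t n x) - pderiv i P x\<bar> \<le> Bd"
            using le1[of "pderiv i P x" "t n x"] Bd[OF x] by linarith
          ultimately show ?thesis unfolding d\<phi> by linarith
        qed
      qed
    qed
  qed
  ultimately have "approx_test \<phi> P (\<lambda>i. pderiv i P)" by (simp add: approx_test_def)
  then show ?thesis using H1_grad_smooth[OF P] by (auto simp: H10_grad_def)
qed

text \<open>On a finite measure uniform closeness is L2 closeness. For each tolerance 1/(n+1) one
  test function close to an approximant is picked, and these form the required sequence.\<close>

lemma H10_closed_uniform:
  assumes f: "H1_grad f g"
    and ex: "\<And>e::real. 0 < e \<Longrightarrow> \<exists>F G. H10_grad F G \<and> (\<forall>x\<in>U. \<bar>F x - f x\<bar> \<le> e \<and> (\<forall>i\<in>{1,2}. \<bar>G i x - g i x\<bar> \<le> e))"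
  shows "H10_grad f g"
proof -
  note h = H1_gradD[OF f]
  have split: "(\<integral>x. (u x - v x)\<^sup>2 \<partial>M) \<le> 2 * (\<integral>x. (u x - w x)\<^sup>2 \<partial>M) + 2 * (e\<^sup>2 * measure M (space M))"
    if s: "sq_integrable M u" "sq_integrable M v" "sq_integrable M w" and b: "\<And>x. x \<in> U \<Longrightarrow> \<bar>w x - v x\<bar> \<le> e" for u v w and e :: real
  proof -
    note i = sq_integrable_diff[OF s(1,2)] sq_integrable_diff[OF s(1,3)]
    have "(\<integral>x. (u x - v x)\<^sup>2 \<partial>M) \<le> (\<integral>x. 2 * (u x - w x)\<^sup>2 + 2 * e\<^sup>2 \<partial>M)"
    proof (rule integral_mono)
      fix x assume "x \<in> space M"
      then have "\<bar>w x - v x\<bar> \<le> \<bar>e\<bar>" using b[of x] by auto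
      then have "(w x - v x)\<^sup>2 \<le> e\<^sup>2" by (simp add: abs_le_square_iff)
      moreover have "(u x - v x)\<^sup>2 \<le> 2 * (u x - w x)\<^sup>2 + 2 * (w x - v x)\<^sup>2"
        using sum_squares_bound[of "u x - w x" "w x - v x"] by (simp add: power2_eq_square algebra_simps)
      ultimately show "(u x - v x)\<^sup>2 \<le> 2 * (u x - w x)\<^sup>2 + 2 * e\<^sup>2" by linarith
    qed (use i in \<open>auto simp: sq_integrable_def\<close>)
    then show ?thesis using i by (simp add: sq_integrable_def mult_ac)
  qed
  define e where "e n = 1 / real (Suc n)" for n
  have e: "0 < e n" for n by (simp add: e_def)
  have e0: "e \<longlonglongrightarrow> 0" unfolding e_def using LIMSEQ_inverse_real_of_nat by (simp add: inverse_eq_divide)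
  let ?Q = "\<lambda>n \<psi>. test_fun U \<psi> \<and> (\<integral>x. (\<psi> x - f x)\<^sup>2 \<partial>M) \<le> 2 * e n + 2 * ((e n)\<^sup>2 * measure M (space M))
    \<and> (\<forall>i\<in>{1,2}. (\<integral>x. (pderiv i \<psi> x - g i x)\<^sup>2 \<partial>M) \<le> 2 * e n + 2 * ((e n)\<^sup>2 * measure M (space M)))"
  have "\<exists>\<psi>. ?Q n \<psi>" for n
  proof -
    obtain F G where FG: "H10_grad F G" "\<And>x. x \<in> U \<Longrightarrow> \<bar>F x - f x\<bar> \<le> e n" "\<And>i x. i \<in> {1,2} \<Longrightarrow> x \<in> U \<Longrightarrow> \<bar>G i x - g i x\<bar> \<le> e n"
      using ex[OF e] by blast
    note k = H1_gradD[OF H10_gradD[OF FG(1)]]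
    obtain \<phi> where \<phi>: "approx_test \<phi> F G" using FG(1) by (auto simp: H10_grad_def)
    note t = approx_testD[OF \<phi>]
    have "\<forall>\<^sub>F m in sequentially. (\<integral>x. (\<phi> m x - F x)\<^sup>2 \<partial>M) < e n \<and> (\<integral>x. (pderiv 1 (\<phi> m) x - G 1 x)\<^sup>2 \<partial>M) < e n \<and> (\<integral>x. (pderiv 2 (\<phi> m) x - G 2 x)\<^sup>2 \<partial>M) < e n"
      using order_tendstoD(2)[OF t(5) e[of n]] order_tendstoD(2)[OF t(6)[of 1] e[of n]] order_tendstoD(2)[OF t(6)[of 2] e[of n]]
      by (intro eventually_conj) auto
    then obtain m where m: "(\<integral>x. (\<phi> m x - F x)\<^sup>2 \<partial>M) < e n" "(\<integral>x. (pderiv 1 (\<phi> m) x - G 1 x)\<^sup>2 \<partial>M) < e n" "(\<integral>x. (pderiv 2 (\<phi> m) x - G 2 x)\<^sup>2 \<partial>M) < e n"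
      by (auto simp: eventually_sequentially)
    have mi: "(\<integral>x. (pderiv i (\<phi> m) x - G i x)\<^sup>2 \<partial>M) < e n" if "i \<in> {1,2}" for i
      using m that by auto
    have "(\<integral>x. (\<phi> m x - f x)\<^sup>2 \<partial>M) \<le> 2 * e n + 2 * ((e n)\<^sup>2 * measure M (space M))"
      using split[OF t(3)[of m] h(1) k(1) FG(2)] m(1) by linarith
    moreover have "(\<integral>x. (pderiv i (\<phi> m) x - g i x)\<^sup>2 \<partial>M) \<le> 2 * e n + 2 * ((e n)\<^sup>2 * measure M (space M))" if i: "i \<in> {1,2}" for i
      using split[OF t(4)[of i m] h(2)[OF i] k(2)[OF i] FG(3)[OF i]] mi[OF i] by linarith
    ultimately show ?thesis using t(1) by blast
  qed
  then have "\<forall>n. \<exists>\<psi>. ?Q n \<psi>" by blast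
  from choice[OF this] obtain \<psi> where Q: "\<And>n. ?Q n (\<psi> n)" by blast
  have \<psi>: "\<And>n. test_fun U (\<psi> n)" "\<And>n. (\<integral>x. (\<psi> n x - f x)\<^sup>2 \<partial>M) \<le> 2 * e n + 2 * ((e n)\<^sup>2 * measure M (space M))"
    "\<And>n i. i \<in> {1,2} \<Longrightarrow> (\<integral>x. (pderiv i (\<psi> n) x - g i x)\<^sup>2 \<partial>M) \<le> 2 * e n + 2 * ((e n)\<^sup>2 * measure M (space M))"
    using Q by blast+
  have "(\<lambda>n. 2 * e n + 2 * ((e n)\<^sup>2 * measure M (space M))) \<longlonglongrightarrow> 2 * 0 + 2 * (0\<^sup>2 * measure M (space M))"
    by (intro tendsto_intros e0)
  then have l: "(\<lambda>n. 2 * e n + 2 * ((e n)\<^sup>2 * measure M (space M))) \<longlonglongrightarrow> 0" by simp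
  have sq0: "X \<longlonglongrightarrow> 0" if "\<And>n. 0 \<le> X n" "\<And>n. X n \<le> 2 * e n + 2 * ((e n)\<^sup>2 * measure M (space M))" for X :: "nat \<Rightarrow> real"
    by (rule tendsto_sandwich[OF _ _ tendsto_const l]) (use that in auto)
  have "approx_test \<psi> f g"
    unfolding approx_test_def using \<psi> by (auto intro!: sq0 integral_nonneg_AE)
  then show ?thesis using f by (auto simp: H10_grad_def)
qed

end

context annulus_domain
begin

lemma ac_increment_le:
  assumes F: "ac F \<phi>" and b: "\<And>t. t \<in> {1..R} \<Longrightarrow> \<bar>\<phi> t\<bar> \<le> e" and \<rho>: "\<rho> \<in> {1..R}"
  shows "\<bar>F \<rho> - F 1\<bar> \<le> e * (R - 1)"
proof -
  have e: "0 \<le> e" using b[of 1] R by auto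
  have "F \<rho> - F 1 = (LINT t:{1..\<rho>}|lborel. \<phi> t)" using acD(2)[OF F \<rho>] by simp
  also have "\<bar>\<dots>\<bar> \<le> (\<integral>t. \<bar>indicator {1..\<rho>} t *\<^sub>R \<phi> t\<bar> \<partial>lborel)"
    unfolding set_lebesgue_integral_def by (rule integral_abs_bound)
  also have "\<dots> \<le> (\<integral>t. indicator {1..R} t *\<^sub>R e \<partial>lborel)"
  proof (rule integral_mono)
    show "integrable lborel (\<lambda>t. \<bar>indicator {1..\<rho>} t *\<^sub>R \<phi> t\<bar>)"
      using acD(3)[OF F \<rho>] unfolding set_integrable_def by (rule integrable_abs)
    show "\<bar>indicator {1..\<rho>} t *\<^sub>R \<phi> t\<bar> \<le> indicator {1..R} t *\<^sub>R e" for t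
      using b[of t] e \<rho> by (auto simp: indicator_def)
    show "integrable lborel (\<lambda>t. indicator {1..R} t *\<^sub>R e)"
      using R by (intro integrable_scaleR_left integrable_real_indicator) auto
  qed
  also have "\<dots> = e * (R - 1)" using R by simp
  finally show ?thesis .
qed

lemma norm_sq: "(fst x)\<^sup>2 + (snd x)\<^sup>2 = (norm x)\<^sup>2" for x :: "real \<times> real"
  by (cases x) (simp add: norm_Pair)

text \<open>With s = |x|^2, the mean value theorem bounds |P s| by a multiple of s - 1 and of R^2 -
  s, hence by a multiple of their product. That product is smooth in \<open>x\<close> and positive
  exactly on the annulus, so \<open>cutoff_H10\<close> applies.\<close>

lemma polynomial_radial_H10:
  assumes p: "\<And>s::real. (P has_real_derivative P' s) (at s)" and P: "smooth_fun (\<lambda>x. P ((fst x)\<^sup>2 + (snd x)\<^sup>2))"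
    and c: "continuous_on UNIV P'" and z: "P 1 = 0" "P (R\<^sup>2) = 0"
  shows "H10_grad (\<lambda>x. P ((norm x)\<^sup>2)) (\<lambda>i x. P' ((norm x)\<^sup>2) * (2 * coord i x))"
proof -
  let ?P = "\<lambda>x. P ((fst x)\<^sup>2 + (snd x)\<^sup>2)"
  let ?z = "\<lambda>x::real \<times> real. ((fst x)\<^sup>2 + (snd x)\<^sup>2 - 1) * (R\<^sup>2 - ((fst x)\<^sup>2 + (snd x)\<^sup>2))"
  let ?T = "R\<^sup>2 - 1"
  have T: "0 < ?T" using R by simp
  have "compact (P' ` {1..R\<^sup>2})" by (intro compact_continuous_image continuous_on_subset[OF c]) auto
  then obtain L where "\<forall>y\<in>P' ` {1..R\<^sup>2}. norm y \<le> L"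
    using compact_imp_bounded[of "P' ` {1..R\<^sup>2}"] unfolding bounded_iff by blast
  then have L: "\<bar>P' s\<bar> \<le> L" if "s \<in> {1..R\<^sup>2}" for s using that by auto
  have mv: "\<bar>P b - P a\<bar> \<le> L * (b - a)" if ab: "a < b" "1 \<le> a" "b \<le> R\<^sup>2" for a b
  proof -
    obtain y where y: "a < y" "y < b" "P b - P a = (b - a) * P' y"
      using MVT2[OF ab(1), of P P'] p by blast
    then show ?thesis using L[of y] ab by (auto simp: abs_mult mult.commute intro!: mult_right_mono)
  qed
  have U: "x \<in> annulus R \<longleftrightarrow> 0 < ?z x" for x
  proof -
    \<comment> \<open>The two factors cannot both be negative, as s < 1 and s > R^2 exclude each
      other.\<close>
    have "0 < ?z x \<longleftrightarrow> 1 < (norm x)\<^sup>2 \<and> (norm x)\<^sup>2 < R\<^sup>2"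
      unfolding norm_sq using T by (auto simp: zero_less_mult_iff)
    also have "1 < (norm x)\<^sup>2 \<longleftrightarrow> 1 < norm x"
      using power2_less_imp_less[of 1 "norm x"] power_strict_mono[of 1 "norm x" 2] by auto
    also have "(norm x)\<^sup>2 < R\<^sup>2 \<longleftrightarrow> norm x < R"
      using power2_less_imp_less[of "norm x" R] power_strict_mono[of "norm x" R 2] R by auto
    finally show ?thesis by (simp add: annulus_def)
  qed
  have H: "H10_grad ?P (\<lambda>i. pderiv i ?P)"
  proof (rule cutoff_H10[where z = ?z and C = "2 * L / ?T"])
    show "smooth_fun ?z" by (intro smooth_fun_intros smooth_fun_diff smooth_fun_power)
    show "x \<in> annulus R \<longleftrightarrow> 0 < ?z x" for x by (rule U)
    show "smooth_fun ?P" by (rule P)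
    fix x assume x: "x \<in> annulus R"
    define s where "s = (fst x)\<^sup>2 + (snd x)\<^sup>2"
    have s: "1 < s" "s < R\<^sup>2"
      using x U[of x] T unfolding s_def[symmetric] by (auto simp: zero_less_mult_iff)
    have 1: "\<bar>P s\<bar> \<le> L * (s - 1)" using mv[of 1 s] s z by simp
    have 2: "\<bar>P s\<bar> \<le> L * (R\<^sup>2 - s)" using mv[of s "R\<^sup>2"] s z by simp
    \<comment> \<open>R^2 - 1 is split as (s - 1) + (R^2 - s), and each part is combined with the
      bound coming from the opposite end; this turns the minimum of two linear bounds into their
      product.\<close>
    have "\<bar>P s\<bar> * ?T = \<bar>P s\<bar> * (s - 1) + \<bar>P s\<bar> * (R\<^sup>2 - s)" by (simp add: algebra_simps)
    also have "\<dots> \<le> L * (R\<^sup>2 - s) * (s - 1) + L * (s - 1) * (R\<^sup>2 - s)"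
      using 1 2 s by (intro add_mono mult_right_mono) auto
    also have "\<dots> = 2 * L * ((s - 1) * (R\<^sup>2 - s))" by (simp add: algebra_simps)
    finally have "\<bar>P s\<bar> \<le> 2 * L * ((s - 1) * (R\<^sup>2 - s)) / ?T" using T by (simp add: pos_le_divide_eq)
    then show "\<bar>P ((fst x)\<^sup>2 + (snd x)\<^sup>2)\<bar> \<le> 2 * L / ?T * ?z x" unfolding s_def[symmetric] by simp
  qed
  have "pderiv i ?P = (\<lambda>x. P' ((norm x)\<^sup>2) * (2 * coord i x))" for i
  proof
    fix x :: "real \<times> real"
    have "((\<lambda>x. (fst x)\<^sup>2 + (snd x)\<^sup>2) has_derivative (\<lambda>h. 2 * fst x * fst h + 2 * snd x * snd h)) (at x)"
      by (auto intro!: derivative_eq_intros)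
    from pderiv_eqI[OF DERIV_compose_FDERIV[OF p this], of i]
    show "pderiv i ?P x = P' ((norm x)\<^sup>2) * (2 * coord i x)"
      unfolding norm_sq by (auto simp: ebasis_def coord_def)
  qed
  with H show ?thesis unfolding norm_sq by simp
qed

text \<open>In the variable \<open>s = \<rho>\<^sup>2\<close> a polynomial profile is a smooth function of the plane, so that
  Weierstrass' theorem provides approximants which the cutoff makes into test functions.\<close>
lemma radial_H10:
  assumes k: "ac k k'" and c: "continuous_on {1..R} k'" and z: "k 1 = 0" "k R = 0"
  shows "H10_grad (\<lambda>x. k (norm x)) (\<lambda>i x. k' (norm x) * (coord i x / norm x))"
proof (rule H10_closed_uniform)
  show "H1_grad (\<lambda>x. k (norm x)) (\<lambda>i x. k' (norm x) * (coord i x / norm x))"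
    by (intro ac_radial_H1 k borel_integrable_atLeastAtMost' continuous_intros c)
  fix e :: real assume "0 < e"
  \<comment> \<open>The final errors will be 2 d (R - 1) for the values and 3 d for the
    gradient.\<close>
  define d where "d = min (e / (2 * R)) (e / 3)"
  have d: "0 < d" "2 * d * (R - 1) \<le> e" "3 * d \<le> e"
  proof -
    show "0 < d" using \<open>0 < e\<close> R by (simp add: d_def)
    have "d \<le> e / (2 * R)" by (simp add: d_def)
    then have "2 * d * R \<le> e" using R by (simp add: field_simps)
    then show "2 * d * (R - 1) \<le> e" using \<open>0 < d\<close> by (simp add: algebra_simps)
    show "3 * d \<le> e" by (simp add: d_def min_def)
  qed
  \<comment> \<open>The derivative of k(sqrt s) with respect to s, so that k' t = 2 t
    \<kappa>(t^2).\<close>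
  define \<kappa> where "\<kappa> s = k' (sqrt s) / (2 * sqrt s)" for s
  have cs: "continuous_on {1..R\<^sup>2} \<kappa>"
    unfolding \<kappa>_def
  proof (intro continuous_intros continuous_on_compose2[OF c])
    show "sqrt ` {1..R\<^sup>2} \<subseteq> {1..R}" using R real_sqrt_le_mono[of _ "R\<^sup>2"] by fastforce
  qed auto
  have "0 < d / (2 * R)" using d R by simp
  from Stone_Weierstrass_real_polynomial_function[OF compact_Icc cs this]
  obtain p where p: "real_polynomial_function p" "\<And>s. s \<in> {1..R\<^sup>2} \<Longrightarrow> \<bar>\<kappa> s - p s\<bar> < d / (2 * R)" by auto
  obtain a n where an: "p = (\<lambda>s. \<Sum>i\<le>n. a i * s ^ i)"
    using p(1) real_polynomial_function_iff_sum[of p] by blast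
  define P0 where "P0 s = (\<Sum>i\<le>n. a i * (s ^ Suc i - 1) / real (Suc i))" for s
  have dP0: "(P0 has_real_derivative p s) (at s)" for s
  proof -
    have "((\<lambda>s. a i * (s ^ Suc i - 1) / real (Suc i)) has_real_derivative a i * s ^ i) (at s)" for i
    proof -
      have "((\<lambda>s. s ^ Suc i) has_real_derivative real (Suc i) * s ^ i) (at s)"
        using DERIV_pow[of "Suc i" s] by simp
      from DERIV_cmult[OF DERIV_diff[OF this DERIV_const[of 1]], of "a i / real (Suc i)"]
      show ?thesis by (simp del: of_nat_Suc)
    qed
    then show ?thesis unfolding P0_def[abs_def] an by (intro DERIV_sum)
  qed
  \<comment> \<open>Subtracting D (s - 1) restores the zero at s = R^2 without disturbing the one at
    s = 1. \<open>D\<close> is small because \<open>P0\<close> at R^2 is close to k R = 0.\<close>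
  define D where "D = P0 (R\<^sup>2) / (R\<^sup>2 - 1)"
  define P where "P s = P0 s - D * (s - 1)" for s
  have dP: "(P has_real_derivative p s - D) (at s)" for s
    unfolding P_def by (auto intro!: derivative_eq_intros dP0)
  have R2: "R\<^sup>2 - 1 = (R - 1) * (R + 1)" by (simp add: power2_eq_square algebra_simps)
  have Rpos: "0 < R\<^sup>2 - 1" using R by simp
  have cp: "continuous_on S p" for S unfolding an by (intro continuous_intros)
  have diff: "\<bar>2 * t * p (t\<^sup>2) - k' t\<bar> \<le> d" if t: "t \<in> {1..R}" for t
  proof -
    have "t\<^sup>2 \<in> {1..R\<^sup>2}" using t power_mono[of 1 t 2] power_mono[of t R 2] by auto
    then have "\<bar>k' t / (2 * t) - p (t\<^sup>2)\<bar> < d / (2 * R)" using p(2)[of "t\<^sup>2"] t by (simp add: \<kappa>_def)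
    then have "(2 * t) * \<bar>k' t / (2 * t) - p (t\<^sup>2)\<bar> \<le> (2 * R) * (d / (2 * R))"
      using t by (intro mult_mono) auto
    moreover have "(2 * t) * \<bar>k' t / (2 * t) - p (t\<^sup>2)\<bar> = \<bar>k' t - 2 * t * p (t\<^sup>2)\<bar>"
    proof -
      have "(2 * t) * \<bar>k' t / (2 * t) - p (t\<^sup>2)\<bar> = \<bar>(2 * t) * (k' t / (2 * t) - p (t\<^sup>2))\<bar>"
        using t by (simp add: abs_mult)
      also have "(2 * t) * (k' t / (2 * t) - p (t\<^sup>2)) = k' t - 2 * t * p (t\<^sup>2)"
        using t by (simp add: right_diff_distrib)
      finally show ?thesis .
    qed
    ultimately show ?thesis using R by (simp add: abs_minus_commute)
  qed
  have ac0: "ac (\<lambda>t. P0 (t\<^sup>2) + (-1) * k t) (\<lambda>t. 2 * t * p (t\<^sup>2) + (-1) * k' t)"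
  proof (intro ac_add ac_cmult k ac_C1)
    fix t
    have "((\<lambda>t. P0 (t\<^sup>2)) has_real_derivative p (t\<^sup>2) * (2 * t)) (at t)"
      by (rule DERIV_chain2[OF dP0]) (auto intro!: derivative_eq_intros)
    then show "((\<lambda>t. P0 (t\<^sup>2)) has_real_derivative 2 * t * p (t\<^sup>2)) (at t)" by (simp add: mult_ac)
  next
    show "continuous_on {1..R} (\<lambda>t. 2 * t * p (t\<^sup>2))"
      by (intro continuous_intros continuous_on_compose2[OF cp[of UNIV]]) auto
  qed
  have P01: "P0 1 = 0" by (simp add: P0_def)
  have close0: "\<bar>P0 (t\<^sup>2) - k t\<bar> \<le> d * (R - 1)" if "t \<in> {1..R}" for t
    using ac_increment_le[OF ac0 _ that, of d] diff P01 z by simp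
  have D: "\<bar>D\<bar> \<le> d / (R + 1)"
  proof -
    have "\<bar>P0 (R\<^sup>2)\<bar> \<le> d * (R - 1)" using close0[of R] z R by simp
    then have "\<bar>D\<bar> \<le> d * (R - 1) / ((R - 1) * (R + 1))"
      unfolding D_def R2[symmetric] using Rpos by (simp add: abs_divide divide_right_mono)
    then show ?thesis using R by simp
  qed
  have H: "H10_grad (\<lambda>x. P ((norm x)\<^sup>2)) (\<lambda>i x. (p ((norm x)\<^sup>2) - D) * (2 * coord i x))"
  proof (rule polynomial_radial_H10[OF dP])
    show "smooth_fun (\<lambda>x. P ((fst x)\<^sup>2 + (snd x)\<^sup>2))"
      unfolding P_def P0_def times_divide_eq_right[symmetric] divide_inverse
      by (intro smooth_fun_diff smooth_fun_sum smooth_fun_intros smooth_fun_power)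
    show "continuous_on UNIV (\<lambda>s. p s - D)" by (intro continuous_intros cp)
    show "P 1 = 0" by (simp add: P_def P01)
    show "P (R\<^sup>2) = 0" using Rpos by (simp add: P_def D_def)
  qed
  have "\<bar>P ((norm x)\<^sup>2) - k (norm x)\<bar> \<le> e \<and>
      (\<forall>i\<in>{1,2}. \<bar>(p ((norm x)\<^sup>2) - D) * (2 * coord i x) - k' (norm x) * (coord i x / norm x)\<bar> \<le> e)"
    if x: "x \<in> annulus R" for x
  proof
    define t where "t = norm x"
    have t: "t \<in> {1..R}" using annulus_norm(1)[OF x] by (simp add: t_def)
    have t2: "t\<^sup>2 \<le> R\<^sup>2" "1 \<le> t\<^sup>2" using t power_mono[of 1 t 2] power_mono[of t R 2] by auto
    have "\<bar>D * (t\<^sup>2 - 1)\<bar> \<le> d / (R + 1) * ((R - 1) * (R + 1))"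
      unfolding abs_mult using D t2 R d by (intro mult_mono) (auto simp: R2[symmetric])
    also have "\<dots> = d * (R - 1)" using R by simp
    finally have "\<bar>P (t\<^sup>2) - k t\<bar> \<le> 2 * d * (R - 1)"
      using close0[OF t] unfolding P_def by linarith
    then show "\<bar>P ((norm x)\<^sup>2) - k (norm x)\<bar> \<le> e" using d unfolding t_def by linarith
    show "\<forall>i\<in>{1,2}. \<bar>(p ((norm x)\<^sup>2) - D) * (2 * coord i x) - k' (norm x) * (coord i x / norm x)\<bar> \<le> e"
    proof
      fix i :: nat
      have "(p (t\<^sup>2) - D) * (2 * coord i x) - k' t * (coord i x / t) = ((2 * t * p (t\<^sup>2) - k' t) - 2 * t * D) * (coord i x / t)"
        using t by (simp add: algebra_simps)
      also have "\<bar>\<dots>\<bar> \<le> \<bar>(2 * t * p (t\<^sup>2) - k' t) - 2 * t * D\<bar>"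
        unfolding abs_mult using norm_ratio[OF x, of i] by (intro mult_left_le) (auto simp: t_def)
      also have "\<dots> \<le> d + 2 * d"
      proof -
        have "\<bar>2 * t * D\<bar> \<le> (2 * (R + 1)) * (d / (R + 1))"
          unfolding abs_mult using D t R d by (intro mult_mono) auto
        also have "\<dots> = 2 * d" using R by (simp add: field_simps)
        finally show ?thesis using diff[OF t] by linarith
      qed
      finally show "\<bar>(p ((norm x)\<^sup>2) - D) * (2 * coord i x) - k' (norm x) * (coord i x / norm x)\<bar> \<le> e"
        using d unfolding t_def by linarith
    qed
  qed
  with H show "\<exists>F G. H10_grad F G \<and> (\<forall>x\<in>annulus R. \<bar>F x - k (norm x)\<bar> \<le> e \<and> (\<forall>i\<in>{1,2}. \<bar>G i x - k' (norm x) * (coord i x / norm x)\<bar> \<le> e))"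
    by blast
qed

end

section \<open>From explicit weak gradients to strong solutions\<close>

context bounded_open
begin

lemma H1_grad_eqI:
  assumes "H1_grad f g" "\<And>x. x \<in> U \<Longrightarrow> f x = f' x" "\<And>i x. i \<in> {1,2} \<Longrightarrow> x \<in> U \<Longrightarrow> g i x = g' i x"
  shows "H1_grad f' g'"
proof (rule H1_grad_cong[OF assms(1)])
  show "AE x in M. f x = f' x" "\<And>i. i \<in> {1,2} \<Longrightarrow> AE x in M. g i x = g' i x"
    using assms by (auto intro!: AE_I2)
  show "f' \<in> borel_measurable M"
    using sq_integrable_measurable[OF H1_gradD(1)[OF assms(1)]] assms(2) by (subst measurable_cong[where g = f]) auto
  show "g' i \<in> borel_measurable M" if i: "i \<in> {1,2}" for i
    using sq_integrable_measurable[OF H1_gradD(2)[OF assms(1) i]] assms(3)[OF i] by (subst measurable_cong[where g = "g i"]) auto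
qed

text \<open>\<open>H2\<close> provides some weak derivative with a weak gradient, while
  \<open>strong_solution\<close> differentiates the chosen one a second time; both agree almost
  everywhere, so the gradient can be carried over.\<close>

lemma H1_grad_transfer:
  assumes f: "H1_grad f g" and g: "H1_grad (g i) h" and i: "i \<in> {1,2}"
  shows "H1_grad (weak_pderiv U i f) h"
proof (rule H1_grad_cong[OF g])
  show "AE x in M. g i x = weak_pderiv U i f x"
    using weak_pderiv_is_weak(2)[OF H1_gradD(3)[OF f i]] by eventually_elim simp
  show "weak_pderiv U i f \<in> borel_measurable M"
    using H1_gradD(2)[OF H1_grad_weak_pderiv[OF f] i] by (rule sq_integrable_measurable)
  show "h k \<in> borel_measurable M" if "k \<in> {1,2}" for k
    using H1_gradD(2)[OF g that] by (rule sq_integrable_measurable)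
qed simp

lemma H2_iff: "H2 U f \<longleftrightarrow> (\<exists>g h. H1_grad f g \<and> (\<forall>i\<in>{1,2}. H1_grad (g i) (h i)))"
proof
  assume "H2 U f"
  then have L: "sq_integrable M f" and "\<forall>i\<in>{1,2}. \<exists>g. (\<exists>h. H1_grad g h) \<and> is_weak_pderiv U i f g"
    by (auto simp: H2_def L2_iff[OF open_U] H1_iff)
  then obtain g h where "\<forall>i\<in>{1,2}. H1_grad (g i) (h i) \<and> is_weak_pderiv U i f (g i)" by metis
  then show "\<exists>g h. H1_grad f g \<and> (\<forall>i\<in>{1,2}. H1_grad (g i) (h i))"
    using L by (intro exI[of _ g] exI[of _ h]) (auto simp: H1_grad_def)
next
  assume "\<exists>g h. H1_grad f g \<and> (\<forall>i\<in>{1,2}. H1_grad (g i) (h i))"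
  then obtain g h where gh: "H1_grad f g" "\<And>i. i \<in> {1,2} \<Longrightarrow> H1_grad (g i) (h i)" by blast
  have "\<exists>g. H1 U g \<and> is_weak_pderiv U i f g" if i: "i \<in> {1,2}" for i
    using gh(2)[OF i] H1_gradD(3)[OF gh(1) i] H1_iff by blast
  then show "H2 U f" using H1_gradD(1)[OF gh(1)] by (simp add: H2_def L2_iff[OF open_U])
qed

end

context annulus_domain
begin

lemma strong_imp_ns:
  assumes s: "strong_solution R \<omega> f u p"
  shows "ns_data (\<lambda>j x. coord j (u x)) (\<lambda>j i. weak_pderiv (annulus R) i (\<lambda>x. coord j (u x)))
    (\<lambda>j i k. weak_pderiv (annulus R) k (weak_pderiv (annulus R) i (\<lambda>x. coord j (u x)))) p (\<lambda>j. weak_pderiv (annulus R) j p)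
    (\<lambda>j x. coord j (f x)) (\<lambda>j x. coord j (bdry_ext R \<omega> x))"
proof -
  let ?U = "annulus R" and ?u = "\<lambda>j x. coord j (u x)"
  have S: "\<forall>j\<in>{1,2}. H2 ?U (?u j)" "H1 ?U p"
    "\<forall>j\<in>{1,2}. AE x in lebesgue. x \<in> ?U \<longrightarrow>
          - (\<Sum>i\<in>{1,2}. weak_pderiv ?U i (weak_pderiv ?U i (?u j)) x)
          + (\<Sum>i\<in>{1,2}. ?u i x * weak_pderiv ?U i (?u j) x)
          + weak_pderiv ?U j p x = coord j (f x)"
    "AE x in lebesgue. x \<in> ?U \<longrightarrow> (\<Sum>i\<in>{1,2}. weak_pderiv ?U i (?u i) x) = 0"
    "\<forall>j\<in>{1,2}. H1_0 ?U (\<lambda>x. ?u j x - coord j (bdry_ext R \<omega> x))"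
    using s unfolding strong_solution_def Let_def by blast+
  have H: "H1_grad (?u j) (\<lambda>i. weak_pderiv ?U i (?u j))"
    "i \<in> {1,2} \<Longrightarrow> H1_grad (weak_pderiv ?U i (?u j)) (\<lambda>k. weak_pderiv ?U k (weak_pderiv ?U i (?u j)))"
    if j: "j \<in> {1,2}" for i j
  proof -
    obtain g h where gh: "H1_grad (?u j) g" "\<And>i. i \<in> {1,2} \<Longrightarrow> H1_grad (g i) (h i)"
      using S(1) j H2_iff by blast
    show "H1_grad (?u j) (\<lambda>i. weak_pderiv ?U i (?u j))" by (rule H1_grad_weak_pderiv[OF gh(1)])
    show "H1_grad (weak_pderiv ?U i (?u j)) (\<lambda>k. weak_pderiv ?U k (weak_pderiv ?U i (?u j)))" if "i \<in> {1,2}"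
      by (rule H1_grad_weak_pderiv[OF H1_grad_transfer[OF gh(1) gh(2)[OF that] that]])
  qed
  show ?thesis
    unfolding ns_data_def
  proof (intro conjI)
    show "H1_grad p (\<lambda>j. weak_pderiv ?U j p)" using S(2) H1_iff H1_grad_weak_pderiv by blast
    show "AE x in M. weak_pderiv ?U 1 (?u 1) x + weak_pderiv ?U 2 (?u 2) x = 0"
      using S(4) unfolding AE_lebesgue_on[OF U_sets] sum_12 .
    show "\<forall>j\<in>{1,2}. AE x in M. - (weak_pderiv ?U 1 (weak_pderiv ?U 1 (?u j)) x + weak_pderiv ?U 2 (weak_pderiv ?U 2 (?u j)) x)
       + (?u 1 x * weak_pderiv ?U 1 (?u j) x + ?u 2 x * weak_pderiv ?U 2 (?u j) x) + weak_pderiv ?U j p x = coord j (f x)"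
      using S(3) unfolding AE_lebesgue_on[OF U_sets] sum_12 .
  qed (use H S(5) in blast)+
qed

lemma ns_imp_strong:
  assumes n: "ns_data (\<lambda>j x. coord j (u x)) du ddu p dp (\<lambda>j x. coord j (f x)) (\<lambda>j x. coord j (bdry_ext R \<omega> x))"
  shows "strong_solution R \<omega> f u p"
proof -
  let ?U = "annulus R" and ?u = "\<lambda>j x. coord j (u x)"
  note d = ns_dataD[OF n]
  have e1: "AE x in M. weak_pderiv ?U i (?u j) x = du j i x" if "j \<in> {1,2}" "i \<in> {1,2}" for i j
    by (rule weak_pderiv_is_weak(2)[OF H1_gradD(3)[OF d(1)[OF that(1)] that(2)]])
  have e2: "AE x in M. weak_pderiv ?U i (weak_pderiv ?U i (?u j)) x = ddu j i i x" if "j \<in> {1,2}" "i \<in> {1,2}" for i j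
    by (rule weak_pderiv_is_weak(2)[OF H1_gradD(3)[OF H1_grad_transfer[OF d(1)[OF that(1)] d(2)[OF that] that(2)] that(2)]])
  have e3: "AE x in M. weak_pderiv ?U j p x = dp j x" if "j \<in> {1,2}" for j
    by (rule weak_pderiv_is_weak(2)[OF H1_gradD(3)[OF d(3) that]])
  have "\<forall>j\<in>{1,2}. H2 ?U (?u j)"
  proof
    fix j :: nat assume j: "j \<in> {1,2}"
    have "H1_grad (?u j) (du j) \<and> (\<forall>i\<in>{1,2}. H1_grad (du j i) (ddu j i))" using d(1)[OF j] d(2)[OF j] by simp
    then show "H2 ?U (?u j)" unfolding H2_iff by (intro exI)
  qed
  moreover have "H1 ?U p" using d(3) H1_iff by blast
  moreover have "AE x in lebesgue. x \<in> ?U \<longrightarrow>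
          - (\<Sum>i\<in>{1,2}. weak_pderiv ?U i (weak_pderiv ?U i (?u j)) x)
          + (\<Sum>i\<in>{1,2}. ?u i x * weak_pderiv ?U i (?u j) x)
          + weak_pderiv ?U j p x = coord j (f x)" if j: "j \<in> {1,2}" for j
    unfolding AE_lebesgue_on[OF U_sets] sum_12
    using d(4)[OF j] e2[OF j, of 1, simplified] e2[OF j, of 2, simplified] e1[OF j, of 1, simplified] e1[OF j, of 2, simplified] e3[OF j]
    by eventually_elim simp
  moreover have "AE x in lebesgue. x \<in> ?U \<longrightarrow> (\<Sum>i\<in>{1,2}. weak_pderiv ?U i (?u i) x) = 0"
    unfolding AE_lebesgue_on[OF U_sets] sum_12
    using d(5) e1[of 1 1, simplified] e1[of 2 2, simplified] by eventually_elim simp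
  ultimately show ?thesis
    unfolding strong_solution_def Let_def using d(6) by blast
qed

lemma connected_annulus_domain: "connected (annulus R)"
  using connected_annulus(1)[of 1 "0::real \<times> real" R] by (simp add: annulus_def)

lemma norm_rot: "norm (rot t x) = norm x"
proof -
  have "(norm (rot t x))\<^sup>2 = (cos t * fst x - sin t * snd x)\<^sup>2 + (sin t * fst x + cos t * snd x)\<^sup>2"
    unfolding norm_sq[symmetric] by (simp add: rot_def)
  also have "\<dots> = ((cos t)\<^sup>2 + (sin t)\<^sup>2) * ((fst x)\<^sup>2 + (snd x)\<^sup>2)"
    by algebra
  also have "\<dots> = (norm x)\<^sup>2" by (simp add: norm_sq)
  finally show ?thesis by (rule power2_eq_imp_eq) auto
qed

section \<open>Square-integrable profiles on the interval\<close>

abbreviation "I \<equiv> restrict_space lborel {1..R}"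

lemma set_integrable_I: "set_integrable lborel {1..R} \<phi> \<longleftrightarrow> integrable I \<phi>" for \<phi> :: "real \<Rightarrow> real"
  by (simp add: set_integrable_def integrable_restrict_space)

lemma integral_I: "(LINT t:{1..R}|lborel. \<phi> t) = integral\<^sup>L I \<phi>" for \<phi> :: "real \<Rightarrow> real"
  by (simp add: set_lebesgue_integral_def integral_restrict_space)

lemma measurable_I: "set_borel_measurable lborel {1..R} \<phi> \<longleftrightarrow> \<phi> \<in> borel_measurable I" for \<phi> :: "real \<Rightarrow> real"
  by (simp add: set_borel_measurable_def borel_measurable_restrict_space_iff)

lemma space_I [simp]: "space I = {1..R}"
  by (simp add: space_restrict_space)

lemma finite_measure_I: "finite_measure I"
proof
  show "emeasure I (space I) \<noteq> \<infinity>" using R by (simp add: emeasure_restrict_space)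
qed

lemma continuous_bounded_I:
  fixes H :: "real \<Rightarrow> real"
  assumes H: "continuous_on {1..R} H"
  obtains B where "\<And>t. t \<in> {1..R} \<Longrightarrow> \<bar>H t\<bar> \<le> B"
proof -
  have "compact (H ` {1..R})" using H by (intro compact_continuous_image) auto
  then obtain B where "\<forall>y\<in>H ` {1..R}. norm y \<le> B" using compact_imp_bounded[of "H ` {1..R}"] unfolding bounded_iff by blast
  then show ?thesis by (intro that[of B]) auto
qed

lemma continuous_measurable_I: "continuous_on {1..R} H \<Longrightarrow> H \<in> borel_measurable I" for H :: "real \<Rightarrow> real"
  using borel_integrable_atLeastAtMost'[of 1 R H] unfolding set_integrable_I by auto

lemma sq_integrable_I_mult:
  fixes H :: "real \<Rightarrow> real"
  assumes "sq_integrable I \<phi>" and H: "continuous_on {1..R} H"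
  shows "sq_integrable I (\<lambda>t. H t * \<phi> t)"
proof -
  obtain B where B: "\<And>t. t \<in> {1..R} \<Longrightarrow> \<bar>H t\<bar> \<le> B" using continuous_bounded_I[OF H] by blast
  show ?thesis
    by (rule sq_integrable_bounded_mult[OF assms(1) continuous_measurable_I[OF H], of B]) (use B in \<open>auto intro!: AE_I2\<close>)
qed

lemma sq_integrable_I_continuous:
  fixes H :: "real \<Rightarrow> real"
  assumes H: "continuous_on {1..R} H"
  shows "sq_integrable I H"
proof -
  interpret N: finite_measure I by (rule finite_measure_I)
  obtain B where B: "\<And>t. t \<in> {1..R} \<Longrightarrow> \<bar>H t\<bar> \<le> B" using continuous_bounded_I[OF H] by blast
  show ?thesis
    by (rule N.sq_integrable_bounded[OF continuous_measurable_I[OF H], of B]) (use B in \<open>auto intro!: AE_I2\<close>)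
qed

lemma sq_integrable_I_integrable: "sq_integrable I \<phi> \<Longrightarrow> set_integrable lborel {1..R} \<phi>"
  unfolding set_integrable_I using finite_measure.sq_integrable_integrable[OF finite_measure_I] .

lemma radial_bounded:
  fixes H :: "real \<Rightarrow> real"
  assumes "continuous_on {1..R} H"
  obtains B where "\<And>x. x \<in> annulus R \<Longrightarrow> \<bar>H (norm x)\<bar> \<le> B"
  using continuous_bounded_I[OF assms] annulus_norm(1) by metis

end

section \<open>The Couette flow\<close>

locale couette = annulus_domain R for R :: real +
  fixes \<omega> :: real and fr ft :: "real \<Rightarrow> real"
  assumes \<omega>: "0 \<le> \<omega>" and fr: "sq_integrable (restrict_space lborel {1..R}) fr"
    and ft: "sq_integrable (restrict_space lborel {1..R}) ft"
begin

abbreviation "A \<equiv> A_R R \<omega> ft"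

definition F0 where "F0 t = (LINT s:{1..t}|lborel. ft s)"
definition F2 where "F2 t = (LINT s:{1..t}|lborel. s\<^sup>2 * ft s)"
definition h where "h t = A * (1 - 1 / t\<^sup>2) - F0 t / 2 + F2 t / (2 * t\<^sup>2)"
definition m where "m t = (2 * A - F2 t) / t ^ 4"
text \<open>The derivative of \<open>m\<close> divided by the radius, as \<open>m\<close> is that of
  \<open>h\<close>. With this division the gradient of h(|x|) is m(|x|) x and that of m(|x|) is
  n(|x|) x, so polynomials in the coordinates are the only other factors.\<close>

definition n where "n t = - (ft t / t ^ 3 + 4 * m t / t\<^sup>2)"

lemma g_prof_h: "t \<noteq> 0 \<Longrightarrow> g_prof R \<omega> ft t = t * h t"
  by (simp add: g_prof_def h_def F0_def F2_def field_simps power2_eq_square)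

lemma ac_F0: "ac F0 ft"
  unfolding F0_def[abs_def] by (rule ac_primitive[OF sq_integrable_I_integrable[OF ft]])

lemma ac_F2: "ac F2 (\<lambda>t. t\<^sup>2 * ft t)"
  unfolding F2_def[abs_def]
  by (intro ac_primitive sq_integrable_I_integrable sq_integrable_I_mult ft continuous_intros)

lemma F_1: "F0 1 = 0" "F2 1 = 0"
  using acD(2)[OF ac_F0, of 1] acD(2)[OF ac_F2, of 1] R unfolding F0_def F2_def by auto

lemma inverse_power_derivative:
  assumes "t \<noteq> 0"
  shows "((\<lambda>t::real. 1 / t ^ k) has_real_derivative - real k / t ^ Suc k) (at t)"
proof -
  have "((\<lambda>t. 1 / t ^ k) has_real_derivative - (real k * t ^ (k - 1)) / (t ^ k * t ^ k)) (at t)"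
    using assms by (auto intro!: derivative_eq_intros simp: One_nat_def)
  moreover have "- (real k * t ^ (k - 1)) / (t ^ k * t ^ k) = - real k / t ^ Suc k"
    using assms by (cases k) (auto simp: field_simps)
  ultimately show ?thesis by simp
qed

lemma continuous_inverse_power: "continuous_on {1..R} (\<lambda>t. c / t ^ k)"
  by (intro continuous_intros) auto

lemma ac_inverse_power: "ac (\<lambda>t. 1 / t ^ k) (\<lambda>t. - real k / t ^ Suc k)"
  by (intro ac_C1 inverse_power_derivative continuous_inverse_power) auto

lemma ac_const: "ac (\<lambda>t. c) (\<lambda>t. 0)"
  by (intro ac_C1) auto

text \<open>The two terms containing \<open>ft\<close> itself cancel in the derivative of
  \<open>h\<close>. What remains is again absolutely continuous, which supplies the second
  derivative of the flow.\<close>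

lemma ac_h: "ac h (\<lambda>t. t * m t)"
proof (rule ac_cong)
  have 1: "ac (\<lambda>t. A + (- A) * (1 / t\<^sup>2)) (\<lambda>t. 0 + (- A) * (- real 2 / t ^ Suc 2))"
    by (intro ac_add ac_const ac_cmult ac_inverse_power)
  have 2: "ac (\<lambda>t. F2 t * (1 / t\<^sup>2)) (\<lambda>t. t\<^sup>2 * ft t * (1 / t\<^sup>2) + F2 t * (- real 2 / t ^ Suc 2))"
    by (intro ac_mult_C1[OF ac_F2] inverse_power_derivative continuous_inverse_power) auto
  show "ac (\<lambda>t. A + (- A) * (1 / t\<^sup>2) + (- 1 / 2) * F0 t + (1 / 2) * (F2 t * (1 / t\<^sup>2)))
     (\<lambda>t. 0 + (- A) * (- real 2 / t ^ Suc 2) + (- 1 / 2) * ft t + (1 / 2) * (t\<^sup>2 * ft t * (1 / t\<^sup>2) + F2 t * (- real 2 / t ^ Suc 2)))"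
    by (intro ac_add[OF ac_add] 1 ac_cmult[OF 2] ac_cmult[OF ac_F0])
  fix t assume t: "t \<in> {1..R}"
  show "A + (- A) * (1 / t\<^sup>2) + (- 1 / 2) * F0 t + (1 / 2) * (F2 t * (1 / t\<^sup>2)) = h t"
    by (simp add: h_def right_diff_distrib)
  show "0 + (- A) * (- real 2 / t ^ Suc 2) + (- 1 / 2) * ft t + (1 / 2) * (t\<^sup>2 * ft t * (1 / t\<^sup>2) + F2 t * (- real 2 / t ^ Suc 2)) = t * m t"
  proof -
    have "t ^ 4 = t * t ^ 3" "t ^ Suc 2 = t ^ 3" by (simp_all add: power_numeral_reduce)
    with t show ?thesis by (simp add: m_def divide_simps)
  qed
qed

lemma ac_m: "ac m (\<lambda>t. t * n t)"
proof (rule ac_cong)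
  have 1: "ac (\<lambda>t. 2 * A + (- 1) * F2 t) (\<lambda>t. 0 + (- 1) * (t\<^sup>2 * ft t))"
    by (intro ac_add ac_cmult ac_F2 ac_const)
  show "ac (\<lambda>t. (2 * A + (- 1) * F2 t) * (1 / t ^ 4)) (\<lambda>t. (0 + (- 1) * (t\<^sup>2 * ft t)) * (1 / t ^ 4) + (2 * A + (- 1) * F2 t) * (- real 4 / t ^ Suc 4))"
    by (intro ac_mult_C1[OF 1] inverse_power_derivative continuous_inverse_power) auto
  fix t assume t: "t \<in> {1..R}"
  show "(2 * A + (- 1) * F2 t) * (1 / t ^ 4) = m t" by (simp add: m_def)
  show "(0 + (- 1) * (t\<^sup>2 * ft t)) * (1 / t ^ 4) + (2 * A + (- 1) * F2 t) * (- real 4 / t ^ Suc 4) = t * n t"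
  proof -
    have "t \<noteq> 0" using t by auto
    then show ?thesis unfolding m_def n_def by (simp add: divide_simps) algebra
  qed
qed

lemma continuous_h: "continuous_on {1..R} h" and continuous_m: "continuous_on {1..R} m"
  by (rule ac_continuous[OF ac_h] ac_continuous[OF ac_m])+

lemma H1_h: "H1_grad (\<lambda>x. h (norm x)) (\<lambda>i x. m (norm x) * coord i x)"
proof (rule H1_grad_eqI)
  show "H1_grad (\<lambda>x. h (norm x)) (\<lambda>i x. (norm x * m (norm x)) * (coord i x / norm x))"
    by (intro ac_radial_H1[OF ac_h] borel_integrable_atLeastAtMost' continuous_intros continuous_m)
qed (use annulus_norm(1) in force)+

text \<open>The profile \<open>t * n t\<close> is \<open>ft\<close> times a bounded function plus a
  continuous function. The square integrability of \<open>ft\<close> enters the second derivatives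
  of the flow here.\<close>

lemma H1_m: "H1_grad (\<lambda>x. m (norm x)) (\<lambda>i x. n (norm x) * coord i x)"
proof (rule H1_grad_eqI)
  have "sq_integrable I (\<lambda>t. (- (1 / t\<^sup>2)) * ft t + (- 4 * m t / t))"
    by (intro sq_integrable_add sq_integrable_I_mult sq_integrable_I_continuous ft continuous_intros continuous_m) auto
  moreover have "(- (1 / t\<^sup>2)) * ft t + (- 4 * m t / t) = t * n t" if "t \<in> {1..R}" for t
    using that by (simp add: n_def divide_simps power3_eq_cube power2_eq_square)
  ultimately have "integrable I (\<lambda>t. (t * n t)\<^sup>2)"
    unfolding sq_integrable_def by (subst Bochner_Integration.integrable_cong[OF refl, of _ _ "\<lambda>t. ((- (1 / t\<^sup>2)) * ft t + (- 4 * m t / t))\<^sup>2"]) auto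
  then show "H1_grad (\<lambda>x. m (norm x)) (\<lambda>i x. (norm x * n (norm x)) * (coord i x / norm x))"
    by (intro ac_radial_H1[OF ac_m]) (simp add: set_integrable_I)
qed (use annulus_norm(1) in force)+

section \<open>The flow and its derivatives in Cartesian components\<close>

definition V :: "nat \<Rightarrow> real \<times> real \<Rightarrow> real" where
  "V j x = (if j = 1 then - snd x * h (norm x) else fst x * h (norm x))"

definition dV :: "nat \<Rightarrow> nat \<Rightarrow> real \<times> real \<Rightarrow> real" where
  "dV j i x = (if j = 1 then (if i = 1 then - (fst x * snd x) * m (norm x) else - h (norm x) - (snd x)\<^sup>2 * m (norm x))
     else (if i = 1 then h (norm x) + (fst x)\<^sup>2 * m (norm x) else fst x * snd x * m (norm x)))"

definition ddV :: "nat \<Rightarrow> nat \<Rightarrow> nat \<Rightarrow> real \<times> real \<Rightarrow> real" where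
  "ddV j i k x =
    (let e1 = fst (ebasis k); e2 = snd (ebasis k); N = n (norm x) * coord k x; m' = m (norm x) in
     if j = 1 then (if i = 1 then - (fst x * snd x) * N - (e1 * snd x + fst x * e2) * m'
                    else - (m' * coord k x) - ((snd x)\<^sup>2 * N + 2 * snd x * e2 * m'))
     else (if i = 1 then m' * coord k x + ((fst x)\<^sup>2 * N + 2 * fst x * e1 * m')
           else fst x * snd x * N + (e1 * snd x + fst x * e2) * m'))"

lemma coord_v_star: "coord j (v_star R \<omega> ft x) = V j x"
proof (cases "x = 0")
  case False
  then show ?thesis by (simp add: v_star_def V_def coord_def theta_hat_def g_prof_h)
\<comment> \<open>At the origin \<open>theta_hat\<close> is 0, since division by 0 yields 0, and
  both sides vanish.\<close>
qed (simp add: v_star_def V_def coord_def theta_hat_def)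

lemma H1_V:
  assumes "j \<in> {1,2}"
  shows "H1_grad (V j) (dV j)"
proof -
  have e: "pderiv i (\<lambda>x. - snd x) x = - snd (ebasis i)" for i x
    by (rule pderiv_eqI[THEN trans]) (auto intro!: derivative_eq_intros)
  have "H1_grad (V 1) (dV 1)"
    by (rule H1_grad_eqI[OF H1_grad_smooth_mult[OF smooth_fun_minus[OF smooth_fun_intros(3)] H1_h]])
      (auto simp: V_def dV_def e coord_def ebasis_def power2_eq_square)
  moreover have "H1_grad (V 2) (dV 2)"
    by (rule H1_grad_eqI[OF H1_grad_smooth_mult[OF smooth_fun_intros(2) H1_h]])
      (auto simp: V_def dV_def pderiv_coord coord_def ebasis_def power2_eq_square)
  ultimately show ?thesis using assms by auto
qed

lemma H1_dV:
  assumes "j \<in> {1,2}" "i \<in> {1,2}"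
  shows "H1_grad (dV j i) (ddV j i)"
proof -
  have e: "pderiv k (\<lambda>x. fst x * snd x) x = fst (ebasis k) * snd x + fst x * snd (ebasis k)"
    "pderiv k (\<lambda>x. (fst x)\<^sup>2) x = 2 * fst x * fst (ebasis k)" "pderiv k (\<lambda>x. (snd x)\<^sup>2) x = 2 * snd x * snd (ebasis k)" for k x
    by (rule pderiv_eqI[THEN trans], (auto intro!: derivative_eq_intros)[2])+
  have xy: "H1_grad (\<lambda>x. fst x * snd x * m (norm x)) (\<lambda>k x. fst x * snd x * (n (norm x) * coord k x) + pderiv k (\<lambda>x. fst x * snd x) x * m (norm x))"
    and xx: "H1_grad (\<lambda>x. (fst x)\<^sup>2 * m (norm x)) (\<lambda>k x. (fst x)\<^sup>2 * (n (norm x) * coord k x) + pderiv k (\<lambda>x. (fst x)\<^sup>2) x * m (norm x))"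
    and yy: "H1_grad (\<lambda>x. (snd x)\<^sup>2 * m (norm x)) (\<lambda>k x. (snd x)\<^sup>2 * (n (norm x) * coord k x) + pderiv k (\<lambda>x. (snd x)\<^sup>2) x * m (norm x))"
    by (intro H1_grad_smooth_mult H1_m smooth_fun_intros smooth_fun_power)+
  have z: "H1_grad (\<lambda>x. 0) (\<lambda>k x. 0)"
    using H1_grad_diff[OF H1_m H1_m] by simp
  have "H1_grad (dV 1 1) (ddV 1 1)"
    by (rule H1_grad_eqI[OF H1_grad_diff[OF z xy]]) (auto simp: dV_def ddV_def Let_def e)
  moreover have "H1_grad (dV 1 2) (ddV 1 2)"
    by (rule H1_grad_eqI[OF H1_grad_diff[OF H1_grad_diff[OF z H1_h] yy]]) (auto simp: dV_def ddV_def Let_def e)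
  moreover have "H1_grad (dV 2 1) (ddV 2 1)"
    by (rule H1_grad_eqI[OF H1_grad_add[OF H1_h xx]]) (auto simp: dV_def ddV_def Let_def e)
  moreover have "H1_grad (dV 2 2) (ddV 2 2)"
    by (rule H1_grad_eqI[OF xy]) (auto simp: dV_def ddV_def Let_def e)
  ultimately show ?thesis using assms by auto
qed

text \<open>The radial derivative g^2/\<rho> + f^\<rho> of the pressure, with g = \<rho> h, times
  the unit radial vector.\<close>

definition dQ :: "nat \<Rightarrow> real \<times> real \<Rightarrow> real" where
  "dQ j x = (norm x * (h (norm x))\<^sup>2 + fr (norm x)) * (coord j x / norm x)"

lemma H1_Q: "H1_grad (q_star R \<omega> fr ft) dQ"
proof -
  have c: "continuous_on {1..R} (\<lambda>t. t * (h t)\<^sup>2)" by (intro continuous_intros continuous_h)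
  have s: "sq_integrable I (\<lambda>t. t * (h t)\<^sup>2 + fr t)"
    by (intro sq_integrable_add sq_integrable_I_continuous c fr)
  have a: "ac (\<lambda>t. (LINT s:{1..t}|lborel. s * (h s)\<^sup>2) + (LINT s:{1..t}|lborel. fr s)) (\<lambda>t. t * (h t)\<^sup>2 + fr t)"
    by (intro ac_add ac_primitive sq_integrable_I_integrable fr borel_integrable_atLeastAtMost' c)
  show ?thesis
  proof (rule H1_grad_eqI)
    show "H1_grad (\<lambda>x. (LINT s:{1..norm x}|lborel. s * (h s)\<^sup>2) + (LINT s:{1..norm x}|lborel. fr s))
      (\<lambda>i x. (norm x * (h (norm x))\<^sup>2 + fr (norm x)) * (coord i x / norm x))"
      using s by (intro ac_radial_H1[OF a]) (simp add: set_integrable_I sq_integrable_def)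
    fix x assume "x \<in> annulus R"
    have "(LINT s:{1..norm x}|lborel. s * (h s)\<^sup>2) = (LINT s:{1..norm x}|lborel. (g_prof R \<omega> ft s)\<^sup>2 / s)"
      by (rule set_lebesgue_integral_cong) (auto simp: g_prof_h power2_eq_square)
    then show "(LINT s:{1..norm x}|lborel. s * (h s)\<^sup>2) + (LINT s:{1..norm x}|lborel. fr s) = q_star R \<omega> fr ft x"
      by (simp add: q_star_def)
  qed (simp add: dQ_def)
qed

text \<open>In terms of g the second equation is g(R) = \<omega>: the constant \<open>A_R\<close> is
  determined by it.\<close>

lemma h_boundary: "h 1 = 0" "h R = \<omega> / R"
proof -
  show "h 1 = 0" by (simp add: h_def F_1)
  have R0: "R\<^sup>2 - 1 \<noteq> 0" "R \<noteq> 0" using R by (auto simp: power2_eq_1_iff)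
  have "A * (R\<^sup>2 - 1) = R * (\<omega> + R / 2 * F0 R - 1 / (2 * R) * F2 R)"
    using R0 by (simp add: A_R_def F0_def F2_def)
  moreover have "A * (1 - 1 / R\<^sup>2) = A * (R\<^sup>2 - 1) / R\<^sup>2"
    using R0 by (simp add: diff_divide_distrib right_diff_distrib)
  ultimately have A: "A * (1 - 1 / R\<^sup>2) = (\<omega> + R / 2 * F0 R - 1 / (2 * R) * F2 R) / R"
    using R0(2) by (simp only: power2_eq_square[of R] mult_divide_mult_cancel_left_if if_False)
  show "h R = \<omega> / R"
    unfolding h_def A using R0(2) by (simp add: add_divide_distrib diff_divide_distrib power2_eq_square)
qed

text \<open>The boundary extension is \<omega>/(R - 1) (1 - 1/|x|) (-x_2, x_1), so the difference is
  a coordinate function times a radial profile \<open>k\<close> that vanishes on both circles.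
  \<open>radial_H10\<close> handles the profile and the smooth factor is harmless.\<close>

lemma boundary_V:
  assumes "j \<in> {1,2}"
  shows "H1_0 (annulus R) (\<lambda>x. V j x - coord j (bdry_ext R \<omega> x))"
proof -
  define k where "k t = h t + (-1) * (\<omega> / (R - 1) * (1 - 1 / t))" for t
  define k' where "k' t = t * m t + (-1) * (\<omega> / (R - 1) * (1 / t\<^sup>2))" for t
  have "ac k k'"
    unfolding k_def[abs_def] k'_def[abs_def]
  proof (intro ac_add ac_h ac_cmult ac_C1)
    fix t assume "t \<in> {1..R}"
    then show "((\<lambda>t. 1 - 1 / t) has_real_derivative 1 / t\<^sup>2) (at t)"
      using DERIV_diff[OF DERIV_const[of 1] inverse_power_derivative[of t 1]] by (simp add: power2_eq_square)
  qed (rule continuous_inverse_power)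
  moreover have "continuous_on {1..R} k'" unfolding k'_def by (intro continuous_intros continuous_m) auto
  moreover have "k 1 = 0" "k R = 0"
    using R by (simp_all add: k_def h_boundary field_simps)
  ultimately have K: "H10_grad (\<lambda>x. k (norm x)) (\<lambda>i x. k' (norm x) * (coord i x / norm x))" by (rule radial_H10)
  have ex: "H1_0 (annulus R) (\<lambda>x. P x * k (norm x))" if "smooth_fun P" for P
    using H10_smooth_mult[OF that K] H1_0_iff[OF H10_gradD] by blast
  have "(\<lambda>x. V 1 x - coord 1 (bdry_ext R \<omega> x)) = (\<lambda>x. (- snd x) * k (norm x))"
  proof
    fix x show "V 1 x - coord 1 (bdry_ext R \<omega> x) = (- snd x) * k (norm x)"
      by (cases "x = 0") (use R in \<open>auto simp: V_def k_def bdry_ext_def theta_hat_def coord_def field_simps\<close>)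
  qed
  moreover have "(\<lambda>x. V 2 x - coord 2 (bdry_ext R \<omega> x)) = (\<lambda>x. fst x * k (norm x))"
  proof
    fix x show "V 2 x - coord 2 (bdry_ext R \<omega> x) = fst x * k (norm x)"
      by (cases "x = 0") (use R in \<open>auto simp: V_def k_def bdry_ext_def theta_hat_def coord_def field_simps\<close>)
  qed
  ultimately show ?thesis
    using assms ex[OF smooth_fun_minus[OF smooth_fun_intros(3)]] ex[OF smooth_fun_intros(2)] by auto
qed

text \<open>Convection reduces to the centripetal term -h^2 x, which the part \<rho> h^2 of the
  pressure derivative cancels. The viscous term is N \<rho>^2 + 4 m times (x_2, -x_1), and the
  formula for \<open>N\<close> makes it equal to the azimuthal force.\<close>

lemma momentum_identity:
  fixes x y \<rho> h m f0 f1 N :: real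
  assumes "\<rho> \<noteq> 0" "x\<^sup>2 + y\<^sup>2 = \<rho>\<^sup>2" "N = - (f1 / \<rho> ^ 3 + 4 * m / \<rho>\<^sup>2)"
  shows "- ((- (x * y) * (N * x) - y * m) + (- (m * y) - (y\<^sup>2 * (N * y) + 2 * y * m)))
      + ((- y * h) * (- (x * y) * m) + (x * h) * (- h - y\<^sup>2 * m)) + (\<rho> * h\<^sup>2 + f0) * (x / \<rho>) = f0 * (x / \<rho>) + f1 * (- y / \<rho>)"
    and "- ((m * x + (x\<^sup>2 * (N * x) + 2 * x * m)) + (x * y * (N * y) + x * m))
      + ((- y * h) * (h + x\<^sup>2 * m) + (x * h) * (x * y * m)) + (\<rho> * h\<^sup>2 + f0) * (y / \<rho>) = f0 * (y / \<rho>) + f1 * (x / \<rho>)"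
proof -
  have N: "N * \<rho>\<^sup>2 + 4 * m = - (f1 / \<rho>)"
    using assms(1) unfolding assms(3) by (simp add: divide_simps) algebra
  have p: "(\<rho> * h\<^sup>2 + f0) * (x / \<rho>) = x * h\<^sup>2 + f0 * (x / \<rho>)" "(\<rho> * h\<^sup>2 + f0) * (y / \<rho>) = y * h\<^sup>2 + f0 * (y / \<rho>)"
    using assms(1) by (simp_all add: field_simps)
  have "- ((- (x * y) * (N * x) - y * m) + (- (m * y) - (y\<^sup>2 * (N * y) + 2 * y * m)))
      + ((- y * h) * (- (x * y) * m) + (x * h) * (- h - y\<^sup>2 * m)) + x * h\<^sup>2 = y * (N * (x\<^sup>2 + y\<^sup>2) + 4 * m)"
    by (simp add: algebra_simps power2_eq_square)
  then show "- ((- (x * y) * (N * x) - y * m) + (- (m * y) - (y\<^sup>2 * (N * y) + 2 * y * m)))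
      + ((- y * h) * (- (x * y) * m) + (x * h) * (- h - y\<^sup>2 * m)) + (\<rho> * h\<^sup>2 + f0) * (x / \<rho>) = f0 * (x / \<rho>) + f1 * (- y / \<rho>)"
    unfolding p assms(2) N by (simp add: algebra_simps)
  have "- ((m * x + (x\<^sup>2 * (N * x) + 2 * x * m)) + (x * y * (N * y) + x * m))
      + ((- y * h) * (h + x\<^sup>2 * m) + (x * h) * (x * y * m)) + y * h\<^sup>2 = - x * (N * (x\<^sup>2 + y\<^sup>2) + 4 * m)"
    by (simp add: algebra_simps power2_eq_square)
  then show "- ((m * x + (x\<^sup>2 * (N * x) + 2 * x * m)) + (x * y * (N * y) + x * m))
      + ((- y * h) * (h + x\<^sup>2 * m) + (x * h) * (x * y * m)) + (\<rho> * h\<^sup>2 + f0) * (y / \<rho>) = f0 * (y / \<rho>) + f1 * (x / \<rho>)"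
    unfolding p assms(2) N by (simp add: algebra_simps)
qed

lemma ns_V:
  assumes f: "\<And>\<xi>. f \<xi> = fr (norm \<xi>) *\<^sub>R rho_hat \<xi> + ft (norm \<xi>) *\<^sub>R theta_hat \<xi>"
  shows "ns_data V dV ddV (q_star R \<omega> fr ft) dQ (\<lambda>j x. coord j (f x)) (\<lambda>j x. coord j (bdry_ext R \<omega> x))"
  unfolding ns_data_def
proof (intro conjI ballI)
  show "AE x in M. dV 1 1 x + dV 2 2 x = 0" by (simp add: dV_def)
  fix j :: nat assume j: "j \<in> {1,2}"
  show "AE x in M. - (ddV j 1 1 x + ddV j 2 2 x) + (V 1 x * dV j 1 x + V 2 x * dV j 2 x) + dQ j x = coord j (f x)"
  proof (rule AE_I2)
    fix x assume "x \<in> space M"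
    then have x: "norm x \<noteq> 0" using annulus_norm(1)[of x] by auto
    note id = momentum_identity(1)[OF x norm_sq refl, of "ft (norm x)" "m (norm x)" "h (norm x)" "fr (norm x)", folded n_def]
      momentum_identity(2)[OF x norm_sq refl, of "m (norm x)" "ft (norm x)" "h (norm x)" "fr (norm x)", folded n_def]
    show "- (ddV j 1 1 x + ddV j 2 2 x) + (V 1 x * dV j 1 x + V 2 x * dV j 2 x) + dQ j x = coord j (f x)"
    proof (cases "j = 1")
      case True
      then show ?thesis
        using id(1) unfolding f
        by (simp add: ddV_def dV_def V_def dQ_def Let_def coord_def ebasis_def rho_hat_def theta_hat_def)
    next
      case False
      then have "j = 2" using j by simp
      then show ?thesis
        using id(2) unfolding f
        by (simp add: ddV_def dV_def V_def dQ_def Let_def coord_def ebasis_def rho_hat_def theta_hat_def)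
    qed
  qed
qed (use H1_V H1_dV H1_Q boundary_V in auto)

lemma V_bounded:
  obtains B where "\<And>j. j \<in> {1,2} \<Longrightarrow> AE x in M. \<bar>V j x\<bar> \<le> B" "\<And>i j. i \<in> {1,2} \<Longrightarrow> j \<in> {1,2} \<Longrightarrow> AE x in M. \<bar>dV j i x\<bar> \<le> B"
proof -
  obtain Bh where Bh: "\<And>x. x \<in> annulus R \<Longrightarrow> \<bar>h (norm x)\<bar> \<le> Bh" using radial_bounded[OF continuous_h] by blast
  obtain Bm where Bm: "\<And>x. x \<in> annulus R \<Longrightarrow> \<bar>m (norm x)\<bar> \<le> Bm" using radial_bounded[OF continuous_m] by blast
  define q1 q2 where "q1 = R * Bh" and "q2 = R\<^sup>2 * Bm"
  define B where "B = q1 + Bh + q2"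
  have "\<bar>V j x\<bar> \<le> B \<and> \<bar>dV j i x\<bar> \<le> B" if x: "x \<in> annulus R" for i j x
  proof -
    have c: "\<bar>fst x\<bar> \<le> R" "\<bar>snd x\<bar> \<le> R"
      using coord_bounds(1)[of 1 x] coord_bounds(1)[of 2 x] x by (auto simp: annulus_def coord_bounds)
    have nn: "0 \<le> Bh" "0 \<le> Bm" using Bh[OF x] Bm[OF x] by auto
    have vh: "\<bar>fst x * h (norm x)\<bar> \<le> q1" "\<bar>snd x * h (norm x)\<bar> \<le> q1"
      unfolding q1_def abs_mult using c Bh[OF x] R by (auto intro!: mult_mono)
    have q: "\<bar>(a * b) * m (norm x)\<bar> \<le> q2" if "\<bar>a\<bar> \<le> R" "\<bar>b\<bar> \<le> R" for a b
      unfolding q2_def abs_mult power2_eq_square using that Bm[OF x] R by (auto intro!: mult_mono)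
    note qs = q[OF c(1) c(2)] q[OF c(1) c(1)] q[OF c(2) c(2)]
    have pos: "0 \<le> q1" "0 \<le> q2" unfolding q1_def q2_def using nn R by auto
    have "\<bar>V j x\<bar> \<le> B" unfolding V_def B_def using vh pos nn by auto
    moreover have "\<bar>dV j i x\<bar> \<le> B"
      unfolding dV_def B_def power2_eq_square[of "fst x"] power2_eq_square[of "snd x"] using qs pos nn Bh[OF x] by auto
    ultimately show ?thesis by blast
  qed
  then show ?thesis by (intro that[of B] AE_I2) auto
qed

section \<open>Comparison with an arbitrary solution\<close>

lemma same_solutionI:
  assumes "\<And>j. j \<in> {1,2} \<Longrightarrow> AE x in M. coord j (u x) = V j x" "\<exists>c. AE x in M. p x = q_star R \<omega> fr ft x + c"
  shows "same_solution R u p (v_star R \<omega> ft) (q_star R \<omega> fr ft)"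
proof -
  have "AE x in M. u x = v_star R \<omega> ft x"
    using assms(1)[of 1, simplified] assms(1)[of 2, simplified]
    by eventually_elim (auto simp: coord_v_star[symmetric] coord_def prod_eq_iff)
  then show ?thesis
    using assms(2) unfolding same_solution_def AE_lebesgue_on[OF U_sets] by blast
qed

lemma rot_annulus: "rot t x \<in> annulus R \<longleftrightarrow> x \<in> annulus R"
  by (simp add: annulus_def norm_rot)

lemma unique_rotational:
  assumes f: "\<And>\<xi>. f \<xi> = fr (norm \<xi>) *\<^sub>R rho_hat \<xi> + ft (norm \<xi>) *\<^sub>R theta_hat \<xi>"
    and s: "strong_solution R \<omega> f u p" and inv: "rot_inv_field R u"
  shows "same_solution R u p (v_star R \<omega> ft) (q_star R \<omega> fr ft)"
proof -
  note nu = strong_imp_ns[OF s] and nV = ns_V[OF f]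
  let ?w = "\<lambda>j x. coord j (u x) - V j x"
  obtain B where B: "\<And>j. j \<in> {1,2} \<Longrightarrow> AE x in M. \<bar>V j x\<bar> \<le> B" "\<And>i j. i \<in> {1,2} \<Longrightarrow> j \<in> {1,2} \<Longrightarrow> AE x in M. \<bar>dV j i x\<bar> \<le> B"
    using V_bounded by blast
  have rad: "AE x in M. fst x * coord 1 (u x) + snd x * coord 2 (u x) = 0"
  proof (rule radial_component_zero[OF _ _ _ nu])
    show "rot t x \<in> annulus R \<longleftrightarrow> x \<in> annulus R" for t x by (rule rot_annulus)
    show "x \<noteq> 0" if "x \<in> annulus R" for x using that by (auto simp: annulus_def)
    show "(coord 1 (u x), coord 2 (u x)) = rotT t (coord 1 (u (rot t x)), coord 2 (u (rot t x)))"
      if "x \<in> annulus R" "0 \<le> t" "t \<le> 2 * pi" for t x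
      using inv that unfolding rot_inv_field_def by (simp add: coord_def)
    show "fst x * coord 1 (bdry_ext R \<omega> x) + snd x * coord 2 (bdry_ext R \<omega> x) = 0" for x
      by (simp add: bdry_ext_def theta_hat_def coord_def)
  qed
  let ?F = "\<lambda>x. ?w 1 x * dV 1 1 x * ?w 1 x + ?w 2 x * dV 1 2 x * ?w 1 x + (?w 1 x * dV 2 1 x * ?w 2 x + ?w 2 x * dV 2 2 x * ?w 2 x)"
  have F0: "AE x in M. ?F x = 0"
    using rad
  proof eventually_elim
    case (elim x)
    \<comment> \<open>The gradient matrix of V is \<open>h\<close> times an antisymmetric matrix
      plus \<open>m\<close> times the product of (-x_2, x_1) and x; in the quadratic form the
      antisymmetric part drops out.\<close>
    have "?F x = m (norm x) * (fst x * ?w 1 x + snd x * ?w 2 x) * (fst x * ?w 2 x - snd x * ?w 1 x)"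
      by (simp add: dV_def algebra_simps power2_eq_square)
    \<comment> \<open>V is tangential, so the radial component of \<open>w\<close> is that of
      \<open>u\<close>.\<close>
    also have "fst x * ?w 1 x + snd x * ?w 2 x = 0" using elim by (simp add: V_def algebra_simps)
    finally show ?case by simp
  qed
  have "(\<integral>x. ?F x \<partial>M) = 0"
  \<comment> \<open>A non-integrable function has integral 0 by convention, so both cases lead to
    the same value.\<close>
  proof (cases "integrable M ?F")
    case True
    then have "(\<integral>x. ?F x \<partial>M) = (\<integral>x. 0 \<partial>M)" using F0 by (intro integral_cong_AE) auto
    then show ?thesis by simp
  qed (rule not_integrable_integral_eq)
  then have "energy (\<lambda>j i x. weak_pderiv (annulus R) i (\<lambda>x. coord j (u x)) x - dV j i x) = 0"
    using energy_identity(1)[OF nu nV B refl refl] by simp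
  from ns_unique_if_energy_zero[OF nu nV connected_annulus_domain this]
  show ?thesis by (rule same_solutionI)
qed

text \<open>The origin of the polynomial and of the number 15 in \<open>K_R\<close>: the squared L2
  norm of the kernel that pairs with \<open>ft\<close> at the outer radius.\<close>

lemma kernel_integral:
  "(\<integral>t. (R - t\<^sup>2 / R)\<^sup>2 \<partial>I) = (R - 1) * (8 * R ^ 4 - 7 * R ^ 3 - 7 * R\<^sup>2 + 3 * R + 3) / (15 * R\<^sup>2)"
proof -
  have R0: "R \<noteq> 0" using R by simp
  have "(\<integral>t. (R - t\<^sup>2 / R)\<^sup>2 \<partial>I) = (\<integral>t. indicator {1..R} t *\<^sub>R (R - t\<^sup>2 / R)\<^sup>2 \<partial>lborel)"
    by (simp add: integral_restrict_space)
  also have "\<dots> = (R\<^sup>2 * R - 2 * R ^ 3 / 3 + R ^ 5 / (5 * R\<^sup>2)) - (R\<^sup>2 * 1 - 2 * 1 ^ 3 / 3 + 1 ^ 5 / (5 * R\<^sup>2))"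
  proof (rule integral_FTC_Icc)
    show "1 \<le> R" using R by simp
    show "continuous_on {1..R} (\<lambda>t. (R - t\<^sup>2 / R)\<^sup>2)" using R0 by (intro continuous_intros) auto
    fix t
    have "(R - t\<^sup>2 / R)\<^sup>2 = R\<^sup>2 - 2 * t\<^sup>2 + t ^ 4 / R\<^sup>2"
      using R0 by (simp add: divide_simps) algebra
    moreover have "s * R\<^sup>2 / R ^ 4 = s / R\<^sup>2" for s
      using R0 by (simp add: power2_eq_square power4_eq_xxxx)
    ultimately have "((\<lambda>t. R\<^sup>2 * t - 2 * t ^ 3 / 3 + t ^ 5 / (5 * R\<^sup>2)) has_real_derivative (R - t\<^sup>2 / R)\<^sup>2) (at t within {1..R})"
      using R0 by (auto intro!: derivative_eq_intros)
    then show "((\<lambda>t. R\<^sup>2 * t - 2 * t ^ 3 / 3 + t ^ 5 / (5 * R\<^sup>2)) has_vector_derivative (R - t\<^sup>2 / R)\<^sup>2) (at t within {1..R})"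
      by (simp add: has_real_derivative_iff_has_vector_derivative)
  qed
  also have "\<dots> = (R - 1) * (8 * R ^ 4 - 7 * R ^ 3 - 7 * R\<^sup>2 + 3 * R + 3) / (15 * R\<^sup>2)"
    using R0 by (simp add: divide_simps) algebra
  finally show ?thesis .
qed

text \<open>Both \<open>J R\<close> and \<open>J \<rho>\<close> are pairings of \<open>ft\<close>
  with a kernel of norm at most \<open>?C\<close>. Each enters with a coefficient of modulus at most
  1/2, so together they cost one full product \<open>?C * ?\<Phi>\<close>.\<close>

lemma g_prof_le_K:
  assumes \<rho>: "\<rho> \<in> {1..R}"
  shows "\<bar>g_prof R \<omega> ft \<rho>\<bar> \<le> K_R R \<omega> ft"
proof -
  let ?\<Phi> = "sqrt (\<integral>t. (ft t)\<^sup>2 \<partial>I)" and ?C = "sqrt (\<integral>t. (R - t\<^sup>2 / R)\<^sup>2 \<partial>I)"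
  \<comment> \<open>The profile of the unforced flow driven by unit speed at the outer circle: it
    grows from 0 at \<rho> = 1 to 1 at \<rho> = R.\<close>
  define \<theta> where "\<theta> = R / (R\<^sup>2 - 1) * (\<rho> - 1 / \<rho>)"
  define J where "J r = (LINT t:{1..r}|lborel. (r - t\<^sup>2 / r) * ft t)" for r
  have R0: "R\<^sup>2 - 1 > 0" "0 < R" using R by auto
  have \<rho>0: "0 < \<rho>" using \<rho> by auto
  have Jsplit: "J r = r * F0 r - F2 r / r" if r: "r \<in> {1..R}" for r
  proof -
    have "J r = (LINT t:{1..r}|lborel. r * ft t - (1 / r) * (t\<^sup>2 * ft t))"
      unfolding J_def by (simp add: algebra_simps)
    also have "\<dots> = (LINT t:{1..r}|lborel. r * ft t) - (LINT t:{1..r}|lborel. (1 / r) * (t\<^sup>2 * ft t))"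
      using acD(3)[OF ac_F0 r] acD(3)[OF ac_F2 r] by (intro set_integral_diff(2) set_integrable_mult_right) auto
    finally show ?thesis by (simp add: F0_def F2_def)
  qed
  have Jle: "\<bar>J r\<bar> \<le> ?C * ?\<Phi>" if r: "r \<in> {1..R}" for r
  proof -
    let ?k = "\<lambda>t. indicator {1..r} t * (r - t\<^sup>2 / r)"
    have mk: "?k \<in> borel_measurable I"
      by (intro borel_measurable_times measurable_restrict_space1) auto
    \<comment> \<open>For t \<le> r the kernel r - t^2/r is non-negative and increases with r, so
      its truncation at r is dominated by the kernel for r = R.\<close>
    have bk: "(?k t)\<^sup>2 \<le> (R - t\<^sup>2 / R)\<^sup>2" if t: "t \<in> {1..R}" for t
    proof (cases "t \<le> r")
      case True
      have "t\<^sup>2 \<le> r\<^sup>2" using True t by (intro power_mono) auto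
      then have "0 \<le> r - t\<^sup>2 / r" using r by (simp add: pos_divide_le_eq power2_eq_square)
      moreover have "r - t\<^sup>2 / r \<le> R - t\<^sup>2 / R"
      proof -
        have "t\<^sup>2 / R \<le> t\<^sup>2 / r" using r by (intro divide_left_mono) auto
        then show ?thesis using r by auto
      qed
      ultimately show ?thesis using True t by (auto intro!: power_mono)
    qed (simp add: indicator_def)
    have cR: "continuous_on {1..R} (\<lambda>t. R - t\<^sup>2 / R)" using R0 by (intro continuous_intros) auto
    have sR: "sq_integrable I (\<lambda>t. R - t\<^sup>2 / R)" by (rule sq_integrable_I_continuous[OF cR])
    have sk: "sq_integrable I ?k"
      unfolding sq_integrable_def
    proof (intro conjI mk)
      show "integrable I (\<lambda>t. (?k t)\<^sup>2)"
        using bk sR mk by (intro Bochner_Integration.integrable_bound[where g = "\<lambda>t. (?k t)\<^sup>2" and f = "\<lambda>t. (R - t\<^sup>2 / R)\<^sup>2"] AE_I2)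
          (auto simp: sq_integrable_def)
    qed
    have "J r = (\<integral>t. ?k t * ft t \<partial>I)"
      unfolding J_def set_lebesgue_integral_def using r
      by (subst integral_restrict_space) (auto intro!: Bochner_Integration.integral_cong simp: indicator_def)
    also have "\<bar>\<dots>\<bar> \<le> sqrt (\<integral>t. (?k t)\<^sup>2 \<partial>I) * ?\<Phi>"
      by (rule integral_Cauchy_Schwarz_abs[OF sk ft])
    also have "\<dots> \<le> ?C * ?\<Phi>"
    proof (intro mult_right_mono real_sqrt_le_mono integral_mono)
      show "integrable I (\<lambda>t. (?k t)\<^sup>2)" "integrable I (\<lambda>t. (R - t\<^sup>2 / R)\<^sup>2)"
        using sk sR by (auto simp: sq_integrable_def)
      show "(?k t)\<^sup>2 \<le> (R - t\<^sup>2 / R)\<^sup>2" if "t \<in> space I" for t using bk that by simp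
    qed simp
    finally show ?thesis .
  qed
  have \<theta>: "0 \<le> \<theta>" "\<theta> \<le> 1"
  proof -
    have "1 / \<rho> \<le> \<rho>" using \<rho> by (simp add: pos_divide_le_eq mult_le_cancel_left1) (auto intro: order_trans[of 1 \<rho>] mult_mono)
    then show "0 \<le> \<theta>" unfolding \<theta>_def using R0 by (intro mult_nonneg_nonneg) auto
    have "\<rho> - 1 / \<rho> \<le> R - 1 / R"
      using \<rho> R0 by (intro diff_mono divide_left_mono) auto
    then have "\<theta> \<le> R / (R\<^sup>2 - 1) * (R - 1 / R)" unfolding \<theta>_def using R0 by (intro mult_left_mono) auto
    also have "\<dots> = 1" using R0 by (simp add: field_simps power2_eq_square)
    finally show "\<theta> \<le> 1" .
  qed
  have "J R / 2 = R / 2 * F0 R - 1 / (2 * R) * F2 R"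
    using Jsplit[of R] R R0(2) by (simp add: diff_divide_distrib)
  then have A: "A = R / (R\<^sup>2 - 1) * (\<omega> + J R / 2)"
    by (simp only: A_R_def F0_def F2_def add_diff_eq)
  have "g_prof R \<omega> ft \<rho> = A * (\<rho> - 1 / \<rho>) - J \<rho> / 2"
    using Jsplit[OF \<rho>] \<rho>0 by (simp add: g_prof_def F0_def F2_def field_simps)
  also have "\<dots> = \<theta> * \<omega> + (\<theta> * (J R / 2) - J \<rho> / 2)"
  proof -
    have "A * (\<rho> - 1 / \<rho>) = \<theta> * (\<omega> + J R / 2)"
      unfolding A \<theta>_def by (simp only: mult_ac)
    then show ?thesis by (simp only: distrib_left add_diff_eq)
  qed
  also have "\<bar>\<dots>\<bar> \<le> \<bar>\<theta> * \<omega>\<bar> + (\<bar>\<theta> * (J R / 2)\<bar> + \<bar>J \<rho> / 2\<bar>)"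
    by linarith
  also have "\<dots> \<le> \<omega> + (?C * ?\<Phi> / 2 + ?C * ?\<Phi> / 2)"
  proof (intro add_mono)
    show "\<bar>\<theta> * \<omega>\<bar> \<le> \<omega>" using \<theta> \<omega> by (simp add: abs_mult mult_left_le_one_le)
    have "\<bar>\<theta> * (J R / 2)\<bar> \<le> 1 * \<bar>J R / 2\<bar>" unfolding abs_mult[of \<theta>] using \<theta> by (intro mult_right_mono) auto
    then show "\<bar>\<theta> * (J R / 2)\<bar> \<le> ?C * ?\<Phi> / 2" using Jle[of R] R by simp
    show "\<bar>J \<rho> / 2\<bar> \<le> ?C * ?\<Phi> / 2" using Jle[OF \<rho>] by simp
  qed
  also have "\<dots> = \<omega> + ?C * ?\<Phi>" by simp
  also have "\<dots> \<le> K_R R \<omega> ft"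
  proof -
    have C: "?C = sqrt (R - 1) / (sqrt 15 * R) * sqrt (8 * R ^ 4 - 7 * R ^ 3 - 7 * R\<^sup>2 + 3 * R + 3)"
      unfolding kernel_integral using R by (simp add: real_sqrt_divide real_sqrt_mult)
    have i: "integrable I (\<lambda>t. (ft t)\<^sup>2)" using ft by (simp add: sq_integrable_def)
    have it: "integrable I (\<lambda>t. t * (ft t)\<^sup>2)"
      using set_integrable_continuous_mult[of "\<lambda>t. (ft t)\<^sup>2" "\<lambda>t. t"] i by (simp add: set_integrable_I mult.commute)
    \<comment> \<open>The interval norm is compared with the norm on the annulus, whose weight 2 pi
      t is at least 1 for t \<ge> 1.\<close>
    have "(\<integral>t. (ft t)\<^sup>2 \<partial>I) \<le> (\<integral>t. 2 * pi * (t * (ft t)\<^sup>2) \<partial>I)"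
    proof (rule integral_mono)
      fix t assume "t \<in> space I"
      then have "1 * 1 \<le> (2 * pi) * t" using pi_gt3 by (intro mult_mono) auto
      then have "1 * (ft t)\<^sup>2 \<le> (2 * pi * t) * (ft t)\<^sup>2" by (intro mult_right_mono) auto
      then show "(ft t)\<^sup>2 \<le> 2 * pi * (t * (ft t)\<^sup>2)" by (simp add: mult.assoc)
    qed (use i it in auto)
    also have "\<dots> = 2 * pi * (LINT t:{1..R}|lborel. t * (ft t)\<^sup>2)" by (simp add: integral_I)
    finally have "?\<Phi> \<le> sqrt (2 * pi * (LINT t:{1..R}|lborel. t * (ft t)\<^sup>2))" by (rule real_sqrt_le_mono)
    moreover have "0 \<le> ?C" by (simp add: integral_nonneg_AE)
    ultimately show ?thesis unfolding K_R_def C[symmetric] by (simp add: mult_left_mono)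
  qed
  finally show ?thesis .
qed

lemma unique_small:
  assumes f: "\<And>\<xi>. f \<xi> = fr (norm \<xi>) *\<^sub>R rho_hat \<xi> + ft (norm \<xi>) *\<^sub>R theta_hat \<xi>"
    and s: "strong_solution R \<omega> f u p" and K: "K_R R \<omega> ft < sqrt (dirichlet_eigenvalue (annulus R))"
  shows "same_solution R u p (v_star R \<omega> ft) (q_star R \<omega> fr ft)"
proof -
  note nu = strong_imp_ns[OF s] and nV = ns_V[OF f]
  obtain B where B: "\<And>j. j \<in> {1,2} \<Longrightarrow> AE x in M. \<bar>V j x\<bar> \<le> B" "\<And>i j. i \<in> {1,2} \<Longrightarrow> j \<in> {1,2} \<Longrightarrow> AE x in M. \<bar>dV j i x\<bar> \<le> B"
    using V_bounded by blast
  have K0: "0 \<le> K_R R \<omega> ft"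
    using g_prof_le_K[of 1] R by (auto intro: order_trans[rotated])
  have VK: "AE x in M. (V 1 x)\<^sup>2 + (V 2 x)\<^sup>2 \<le> (K_R R \<omega> ft)\<^sup>2"
  proof (rule AE_I2)
    fix x assume "x \<in> space M"
    then have x: "norm x \<in> {1..R}" using annulus_norm(1) by simp
    \<comment> \<open>The speed of the flow is |x| |h|, that is |g|, so the bound on the profile is
      a bound on the velocity.\<close>
    have "(V 1 x)\<^sup>2 + (V 2 x)\<^sup>2 = ((fst x)\<^sup>2 + (snd x)\<^sup>2) * (h (norm x))\<^sup>2"
      by (simp add: V_def algebra_simps power2_eq_square)
    also have "\<dots> = (g_prof R \<omega> ft (norm x))\<^sup>2"
      using x by (subst g_prof_h) (auto simp: norm_sq power_mult_distrib)
    also have "\<dots> \<le> (K_R R \<omega> ft)\<^sup>2"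
      using g_prof_le_K[OF x] by (simp add: abs_le_square_iff[symmetric])
    finally show "(V 1 x)\<^sup>2 + (V 2 x)\<^sup>2 \<le> (K_R R \<omega> ft)\<^sup>2" .
  qed
  have "energy (\<lambda>j i x. weak_pderiv (annulus R) i (\<lambda>x. coord j (u x)) x - dV j i x) = 0"
    by (rule energy_zero_if_small[OF nu nV B(2) VK K0 K])
  from ns_unique_if_energy_zero[OF nu nV connected_annulus_domain this]
  show ?thesis by (rule same_solutionI)
qed

end

theorem theorem2p1:
  fixes R \<omega> :: real and fr ft :: "real \<Rightarrow> real" and f :: "real \<times> real \<Rightarrow> real \<times> real"
  assumes "R > 1" and "\<omega> \<ge> 0"
    and "set_borel_measurable lborel {1..R} fr" and "set_integrable lborel {1..R} (\<lambda>t. (fr t)\<^sup>2)"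
    and "set_borel_measurable lborel {1..R} ft" and "set_integrable lborel {1..R} (\<lambda>t. (ft t)\<^sup>2)"
    and "\<And>\<xi>. f \<xi> = fr (norm \<xi>) *\<^sub>R rho_hat \<xi> + ft (norm \<xi>) *\<^sub>R theta_hat \<xi>"
  shows "strong_solution R \<omega> f (v_star R \<omega> ft) (q_star R \<omega> fr ft)
    \<and> (\<forall>u p. rot_inv_field R u \<and> rot_inv_scalar R p \<and> strong_solution R \<omega> f u p
          \<longrightarrow> same_solution R u p (v_star R \<omega> ft) (q_star R \<omega> fr ft))
    \<and> (K_R R \<omega> ft < sqrt (dirichlet_eigenvalue (annulus R)) \<longrightarrow>
        (\<forall>u p. strong_solution R \<omega> f u p
          \<longrightarrow> same_solution R u p (v_star R \<omega> ft) (q_star R \<omega> fr ft)))"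
proof -
  interpret annulus_domain R by unfold_locales (rule assms(1))
  interpret couette R \<omega> fr ft
    using assms(2-6) by unfold_locales (simp_all add: sq_integrable_def measurable_I set_integrable_I)
  have "strong_solution R \<omega> f (v_star R \<omega> ft) (q_star R \<omega> fr ft)"
    using ns_imp_strong[of "v_star R \<omega> ft"] ns_V[OF assms(7)] unfolding coord_v_star by blast
  then show ?thesis using unique_rotational[OF assms(7)] unique_small[OF assms(7)] by blast
qed

end
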